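(* Let $k$ be an algebraically closed field of characteristic $p>0$. Let $G$ be a quasi-$p$ group and $P\le G$ a $p$-subgroup. Suppose that $(G,P)$ is realizable, that there is no epimorphism from $G$ to $\mathbb{Z}/p\mathbb{Z}$, and that $P$ has a $p^2$-cyclic quotient $a:P\to\mathbb{Z}/p^2\mathbb{Z}$ (i.e. $a$ is an epimorphism). Then there exists an index $p$ subgroup $Q$ of $P\times_{\mathbb{Z}/p\mathbb{Z}}\mathbb{Z}/p^2\mathbb{Z}$ such that $(G\times\mathbb{Z}/p^2\mathbb{Z},Q)$ is realizable.
   Context: A finite group $G$ is quasi-$p$ if it is generated by its Sylow $p$-subgroups. A $G$-cover of $\mathbb{P}^1_k$ is a finite generically separable morphism $X\to\mathbb{P}^1_k$ from a smooth connected projective $k$-curve whose function field extension is Galois with group $G$. For a subgroup $I\le G$, the pair $(G,I)$ is realizable if there exists a $G$-cover $X\to\mathbb{P}^1_k$ branched at the point $\infty$ and nowhere else such that the inertia group at some point of $X$ above $\infty$ is $I$. The fibre product $P\times_{\mathbb{Z}/p\mathbb{Z}}\mathbb{Z}/p^2\mathbb{Z}$ is formed with respect to the composite of $a:P\to\mathbb{Z}/p^2\mathbb{Z}$ with the quotient map $\mathbb{Z}/p^2\mathbb{Z}\to\mathbb{Z}/p\mathbb{Z}$, and the quotient map $\mathbb{Z}/p^2\mathbb{Z}\to\mathbb{Z}/p\mathbb{Z}$; it is viewed as a subgroup of $P\times\mathbb{Z}/p^2\mathbb{Z}\le G\times\mathbb{Z}/p^2\mathbb{Z}$. *)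

theory Defs
  imports "HOL-Algebra.Algebra" "HOL-Algebra.Algebraic_Closure_Type"
begin

section \<open>Groups\<close>

definition sylow_subgroups :: "nat \<Rightarrow> ('g, 'r) monoid_scheme \<Rightarrow> 'g set set" where
  "sylow_subgroups p G = {H. subgroup H G \<and> card H = p ^ multiplicity p (Coset.order G)}"

definition quasi_p_group :: "nat \<Rightarrow> ('g, 'r) monoid_scheme \<Rightarrow> bool" where
  "quasi_p_group p G \<longleftrightarrow>
     group G \<and> finite (carrier G) \<and> generate G (\<Union>(sylow_subgroups p G)) = carrier G"

definition p_subgroup :: "nat \<Rightarrow> 'g set \<Rightarrow> ('g, 'r) monoid_scheme \<Rightarrow> bool" where
  "p_subgroup p P G \<longleftrightarrow> subgroup P G \<and> (\<exists>n. card P = p ^ n)"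

text \<open>
  Residue classes modulo \<open>p\<^sup>2\<close> are represented by the integers in \<open>{0..<p\<^sup>2}\<close>, so the quotient
  map from the integers modulo \<open>p\<^sup>2\<close> to the integers modulo \<open>p\<close> is reduction modulo \<open>p\<close>.
\<close>

definition fibre_product :: "nat \<Rightarrow> 'g set \<Rightarrow> ('g \<Rightarrow> int) \<Rightarrow> ('g \<times> int) set" where
  "fibre_product p P a =
     {(g, c). g \<in> P \<and> c \<in> carrier (integer_mod_group (p ^ 2)) \<and> a g mod int p = c mod int p}"


section \<open>Integral schemes inside a field\<close>

text \<open>
  An integral separated scheme with function field \<open>L\<close> is determined by its set of local rings,
  which are subrings of \<open>L\<close> (Chevalley, Zariski; see EGA I, Section 8, and Zariski--Samuel,
  \<^emph>\<open>Commutative Algebra\<close> II, Chapter VI, Section 17).  A scheme is represented here by this set: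
  a point is the same thing as its local ring, the generic point is \<open>L\<close>, and \<open>L\<close> is the
  union of all the local rings.  All rings are subrings of one ambient field.
\<close>

abbreviation subring_of_type :: "'a::Fields.field set \<Rightarrow> 'a ring" where
  "subring_of_type A \<equiv> (ring_of_type_algebra :: 'a ring)\<lparr>carrier := A\<rparr>"

definition localization_at :: "'a::Fields.field set \<Rightarrow> 'a set \<Rightarrow> 'a set" where
  "localization_at A I = {a / s | a s. a \<in> A \<and> s \<in> A - I}"

definition spec :: "'a::Fields.field set \<Rightarrow> 'a set set" where
  "spec A = localization_at A ` {I. primeideal I (subring_of_type A)}"

definition algebra_generated :: "'a::Fields.field set \<Rightarrow> 'a set \<Rightarrow> 'a set" where
  "algebra_generated K S = generate_ring ring_of_type_algebra (K \<union> S)"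

text \<open>
  If \<open>S = {f\<^sub>0, \<dots>, f\<^sub>n}\<close> then \<open>proj_model K S\<close> is the integral closed subscheme of projective
  \<open>n\<close>-space over \<open>K\<close> with generic point \<open>(f\<^sub>0 : \<dots> : f\<^sub>n)\<close>.  Its intersection with the chart where
  the \<open>i\<close>-th homogeneous coordinate does not vanish is the spectrum of the algebra
  \<open>K[f\<^sub>0 / f\<^sub>i, \<dots>, f\<^sub>n / f\<^sub>i]\<close>.
\<close>

definition chart :: "'a::Fields.field set \<Rightarrow> 'a set \<Rightarrow> 'a \<Rightarrow> 'a set" where
  "chart K S f = algebra_generated K ((\<lambda>g. g / f) ` S)"

definition proj_model :: "'a::Fields.field set \<Rightarrow> 'a set \<Rightarrow> 'a set set" where
  "proj_model K S = (\<Union>f \<in> S - {0}. spec (chart K S f))"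

definition projective_scheme :: "'a::Fields.field set \<Rightarrow> 'a set set \<Rightarrow> bool" where
  "projective_scheme K C \<longleftrightarrow> (\<exists>S. finite S \<and> \<not> S \<subseteq> {0} \<and> C = proj_model K S)"

abbreviation function_field :: "'a::Fields.field set set \<Rightarrow> 'a set" where
  "function_field C \<equiv> \<Union>C"

definition max_ideal :: "'a::Fields.field set \<Rightarrow> 'a set" where
  "max_ideal Q = Q - Units (subring_of_type Q)"

text \<open>
  A dominant morphism is given by the inclusion of function fields, and it maps \<open>Q\<close> to the point
  \<open>y\<close> if and only if the local ring \<open>Q\<close> dominates the local ring \<open>y\<close>.
\<close>

definition lies_above :: "'a::Fields.field set \<Rightarrow> 'a set \<Rightarrow> bool" where
  "lies_above Q y \<longleftrightarrow> y \<subseteq> Q \<and> max_ideal y \<subseteq> max_ideal Q"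

definition dominant_morphism :: "'a::Fields.field set set \<Rightarrow> 'a set set \<Rightarrow> bool" where
  "dominant_morphism C Y \<longleftrightarrow>
     function_field Y \<subseteq> function_field C \<and> (\<forall>Q\<in>C. \<exists>y\<in>Y. lies_above Q y)"

definition finite_module :: "'a::Fields.field set \<Rightarrow> 'a set \<Rightarrow> bool" where
  "finite_module A B \<longleftrightarrow> (\<exists>S. finite S \<and> B = {\<Sum>s\<in>S. c s * s | c. c \<in> S \<rightarrow> A})"

definition finite_over_affine :: "'a::Fields.field set set \<Rightarrow> 'a set \<Rightarrow> bool" where
  "finite_over_affine C A \<longleftrightarrow>
     (\<exists>B. subring B ring_of_type_algebra \<and> A \<subseteq> B \<and> finite_module A B \<and>
          {Q \<in> C. \<exists>y\<in>spec A. lies_above Q y} = spec B)"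

text \<open>
  Dominant morphisms of smooth curves are flat, so the branch points are the images of the points
  that are not unramified.  The second condition says that the maximal ideal of \<open>y\<close> generates that of \<open>Q\<close>.  The third one
  says that the residue field extension is separable: each residue class \<open>a\<close> is a simple root of a
  polynomial over the residue field of \<open>y\<close>.
\<close>

definition unramified :: "'a::Fields.field set \<Rightarrow> 'a set \<Rightarrow> bool" where
  "unramified Q y \<longleftrightarrow>
     lies_above Q y \<and>
     Idl\<^bsub>subring_of_type Q\<^esub> (max_ideal y) = max_ideal Q \<and>
     (\<forall>a\<in>Q. \<exists>f. set (Polynomial.coeffs f) \<subseteq> y \<and>
        poly f a \<in> max_ideal Q \<and> poly (Polynomial.pderiv f) a \<notin> max_ideal Q)"

definition branch_locus :: "'a::Fields.field set set \<Rightarrow> 'a set set \<Rightarrow> 'a set set" where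
  "branch_locus C Y = {y \<in> Y. \<exists>Q\<in>C. lies_above Q y \<and> \<not> unramified Q y}"


section \<open>Galois theory\<close>

definition separable_extension :: "'a::Fields.field set \<Rightarrow> 'a set \<Rightarrow> bool" where
  "separable_extension F L \<longleftrightarrow>
     (\<forall>a\<in>L. \<exists>f. set (Polynomial.coeffs f) \<subseteq> F \<and> rsquarefree f \<and> poly f a = 0)"

definition galois_group :: "'a::Fields.field set \<Rightarrow> 'a set \<Rightarrow> ('a \<Rightarrow> 'a) monoid" where
  "galois_group F L = (BijGroup L)\<lparr>carrier :=
     {\<sigma> \<in> Bij L. \<sigma> \<in> ring_hom (subring_of_type L) (subring_of_type L) \<and> (\<forall>a\<in>F. \<sigma> a = a)}\<rparr>"

text \<open>
  Artin's definition of a Galois extension, for \<open>L\<close> algebraic over \<open>F\<close>.  This is automatic for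
  the extensions considered below, since their ambient field is algebraic over the base field.
\<close>

definition galois_extension :: "'a::Fields.field set \<Rightarrow> 'a set \<Rightarrow> bool" where
  "galois_extension F L \<longleftrightarrow> {a \<in> L. \<forall>\<sigma>\<in>carrier (galois_group F L). \<sigma> a = a} = F"

definition inertia_group :: "'a::Fields.field set \<Rightarrow> 'a set \<Rightarrow> 'a set \<Rightarrow> ('a \<Rightarrow> 'a) set" where
  "inertia_group F L Q =
     {\<sigma> \<in> carrier (galois_group F L). \<sigma> ` Q = Q \<and> (\<forall>a\<in>Q. \<sigma> a - a \<in> max_ideal Q)}"


section \<open>Covers of the projective line\<close>

text \<open>
  The ambient field is an algebraic closure of \<open>k(x)\<close>.  The function field of every connected cover
  of the projective line embeds into it over \<open>k(x)\<close>, so up to isomorphism nothing is lost by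
  considering only covers whose function field lies in it.
\<close>

type_synonym 'k ambient = "'k poly fract alg_closure"

definition of_polynomial :: "'k::Fields.field poly \<Rightarrow> 'k ambient" where
  "of_polynomial f = to_ac (Fraction_Field.Fract f 1)"

definition constants :: "'k::Fields.field ambient set" where
  "constants = range (\<lambda>c. of_polynomial [:c:])"

definition coordinate :: "'k::Fields.field ambient" where
  "coordinate = of_polynomial [:0, 1:]"

definition rational_functions :: "'k::Fields.field ambient set" where
  "rational_functions = range to_ac"

definition P1 :: "'k::Fields.field ambient set set" where
  "P1 = proj_model constants {1, coordinate}"

text \<open>The local ring at infinity: the fractions \<open>f / g\<close> without a pole there.\<close>

definition infinity_point :: "'k::Fields.field ambient set" where
  "infinity_point =
     {of_polynomial f / of_polynomial g | f g.
        g \<noteq> 0 \<and> Polynomial.degree f \<le> Polynomial.degree g}"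

text \<open>
  The function field of \<open>C\<close> has transcendence degree at most one, being contained in the ambient
  field, and as \<open>k\<close> is algebraically closed this degree is one as soon as there is a nonconstant
  function.  Smooth means regular, again because \<open>k\<close> is algebraically closed.  On a curve the local
  ring of the generic point is a field and every other local ring has dimension one, so regularity
  says that all maximal ideals are principal.
\<close>

definition smooth_projective_curve :: "'k::alg_closed_field ambient set set \<Rightarrow> bool" where
  "smooth_projective_curve C \<longleftrightarrow>
     projective_scheme constants C \<and>
     \<not> function_field C \<subseteq> constants \<and>
     (\<forall>Q\<in>C. \<exists>t\<in>Q. max_ideal Q = PIdl\<^bsub>subring_of_type Q\<^esub> t)"

text \<open>Finiteness is expressed on the two standard affine charts covering the projective line.\<close>

definition finite_morphism_P1 :: "'k::alg_closed_field ambient set set \<Rightarrow> bool" where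
  "finite_morphism_P1 C \<longleftrightarrow>
     dominant_morphism C P1 \<and>
     (\<forall>f \<in> {1, coordinate}. finite_over_affine C (chart constants {1, coordinate} f))"

text \<open>
  \<open>\<phi>\<close> is the identification of \<open>G\<close> with the Galois group, through which subgroups of \<open>G\<close> are
  compared with inertia groups.
\<close>

definition G_cover ::
  "('g, 'r) monoid_scheme \<Rightarrow> 'k::alg_closed_field ambient set set \<Rightarrow>
   ('g \<Rightarrow> 'k ambient \<Rightarrow> 'k ambient) \<Rightarrow> bool" where
  "G_cover G C \<phi> \<longleftrightarrow>
     smooth_projective_curve C \<and>
     finite_morphism_P1 C \<and>
     separable_extension rational_functions (function_field C) \<and>
     galois_extension rational_functions (function_field C) \<and>
     \<phi> \<in> iso G (galois_group rational_functions (function_field C))"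

definition realizable ::
  "'k::alg_closed_field itself \<Rightarrow> ('g, 'r) monoid_scheme \<Rightarrow> 'g set \<Rightarrow> bool" where
  "realizable TYPE('k) G I \<longleftrightarrow>
     subgroup I G \<and>
     (\<exists>(C :: 'k ambient set set) \<phi>.
        G_cover G C \<phi> \<and>
        branch_locus C P1 = {infinity_point} \<and>
        (\<exists>Q\<in>C. lies_above Q infinity_point \<and>
           \<phi> ` I = inertia_group rational_functions (function_field C) Q))"

end

theory Submission
  imports Defs
begin

text \<open>
  The subgroup \<open>Q\<close> is the graph of \<open>a\<close>.  The given cover with group \<open>G\<close> is dominated by a cover whose function
  field is obtained from the function field \<open>N\<close> of the given one by two Artin--Schreier extensions, generated
  by \<open>y0\<close> and \<open>z0\<close>.  The cyclic group of order \<open>p\<^sup>2\<close> acts on these by \<open>(y0, z0) \<mapsto> (y0 + n, z0 + cs n y0)\<close>,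
  where \<open>cs\<close> is an explicit cocycle with \<open>cs p = 1\<close>, and its action commutes with that of \<open>G\<close>.  The task is to
  choose the right hand sides of the two equations in such a way that there is no new ramification above the
  affine line and that the inertia group above infinity acts on \<open>(y0, z0)\<close> through \<open>a\<close>.

  Consider one step \<open>z ^ p - z = \<delta> + g\<close>, where the action of the inertia group on the future root is prescribed by
  a cocycle \<open>k\<close>.  Hilbert's Theorem 90 splits \<open>k\<close> by some element \<open>w\<close> of the given field.  Then \<open>w ^ p - w - \<delta>\<close> is
  fixed by the inertia group at the chosen point \<open>q\<close> above infinity, so at \<open>q\<close> it is approximated by a rational
  function, hence by a polynomial \<open>g\<close> in the coordinate \<open>x\<close> (\<open>split_cocycle_at_infinity\<close>).  With this \<open>g\<close> the
  difference \<open>w - z\<close> is a root of an Artin--Schreier equation whose right hand side vanishes at \<open>q\<close>.  Such a root is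
  fixed by the inertia group, so the inertia group acts on \<open>z\<close> through \<open>k\<close> (\<open>inertia_acts_by_cocycle\<close>).  Since \<open>g\<close>
  is regular on the affine line, the equation is unramified there (\<open>extend_cover\<close>).  The first step takes
  \<open>\<delta> = 0\<close> and the reduction of \<open>a\<close> modulo \<open>p\<close>; it is nontrivial because \<open>G\<close> has no quotient of order \<open>p\<close>.  The second
  step takes \<open>\<delta> = ds y0\<close>, which changes by \<open>cs n y0 ^ p - cs n y0\<close> when \<open>y0\<close> is translated by \<open>n\<close>
  (\<open>cyclic_extension\<close>).  The resulting inertia group is contained in the graph of \<open>a\<close>, and it is all of the graph
  because it maps onto the inertia group of the given cover (\<open>inertia_surjective\<close>, \<open>cyclic_extension_group\<close>).

  Everything else provides the geometry of a finite Galois extension \<open>N\<close> of the field of rational functions in one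
  variable over an algebraically closed field.  The closed points are the localizations of the integral closures
  of the two polynomial rings in \<open>x\<close> and in \<open>1 / x\<close>; these are valuation rings (\<open>R_valuation_ring\<close>), their residue
  fields are trivial, and every function fixed by the inertia group is approximated by rational functions
  (\<open>density\<close>).  The approximation also shows that trivial inertia means unramified.  The integral closures
  glue to a projective curve (\<open>points_projective\<close>), and every smooth cover agrees with it because regular
  local rings of dimension at most one are maximal with respect to domination (\<open>regular_dominated_eq\<close>).  The main
  tool is \<open>galois_coordinates\<close>, a tensor in \<open>N \<otimes> N\<close> that separates the identity from the other automorphisms: it
  gives elements of trace one, finiteness of integral closures and Artin's theorem.
\<close>

section \<open>Subrings of a field and their localizations\<close>

abbreviation sring :: "'a::Fields.field set \<Rightarrow> bool" where
  "sring A \<equiv> subring A ring_of_type_algebra"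

lemma ring_of_type_algebra_simps [simp]:
  "carrier (ring_of_type_algebra :: 'a::Fields.field ring) = UNIV"
  "\<one>\<^bsub>(ring_of_type_algebra :: 'a ring)\<^esub> = 1" "\<zero>\<^bsub>(ring_of_type_algebra :: 'a ring)\<^esub> = 0"
  "a \<otimes>\<^bsub>(ring_of_type_algebra :: 'a ring)\<^esub> b = a * b"
  "a \<oplus>\<^bsub>(ring_of_type_algebra :: 'a ring)\<^esub> b = a + b"
  by (auto simp: ring_of_type_algebra_def)

lemma a_inv_ring_of_type_algebra [simp]: "\<ominus>\<^bsub>(ring_of_type_algebra :: 'a::Fields.field ring)\<^esub> a = - a"
proof -
  interpret Ring.field "ring_of_type_algebra :: 'a ring" by auto
  show ?thesis by (rule add.inv_equality) auto
qed

lemma sringI: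
  assumes "1 \<in> A" "\<And>a. a \<in> A \<Longrightarrow> - a \<in> A" "\<And>a b. a \<in> A \<Longrightarrow> b \<in> A \<Longrightarrow> a * b \<in> A"
    "\<And>a b. a \<in> A \<Longrightarrow> b \<in> A \<Longrightarrow> a + b \<in> A"
  shows "sring A"
proof -
  interpret Ring.field "ring_of_type_algebra :: 'a ring" by auto
  show ?thesis by (rule subringI) (use assms in auto)
qed

context
  fixes A :: "'a::Fields.field set"
  assumes A: "sring A"
begin

lemma sring_0 [intro, simp]: "0 \<in> A" using subringE(2)[OF A] by simp
lemma sring_1 [intro, simp]: "1 \<in> A" using subringE(3)[OF A] by simp
lemma sring_uminus [intro]: "a \<in> A \<Longrightarrow> - a \<in> A" using subringE(5)[OF A] by simp
lemma sring_mult [intro]: "a \<in> A \<Longrightarrow> b \<in> A \<Longrightarrow> a * b \<in> A" using subringE(6)[OF A] by simp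
lemma sring_add [intro]: "a \<in> A \<Longrightarrow> b \<in> A \<Longrightarrow> a + b \<in> A" using subringE(7)[OF A] by simp
lemma sring_diff [intro]: "a \<in> A \<Longrightarrow> b \<in> A \<Longrightarrow> a - b \<in> A"
  using sring_add sring_uminus by (metis add_uminus_conv_diff)
lemma sring_power [intro]: "a \<in> A \<Longrightarrow> a ^ n \<in> A" by (induction n) auto
lemma sring_sum [intro]: "(\<And>i. i \<in> I \<Longrightarrow> f i \<in> A) \<Longrightarrow> sum f I \<in> A"
  by (induction I rule: infinite_finite_induct) auto
lemma sring_prod [intro]: "(\<And>i. i \<in> I \<Longrightarrow> f i \<in> A) \<Longrightarrow> prod f I \<in> A"
  by (induction I rule: infinite_finite_induct) auto
lemma sring_of_nat [intro]: "of_nat n \<in> A" by (induction n) auto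

lemma cring_subring_of_type: "cring (subring_of_type A)"
proof -
  interpret Ring.field "ring_of_type_algebra :: 'a ring" by auto
  have "subcring A ring_of_type_algebra"
    using A by (auto intro!: subcring.intro subcring_axioms.intro)
  then show ?thesis
    using subcring_iff[of A] by auto
qed

lemma primeideal_iff:
  "primeideal I (subring_of_type A) \<longleftrightarrow>
     I \<subseteq> A \<and> 0 \<in> I \<and> 1 \<notin> I \<and> (\<forall>a\<in>I. \<forall>b\<in>I. a + b \<in> I) \<and> (\<forall>a\<in>A. \<forall>b\<in>I. a * b \<in> I) \<and>
     (\<forall>a\<in>A. \<forall>b\<in>A. a * b \<in> I \<longrightarrow> a \<in> I \<or> b \<in> I)" (is "?l \<longleftrightarrow> ?r")
proof
  assume ?l
  then interpret primeideal I "subring_of_type A" .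
  have s: "I \<subseteq> A" using a_subset by simp
  have "1 \<notin> I" using I_notcarr one_imp_carrier by auto
  moreover have "0 \<in> I" using additive_subgroup.zero_closed[OF is_additive_subgroup] by simp
  moreover have "\<forall>a\<in>I. \<forall>b\<in>I. a + b \<in> I"
    using additive_subgroup.a_closed[OF is_additive_subgroup] by auto
  moreover have "\<forall>a\<in>A. \<forall>b\<in>I. a * b \<in> I"
    using I_l_closed by auto
  moreover have "\<forall>a\<in>A. \<forall>b\<in>A. a * b \<in> I \<longrightarrow> a \<in> I \<or> b \<in> I"
    using I_prime by auto
  ultimately show ?r using s by blast
next
  assume r: ?r
  interpret cring "subring_of_type A" by (rule cring_subring_of_type)
  have inv: "\<ominus>\<^bsub>subring_of_type A\<^esub> a = - a" if "a \<in> A" for a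
    by (rule add.inv_equality) (use that in auto)
  have neg: "- a \<in> I" if "a \<in> I" for a
    using r that sring_uminus[of 1] by (metis sring_1 mult_minus1)
  show ?l
  proof (rule primeidealI2)
    show "additive_subgroup I (subring_of_type A)"
      by (rule additive_subgroupI, rule add.subgroupI) (use r in \<open>auto simp: inv neg subset_eq simp flip: a_inv_def\<close>)
    show "cring (subring_of_type A)" by (rule cring_subring_of_type)
    show "a \<otimes>\<^bsub>subring_of_type A\<^esub> x \<in> I" if "a \<in> I" "x \<in> carrier (subring_of_type A)" for a x
      using r that by (simp add: mult.commute[of a x])
  qed (use r in auto)
qed

lemma Units_subring_of_type:
  "Units (subring_of_type A) = {a \<in> A. a \<noteq> 0 \<and> inverse a \<in> A}"
proof -
  have "a \<noteq> 0 \<and> inverse a \<in> A" if "a \<in> A" "b \<in> A" "a * b = 1" for a b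
    using that by (metis inverse_unique mult_zero_left zero_neq_one)
  then show ?thesis
    unfolding Units_def by (auto simp: mult.commute intro!: bexI[where x="inverse _"])
qed

lemma max_ideal_eq: "max_ideal A = {a \<in> A. a = 0 \<or> inverse a \<notin> A}"
  unfolding max_ideal_def Units_subring_of_type by auto

end

lemma prime_sub: "sring A \<Longrightarrow> primeideal I (subring_of_type A) \<Longrightarrow> I \<subseteq> A"
  and prime_0: "sring A \<Longrightarrow> primeideal I (subring_of_type A) \<Longrightarrow> 0 \<in> I"
  and prime_1: "sring A \<Longrightarrow> primeideal I (subring_of_type A) \<Longrightarrow> 1 \<notin> I"
  and prime_add: "sring A \<Longrightarrow> primeideal I (subring_of_type A) \<Longrightarrow> a \<in> I \<Longrightarrow> b \<in> I \<Longrightarrow> a + b \<in> I"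
  and prime_multL: "sring A \<Longrightarrow> primeideal I (subring_of_type A) \<Longrightarrow> a \<in> A \<Longrightarrow> b \<in> I \<Longrightarrow> a * b \<in> I"
  and prime_disj: "sring A \<Longrightarrow> primeideal I (subring_of_type A) \<Longrightarrow> a \<in> A \<Longrightarrow> b \<in> A \<Longrightarrow> a * b \<in> I \<Longrightarrow> a \<in> I \<or> b \<in> I"
  by (simp_all add: primeideal_iff)

context
  fixes A I :: "'a::Fields.field set"
  assumes A: "sring A" and I: "primeideal I (subring_of_type A)"
begin

lemma prime_multR: "a \<in> I \<Longrightarrow> b \<in> A \<Longrightarrow> a * b \<in> I"
  using prime_multL[OF A I] by (metis mult.commute)

lemma prime_uminus: "a \<in> I \<Longrightarrow> - a \<in> I"
  using prime_multL[OF A I, of "-1"] A by (metis mult_minus1 sring_1 sring_uminus)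

lemma prime_diff: "a \<in> I \<Longrightarrow> b \<in> I \<Longrightarrow> a - b \<in> I"
  using prime_add[OF A I] prime_uminus by (metis add_uminus_conv_diff)

lemma prime_sum: "(\<And>i. i \<in> J \<Longrightarrow> f i \<in> I) \<Longrightarrow> sum f J \<in> I"
  by (induction J rule: infinite_finite_induct) (auto simp: prime_0[OF A I] prime_add[OF A I])

lemma prime_mult_notin: "a \<in> A \<Longrightarrow> b \<in> A \<Longrightarrow> a \<notin> I \<Longrightarrow> b \<notin> I \<Longrightarrow> a * b \<notin> I"
  using prime_disj[OF A I, of a b] by blast

lemma prime_power: "a \<in> A \<Longrightarrow> a ^ n \<in> I \<Longrightarrow> a \<in> I"
  by (induction n) (use A prime_1[OF A I] prime_mult_notin in auto)

lemma prime_prod: "finite J \<Longrightarrow> (\<And>i. i \<in> J \<Longrightarrow> f i \<in> A) \<Longrightarrow> prod f J \<in> I \<Longrightarrow> \<exists>i\<in>J. f i \<in> I"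
proof (induction J rule: finite_induct)
  case (insert x J)
  then have "f x \<in> I \<or> prod f J \<in> I" using prime_disj[OF A I, of "f x" "prod f J"] A by auto
  then show ?case using insert by auto
qed (use prime_1[OF A I] in auto)

lemma prime_prod_mem:
  assumes "finite J" "\<And>i. i \<in> J \<Longrightarrow> f i \<in> A" "j \<in> J" "f j \<in> I"
  shows "prod f J \<in> I"
proof -
  have "prod f J = f j * prod f (J - {j})" using assms by (simp add: prod.remove)
  then show ?thesis using assms A by (auto intro!: prime_multR sring_prod)
qed

lemma localization_sub: "A \<subseteq> localization_at A I"
proof
  fix a assume "a \<in> A"
  moreover have "a = a / 1" by simp
  ultimately show "a \<in> localization_at A I"
    unfolding localization_at_def using A prime_1[OF A I] by blast
qed

lemma localizationI: "a \<in> A \<Longrightarrow> s \<in> A \<Longrightarrow> s \<notin> I \<Longrightarrow> a / s \<in> localization_at A I"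
  unfolding localization_at_def by auto

lemma localizationE:
  assumes "a \<in> localization_at A I"
  obtains b s where "b \<in> A" "s \<in> A" "s \<notin> I" "s \<noteq> 0" "a = b / s"
  using assms prime_0[OF A I] unfolding localization_at_def by auto

lemma sring_localization: "sring (localization_at A I)"
proof (rule sringI)
  show "1 \<in> localization_at A I" using localization_sub A by auto
  show "- a \<in> localization_at A I" if a: "a \<in> localization_at A I" for a
  proof -
    obtain b s where bs: "b \<in> A" "s \<in> A" "s \<notin> I" "a = b / s" using a by (rule localizationE)
    have "(- b) / s \<in> localization_at A I" by (rule localizationI) (use bs A in auto)
    then show ?thesis using bs by simp
  qed
next
  fix a b assume a: "a \<in> localization_at A I" and b: "b \<in> localization_at A I"
  obtain a1 a2 where a12: "a1 \<in> A" "a2 \<in> A" "a2 \<notin> I" "a2 \<noteq> 0" "a = a1 / a2"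
    using a by (rule localizationE)
  obtain b1 b2 where b12: "b1 \<in> A" "b2 \<in> A" "b2 \<notin> I" "b2 \<noteq> 0" "b = b1 / b2"
    using b by (rule localizationE)
  note ab = a12 b12
  then have s: "a2 * b2 \<in> A" "a2 * b2 \<notin> I" using A prime_mult_notin by auto
  have "a * b = (a1 * b1) / (a2 * b2)" "a + b = (a1 * b2 + b1 * a2) / (a2 * b2)"
    using ab by (auto simp: field_simps)
  then show "a * b \<in> localization_at A I" "a + b \<in> localization_at A I"
    using ab A s by (auto intro!: localizationI)
qed

lemma max_ideal_localization: "max_ideal (localization_at A I) = {a / s | a s. a \<in> I \<and> s \<in> A - I}"
proof (intro equalityI subsetI)
  fix a assume a: "a \<in> max_ideal (localization_at A I)"
  then have "a \<in> localization_at A I" using max_ideal_eq[OF sring_localization] by auto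
  then obtain b s where bs: "b \<in> A" "s \<in> A" "s \<notin> I" "s \<noteq> 0" "a = b / s" by (rule localizationE)
  have "b \<in> I"
  proof (rule ccontr)
    assume "b \<notin> I"
    then have "s / b \<in> localization_at A I" "b \<noteq> 0" using bs prime_0[OF A I] by (auto intro!: localizationI)
    then show False using a bs max_ideal_eq[OF sring_localization] by auto
  qed
  then show "a \<in> {a / s | a s. a \<in> I \<and> s \<in> A - I}" using bs by auto
next
  fix a assume "a \<in> {a / s | a s. a \<in> I \<and> s \<in> A - I}"
  then obtain b s where bs: "b \<in> I" "s \<in> A" "s \<notin> I" "a = b / s" by auto
  then have bA: "b \<in> A" "s \<noteq> 0" using prime_sub[OF A I] prime_0[OF A I] by auto
  have "a = 0 \<or> inverse a \<notin> localization_at A I"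
  proof (rule ccontr)
    assume "\<not> ?thesis"
    then have a0: "a \<noteq> 0" "inverse a \<in> localization_at A I" by auto
    then obtain c r where cr: "c \<in> A" "r \<in> A" "r \<notin> I" "r \<noteq> 0" "inverse a = c / r" using localizationE[of "inverse a" thesis] by blast
    have "s * r = b * c" using cr(4,5) a0(1) bs(4) bA by (auto simp: field_simps)
    then have "s * r \<in> I" using prime_multR bs(1) cr(1) by auto
    then show False using prime_mult_notin bs cr by auto
  qed
  then show "a \<in> max_ideal (localization_at A I)"
    using bs bA max_ideal_eq[OF sring_localization] by (auto intro!: localizationI)
qed

lemma prime_sub_max_ideal: "I \<subseteq> max_ideal (localization_at A I)"
proof
  fix a assume "a \<in> I"
  moreover have "a = a / 1" by simp
  ultimately show "a \<in> max_ideal (localization_at A I)"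
    unfolding max_ideal_localization using A prime_1[OF A I] by blast
qed

lemma max_ideal_localization_Int: "max_ideal (localization_at A I) \<inter> A = I"
proof
  show "I \<subseteq> max_ideal (localization_at A I) \<inter> A"
    using prime_sub_max_ideal prime_sub[OF A I] by auto
next
  show "max_ideal (localization_at A I) \<inter> A \<subseteq> I"
  proof
    fix a assume "a \<in> max_ideal (localization_at A I) \<inter> A"
    then obtain b s where bs: "b \<in> I" "s \<in> A" "s \<notin> I" "a = b / s" "a \<in> A"
      unfolding max_ideal_localization by auto
    then have "s \<noteq> 0" using prime_0[OF A I] by auto
    then have "a * s \<in> I" using bs by auto
    then show "a \<in> I" using prime_disj[OF A I, of a s] bs by auto
  qed
qed

lemma primeideal_max_ideal_localization:
  "primeideal (max_ideal (localization_at A I)) (subring_of_type (localization_at A I))"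
proof -
  let ?R = "localization_at A I"
  have m: "a / s \<in> max_ideal ?R" if "a \<in> I" "s \<in> A" "s \<notin> I" for a s
    using that unfolding max_ideal_localization by auto
  have "a \<in> max_ideal ?R \<Longrightarrow> \<exists>b s. b \<in> I \<and> b \<in> A \<and> s \<in> A \<and> s \<notin> I \<and> s \<noteq> 0 \<and> a = b / s" for a
    using prime_0[OF A I] prime_sub[OF A I] unfolding max_ideal_localization by blast
  note e = this
  have "a + b \<in> max_ideal ?R" if ab: "a \<in> max_ideal ?R" "b \<in> max_ideal ?R" for a b
  proof -
    obtain a1 a2 b1 b2 where ab: "a1 \<in> I" "a2 \<in> A" "a2 \<notin> I" "b1 \<in> I" "b2 \<in> A" "b2 \<notin> I"
      "a = a1 / a2" "b = b1 / b2" "a2 \<noteq> 0" "b2 \<noteq> 0"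
      using e[OF ab(1)] e[OF ab(2)] by blast
    then have "a2 * b2 \<in> A" "a2 * b2 \<notin> I" using sring_mult[OF A, of a2 b2] prime_mult_notin[of a2 b2] by auto
    moreover have "a + b = (a1 * b2 + b1 * a2) / (a2 * b2)"
      using ab by (auto simp: field_simps)
    moreover have "a1 * b2 + b1 * a2 \<in> I" using ab by (intro prime_add[OF A I] prime_multR) auto
    ultimately show ?thesis using m[of "a1 * b2 + b1 * a2" "a2 * b2"] by simp
  qed
  moreover have "a * b \<in> max_ideal ?R" if ab: "a \<in> ?R" "b \<in> max_ideal ?R" for a b
  proof -
    obtain b1 b2 where b: "b1 \<in> I" "b2 \<in> A" "b2 \<notin> I" "b = b1 / b2"
      using e[OF ab(2)] by blast
    obtain a1 a2 where a: "a1 \<in> A" "a2 \<in> A" "a2 \<notin> I" "a = a1 / a2" using ab(1) by (rule localizationE)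
    have "a2 * b2 \<in> A" "a2 * b2 \<notin> I" using a b sring_mult[OF A, of a2 b2] prime_mult_notin[of a2 b2] by auto
    moreover have "a * b = (a1 * b1) / (a2 * b2)"
      using a b by (auto simp: field_simps)
    moreover have "a1 * b1 \<in> I" using a b by (intro prime_multL[OF A I]) auto
    ultimately show ?thesis using m[of "a1 * b1" "a2 * b2"] by simp
  qed
  moreover have "0 \<in> max_ideal ?R" "1 \<notin> max_ideal ?R" "max_ideal ?R \<subseteq> ?R"
    using max_ideal_eq[OF sring_localization] sring_localization by auto
  moreover have "a \<in> max_ideal ?R \<or> b \<in> max_ideal ?R" if "a \<in> ?R" "b \<in> ?R" "a * b \<in> max_ideal ?R" for a b
    using that max_ideal_eq[OF sring_localization] sring_localization by auto
  ultimately show ?thesis unfolding primeideal_iff[OF sring_localization] by blast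
qed

end

lemma primeideal_contract:
  assumes A: "sring A" and R: "sring R" and P: "primeideal P (subring_of_type R)" and AR: "A \<subseteq> R"
  shows "primeideal (P \<inter> A) (subring_of_type A)"
  using P AR unfolding primeideal_iff[OF A] primeideal_iff[OF R] using A by (auto simp: subset_eq)

text \<open>The elements of \<open>A\<close> outside the maximal ideal of \<open>R\<close> are units of \<open>R\<close>.\<close>

lemma localization_contract:
  assumes A: "sring A" and R: "sring R" and P: "primeideal (max_ideal R) (subring_of_type R)" and AR: "A \<subseteq> R"
  shows "localization_at A (max_ideal R \<inter> A) \<subseteq> R"
    "max_ideal (localization_at A (max_ideal R \<inter> A)) \<subseteq> max_ideal R"
proof -
  note I = primeideal_contract[OF A R P AR]
  have inv: "inverse s \<in> R" if "s \<in> A" "s \<notin> max_ideal R" for s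
    using that AR max_ideal_eq[OF R] by auto
  show "localization_at A (max_ideal R \<inter> A) \<subseteq> R"
  proof
    fix a assume "a \<in> localization_at A (max_ideal R \<inter> A)"
    then obtain b s where "b \<in> A" "s \<in> A" "s \<notin> max_ideal R \<inter> A" "a = b / s" by (rule localizationE[OF A I])
    then show "a \<in> R" using R AR inv[of s] by (auto simp: divide_inverse)
  qed
  show "max_ideal (localization_at A (max_ideal R \<inter> A)) \<subseteq> max_ideal R"
    unfolding max_ideal_localization[OF A I] using inv AR
    by (auto simp: divide_inverse intro!: prime_multR[OF R P])
qed

lemma lies_above_contract:
  assumes "sring A" "sring R" "primeideal (max_ideal R) (subring_of_type R)" "A \<subseteq> R"
  shows "lies_above R (localization_at A (max_ideal R \<inter> A))"
    "localization_at A (max_ideal R \<inter> A) \<in> spec A"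
  unfolding lies_above_def spec_def using localization_contract[OF assms] primeideal_contract[OF assms] by auto

definition valuation_ring :: "'a::Fields.field set \<Rightarrow> 'a set \<Rightarrow> bool" where
  "valuation_ring N R \<longleftrightarrow> sring R \<and> R \<subseteq> N \<and> (\<forall>a\<in>N. a \<in> R \<or> inverse a \<in> max_ideal R)"

text \<open>
  If an element of \<open>R\<close> were not in \<open>V\<close>, its inverse would lie in the maximal ideal of
  \<open>V\<close> and hence in that of \<open>R\<close>.
\<close>

lemma valuation_ring_dominated:
  assumes V: "valuation_ring N V" and R: "sring R" "R \<subseteq> N" and "lies_above R V"
  shows "R = V"
proof
  show "V \<subseteq> R" using assms unfolding lies_above_def by auto
  show "R \<subseteq> V"
  proof
    fix a assume a: "a \<in> R"
    show "a \<in> V"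
    proof (rule ccontr)
      assume "a \<notin> V"
      then have "inverse a \<in> max_ideal R" "a \<noteq> 0"
        using V a R assms(4) unfolding valuation_ring_def lies_above_def by auto
      then show False using a max_ideal_eq[OF R(1)] by auto
    qed
  qed
qed

section \<open>Finite groups of automorphisms of a field\<close>

definition polys :: "'a::Fields.field set \<Rightarrow> 'a poly set" where
  "polys A = {f. \<forall>i. Polynomial.coeff f i \<in> A}"

lemma polysI: "(\<And>i. Polynomial.coeff f i \<in> A) \<Longrightarrow> f \<in> polys A"
  and polysD: "f \<in> polys A \<Longrightarrow> Polynomial.coeff f i \<in> A"
  by (auto simp: polys_def)

lemma polys_mono: "A \<subseteq> B \<Longrightarrow> f \<in> polys A \<Longrightarrow> f \<in> polys B"
  by (auto simp: polys_def)

lemma coeffs_subset_iff: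
  assumes "sring A"
  shows "set (Polynomial.coeffs f) \<subseteq> A \<longleftrightarrow> f \<in> polys A"
proof -
  have "f \<in> polys A \<longleftrightarrow> range (Polynomial.coeff f) \<subseteq> A" by (auto simp: polys_def)
  then show ?thesis using sring_0[OF assms] unfolding range_coeff by simp
qed

context
  fixes A :: "'a::Fields.field set"
  assumes A: "sring A"
begin

lemma polys_0 [simp]: "0 \<in> polys A" using A by (auto intro!: polysI)
lemma polys_pCons: "a \<in> A \<Longrightarrow> f \<in> polys A \<Longrightarrow> pCons a f \<in> polys A"
  by (auto intro!: polysI simp: coeff_pCons polysD split: nat.splits)
lemma polys_1 [simp]: "1 \<in> polys A"
  using polys_pCons[OF sring_1[OF A] polys_0] by (simp add: pCons_one)
lemma polys_add: "f \<in> polys A \<Longrightarrow> g \<in> polys A \<Longrightarrow> f + g \<in> polys A"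
  using A by (auto intro!: polysI simp: polysD sring_add)
lemma polys_diff: "f \<in> polys A \<Longrightarrow> g \<in> polys A \<Longrightarrow> f - g \<in> polys A"
  using A by (auto intro!: polysI sring_diff simp: polysD)
lemma polys_mult: "f \<in> polys A \<Longrightarrow> g \<in> polys A \<Longrightarrow> f * g \<in> polys A"
  using A by (auto intro!: polysI sring_sum sring_mult simp: polysD coeff_mult)
lemma polys_smult: "a \<in> A \<Longrightarrow> g \<in> polys A \<Longrightarrow> Polynomial.smult a g \<in> polys A"
  using A by (auto intro!: polysI sring_mult simp: polysD)
lemma polys_monom: "a \<in> A \<Longrightarrow> Polynomial.monom a n \<in> polys A"
  using A by (auto intro!: polysI)
lemma polys_prod: "(\<And>i. i \<in> I \<Longrightarrow> f i \<in> polys A) \<Longrightarrow> prod f I \<in> polys A"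
  by (induction I rule: infinite_finite_induct) (auto intro: polys_mult)
lemma polys_sum: "(\<And>i. i \<in> I \<Longrightarrow> f i \<in> polys A) \<Longrightarrow> sum f I \<in> polys A"
  by (induction I rule: infinite_finite_induct) (auto intro: polys_add)

lemma poly_mem: "f \<in> polys A \<Longrightarrow> a \<in> A \<Longrightarrow> poly f a \<in> A"
  unfolding poly_altdef using A by (auto intro!: sring_sum sring_mult sring_power simp: polysD)

end

text \<open>
  A Galois automorphism respects sums and products on the field it acts on only, so the coefficients have to stay
  in that field.
\<close>

lemma map_poly_mult_on:
  assumes A: "sring A" and f: "f \<in> polys A" and g: "g \<in> polys A"
    and h: "h 0 = 0" "\<And>a b. a \<in> A \<Longrightarrow> b \<in> A \<Longrightarrow> h (a + b) = h a + h b"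
      "\<And>a b. a \<in> A \<Longrightarrow> b \<in> A \<Longrightarrow> h (a * b) = h a * h b"
  shows "map_poly h (f * g) = map_poly h f * map_poly h g"
proof (rule poly_eqI)
  have hs: "finite I \<Longrightarrow> (\<And>i. i \<in> I \<Longrightarrow> q i \<in> A) \<Longrightarrow> h (sum q I) = (\<Sum>i\<in>I. h (q i))" for q and I :: "nat set"
    by (induction I rule: finite_induct) (auto simp: h sring_sum[OF A])
  fix n
  have "h (\<Sum>i\<le>n. Polynomial.coeff f i * Polynomial.coeff g (n - i)) = (\<Sum>i\<le>n. h (Polynomial.coeff f i * Polynomial.coeff g (n - i)))"
    using A by (intro hs) (auto simp: polysD[OF f] polysD[OF g])
  then show "Polynomial.coeff (map_poly h (f * g)) n = Polynomial.coeff (map_poly h f * map_poly h g) n"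
    by (simp add: coeff_map_poly h coeff_mult polysD[OF f] polysD[OF g])
qed

lemma map_poly_add_on:
  assumes f: "f \<in> polys A" and g: "g \<in> polys A"
    and h: "h 0 = 0" "\<And>a b. a \<in> A \<Longrightarrow> b \<in> A \<Longrightarrow> h (a + b) = h a + h b"
  shows "map_poly h (f + g) = map_poly h f + map_poly h g"
  by (rule poly_eqI) (simp add: coeff_map_poly h polysD[OF f] polysD[OF g])

lemma galois_group_mem:
  "\<sigma> \<in> carrier (galois_group F N) \<longleftrightarrow>
     \<sigma> \<in> Bij N \<and> (\<forall>a\<in>N. \<sigma> a \<in> N) \<and> \<sigma> 1 = 1 \<and> (\<forall>a\<in>F. \<sigma> a = a) \<and>
     (\<forall>a\<in>N. \<forall>b\<in>N. \<sigma> (a + b) = \<sigma> a + \<sigma> b \<and> \<sigma> (a * b) = \<sigma> a * \<sigma> b)"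
  unfolding galois_group_def ring_hom_def by auto

lemma galois_group_mult:
  assumes "\<sigma> \<in> carrier (galois_group F N)" "\<tau> \<in> carrier (galois_group F N)"
  shows "\<sigma> \<otimes>\<^bsub>galois_group F N\<^esub> \<tau> = compose N \<sigma> \<tau>"
  using assms by (auto simp: galois_group_mem) (auto simp: galois_group_def BijGroup_def)

lemma galois_group_one: "\<one>\<^bsub>galois_group F N\<^esub> = (\<lambda>x\<in>N. x)"
  by (simp add: galois_group_def BijGroup_def)

lemma group_galois_group:
  assumes N: "sring N" and F: "F \<subseteq> N"
  shows "group (galois_group F N)"
proof -
  interpret B: group "BijGroup N" by (rule group_BijGroup)
  let ?C = "carrier (galois_group F N)"
  have BC: "?C \<subseteq> Bij N" by (auto simp: galois_group_mem)
  have "subgroup ?C (BijGroup N)"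
  proof (rule B.subgroupI)
    show "?C \<subseteq> carrier (BijGroup N)" using BC by (auto simp: BijGroup_def)
    have "(\<lambda>x\<in>N. x) \<in> ?C"
      using N F by (auto simp: galois_group_mem id_Bij)
    then show "?C \<noteq> {}" by auto
  next
    fix s assume s: "s \<in> ?C"
    then have sB: "s \<in> Bij N" using BC by auto
    let ?i = "\<lambda>x\<in>N. inv_into N s x"
    have img: "s ` N = N" and inj: "inj_on s N" using sB by (auto simp: Bij_def bij_betw_def)
    have hs: "s (a + b) = s a + s b" "s (a * b) = s a * s b" if "a \<in> N" "b \<in> N" for a b
      using s that by (auto simp: galois_group_mem)
    have mem: "inv_into N s a \<in> N" if "a \<in> N" for a using sB that by (rule Bij_inv_into_mem)
    have "inv_into N s (a + b) = inv_into N s a + inv_into N s b"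
      "inv_into N s (a * b) = inv_into N s a * inv_into N s b" if "a \<in> N" "b \<in> N" for a b
    proof -
      have "a = s (inv_into N s a)" "b = s (inv_into N s b)"
        using that img by (simp_all add: f_inv_into_f)
      then show "inv_into N s (a + b) = inv_into N s a + inv_into N s b"
        "inv_into N s (a * b) = inv_into N s a * inv_into N s b"
        using hs[of "inv_into N s a" "inv_into N s b"] mem that N inj
        by (metis inv_into_f_f sring_add, metis inv_into_f_f sring_mult)
    qed
    moreover have fixs: "inv_into N s a = a" if "a \<in> N" "s a = a" for a
      using that inj by (metis inv_into_f_f)
    have "inv_into N s 1 = 1" using s N by (intro fixs) (auto simp: galois_group_mem)
    moreover have "inv_into N s a = a" if "a \<in> F" for a
      using s that F by (intro fixs) (auto simp: galois_group_mem)
    moreover have "?i \<in> Bij N" using sB by (rule restrict_inv_into_Bij)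
    ultimately have "?i \<in> ?C" using mem N F by (auto simp: galois_group_mem)
    then show "inv\<^bsub>BijGroup N\<^esub> s \<in> ?C" using inv_BijGroup[OF sB] by simp
  next
    fix s t assume st: "s \<in> ?C" "t \<in> ?C"
    then have "compose N s t \<in> Bij N" using BC by (auto intro!: compose_Bij)
    then have "compose N s t \<in> ?C"
      using st N F by (auto simp: galois_group_mem compose_def)
    moreover have "s \<otimes>\<^bsub>BijGroup N\<^esub> t = compose N s t"
      using st BC by (auto simp: BijGroup_def)
    ultimately show "s \<otimes>\<^bsub>BijGroup N\<^esub> t \<in> ?C" by simp
  qed
  then have "group (BijGroup N\<lparr>carrier := ?C\<rparr>)"
    by (rule subgroup.subgroup_is_group) (rule group_BijGroup)
  then show ?thesis by (simp add: galois_group_def)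
qed

locale galois =
  fixes F N :: "'a::Fields.field set"
  assumes N: "sring N" and N_inverse: "a \<in> N \<Longrightarrow> inverse a \<in> N"
    and galois_extension: "galois_extension F N"
    and finite_gal: "finite (carrier (galois_group F N))"
begin

abbreviation \<Gamma> where "\<Gamma> \<equiv> galois_group F N"
abbreviation Gal where "Gal \<equiv> carrier \<Gamma>"

lemma fixed_iff: "a \<in> F \<longleftrightarrow> a \<in> N \<and> (\<forall>\<sigma>\<in>Gal. \<sigma> a = a)"
  using galois_extension unfolding galois_extension_def by auto

lemma F_subset: "F \<subseteq> N" using fixed_iff by auto

sublocale gal: group \<Gamma> by (rule group_galois_group[OF N F_subset])

lemma gal_closed [intro, simp]: "\<sigma> \<in> Gal \<Longrightarrow> a \<in> N \<Longrightarrow> \<sigma> a \<in> N"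
  and gal_1 [simp]: "\<sigma> \<in> Gal \<Longrightarrow> \<sigma> 1 = 1"
  and gal_fix [simp]: "\<sigma> \<in> Gal \<Longrightarrow> a \<in> F \<Longrightarrow> \<sigma> a = a"
  and gal_add: "\<sigma> \<in> Gal \<Longrightarrow> a \<in> N \<Longrightarrow> b \<in> N \<Longrightarrow> \<sigma> (a + b) = \<sigma> a + \<sigma> b"
  and gal_mult: "\<sigma> \<in> Gal \<Longrightarrow> a \<in> N \<Longrightarrow> b \<in> N \<Longrightarrow> \<sigma> (a * b) = \<sigma> a * \<sigma> b"
  by (auto simp: galois_group_mem)

lemma gal_bij: "\<sigma> \<in> Gal \<Longrightarrow> bij_betw \<sigma> N N"
  unfolding galois_group_mem Bij_def by blast

lemma gal_0 [simp]: "\<sigma> \<in> Gal \<Longrightarrow> \<sigma> 0 = 0"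
  using gal_add[of \<sigma> 0 0] sring_0[OF N] by (simp only: add_0_right add_cancel_right_right)

lemma gal_uminus: "\<sigma> \<in> Gal \<Longrightarrow> a \<in> N \<Longrightarrow> \<sigma> (- a) = - \<sigma> a"
  using gal_add[of \<sigma> a "- a"] N by (auto simp: eq_neg_iff_add_eq_0 add.commute)

lemma gal_diff: "\<sigma> \<in> Gal \<Longrightarrow> a \<in> N \<Longrightarrow> b \<in> N \<Longrightarrow> \<sigma> (a - b) = \<sigma> a - \<sigma> b"
  using gal_add[of \<sigma> a "- b"] gal_uminus[of \<sigma> b] N by auto

lemma gal_eq_0_iff [simp]: "\<sigma> \<in> Gal \<Longrightarrow> a \<in> N \<Longrightarrow> \<sigma> a = 0 \<longleftrightarrow> a = 0"
  using gal_bij[of \<sigma>] N unfolding bij_betw_def inj_on_def by (metis gal_0 sring_0)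

lemma gal_inverse: "\<sigma> \<in> Gal \<Longrightarrow> a \<in> N \<Longrightarrow> \<sigma> (inverse a) = inverse (\<sigma> a)"
proof (cases "a = 0")
  case False
  assume s: "\<sigma> \<in> Gal" "a \<in> N"
  have "\<sigma> a * \<sigma> (inverse a) = 1"
    using gal_mult[OF s N_inverse[OF s(2)]] False s(1) by simp
  then show ?thesis by (simp add: inverse_unique)
qed auto

lemma N_divide: "a \<in> N \<Longrightarrow> b \<in> N \<Longrightarrow> a / b \<in> N"
  using N N_inverse[of b] by (auto simp: divide_inverse)

lemma gal_divide: "\<sigma> \<in> Gal \<Longrightarrow> a \<in> N \<Longrightarrow> b \<in> N \<Longrightarrow> \<sigma> (a / b) = \<sigma> a / \<sigma> b"
  using gal_mult[of \<sigma> a "inverse b"] N_inverse[of b] gal_inverse[of \<sigma> b] by (simp add: divide_inverse)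

lemma gal_power: "\<sigma> \<in> Gal \<Longrightarrow> a \<in> N \<Longrightarrow> \<sigma> (a ^ n) = \<sigma> a ^ n"
  using N by (induction n) (auto simp: gal_mult sring_power)

lemma gal_sum: "\<sigma> \<in> Gal \<Longrightarrow> (\<And>i. i \<in> I \<Longrightarrow> f i \<in> N) \<Longrightarrow> \<sigma> (sum f I) = (\<Sum>i\<in>I. \<sigma> (f i))"
  using N by (induction I rule: infinite_finite_induct) (auto simp: gal_add sring_sum)

lemma gal_prod: "\<sigma> \<in> Gal \<Longrightarrow> (\<And>i. i \<in> I \<Longrightarrow> f i \<in> N) \<Longrightarrow> \<sigma> (prod f I) = (\<Prod>i\<in>I. \<sigma> (f i))"
  using N by (induction I rule: infinite_finite_induct) (auto simp: gal_mult sring_prod)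

lemma gal_comp: "\<sigma> \<in> Gal \<Longrightarrow> \<tau> \<in> Gal \<Longrightarrow> a \<in> N \<Longrightarrow> (\<sigma> \<otimes>\<^bsub>\<Gamma>\<^esub> \<tau>) a = \<sigma> (\<tau> a)"
  by (simp add: galois_group_mult compose_def)

lemma gal_one: "a \<in> N \<Longrightarrow> \<one>\<^bsub>\<Gamma>\<^esub> a = a"
  by (simp add: galois_group_one)

lemma gal_inv: "\<sigma> \<in> Gal \<Longrightarrow> a \<in> N \<Longrightarrow> (inv\<^bsub>\<Gamma>\<^esub> \<sigma>) (\<sigma> a) = a" "\<sigma> \<in> Gal \<Longrightarrow> a \<in> N \<Longrightarrow> \<sigma> ((inv\<^bsub>\<Gamma>\<^esub> \<sigma>) a) = a"
  using gal_comp[of "inv\<^bsub>\<Gamma>\<^esub> \<sigma>" \<sigma> a] gal_comp[of \<sigma> "inv\<^bsub>\<Gamma>\<^esub> \<sigma>" a] gal_one[of a] by auto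

lemma gal_ext:
  assumes "\<sigma> \<in> Gal" "\<tau> \<in> Gal" "\<And>a. a \<in> N \<Longrightarrow> \<sigma> a = \<tau> a"
  shows "\<sigma> = \<tau>"
proof (rule extensionalityI[where A=N])
  show "\<sigma> \<in> extensional N" "\<tau> \<in> extensional N" 
    using assms(1,2) unfolding galois_group_mem Bij_def by blast+
qed (rule assms(3))

lemma fixedI: "a \<in> N \<Longrightarrow> (\<And>\<sigma>. \<sigma> \<in> Gal \<Longrightarrow> \<sigma> a = a) \<Longrightarrow> a \<in> F" using fixed_iff by auto

lemma F: "sring F"
  using N by (auto simp: fixed_iff gal_add gal_mult gal_uminus intro!: sringI)

lemma F_inverse: "a \<in> F \<Longrightarrow> inverse a \<in> F"
  by (auto simp: fixed_iff gal_inverse N_inverse)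

lemma translate_bij:
  assumes H: "subgroup H \<Gamma>" and s: "\<sigma> \<in> H"
  shows "bij_betw (\<lambda>\<tau>. \<sigma> \<otimes>\<^bsub>\<Gamma>\<^esub> \<tau>) H H"
proof -
  interpret H: group "\<Gamma>\<lparr>carrier := H\<rparr>" using H by (rule gal.subgroup_imp_group)
  show ?thesis
    unfolding bij_betw_def using H.surj_const_mult[of \<sigma>] H.inj_on_cmult[of \<sigma>] s by simp
qed

lemma subgroup_mem: "subgroup H \<Gamma> \<Longrightarrow> \<sigma> \<in> H \<Longrightarrow> \<sigma> \<in> Gal"
  using subgroup.mem_carrier by metis

lemma sum_translate:
  assumes H: "subgroup H \<Gamma>" and s: "\<sigma> \<in> H"
  shows "(\<Sum>\<tau>\<in>H. f (\<sigma> \<otimes>\<^bsub>\<Gamma>\<^esub> \<tau>)) = (\<Sum>\<tau>\<in>H. f \<tau>)"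
  using sum.reindex_bij_betw[OF translate_bij[OF assms]] by simp

lemma prod_translate:
  assumes H: "subgroup H \<Gamma>" and s: "\<sigma> \<in> H"
  shows "(\<Prod>\<tau>\<in>H. f (\<sigma> \<otimes>\<^bsub>\<Gamma>\<^esub> \<tau>)) = (\<Prod>\<tau>\<in>H. f \<tau>)"
  using prod.reindex_bij_betw[OF translate_bij[OF assms]] by simp

lemma trace_fixed:
  assumes H: "subgroup H \<Gamma>" and s: "\<sigma> \<in> H" and a: "a \<in> N"
  shows "\<sigma> (\<Sum>\<tau>\<in>H. \<tau> a) = (\<Sum>\<tau>\<in>H. \<tau> a)"
proof -
  have "\<sigma> (\<Sum>\<tau>\<in>H. \<tau> a) = (\<Sum>\<tau>\<in>H. (\<sigma> \<otimes>\<^bsub>\<Gamma>\<^esub> \<tau>) a)"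
    using a subgroup_mem[OF H] subgroup_mem[OF H s] by (subst gal_sum) (auto simp: gal_comp intro!: sum.cong)
  then show ?thesis using sum_translate[OF H s, of "\<lambda>\<tau>. \<tau> a"] by simp
qed

lemma norm_fixed:
  assumes H: "subgroup H \<Gamma>" and s: "\<sigma> \<in> H" and a: "a \<in> N"
  shows "\<sigma> (\<Prod>\<tau>\<in>H. \<tau> a) = (\<Prod>\<tau>\<in>H. \<tau> a)"
proof -
  have "\<sigma> (\<Prod>\<tau>\<in>H. \<tau> a) = (\<Prod>\<tau>\<in>H. (\<sigma> \<otimes>\<^bsub>\<Gamma>\<^esub> \<tau>) a)"
    using a subgroup_mem[OF H] subgroup_mem[OF H s] by (subst gal_prod) (auto simp: gal_comp intro!: prod.cong)
  then show ?thesis using prod_translate[OF H s, of "\<lambda>\<tau>. \<tau> a"] by simp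
qed

lemma trace_mem: "a \<in> N \<Longrightarrow> (\<Sum>\<tau>\<in>Gal. \<tau> a) \<in> F"
  by (rule fixedI) (auto simp: trace_fixed[OF gal.subgroup_self] intro!: sring_sum[OF N])

text \<open>
  For \<open>\<sigma> \<noteq> 1\<close> choose \<open>c\<close> with \<open>\<sigma> c \<noteq> c\<close>; the tensor \<open>(1 \<otimes> c - \<sigma> c \<otimes> 1) / (c - \<sigma> c)\<close> takes the value
  \<open>1\<close> at the identity and \<open>0\<close> at \<open>\<sigma>\<close>, where \<open>a \<otimes> b\<close> takes the value \<open>a * \<tau> b\<close> at \<open>\<tau>\<close>.  The product of
  these tensors is the list below.  It replaces primitive elements and dual bases: it shows at once
  that \<open>N\<close> is spanned by finitely many elements and that traces do not vanish.
\<close>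

lemma galois_coordinates:
  obtains ps where "set ps \<subseteq> N \<times> N"
    "\<And>\<sigma>. \<sigma> \<in> Gal \<Longrightarrow> (\<Sum>(a, b)\<leftarrow>ps. a * \<sigma> b) = (if \<sigma> = \<one>\<^bsub>\<Gamma>\<^esub> then 1 else 0)"
proof -
  define T where "T ps \<tau> = (\<Sum>(a, b)\<leftarrow>ps. a * \<tau> b)" for ps and \<tau> :: "'a \<Rightarrow> 'a"
  have "finite S \<Longrightarrow> S \<subseteq> Gal - {\<one>\<^bsub>\<Gamma>\<^esub>} \<Longrightarrow>
    \<exists>ps. set ps \<subseteq> N \<times> N \<and> T ps \<one>\<^bsub>\<Gamma>\<^esub> = 1 \<and> (\<forall>\<sigma>\<in>S. T ps \<sigma> = 0)" for S
  proof (induction S rule: finite_induct)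
    case empty
    have "set [(1, 1)] \<subseteq> N \<times> N \<and> T [(1, 1)] \<one>\<^bsub>\<Gamma>\<^esub> = 1" using N by (auto simp: T_def)
    then show ?case by blast
  next
    case (insert s S)
    then obtain ps where ps: "set ps \<subseteq> N \<times> N" "T ps \<one>\<^bsub>\<Gamma>\<^esub> = 1" "\<And>\<sigma>. \<sigma> \<in> S \<Longrightarrow> T ps \<sigma> = 0" by auto
    have s: "s \<in> Gal" "s \<noteq> \<one>\<^bsub>\<Gamma>\<^esub>" using insert by auto
    then obtain c where c: "c \<in> N" "s c \<noteq> c" using gal_ext[OF s(1) gal.one_closed] gal_one by force
    define D where "D = c - s c"
    have D: "D \<in> N" "D \<noteq> 0" using c s N by (auto simp: D_def intro!: sring_diff)
    define qs where "qs = map (\<lambda>(a, b). (a / D, b * c)) ps @ map (\<lambda>(a, b). (- (a * s c / D), b)) ps"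
    have qs: "set qs \<subseteq> N \<times> N"
      using ps(1) c s N D unfolding qs_def by (fastforce intro!: N_divide sring_mult[OF N] sring_uminus[OF N])
    have aux: "set xs \<subseteq> N \<times> N \<Longrightarrow>
      T (map (\<lambda>(a, b). (a / D, b * c)) xs) \<tau> + T (map (\<lambda>(a, b). (- (a * s c / D), b)) xs) \<tau> = (\<tau> c - s c) / D * T xs \<tau>"
      if t: "\<tau> \<in> Gal" for \<tau> xs
      by (induction xs) (use t c in \<open>auto simp: T_def gal_mult diff_divide_distrib algebra_simps\<close>)
    have Tqs: "T qs \<tau> = (\<tau> c - s c) / D * T ps \<tau>" if "\<tau> \<in> Gal" for \<tau>
      using aux[OF that ps(1)] unfolding qs_def by (simp add: T_def)
    have "T qs \<one>\<^bsub>\<Gamma>\<^esub> = 1" using Tqs[OF gal.one_closed] D ps(2) gal_one[OF c(1)] by (simp add: D_def)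
    moreover have "T qs \<sigma> = 0" if "\<sigma> \<in> insert s S" for \<sigma>
      using Tqs[of \<sigma>] that ps(3)[of \<sigma>] insert.prems by auto
    ultimately show ?case using qs by blast
  qed
  from this[of "Gal - {\<one>\<^bsub>\<Gamma>\<^esub>}"] obtain ps where "set ps \<subseteq> N \<times> N" "T ps \<one>\<^bsub>\<Gamma>\<^esub> = 1" "\<And>\<sigma>. \<sigma> \<in> Gal - {\<one>\<^bsub>\<Gamma>\<^esub>} \<Longrightarrow> T ps \<sigma> = 0"
    using finite_gal by auto
  then show thesis
    by (intro that[of ps]) (auto simp: T_def)
qed

lemma sum_coordinates:
  fixes ps :: "('a \<times> 'a) list"
  assumes "finite H"
  shows "(\<Sum>\<sigma>\<in>H. \<Sum>(a, b)\<leftarrow>ps. a * f \<sigma> b) = (\<Sum>(a, b)\<leftarrow>ps. a * (\<Sum>\<sigma>\<in>H. f \<sigma> b))"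
  by (induction ps) (auto simp: sum.distrib sum_distrib_left)

text \<open>
  Not all traces vanish, since by \<open>galois_coordinates\<close> some linear combination of traces is
  \<open>1\<close>; divide by a nonzero one.
\<close>

lemma trace_one:
  assumes H: "subgroup H \<Gamma>"
  obtains e where "e \<in> N" "(\<Sum>\<sigma>\<in>H. \<sigma> e) = 1"
proof -
  obtain ps where ps: "set ps \<subseteq> N \<times> N"
    "\<And>\<sigma>. \<sigma> \<in> Gal \<Longrightarrow> (\<Sum>(a, b)\<leftarrow>ps. a * \<sigma> b) = (if \<sigma> = \<one>\<^bsub>\<Gamma>\<^esub> then 1 else 0)"
    using galois_coordinates by blast
  have fin: "finite H" using finite_gal subgroup.subset[OF H] finite_subset by auto
  have one: "\<one>\<^bsub>\<Gamma>\<^esub> \<in> H" by (rule subgroup.one_closed[OF H])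
  have "(\<Sum>(a, b)\<leftarrow>ps. a * (\<Sum>\<sigma>\<in>H. \<sigma> b)) = (\<Sum>\<sigma>\<in>H. if \<sigma> = \<one>\<^bsub>\<Gamma>\<^esub> then 1 else 0)"
    unfolding sum_coordinates[OF fin, symmetric] using subgroup_mem[OF H] ps(2) by (intro sum.cong) auto
  also have "\<dots> = 1" using one fin by (simp add: sum.delta)
  finally have sum1: "(\<Sum>(a, b)\<leftarrow>ps. a * (\<Sum>\<sigma>\<in>H. \<sigma> b)) = 1" .
  have "\<exists>b\<in>N. (\<Sum>\<sigma>\<in>H. \<sigma> b) \<noteq> 0"
  proof (rule ccontr)
    assume "\<not> ?thesis"
    then have "set xs \<subseteq> N \<times> N \<Longrightarrow> (\<Sum>(a, b)\<leftarrow>xs. a * (\<Sum>\<sigma>\<in>H. \<sigma> b)) = 0" for xs :: "('a \<times> 'a) list"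
      by (induction xs) auto
    then show False using sum1 ps(1) by force
  qed
  then obtain b where b: "b \<in> N" "(\<Sum>\<sigma>\<in>H. \<sigma> b) \<noteq> 0" by auto
  define c where "c = (\<Sum>\<sigma>\<in>H. \<sigma> b)"
  have c: "c \<in> N" "c \<noteq> 0" using b subgroup_mem[OF H] unfolding c_def by (auto intro!: sring_sum[OF N])
  have "\<sigma> (b / c) = \<sigma> b / c" if "\<sigma> \<in> H" for \<sigma>
    using gal_divide[OF subgroup_mem[OF H that] b(1) c(1)] trace_fixed[OF H that b(1)] by (simp add: c_def)
  then have "(\<Sum>\<sigma>\<in>H. \<sigma> (b / c)) = (\<Sum>\<sigma>\<in>H. \<sigma> b) / c" by (simp add: sum_divide_distrib)
  then show thesis using that[of "b / c"] b c N_divide by (simp add: c_def)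
qed

text \<open>
  An element \<open>e\<close> of trace one splits the cocycle: take minus the sum of the elements
  \<open>\<kappa> \<tau> * \<tau> e\<close>.
\<close>

lemma hilbert90:
  assumes H: "subgroup H \<Gamma>" and kN: "\<And>\<sigma>. \<sigma> \<in> H \<Longrightarrow> \<kappa> \<sigma> \<in> N"
    and k: "\<And>\<sigma> \<tau>. \<sigma> \<in> H \<Longrightarrow> \<tau> \<in> H \<Longrightarrow> \<kappa> (\<sigma> \<otimes>\<^bsub>\<Gamma>\<^esub> \<tau>) = \<kappa> \<sigma> + \<sigma> (\<kappa> \<tau>)"
  obtains z where "z \<in> N" "\<And>\<sigma>. \<sigma> \<in> H \<Longrightarrow> \<sigma> z = z + \<kappa> \<sigma>"
proof -
  obtain e where e: "e \<in> N" "(\<Sum>\<sigma>\<in>H. \<sigma> e) = 1" using trace_one[OF H] by blast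
  define z where "z = - (\<Sum>\<tau>\<in>H. \<kappa> \<tau> * \<tau> e)"
  have mem: "\<kappa> \<tau> * \<tau> e \<in> N" if "\<tau> \<in> H" for \<tau>
    using kN[OF that] subgroup_mem[OF H that] e(1) by (intro sring_mult[OF N]) auto
  have zN: "(\<Sum>\<tau>\<in>H. \<kappa> \<tau> * \<tau> e) \<in> N" using mem by (intro sring_sum[OF N])
  have "\<sigma> z = z + \<kappa> \<sigma>" if s: "\<sigma> \<in> H" for \<sigma>
  proof -
    note sG = subgroup_mem[OF H s]
    have "\<sigma> (\<Sum>\<tau>\<in>H. \<kappa> \<tau> * \<tau> e) = (\<Sum>\<tau>\<in>H. \<sigma> (\<kappa> \<tau> * \<tau> e))"
      using sG mem by (rule gal_sum)
    also have "\<dots> = (\<Sum>\<tau>\<in>H. \<kappa> (\<sigma> \<otimes>\<^bsub>\<Gamma>\<^esub> \<tau>) * (\<sigma> \<otimes>\<^bsub>\<Gamma>\<^esub> \<tau>) e - \<kappa> \<sigma> * (\<sigma> \<otimes>\<^bsub>\<Gamma>\<^esub> \<tau>) e)"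
    proof (rule sum.cong[OF refl])
      fix \<tau> assume t: "\<tau> \<in> H"
      have "\<sigma> (\<kappa> \<tau> * \<tau> e) = \<sigma> (\<kappa> \<tau>) * \<sigma> (\<tau> e)"
        using kN[OF t] subgroup_mem[OF H t] e(1) by (intro gal_mult[OF sG]) auto
      also have "\<dots> = (\<kappa> (\<sigma> \<otimes>\<^bsub>\<Gamma>\<^esub> \<tau>) - \<kappa> \<sigma>) * (\<sigma> \<otimes>\<^bsub>\<Gamma>\<^esub> \<tau>) e"
        using k[OF s t] gal_comp[OF sG subgroup_mem[OF H t] e(1)] by simp
      finally show "\<sigma> (\<kappa> \<tau> * \<tau> e) = \<kappa> (\<sigma> \<otimes>\<^bsub>\<Gamma>\<^esub> \<tau>) * (\<sigma> \<otimes>\<^bsub>\<Gamma>\<^esub> \<tau>) e - \<kappa> \<sigma> * (\<sigma> \<otimes>\<^bsub>\<Gamma>\<^esub> \<tau>) e"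
        by (simp add: left_diff_distrib)
    qed
    also have "\<dots> = (\<Sum>\<tau>\<in>H. \<kappa> \<tau> * \<tau> e) - \<kappa> \<sigma>"
      using sum_translate[OF H s, of "\<lambda>\<tau>. \<kappa> \<tau> * \<tau> e - \<kappa> \<sigma> * \<tau> e"] e(2)
      by (simp add: sum_subtractf sum_distrib_left[symmetric])
    finally show ?thesis unfolding z_def using gal_uminus[OF sG zN] by simp
  qed
  moreover have "z \<in> N" unfolding z_def using zN by (rule sring_uminus[OF N])
  ultimately show thesis using that by blast
qed

text \<open>
  For \<open>\<tau>\<close> outside \<open>J\<close>, summing \<open>galois_coordinates\<close> over
  \<open>J\<close> gives \<open>1\<close> and summing over \<open>\<tau> J\<close> gives \<open>0\<close>, but the
  two sums agree because \<open>\<tau>\<close> fixes all traces over \<open>J\<close>.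
\<close>

lemma artin_fixed_field:
  assumes J: "subgroup J \<Gamma>" and t: "\<tau> \<in> Gal"
    and fixed: "\<And>a. a \<in> N \<Longrightarrow> (\<And>\<sigma>. \<sigma> \<in> J \<Longrightarrow> \<sigma> a = a) \<Longrightarrow> \<tau> a = a"
  shows "\<tau> \<in> J"
proof (rule ccontr)
  assume tJ: "\<tau> \<notin> J"
  obtain ps where ps: "set ps \<subseteq> N \<times> N"
    "\<And>\<sigma>. \<sigma> \<in> Gal \<Longrightarrow> (\<Sum>(a, b)\<leftarrow>ps. a * \<sigma> b) = (if \<sigma> = \<one>\<^bsub>\<Gamma>\<^esub> then 1 else 0)"
    using galois_coordinates by blast
  have fin: "finite J" using finite_gal subgroup.subset[OF J] finite_subset by auto
  have one: "\<one>\<^bsub>\<Gamma>\<^esub> \<in> J" by (rule subgroup.one_closed[OF J])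
  have "(\<Sum>(a, b)\<leftarrow>ps. a * (\<Sum>\<sigma>\<in>J. \<sigma> b)) = (\<Sum>\<sigma>\<in>J. if \<sigma> = \<one>\<^bsub>\<Gamma>\<^esub> then 1 else 0)"
    unfolding sum_coordinates[OF fin, symmetric] using subgroup_mem[OF J] ps(2) by (intro sum.cong) auto
  also have "\<dots> = 1" using one fin by (simp add: sum.delta)
  finally have sum1: "(\<Sum>(a, b)\<leftarrow>ps. a * (\<Sum>\<sigma>\<in>J. \<sigma> b)) = 1" .
  have "\<tau> \<otimes>\<^bsub>\<Gamma>\<^esub> \<sigma> \<noteq> \<one>\<^bsub>\<Gamma>\<^esub>" if "\<sigma> \<in> J" for \<sigma>
  proof
    assume "\<tau> \<otimes>\<^bsub>\<Gamma>\<^esub> \<sigma> = \<one>\<^bsub>\<Gamma>\<^esub>"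
    then have "\<tau> = inv\<^bsub>\<Gamma>\<^esub> \<sigma>" using gal.inv_equality[OF _ subgroup_mem[OF J that] t] by simp
    then show False using tJ subgroup.m_inv_closed[OF J that] by simp
  qed
  then have "(\<Sum>\<sigma>\<in>J. \<Sum>(a, b)\<leftarrow>ps. a * (\<tau> \<otimes>\<^bsub>\<Gamma>\<^esub> \<sigma>) b) = 0"
    using ps(2) t subgroup_mem[OF J] by (intro sum.neutral) auto
  then have sum0: "(\<Sum>(a, b)\<leftarrow>ps. a * (\<Sum>\<sigma>\<in>J. (\<tau> \<otimes>\<^bsub>\<Gamma>\<^esub> \<sigma>) b)) = 0"
    using sum_coordinates[OF fin, of "\<lambda>\<sigma>. \<tau> \<otimes>\<^bsub>\<Gamma>\<^esub> \<sigma>" ps] by simp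
  have eq: "(\<Sum>\<sigma>\<in>J. (\<tau> \<otimes>\<^bsub>\<Gamma>\<^esub> \<sigma>) b) = (\<Sum>\<sigma>\<in>J. \<sigma> b)" if b: "b \<in> N" for b
  proof -
    have "(\<Sum>\<sigma>\<in>J. (\<tau> \<otimes>\<^bsub>\<Gamma>\<^esub> \<sigma>) b) = \<tau> (\<Sum>\<sigma>\<in>J. \<sigma> b)"
      using t b subgroup_mem[OF J] by (subst gal_sum) (auto simp: gal_comp intro!: sum.cong)
    also have "\<dots> = (\<Sum>\<sigma>\<in>J. \<sigma> b)"
      using b trace_fixed[OF J _ b] subgroup_mem[OF J] by (intro fixed sring_sum[OF N]) auto
    finally show ?thesis .
  qed
  have "set xs \<subseteq> N \<times> N \<Longrightarrow> (\<Sum>(a, b)\<leftarrow>xs. a * (\<Sum>\<sigma>\<in>J. (\<tau> \<otimes>\<^bsub>\<Gamma>\<^esub> \<sigma>) b)) = (\<Sum>(a, b)\<leftarrow>xs. a * (\<Sum>\<sigma>\<in>J. \<sigma> b))" for xs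
    by (induction xs) (auto simp: eq)
  then show False using sum0 sum1 ps(1) by simp
qed

definition charpoly :: "'a \<Rightarrow> 'a poly" where
  "charpoly b = (\<Prod>\<sigma>\<in>Gal. [:- \<sigma> b, 1:])"

lemma poly_charpoly: "b \<in> N \<Longrightarrow> poly (charpoly b) b = 0"
  using gal.one_closed finite_gal gal_one[of b]
  by (auto simp: charpoly_def poly_prod intro!: prod_zero bexI[of _ "\<one>\<^bsub>\<Gamma>\<^esub>"])

lemma degree_charpoly: "Polynomial.degree (charpoly b) = card Gal"
  unfolding charpoly_def by (subst degree_prod_eq_sum_degree) auto

lemma lead_coeff_charpoly: "Polynomial.lead_coeff (charpoly b) = 1"
  unfolding charpoly_def by (simp add: lead_coeff_prod)

lemma charpoly_polys_N: "b \<in> N \<Longrightarrow> charpoly b \<in> polys N"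
  unfolding charpoly_def using N by (auto intro!: polys_prod polys_pCons sring_uminus)

lemma map_poly_gal_prod:
  assumes s: "\<sigma> \<in> Gal" and "finite I" "\<And>i. i \<in> I \<Longrightarrow> f i \<in> N"
  shows "map_poly \<sigma> (\<Prod>i\<in>I. [:- f i, 1:]) = (\<Prod>i\<in>I. [:- \<sigma> (f i), 1:])"
  using assms(2,3)
proof (induction I rule: finite_induct)
  case empty
  show ?case using s by (simp add: map_poly_1')
next
  case (insert i I)
  have "map_poly \<sigma> ([:- f i, 1:] * (\<Prod>i\<in>I. [:- f i, 1:])) = map_poly \<sigma> [:- f i, 1:] * map_poly \<sigma> (\<Prod>i\<in>I. [:- f i, 1:])"
    using insert s by (intro map_poly_mult_on[OF N])
      (auto simp: gal_add gal_mult N intro!: polys_prod[OF N] polys_pCons[OF N] sring_uminus[OF N])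
  then show ?case using insert s by (simp add: map_poly_pCons gal_uminus)
qed

lemma polys_F_iff: "f \<in> polys F \<longleftrightarrow> f \<in> polys N \<and> (\<forall>\<sigma>\<in>Gal. map_poly \<sigma> f = f)"
  unfolding polys_def by (auto simp: poly_eq_iff coeff_map_poly fixed_iff)

text \<open>Every automorphism permutes the factors.\<close>

lemma charpoly_polys: "b \<in> N \<Longrightarrow> charpoly b \<in> polys F"
proof -
  assume b: "b \<in> N"
  have "map_poly \<tau> (charpoly b) = charpoly b" if t: "\<tau> \<in> Gal" for \<tau>
  proof -
    have "map_poly \<tau> (charpoly b) = (\<Prod>\<sigma>\<in>Gal. [:- \<tau> (\<sigma> b), 1:])"
      unfolding charpoly_def using t finite_gal b by (intro map_poly_gal_prod) auto
    also have "\<dots> = (\<Prod>\<sigma>\<in>Gal. [:- (\<tau> \<otimes>\<^bsub>\<Gamma>\<^esub> \<sigma>) b, 1:])" using t b by (intro prod.cong) (auto simp: gal_comp)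
    also have "\<dots> = charpoly b" unfolding charpoly_def
      using prod.reindex_bij_betw[OF translate_bij[OF gal.subgroup_self t], of "\<lambda>\<sigma>. [:- \<sigma> b, 1:]"] by simp
    finally show ?thesis .
  qed
  then show ?thesis using charpoly_polys_N[OF b] polys_F_iff by auto
qed

lemma charpoly_equation:
  assumes b: "b \<in> N"
  shows "b ^ card Gal = - (\<Sum>i<card Gal. Polynomial.coeff (charpoly b) i * b ^ i)"
proof -
  have "0 = (\<Sum>i\<le>card Gal. Polynomial.coeff (charpoly b) i * b ^ i)"
    using poly_charpoly[OF b] by (simp add: poly_altdef degree_charpoly)
  also have "\<dots> = (\<Sum>i<card Gal. Polynomial.coeff (charpoly b) i * b ^ i) + b ^ card Gal"
    using lead_coeff_charpoly[of b] by (simp add: degree_charpoly lessThan_Suc_atMost[symmetric])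
  finally show ?thesis by (simp add: eq_neg_iff_add_eq_0 add.commute)
qed

lemma card_Gal: "card Gal > 0" using finite_gal gal.one_closed by (auto simp: card_gt_0_iff)

text \<open>In contrast to \<open>charpoly\<close>, each conjugate occurs only once, so that the roots are simple.\<close>

definition orbit_poly :: "'a \<Rightarrow> 'a poly" where
  "orbit_poly b = (\<Prod>c\<in>(\<lambda>\<sigma>. \<sigma> b) ` Gal. [:- c, 1:])"

lemma orbit_image:
  assumes b: "b \<in> N" and t: "\<tau> \<in> Gal"
  shows "bij_betw \<tau> ((\<lambda>\<sigma>. \<sigma> b) ` Gal) ((\<lambda>\<sigma>. \<sigma> b) ` Gal)"
proof (rule bij_betw_imageI)
  show "inj_on \<tau> ((\<lambda>\<sigma>. \<sigma> b) ` Gal)"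
    using gal_bij[OF t] b unfolding bij_betw_def by (auto elim!: inj_on_subset)
  have "\<tau> ` ((\<lambda>\<sigma>. \<sigma> b) ` Gal) = (\<lambda>\<sigma>. \<sigma> b) ` ((\<lambda>\<sigma>. \<tau> \<otimes>\<^bsub>\<Gamma>\<^esub> \<sigma>) ` Gal)"
    using t b by (force simp: image_image gal_comp)
  then show "\<tau> ` ((\<lambda>\<sigma>. \<sigma> b) ` Gal) = (\<lambda>\<sigma>. \<sigma> b) ` Gal"
    using gal.surj_const_mult[OF t] by simp
qed

lemma orbit_poly_polys:
  assumes b: "b \<in> N"
  shows "orbit_poly b \<in> polys F"
proof -
  have "map_poly \<tau> (orbit_poly b) = orbit_poly b" if t: "\<tau> \<in> Gal" for \<tau>
  proof -
    have "map_poly \<tau> (orbit_poly b) = (\<Prod>c\<in>(\<lambda>\<sigma>. \<sigma> b) ` Gal. [:- \<tau> c, 1:])"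
      unfolding orbit_poly_def using t finite_gal b by (intro map_poly_gal_prod) auto
    then show ?thesis unfolding orbit_poly_def
      using prod.reindex_bij_betw[OF orbit_image[OF b t], of "\<lambda>c. [:- c, 1:]"] by simp
  qed
  moreover have "orbit_poly b \<in> polys N"
    unfolding orbit_poly_def using N b by (auto intro!: polys_prod polys_pCons sring_uminus)
  ultimately show ?thesis using polys_F_iff by auto
qed

lemma orbit_poly_simple_roots:
  assumes b: "b \<in> N"
  shows "poly (orbit_poly b) b = 0" "poly (Polynomial.pderiv (orbit_poly b)) b \<noteq> 0" "rsquarefree (orbit_poly b)"
proof -
  let ?O = "(\<lambda>\<sigma>. \<sigma> b) ` Gal"
  have fin: "finite ?O" using finite_gal by auto
  have split: "orbit_poly b = [:- c, 1:] * (\<Prod>c\<in>?O - {c}. [:- c, 1:])" if "c \<in> ?O" for c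
    unfolding orbit_poly_def using fin that by (subst prod.remove) auto
  have nz: "poly (\<Prod>c\<in>?O - {c}. [:- c, 1:]) c \<noteq> 0" for c
    using fin by (auto simp: poly_prod)
  have root: "poly (Polynomial.pderiv (orbit_poly b)) c \<noteq> 0" if "c \<in> ?O" for c
    using nz[of c] unfolding split[OF that] pderiv_mult poly_add poly_mult by (simp add: pderiv_pCons)
  have bO: "b \<in> ?O" by (rule image_eqI[where x="\<one>\<^bsub>\<Gamma>\<^esub>"]) (simp_all add: gal_one[OF b])
  show "poly (Polynomial.pderiv (orbit_poly b)) b \<noteq> 0" by (rule root[OF bO])
  show "poly (orbit_poly b) b = 0" unfolding split[OF bO] by simp
  have "poly (orbit_poly b) c \<noteq> 0 \<or> poly (Polynomial.pderiv (orbit_poly b)) c \<noteq> 0" for c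
  proof (cases "c \<in> ?O")
    case False
    then show ?thesis using fin by (auto simp: orbit_poly_def poly_prod)
  qed (use root in auto)
  then have simple: "poly (orbit_poly b) c \<noteq> 0 \<or> poly (Polynomial.pderiv (orbit_poly b)) c \<noteq> 0" for c .
  have le: "\<not> Polynomial.order c (orbit_poly b) \<ge> 2" for c
  proof
    assume "Polynomial.order c (orbit_poly b) \<ge> 2"
    then have "[:- c, 1:] ^ 2 dvd orbit_poly b"
      using order_1[of c "orbit_poly b"] by (rule power_le_dvd[rotated])
    then obtain g where g: "orbit_poly b = [:- c, 1:] * ([:- c, 1:] * g)"
      unfolding power2_eq_square dvd_def mult.assoc by blast
    have "poly (Polynomial.pderiv (orbit_poly b)) c = 0" "poly (orbit_poly b) c = 0"
      unfolding g pderiv_mult poly_add poly_mult by simp_all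
    then show False using simple[of c] by simp
  qed
  have "Polynomial.order c (orbit_poly b) = 0 \<or> Polynomial.order c (orbit_poly b) = 1" for c
    using le[of c] by linarith
  moreover have "orbit_poly b \<noteq> 0" unfolding orbit_poly_def using fin by auto
  ultimately show "rsquarefree (orbit_poly b)"
    unfolding rsquarefree_def by blast
qed

end

text \<open>
  Restriction makes sense because \<open>\<sigma>\<close> maps each element of \<open>E\<close> to one of its
  conjugates.
\<close>

lemma galois_stable:
  assumes E: "galois F E" and N: "galois F N" and EN: "E \<subseteq> N" and s: "\<sigma> \<in> carrier (galois_group F N)"
  shows "restrict \<sigma> E \<in> carrier (galois_group F E)"
proof -
  interpret E: galois F E by (rule E)
  interpret N: galois F N by (rule N)
  have mem: "\<sigma> a \<in> E" if a: "a \<in> E" for a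
  proof -
    have aN: "a \<in> N" using a EN by auto
    have cN: "Polynomial.coeff (E.charpoly a) i \<in> N" for i
      using polysD[OF E.charpoly_polys[OF a]] N.F_subset by auto
    have "poly (E.charpoly a) (\<sigma> a) = \<sigma> (poly (E.charpoly a) a)"
    proof -
      have "\<sigma> (poly (E.charpoly a) a) = (\<Sum>i\<le>Polynomial.degree (E.charpoly a). \<sigma> (Polynomial.coeff (E.charpoly a) i * a ^ i))"
        unfolding poly_altdef using s aN cN
        by (intro N.gal_sum) (auto intro!: sring_mult[OF N.N] sring_power[OF N.N])
      also have "\<dots> = (\<Sum>i\<le>Polynomial.degree (E.charpoly a). Polynomial.coeff (E.charpoly a) i * \<sigma> a ^ i)"
        using s aN N.F_subset polysD[OF E.charpoly_polys[OF a]]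
        by (intro sum.cong) (auto simp: N.gal_mult N.gal_power subset_eq sring_power[OF N.N])
      finally show ?thesis by (simp add: poly_altdef)
    qed
    then have "poly (E.charpoly a) (\<sigma> a) = 0" using E.poly_charpoly[OF a] s by simp
    then obtain \<tau> where "\<tau> \<in> E.Gal" "\<sigma> a = \<tau> a"
      using E.finite_gal unfolding E.charpoly_def by (auto simp: poly_prod)
    then show ?thesis using a by simp
  qed
  have inj: "inj_on (restrict \<sigma> E) E"
    using N.gal_bij[OF s] EN by (auto simp: bij_betw_def inj_on_def)
  have "E \<subseteq> restrict \<sigma> E ` E"
  proof
    fix a assume a: "a \<in> E"
    \<comment> \<open>\<open>\<sigma>\<close> permutes the finitely many conjugates of \<open>a\<close>\<close>
    let ?O = "(\<lambda>\<tau>. \<tau> a) ` E.Gal"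
    have "\<sigma> b \<in> ?O" if b: "b \<in> ?O" for b
    proof -
      have bE: "b \<in> E" "b \<in> N" "?O \<subseteq> E" using b a EN by auto
      have cN: "Polynomial.coeff (E.orbit_poly a) i \<in> N" for i
        using polysD[OF E.orbit_poly_polys[OF a]] N.F_subset by auto
      have "poly (E.orbit_poly a) (\<sigma> b) = \<sigma> (poly (E.orbit_poly a) b)"
      proof -
        have "\<sigma> (poly (E.orbit_poly a) b) = (\<Sum>i\<le>Polynomial.degree (E.orbit_poly a). \<sigma> (Polynomial.coeff (E.orbit_poly a) i * b ^ i))"
          unfolding poly_altdef using s bE cN
          by (intro N.gal_sum) (auto intro!: sring_mult[OF N.N] sring_power[OF N.N])
        also have "\<dots> = (\<Sum>i\<le>Polynomial.degree (E.orbit_poly a). Polynomial.coeff (E.orbit_poly a) i * \<sigma> b ^ i)"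
          using s bE N.F_subset polysD[OF E.orbit_poly_polys[OF a]]
          by (intro sum.cong) (auto simp: N.gal_mult N.gal_power subset_eq sring_power[OF N.N])
        finally show ?thesis by (simp add: poly_altdef)
      qed
      moreover have "poly (E.orbit_poly a) b = 0"
        using b E.finite_gal by (auto simp: E.orbit_poly_def poly_prod intro!: prod_zero)
      ultimately have "poly (E.orbit_poly a) (\<sigma> b) = 0" using s by simp
      then show ?thesis using E.finite_gal by (auto simp: E.orbit_poly_def poly_prod)
    qed
    then have "\<sigma> ` ?O \<subseteq> ?O" by auto
    moreover have "inj_on \<sigma> ?O" using inj a by (auto simp: inj_on_def)
    ultimately have "\<sigma> ` ?O = ?O" using E.finite_gal by (intro endo_inj_surj) auto
    moreover have "a \<in> ?O" by (rule image_eqI[where x="\<one>\<^bsub>E.\<Gamma>\<^esub>"]) (simp_all add: E.gal_one[OF a])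
    ultimately obtain b where "b \<in> ?O" "a = \<sigma> b" by (metis imageE)
    moreover from this have "b \<in> E" using E.gal_closed a by blast
    ultimately show "a \<in> restrict \<sigma> E ` E" by force
  qed
  then have "restrict \<sigma> E \<in> Bij E"
    using inj mem by (auto simp: Bij_def bij_betw_def)
  moreover have "restrict \<sigma> E (a + b) = restrict \<sigma> E a + restrict \<sigma> E b \<and>
      restrict \<sigma> E (a * b) = restrict \<sigma> E a * restrict \<sigma> E b" if "a \<in> E" "b \<in> E" for a b
    using that EN sring_add[OF E.N that] sring_mult[OF E.N that]
    by (simp add: N.gal_add[OF s] N.gal_mult[OF s] subset_eq)
  moreover have "restrict \<sigma> E 1 = 1" using sring_1[OF E.N] s by simp
  moreover have "restrict \<sigma> E a = a" if "a \<in> F" for a using that s E.F_subset by auto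
  ultimately show ?thesis
    unfolding galois_group_mem using mem by simp
qed

lemma restrict_galois_mult:
  assumes E: "galois F E" and N: "galois F N" and EN: "E \<subseteq> N"
    and s: "\<sigma> \<in> carrier (galois_group F N)" "\<tau> \<in> carrier (galois_group F N)"
  shows "restrict (\<sigma> \<otimes>\<^bsub>galois_group F N\<^esub> \<tau>) E = restrict \<sigma> E \<otimes>\<^bsub>galois_group F E\<^esub> restrict \<tau> E"
proof -
  interpret E: galois F E by (rule E)
  interpret N: galois F N by (rule N)
  note r = galois_stable[OF E N EN]
  show ?thesis
  proof (rule E.gal_ext)
    show "restrict (\<sigma> \<otimes>\<^bsub>N.\<Gamma>\<^esub> \<tau>) E \<in> E.Gal" using s by (intro r) auto
    show "restrict \<sigma> E \<otimes>\<^bsub>E.\<Gamma>\<^esub> restrict \<tau> E \<in> E.Gal" using s r by auto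
    fix a assume a: "a \<in> E"
    have "restrict \<tau> E a \<in> E" using E.gal_closed[OF r[OF s(2)] a] .
    then show "restrict (\<sigma> \<otimes>\<^bsub>N.\<Gamma>\<^esub> \<tau>) E a = (restrict \<sigma> E \<otimes>\<^bsub>E.\<Gamma>\<^esub> restrict \<tau> E) a"
      using a EN N.gal_comp[OF s, of a] E.gal_comp[OF r[OF s(1)] r[OF s(2)] a] by auto
  qed
qed

section \<open>Integral closures of polynomial rings\<close>

definition aspan :: "'a::Fields.field set \<Rightarrow> 'a set \<Rightarrow> 'a set" where
  "aspan A S = {\<Sum>s\<in>S. c s * s | c. c \<in> S \<rightarrow> A}"

lemma aspanI: "c \<in> S \<rightarrow> A \<Longrightarrow> (\<Sum>s\<in>S. c s * s) \<in> aspan A S"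
  by (auto simp: aspan_def)

context
  fixes A :: "'a::Fields.field set"
  assumes A: "sring A"
begin

lemma aspan_incl:
  assumes "finite S" "s \<in> S"
  shows "s \<in> aspan A S"
proof -
  have "(\<Sum>r\<in>S. (if r = s then 1 else 0) * r) = s"
    using assms by (simp add: if_distrib[of "\<lambda>x. x * _"] sum.delta cong: if_cong)
  moreover have "(\<lambda>r. if r = s then 1 else 0) \<in> S \<rightarrow> A" using A by auto
  ultimately show ?thesis using aspanI[of "\<lambda>r. if r = s then 1 else 0" S A] by simp
qed

lemma aspan_0: "0 \<in> aspan A S"
proof -
  have "(\<lambda>r. 0) \<in> S \<rightarrow> A" using A by auto
  then show ?thesis using aspanI[of "\<lambda>r. 0" S A] by simp
qed

lemma aspan_add: "x \<in> aspan A S \<Longrightarrow> y \<in> aspan A S \<Longrightarrow> x + y \<in> aspan A S"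
proof -
  assume "x \<in> aspan A S" "y \<in> aspan A S"
  then obtain c d where cd: "x = (\<Sum>s\<in>S. c s * s)" "c \<in> S \<rightarrow> A" "y = (\<Sum>s\<in>S. d s * s)" "d \<in> S \<rightarrow> A"
    unfolding aspan_def by blast
  then have "(\<Sum>s\<in>S. (c s + d s) * s) = x + y" by (simp add: sum.distrib distrib_right)
  moreover have "(\<lambda>s. c s + d s) \<in> S \<rightarrow> A" using cd A by auto
  ultimately show ?thesis using aspanI[of "\<lambda>s. c s + d s" S A] by simp
qed

lemma aspan_mult: "a \<in> A \<Longrightarrow> x \<in> aspan A S \<Longrightarrow> a * x \<in> aspan A S"
proof -
  assume a: "a \<in> A" and "x \<in> aspan A S"
  then obtain c where c: "x = (\<Sum>s\<in>S. c s * s)" "c \<in> S \<rightarrow> A" unfolding aspan_def by blast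
  then have "(\<Sum>s\<in>S. (a * c s) * s) = a * x" by (simp add: sum_distrib_left mult.assoc)
  moreover have "(\<lambda>s. a * c s) \<in> S \<rightarrow> A" using a c A by auto
  ultimately show ?thesis using aspanI[of "\<lambda>s. a * c s" S A] by simp
qed

lemma aspan_diff: "x \<in> aspan A S \<Longrightarrow> y \<in> aspan A S \<Longrightarrow> x - y \<in> aspan A S"
  using aspan_add[of x S "- 1 * y"] aspan_mult[of "- 1" y S] sring_uminus[OF A sring_1[OF A]] by simp

lemma aspan_sum: "(\<And>i. i \<in> I \<Longrightarrow> f i \<in> aspan A S) \<Longrightarrow> sum f I \<in> aspan A S"
  by (induction I rule: infinite_finite_induct) (auto simp: aspan_0 aspan_add)

lemma aspan_least:
  assumes "0 \<in> M" "\<And>x y. x \<in> M \<Longrightarrow> y \<in> M \<Longrightarrow> x + y \<in> M" "\<And>a x. a \<in> A \<Longrightarrow> x \<in> M \<Longrightarrow> a * x \<in> M" "S \<subseteq> M"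
  shows "aspan A S \<subseteq> M"
proof
  fix x assume "x \<in> aspan A S"
  then obtain c where c: "x = (\<Sum>s\<in>S. c s * s)" "c \<in> S \<rightarrow> A" unfolding aspan_def by blast
  have "I \<subseteq> S \<Longrightarrow> (\<Sum>s\<in>I. c s * s) \<in> M" for I
    by (induction I rule: infinite_finite_induct) (use assms c in \<open>auto simp: subset_eq Pi_iff\<close>)
  then show "x \<in> M" using c by auto
qed

lemma aspan_trans: "S \<subseteq> aspan A T \<Longrightarrow> aspan A S \<subseteq> aspan A T"
  by (rule aspan_least) (auto simp: aspan_0 aspan_add aspan_mult)

lemma aspan_subring: "sring N \<Longrightarrow> A \<subseteq> N \<Longrightarrow> S \<subseteq> N \<Longrightarrow> aspan A S \<subseteq> N"
  by (rule aspan_least) (auto simp: sring_add sring_mult)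

lemma aspan_times:
  assumes fin: "finite S" "finite T" and x: "x \<in> aspan A S" and y: "y \<in> aspan A T"
  shows "x * y \<in> aspan A ((\<lambda>(s, t). s * t) ` (S \<times> T))" (is "_ \<in> ?M")
proof -
  have st: "s * t \<in> ?M" if "s \<in> S" "t \<in> T" for s t
    using fin that by (intro aspan_incl) auto
  have "aspan A T \<subseteq> {y. s * y \<in> ?M}" if "s \<in> S" for s
    by (rule aspan_least) (use st that aspan_mult[of _ "s * _" "(\<lambda>(s, t). s * t) ` (S \<times> T)"]
      in \<open>auto simp: aspan_0 aspan_add distrib_left mult.left_commute\<close>)
  then have sy: "s * y \<in> ?M" if "s \<in> S" for s using that y by auto
  have "aspan A S \<subseteq> {x. x * y \<in> ?M}"
    by (rule aspan_least) (use sy aspan_mult[of _ "_ * y" "(\<lambda>(s, t). s * t) ` (S \<times> T)"]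
      in \<open>auto simp: aspan_0 aspan_add distrib_right mult.assoc\<close>)
  then show ?thesis using x by auto
qed

end

text \<open>
  Integrality of \<open>b\<close> means that the powers of \<open>b\<close> lie in one finitely generated module.  With this
  definition sums and products need no determinants.
\<close>

definition integral_closure :: "'a::Fields.field set \<Rightarrow> 'a set \<Rightarrow> 'a set" where
  "integral_closure A N = {b \<in> N. \<exists>S. finite S \<and> S \<subseteq> N \<and> (\<forall>n. b ^ n \<in> aspan A S)}"

context
  fixes A N :: "'a::Fields.field set"
  assumes A: "sring A" and N: "sring N" and AN: "A \<subseteq> N"
begin

lemma integral_closure_base: "A \<subseteq> integral_closure A N"
proof
  fix a assume a: "a \<in> A"
  have "a ^ n \<in> aspan A {1}" for n
    using aspan_mult[OF A sring_power[OF A a] aspan_incl[OF A, of "{1}" 1], of n] by simp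
  then show "a \<in> integral_closure A N" using a AN sring_1[OF N]
    unfolding integral_closure_def by (auto intro!: exI[of _ "{1}"])
qed

lemma sring_integral_closure: "sring (integral_closure A N)"
proof (rule sringI)
  show "1 \<in> integral_closure A N" using integral_closure_base A by auto
next
  fix a b assume "a \<in> integral_closure A N" "b \<in> integral_closure A N"
  then obtain S T where S: "a \<in> N" "finite S" "S \<subseteq> N" "\<And>n. a ^ n \<in> aspan A S"
    and T: "b \<in> N" "finite T" "T \<subseteq> N" "\<And>n. b ^ n \<in> aspan A T"
    unfolding integral_closure_def by blast
  let ?U = "(\<lambda>(s, t). s * t) ` (S \<times> T)"
  have U: "finite ?U" "?U \<subseteq> N" using S T N by auto
  have prod: "a ^ i * b ^ j \<in> aspan A ?U" for i j
    using S T by (intro aspan_times[OF A])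
  have "(a * b) ^ n \<in> aspan A ?U" for n using prod[of n n] by (simp add: power_mult_distrib)
  then show "a * b \<in> integral_closure A N"
    using U S(1) T(1) N unfolding integral_closure_def by auto
  have "(a + b) ^ n \<in> aspan A ?U" for n
    unfolding binomial_ring by (intro aspan_sum[OF A]) (auto simp: mult.assoc intro!: aspan_mult[OF A] prod sring_of_nat[OF A])
  then show "a + b \<in> integral_closure A N"
    using U S(1) T(1) N unfolding integral_closure_def by auto
next
  fix a assume "a \<in> integral_closure A N"
  then obtain S where S: "a \<in> N" "finite S" "S \<subseteq> N" "\<And>n. a ^ n \<in> aspan A S"
    unfolding integral_closure_def by blast
  have "(- a) ^ n \<in> aspan A S" for n
    using aspan_mult[OF A sring_power[OF A sring_uminus[OF A sring_1[OF A]]] S(4)[of n], of n]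
    by (simp add: power_minus[of a])
  then show "- a \<in> integral_closure A N"
    using S(1-3) sring_uminus[OF N S(1)] unfolding integral_closure_def by auto
qed

text \<open>
  All powers of \<open>b\<close> remain in a finitely generated module that contains \<open>1\<close> and is
  stable under \<open>b\<close>.
\<close>

lemma integral_closureI_stable:
  assumes "b \<in> N" "finite S" "S \<subseteq> N" "1 \<in> aspan A S" "\<And>s. s \<in> S \<Longrightarrow> b * s \<in> aspan A S"
  shows "b \<in> integral_closure A N"
proof -
  have "aspan A S \<subseteq> {x. b * x \<in> aspan A S}"
    by (rule aspan_least[OF A]) (use assms(5) aspan_mult[OF A, of _ "b * _" S]
      in \<open>auto simp: aspan_0[OF A] aspan_add[OF A] distrib_left mult.left_commute\<close>)
  then have "b ^ n \<in> aspan A S" for n using assms(4) by (induction n) auto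
  then show ?thesis using assms unfolding integral_closure_def by auto
qed

lemma integral_closureI_monic:
  assumes b: "b \<in> N" and c: "\<And>i. i < n \<Longrightarrow> c i \<in> A" and eq: "b ^ n = (\<Sum>i<n. c i * b ^ i)"
  shows "b \<in> integral_closure A N"
proof (rule integral_closureI_stable[OF b, of "(\<lambda>i. b ^ i) ` {..<n}"])
  let ?S = "(\<lambda>i. b ^ i) ` {..<n}"
  have pow: "b ^ i \<in> aspan A ?S" if "i < n" for i using that by (intro aspan_incl[OF A]) auto
  have "b ^ n \<in> aspan A ?S" unfolding eq using c pow by (intro aspan_sum[OF A] aspan_mult[OF A]) auto
  then have pow': "b ^ i \<in> aspan A ?S" if "i \<le> n" for i using pow that by (cases "i = n") auto
  show "1 \<in> aspan A ?S" using pow'[of 0] by simp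
  show "b * s \<in> aspan A ?S" if s: "s \<in> ?S" for s
  proof -
    obtain i where "i < n" "s = b ^ i" using s by auto
    then show ?thesis using pow'[of "Suc i"] by simp
  qed
  show "?S \<subseteq> N" using b by (auto intro: sring_power[OF N])
qed simp

lemma finite_module_integral:
  assumes B: "sring B" "B \<subseteq> N" and "finite_module A B" and AB: "A \<subseteq> B"
  shows "B \<subseteq> integral_closure A N"
proof
  fix b assume b: "b \<in> B"
  obtain S where S: "finite S" "B = aspan A S"
    using assms unfolding finite_module_def aspan_def by blast
  have SB: "S \<subseteq> B" using S aspan_incl[OF A] by auto
  have "b ^ n \<in> aspan A S" for n using S(2) sring_power[OF B(1) b, of n] by simp
  then show "b \<in> integral_closure A N" using SB S(1) B b unfolding integral_closure_def by blast
qed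

end

text \<open>By division with remainder, a nonzero element of minimal degree divides all the others.\<close>

lemma poly_ideal_principal:
  fixes J :: "'k::Fields.field poly set"
  assumes J: "0 \<in> J" "\<And>f g. f \<in> J \<Longrightarrow> g \<in> J \<Longrightarrow> f + g \<in> J" "\<And>f g. g \<in> J \<Longrightarrow> f * g \<in> J"
  obtains f where "f \<in> J" "\<And>g. g \<in> J \<Longrightarrow> f dvd g"
proof (cases "J = {0}")
  case True
  then show ?thesis using that[of 0] by auto
next
  case False
  then have "\<exists>f. f \<in> J \<and> f \<noteq> 0" using J(1) by auto
  then obtain f where f: "f \<in> J" "f \<noteq> 0"
    and min: "\<And>g. g \<in> J \<Longrightarrow> g \<noteq> 0 \<Longrightarrow> Polynomial.degree f \<le> Polynomial.degree g"
    using ex_has_least_nat[of "\<lambda>f. f \<in> J \<and> f \<noteq> 0" _ Polynomial.degree] by blast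
  have "f dvd g" if g: "g \<in> J" for g
  proof -
    have "g mod f = g + (- (g div f)) * f" by (simp add: minus_div_mult_eq_mod[symmetric])
    also have "\<dots> \<in> J" by (intro J(2,3) g f(1))
    finally have "g mod f \<in> J" .
    then have "g mod f = 0" using min[of "g mod f"] degree_mod_less[OF f(2), of g] by (metis not_le)
    then show ?thesis by auto
  qed
  then show ?thesis using that f by blast
qed

text \<open>
  The coordinate ring \<open>A\<close> of an affine line over the algebraically closed field of constants, which
  is embedded by \<open>\<kappa>\<close>. It will be used for a coordinate of the projective line and for its
  inverse.
\<close>

locale rational_line =
  fixes \<kappa> :: "'k::alg_closed_field \<Rightarrow> 'a::Fields.field" and u :: 'a
  assumes \<kappa>_add: "\<kappa> (c + d) = \<kappa> c + \<kappa> d" and \<kappa>_mult: "\<kappa> (c * d) = \<kappa> c * \<kappa> d" and \<kappa>_1 [simp]: "\<kappa> 1 = 1"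
    and transcendental: "poly (map_poly \<kappa> f) u = 0 \<Longrightarrow> f = 0"
begin

definition evat :: "'a \<Rightarrow> 'k poly \<Rightarrow> 'a" where "evat b f = poly (map_poly \<kappa> f) b"
abbreviation ev where "ev \<equiv> evat u"
abbreviation K where "K \<equiv> range \<kappa>"
definition A where "A = range ev"

lemma mem_A [simp]: "ev f \<in> A" by (simp add: A_def)
lemma A_E: "a \<in> A \<Longrightarrow> (\<And>f. a = ev f \<Longrightarrow> thesis) \<Longrightarrow> thesis" by (auto simp: A_def)

lemma \<kappa>_0 [simp]: "\<kappa> 0 = 0" using \<kappa>_add[of 0 0] by (simp only: add_0_right add_cancel_right_right)
lemma \<kappa>_uminus: "\<kappa> (- c) = - \<kappa> c" using \<kappa>_add[of c "- c"] by (simp add: eq_neg_iff_add_eq_0 add.commute)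
lemma \<kappa>_of_nat: "\<kappa> (of_nat i) = of_nat i" by (induction i) (simp_all add: \<kappa>_add)

lemma evat_0 [simp]: "evat b 0 = 0" by (simp add: evat_def)
lemma evat_pCons: "evat b (pCons c f) = \<kappa> c + b * evat b f" by (simp add: evat_def map_poly_pCons)
lemma evat_const [simp]: "evat b [:c:] = \<kappa> c" by (simp add: evat_pCons)
lemma evat_1 [simp]: "evat b 1 = 1" using evat_const[of b 1] by (simp add: pCons_one)
lemma evat_linear: "evat b [:c, d:] = \<kappa> c + b * \<kappa> d" by (simp add: evat_pCons)
lemma evat_add: "evat b (f + g) = evat b f + evat b g"
  by (induction f g rule: poly_induct2) (auto simp: evat_pCons \<kappa>_add algebra_simps)
lemma evat_smult: "evat b (Polynomial.smult c f) = \<kappa> c * evat b f"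
  by (induction f) (auto simp: evat_pCons \<kappa>_mult algebra_simps)
lemma evat_mult: "evat b (f * g) = evat b f * evat b g"
  by (induction f) (auto simp: evat_pCons evat_add evat_smult algebra_simps)
lemma evat_uminus: "evat b (- f) = - evat b f"
  using evat_add[of b f "- f"] by (simp add: eq_neg_iff_add_eq_0 add.commute)
lemma evat_diff: "evat b (f - g) = evat b f - evat b g"
  using evat_add[of b f "- g"] by (simp add: evat_uminus)
lemma evat_power: "evat b (f ^ n) = evat b f ^ n" by (induction n) (auto simp: evat_mult)
lemma evat_altdef: "evat b f = (\<Sum>i\<le>Polynomial.degree f. \<kappa> (Polynomial.coeff f i) * b ^ i)"
proof (induction f)
  case (pCons c f)
  show ?case
  proof (cases "f = 0")
    case False
    then show ?thesis using pCons
      by (simp add: evat_pCons sum.atMost_Suc_shift sum_distrib_left mult.left_commute del: sum.atMost_Suc)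
  qed simp
qed simp

lemma ev_eq_0_iff [simp]: "ev f = 0 \<longleftrightarrow> f = 0"
  using transcendental unfolding evat_def by auto
lemma ev_eq_iff [simp]: "ev f = ev g \<longleftrightarrow> f = g"
  using ev_eq_0_iff[of "f - g"] by (simp only: evat_diff right_minus_eq)
lemma \<kappa>_eq_0_iff [simp]: "\<kappa> c = 0 \<longleftrightarrow> c = 0" using ev_eq_0_iff[of "[:c:]"] by (simp only: evat_const pCons_eq_0_iff) auto

lemma A: "sring A"
  by (rule sringI) (auto simp: A_def evat_mult[symmetric] evat_add[symmetric] evat_uminus[symmetric] intro: range_eqI[of _ _ 1])

lemma K_subset: "K \<subseteq> A" using evat_const[of u] unfolding A_def by (metis image_subsetI rangeI)

lemma \<kappa>_mem_A [simp]: "\<kappa> c \<in> A" using K_subset by auto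
lemma u_mem_A [simp]: "u \<in> A" using mem_A[of "[:0, 1:]"] by (simp add: evat_pCons)

lemma A_subsetI: "sring R \<Longrightarrow> K \<subseteq> R \<Longrightarrow> u \<in> R \<Longrightarrow> A \<subseteq> R"
  unfolding A_def evat_altdef by (auto intro!: sring_sum sring_mult sring_power)

lemma ev_root: "ev f - \<kappa> (poly f \<alpha>) \<in> (*) (u - \<kappa> \<alpha>) ` A"
proof -
  have "[:-\<alpha>, 1:] dvd f - [:poly f \<alpha>:]" by (simp add: poly_eq_0_iff_dvd[symmetric])
  then obtain g where "f - [:poly f \<alpha>:] = [:-\<alpha>, 1:] * g" by (elim dvdE)
  then have "ev (f - [:poly f \<alpha>:]) = ev ([:-\<alpha>, 1:] * g)" by simp
  then have "ev f - \<kappa> (poly f \<alpha>) = (u - \<kappa> \<alpha>) * ev g"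
    unfolding evat_diff evat_mult evat_const evat_linear by (simp add: \<kappa>_uminus)
  then show ?thesis by auto
qed

lemma \<kappa>_notin_prime:
  assumes "sring B" "primeideal I (subring_of_type B)" "K \<subseteq> B" "\<kappa> c \<in> I"
  shows "c = 0"
proof (rule ccontr)
  assume "c \<noteq> 0"
  then have "\<kappa> (inverse c) * \<kappa> c = 1" by (simp add: \<kappa>_mult[symmetric])
  moreover have "\<kappa> (inverse c) * \<kappa> c \<in> I" using assms by (intro prime_multL[OF assms(1,2)]) auto
  ultimately show False using prime_1[OF assms(1,2)] by simp
qed

text \<open>
  Over the algebraically closed field of constants \<open>f\<close> is a product of linear factors, one of which
  takes a value in the prime ideal.
\<close>

lemma prime_root:
  assumes B: "sring B" and I: "primeideal I (subring_of_type B)" and KB: "K \<subseteq> B" and b: "b \<in> B"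
  shows "evat b f \<in> I \<Longrightarrow> f \<noteq> 0 \<Longrightarrow> \<exists>\<alpha>. poly f \<alpha> = 0 \<and> b - \<kappa> \<alpha> \<in> I"
proof (induction "Polynomial.degree f" arbitrary: f)
  case 0
  then obtain c where "f = [:c:]" by (metis degree_eq_zeroE)
  then show ?case using 0 \<kappa>_notin_prime[OF B I KB] by auto
next
  case (Suc n)
  then obtain \<alpha> where \<alpha>: "poly f \<alpha> = 0" using alg_closed_imp_poly_has_root[of f] by auto
  then obtain g where g: "f = [:-\<alpha>, 1:] * g" by (metis poly_eq_0_iff_dvd dvdE)
  then have g0: "g \<noteq> 0" using Suc by auto
  then have "Polynomial.degree g = n" using Suc(2) unfolding g by (subst (asm) degree_mult_eq) auto
  have KA: "A' \<subseteq> B" if "A' = range (evat b)" for A'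
    using that KB b B unfolding evat_altdef by (auto intro!: sring_sum sring_mult sring_power)
  have "(b - \<kappa> \<alpha>) * evat b g \<in> I"
    using Suc(3) unfolding g evat_mult evat_linear by (simp add: \<kappa>_uminus)
  then have "b - \<kappa> \<alpha> \<in> I \<or> evat b g \<in> I"
    using prime_disj[OF B I, of "b - \<kappa> \<alpha>" "evat b g"] KA[OF refl] sring_diff[OF B b, of "\<kappa> \<alpha>"] KB by auto
  then show ?case
  proof
    assume "b - \<kappa> \<alpha> \<in> I"
    then show ?thesis using \<alpha> by auto
  next
    assume "evat b g \<in> I"
    then obtain \<beta> where "poly g \<beta> = 0" "b - \<kappa> \<beta> \<in> I" using Suc(1)[of g] g0 \<open>Polynomial.degree g = n\<close> by auto
    then show ?thesis unfolding g by auto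
  qed
qed

text \<open>
  As \<open>A\<close> is a principal ideal domain, the coefficients of \<open>s\<close> in the elements of
  \<open>M\<close> form a principal ideal. Subtracting multiples of one element of \<open>M\<close> reduces the
  others to the span of the remaining generators.
\<close>

lemma submodule_finite:
  assumes "finite S" "M \<subseteq> aspan A S" "0 \<in> M" "\<And>x y. x \<in> M \<Longrightarrow> y \<in> M \<Longrightarrow> x + y \<in> M" "\<And>a x. a \<in> A \<Longrightarrow> x \<in> M \<Longrightarrow> a * x \<in> M"
  shows "\<exists>T. finite T \<and> T \<subseteq> M \<and> M = aspan A T"
  using assms
proof (induction S arbitrary: M rule: finite_induct)
  case empty
  then have "M = {0}" by (auto simp: aspan_def)
  then show ?case by (intro exI[of _ "{}"]) (auto simp: aspan_def)
next
  case (insert s S)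
  note M = insert.prems
  have dec: "x \<in> aspan A (insert s S) \<Longrightarrow> \<exists>f. x - ev f * s \<in> aspan A S" for x
  proof -
    assume "x \<in> aspan A (insert s S)"
    then obtain c where c: "x = (\<Sum>r\<in>insert s S. c r * r)" "c \<in> insert s S \<rightarrow> A" unfolding aspan_def by blast
    then obtain f where "c s = ev f" using A_E[of "c s"] by blast
    then have "x - ev f * s = (\<Sum>r\<in>S. c r * r)" using c insert by simp
    moreover have "c \<in> S \<rightarrow> A" using c by auto
    ultimately have "x - ev f * s \<in> aspan A S" using aspanI[of c S A] by simp
    then show ?thesis ..
  qed
  define J where "J = {f. \<exists>m\<in>M. m - ev f * s \<in> aspan A S}"
  have J0: "0 \<in> J" unfolding J_def using M(2) aspan_0[OF A] by (auto intro!: bexI[of _ 0])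
  have Jadd: "f + g \<in> J" if fg: "f \<in> J" "g \<in> J" for f g
  proof -
    obtain m n where mn: "m \<in> M" "m - ev f * s \<in> aspan A S" "n \<in> M" "n - ev g * s \<in> aspan A S"
      using fg unfolding J_def by auto
    have "(m + n) - ev (f + g) * s = (m - ev f * s) + (n - ev g * s)" by (simp add: evat_add algebra_simps)
    also have "\<dots> \<in> aspan A S" by (rule aspan_add[OF A mn(2,4)])
    finally have "(m + n) - ev (f + g) * s \<in> aspan A S" .
    then show ?thesis using M(3)[OF mn(1,3)] unfolding J_def by blast
  qed
  have Jmult: "f * g \<in> J" if fg: "g \<in> J" for f g
  proof -
    obtain m where m: "m \<in> M" "m - ev g * s \<in> aspan A S" using fg unfolding J_def by auto
    have "ev f * m - ev (f * g) * s = ev f * (m - ev g * s)" by (simp add: evat_mult algebra_simps)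
    also have "\<dots> \<in> aspan A S" by (rule aspan_mult[OF A _ m(2)]) simp
    finally have "ev f * m - ev (f * g) * s \<in> aspan A S" .
    moreover have "ev f * m \<in> M" by (rule M(4)[OF _ m(1)]) simp
    ultimately show ?thesis unfolding J_def by blast
  qed
  obtain f0 where f0: "f0 \<in> J" "\<And>g. g \<in> J \<Longrightarrow> f0 dvd g"
    using poly_ideal_principal[of J] J0 Jadd Jmult by blast
  then obtain m0 where m0: "m0 \<in> M" "m0 - ev f0 * s \<in> aspan A S" unfolding J_def by auto
  have "\<exists>T. finite T \<and> T \<subseteq> M \<inter> aspan A S \<and> M \<inter> aspan A S = aspan A T"
    by (rule insert.IH) (use M aspan_0[OF A] aspan_add[OF A] aspan_mult[OF A] in auto)
  then obtain T where T: "finite T" "T \<subseteq> M" "M \<inter> aspan A S = aspan A T" by auto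
  have "M \<subseteq> aspan A (insert m0 T)"
  proof
    fix m assume m: "m \<in> M"
    then obtain f where f: "m - ev f * s \<in> aspan A S" using dec[of m] M(1) by blast
    then have "f \<in> J" using m unfolding J_def by auto
    then obtain g where g: "f = f0 * g" using f0(2) by (metis dvdE)
    have neg: "- ev g * m0 \<in> M" using M(4)[of "- ev g" m0] m0 sring_uminus[OF A] by auto
    have "m + - ev g * m0 = (m - ev f * s) - ev g * (m0 - ev f0 * s)"
      unfolding g by (simp add: evat_mult algebra_simps)
    also have "\<dots> \<in> aspan A S" by (rule aspan_diff[OF A f aspan_mult[OF A mem_A m0(2)]])
    finally have "m + - ev g * m0 \<in> aspan A T" using T(3) M(3)[OF m neg] by auto
    moreover have "aspan A T \<subseteq> aspan A (insert m0 T)"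
      using T(1) by (intro aspan_trans[OF A] subsetI aspan_incl[OF A]) auto
    moreover have "ev g * m0 \<in> aspan A (insert m0 T)" using T(1) by (intro aspan_mult[OF A] aspan_incl[OF A]) auto
    ultimately have "(m + - ev g * m0) + ev g * m0 \<in> aspan A (insert m0 T)" using aspan_add[OF A] by blast
    then show "m \<in> aspan A (insert m0 T)" by simp
  qed
  moreover have "aspan A (insert m0 T) \<subseteq> M" by (rule aspan_least[OF A]) (use M m0 T in auto)
  ultimately show ?case using T m0 by (intro exI[of _ "insert m0 T"]) auto
qed

text \<open>In other words, \<open>A\<close> is completely integrally closed.\<close>

lemma integrally_closed:
  assumes d: "d \<in> A" "d \<noteq> 0" and b: "b = ev f0 / ev g0" and pow: "\<And>n. d * b ^ n \<in> A"
  shows "b \<in> A"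
proof (cases "b = 0")
  case True
  then show ?thesis using A by simp
next
  case b0: False
  obtain r where r: "d = ev r" "r \<noteq> 0" using d A_E[of d] by force
  have "\<exists>g. \<exists>f. g \<noteq> 0 \<and> b = ev f / ev g" using b b0 by (intro exI[of _ g0] exI[of _ f0]) auto
  from ex_has_least_nat[of "\<lambda>g. \<exists>f. g \<noteq> 0 \<and> b = ev f / ev g" _ Polynomial.degree] this
  obtain f g where fg: "g \<noteq> 0" "b = ev f / ev g"
    and min: "\<And>g'. \<exists>f. g' \<noteq> 0 \<and> b = ev f / ev g' \<Longrightarrow> Polynomial.degree g \<le> Polynomial.degree g'" by blast
  have "Polynomial.degree g = 0"
  proof (rule ccontr)
    assume "Polynomial.degree g \<noteq> 0"
    then obtain \<alpha> where \<alpha>: "poly g \<alpha> = 0" using alg_closed_imp_poly_has_root[of g] by auto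
    then obtain g' where g': "g = [:-\<alpha>, 1:] * g'" by (metis poly_eq_0_iff_dvd dvdE)
    have g'0: "g' \<noteq> 0" using g' fg by auto
    then have deg: "Polynomial.degree g = Suc (Polynomial.degree g')" unfolding g' by (subst degree_mult_eq) auto
    have f\<alpha>: "poly f \<alpha> \<noteq> 0"
    proof
      assume "poly f \<alpha> = 0"
      then obtain f' where f': "f = [:-\<alpha>, 1:] * f'" by (metis poly_eq_0_iff_dvd dvdE)
      have "b = (ev [:-\<alpha>, 1:] * ev f') / (ev [:-\<alpha>, 1:] * ev g')" using fg(2) f' g' by (simp only: evat_mult)
      also have "\<dots> = ev f' / ev g'" by (rule nonzero_mult_divide_mult_cancel_left) (simp only: ev_eq_0_iff, simp)
      finally have "b = ev f' / ev g'" .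
      then show False using min[of g'] g'0 deg by auto
    qed
    \<comment> \<open>the pole of \<open>b ^ n\<close> at \<open>\<alpha>\<close> has order at least \<open>n\<close>, too much for the fixed denominator \<open>r\<close>\<close>
    define n where "n = Suc (Polynomial.order \<alpha> r)"
    obtain q where "d * b ^ n = ev q" using pow[of n] by (rule A_E)
    then have "ev r * ev f ^ n = ev q * ev g ^ n" using r fg by (simp add: field_simps power_divide)
    then have eq: "r * f ^ n = q * g ^ n" by (simp only: evat_power[symmetric] evat_mult[symmetric] ev_eq_iff)
    have "[:-\<alpha>, 1:] dvd g" unfolding g' by (rule dvd_triv_left)
    then have "[:-\<alpha>, 1:] ^ n dvd r * f ^ n" unfolding eq by (intro dvd_mult dvd_power_same)
    moreover have nz: "r * f ^ n \<noteq> 0" using r(2) f\<alpha> by auto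
    ultimately have "n \<le> Polynomial.order \<alpha> (r * f ^ n)" using order_divides by blast
    also have "\<dots> = Polynomial.order \<alpha> r + Polynomial.order \<alpha> (f ^ n)" by (rule order_mult[OF nz])
    also have "Polynomial.order \<alpha> (f ^ n) = 0" using f\<alpha> by (intro order_0I) simp
    finally show False by (simp add: n_def)
  qed
  then obtain c where c: "g = [:c:]" by (metis degree_eq_zeroE)
  then have "c \<noteq> 0" using fg by auto
  then have "\<kappa> c * \<kappa> (inverse c) = 1" by (simp add: \<kappa>_mult[symmetric])
  then have "inverse (\<kappa> c) = \<kappa> (inverse c)" by (rule inverse_unique)
  then have "b = ev f * \<kappa> (inverse c)" using fg c by (simp add: divide_inverse)
  then show ?thesis using A by (auto intro: sring_mult)
qed

end

text \<open>
  A finite Galois extension \<open>N\<close> of the field of rational functions in \<open>u\<close>. The integral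
  closure \<open>B\<close> of \<open>A\<close> in \<open>N\<close> is the coordinate ring of an affine chart of
  the curve with function field \<open>N\<close>.
\<close>

locale line_ext = rational_line \<kappa> u + galois F N
  for \<kappa> :: "'k::alg_closed_field \<Rightarrow> 'a::Fields.field" and u :: 'a and F N :: "'a set" +
  assumes F_eq: "F = {ev f / ev g | f g. True}"
begin

abbreviation B where "B \<equiv> integral_closure A N"

lemma A_F: "A \<subseteq> F"
proof
  fix a assume "a \<in> A"
  then obtain f where "a = ev f" by (rule A_E)
  then have "a = ev f / ev 1" by simp
  then show "a \<in> F" unfolding F_eq by blast
qed

lemma A_N: "A \<subseteq> N" using A_F F_subset by auto
lemma B: "sring B" by (rule sring_integral_closure[OF A N A_N])
lemma A_B: "A \<subseteq> B" by (rule integral_closure_base[OF A N A_N])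
lemma B_N: "B \<subseteq> N" by (auto simp: integral_closure_def)
lemma gal_A [simp]: "\<sigma> \<in> Gal \<Longrightarrow> a \<in> A \<Longrightarrow> \<sigma> a = a" using A_F by auto

lemma F_cases:
  assumes "a \<in> F"
  obtains d b where "d \<in> A" "d \<noteq> 0" "b \<in> A" "a = b / d"
proof -
  obtain f g where fg: "a = ev f / ev g" using assms unfolding F_eq by blast
  show thesis
  proof (cases "g = 0")
    case True
    then show ?thesis using that[of 1 0] fg A by auto
  next
    case False
    then show ?thesis using that[of "ev g" "ev f"] fg by auto
  qed
qed

lemma common_denominator:
  assumes "finite D" "D \<subseteq> F"
  shows "\<exists>d\<in>A. d \<noteq> 0 \<and> (\<forall>x\<in>D. d * x \<in> A)"
  using assms
proof (induction D rule: finite_induct)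
  case empty
  then show ?case using A by (intro bexI[of _ 1]) auto
next
  case (insert x D)
  then obtain d where d: "d \<in> A" "d \<noteq> 0" "\<And>y. y \<in> D \<Longrightarrow> d * y \<in> A" by auto
  obtain e b where e: "e \<in> A" "e \<noteq> 0" "b \<in> A" "x = b / e" using insert F_cases[of x] by blast
  have "(d * e) * y \<in> A" if "y \<in> insert x D" for y
  proof (cases "y = x")
    case True
    then have "(d * e) * y = d * b" using e by simp
    also have "\<dots> \<in> A" using d e by (intro sring_mult[OF A])
    finally show ?thesis .
  next
    case False
    then have "e * (d * y) \<in> A" using that d e by (intro sring_mult[OF A, of e "d * y"]) auto
    then show ?thesis by (simp add: ac_simps)
  qed
  then show ?case using d e A by (intro bexI[of _ "d * e"]) auto
qed

text \<open>
  The characteristic equation of \<open>a\<close>, multiplied by \<open>d ^ n\<close>, is a monic equation for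
  \<open>d * a\<close>.
\<close>

lemma denominator:
  assumes a: "a \<in> N"
  shows "\<exists>d\<in>A. d \<noteq> 0 \<and> d * a \<in> B"
proof -
  let ?c = "Polynomial.coeff (charpoly a)" and ?n = "card Gal"
  obtain d where d: "d \<in> A" "d \<noteq> 0" "\<And>i. i < ?n \<Longrightarrow> d * ?c i \<in> A"
  proof -
    have "?c ` {..<?n} \<subseteq> F" using polysD[OF charpoly_polys[OF a]] by blast
    then show thesis using common_denominator[of "?c ` {..<?n}"] that by blast
  qed
  have "(d * a) ^ ?n = (\<Sum>i<?n. - (d ^ (?n - i) * ?c i) * (d * a) ^ i)"
  proof -
    have "d ^ (?n - i) * d ^ i = d ^ ?n" if "i < ?n" for i using that by (simp add: power_add[symmetric])
    then have "(\<Sum>i<?n. - (d ^ (?n - i) * ?c i) * (d * a) ^ i) = (\<Sum>i<?n. - (d ^ ?n * (?c i * a ^ i)))"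
      by (intro sum.cong) (auto simp: power_mult_distrib algebra_simps)
    also have "\<dots> = d ^ ?n * a ^ ?n" by (simp add: charpoly_equation[OF a] sum_negf sum_distrib_left)
    finally show ?thesis by (simp add: power_mult_distrib)
  qed
  moreover have "- (d ^ (?n - i) * ?c i) \<in> A" if i: "i < ?n" for i
  proof -
    have "?n - i = Suc (?n - i - 1)" using i by simp
    then have "d ^ (?n - i) * ?c i = d ^ (?n - i - 1) * (d * ?c i)" by (metis mult.assoc power_Suc2)
    also have "\<dots> \<in> A" by (rule sring_mult[OF A sring_power[OF A d(1)] d(3)[OF i]])
    finally show ?thesis by (rule sring_uminus[OF A])
  qed
  ultimately have "d * a \<in> B"
    using a d(1) A_N by (intro integral_closureI_monic[OF A N A_N, where n="?n" and c="\<lambda>i. - (d ^ (?n - i) * ?c i)"]) (auto intro: sring_mult[OF N])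
  then show ?thesis using d by auto
qed

lemma N_cases:
  assumes "a \<in> N"
  obtains b d where "b \<in> B" "d \<in> A" "d \<noteq> 0" "a = b / d"
proof -
  obtain d where "d \<in> A" "d \<noteq> 0" "d * a \<in> B" using denominator[OF assms] by auto
  then show thesis using that[of "d * a" d] by auto
qed

text \<open>
  An integral element of \<open>F\<close> is a fraction whose powers have a common denominator: project the module
  that contains its powers to \<open>F\<close> by \<open>x \<mapsto> tr (e * x)\<close>, where \<open>e\<close> has trace one.
\<close>

lemma B_F: "B \<inter> F = A"
proof
  show "A \<subseteq> B \<inter> F" using A_B A_F by auto
  show "B \<inter> F \<subseteq> A"
  proof
    fix b assume b: "b \<in> B \<inter> F"
    then obtain S where S: "finite S" "S \<subseteq> N" "\<And>n. b ^ n \<in> aspan A S" unfolding integral_closure_def by auto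
    obtain e where e: "e \<in> N" "(\<Sum>\<sigma>\<in>Gal. \<sigma> e) = 1" using trace_one[OF gal.subgroup_self] by blast
    define l where "l x = (\<Sum>\<sigma>\<in>Gal. \<sigma> (e * x))" for x
    have lF: "l x \<in> F" if "x \<in> N" for x unfolding l_def using e that N by (intro trace_mem) auto
    obtain d where d: "d \<in> A" "d \<noteq> 0" "\<And>x. x \<in> l ` S \<Longrightarrow> d * x \<in> A"
    proof -
      have "finite (l ` S)" "l ` S \<subseteq> F" using S lF by auto
      then show thesis using common_denominator[of "l ` S"] that by blast
    qed
    have lin: "l (a * x) = a * l x" if "a \<in> F" "x \<in> N" for a x
    proof -
      have "\<sigma> (e * (a * x)) = a * \<sigma> (e * x)" if "\<sigma> \<in> Gal" for \<sigma>
        using that \<open>a \<in> F\<close> \<open>x \<in> N\<close> e N F_subset by (simp add: gal_mult sring_mult subset_eq ac_simps)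
      then show ?thesis unfolding l_def by (simp add: sum_distrib_left)
    qed
    have "aspan A S \<subseteq> {x \<in> N. d * l x \<in> A}"
    proof (rule aspan_least[OF A])
      show "0 \<in> {x \<in> N. d * l x \<in> A}" using N A by (auto simp: l_def)
      show "S \<subseteq> {x \<in> N. d * l x \<in> A}" using S d by auto
      show "x + y \<in> {x \<in> N. d * l x \<in> A}" if "x \<in> {x \<in> N. d * l x \<in> A}" "y \<in> {x \<in> N. d * l x \<in> A}" for x y
      proof -
        have "l (x + y) = l x + l y" unfolding l_def
          using that e N by (auto simp: distrib_left gal_add sring_mult sum.distrib[symmetric] intro!: sum.cong)
        then show ?thesis using that A N by (auto simp: distrib_left simp del: image_iff)
      qed
      show "a * x \<in> {x \<in> N. d * l x \<in> A}" if "a \<in> A" "x \<in> {x \<in> N. d * l x \<in> A}" for a x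
      proof -
        have "d * l (a * x) = a * (d * l x)" using lin[of a x] that A_F by (auto simp: mult.left_commute)
        also have "\<dots> \<in> A" using that by (intro sring_mult[OF A, of a "d * l x"]) auto
        finally have "d * l (a * x) \<in> A" .
        moreover have "a * x \<in> N" using that A_N by (intro sring_mult[OF N]) auto
        ultimately show ?thesis by (intro CollectI conjI)
      qed
    qed
    then have "d * l (b ^ n) \<in> A" for n using S(3)[of n] by auto
    moreover have "l (b ^ n) = b ^ n" for n
    proof -
      have "l (b ^ n * 1) = b ^ n * l 1" using b sring_power[OF F] N by (intro lin) auto
      then show ?thesis using e by (simp add: l_def)
    qed
    ultimately have "d * b ^ n \<in> A" for n by simp
    moreover obtain f g where "b = ev f / ev g" using b unfolding F_eq by blast
    ultimately show "b \<in> A" using integrally_closed[OF d(1,2)] by blast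
  qed
qed

lemma gal_B: "\<sigma> \<in> Gal \<Longrightarrow> b \<in> B \<Longrightarrow> \<sigma> b \<in> B"
proof -
  assume s: "\<sigma> \<in> Gal" and "b \<in> B"
  then obtain S where S: "b \<in> N" "finite S" "S \<subseteq> N" "\<And>n. b ^ n \<in> aspan A S" unfolding integral_closure_def by auto
  have "aspan A S \<subseteq> {x \<in> N. \<sigma> x \<in> aspan A (\<sigma> ` S)}"
  proof (rule aspan_least[OF A])
    show "S \<subseteq> {x \<in> N. \<sigma> x \<in> aspan A (\<sigma> ` S)}" using S by (auto intro: aspan_incl[OF A])
    show "a * x \<in> {x \<in> N. \<sigma> x \<in> aspan A (\<sigma> ` S)}" if "a \<in> A" "x \<in> {x \<in> N. \<sigma> x \<in> aspan A (\<sigma> ` S)}" for a x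
      using that s A_N gal_mult[OF s, of a x] aspan_mult[OF A that(1), of "\<sigma> x"] sring_mult[OF N, of a x] by auto
  qed (use s N aspan_0[OF A] aspan_add[OF A] in \<open>auto simp: gal_add\<close>)
  then have "\<sigma> b ^ n \<in> aspan A (\<sigma> ` S)" for n using S(4)[of n] gal_power[OF s S(1), of n] by auto
  moreover have "finite (\<sigma> ` S)" "\<sigma> ` S \<subseteq> N" using S s by auto
  ultimately show ?thesis unfolding integral_closure_def using gal_closed[OF s S(1)] by blast
qed

lemma trace_A: "b \<in> B \<Longrightarrow> (\<Sum>\<sigma>\<in>Gal. \<sigma> b) \<in> A"
  using trace_mem[of b] B_N B_F sring_sum[OF B, of Gal "\<lambda>\<sigma>. \<sigma> b"] gal_B by blast

lemma charpoly_A: "b \<in> B \<Longrightarrow> charpoly b \<in> polys A"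
proof (rule polysI)
  fix i assume b: "b \<in> B"
  have "charpoly b \<in> polys B"
    unfolding charpoly_def using b B gal_B by (auto intro!: polys_prod polys_pCons sring_uminus)
  then show "Polynomial.coeff (charpoly b) i \<in> A"
    using polysD[of "charpoly b" B i] polysD[OF charpoly_polys, of b i] b B_N B_F by blast
qed

text \<open>\<open>nu b\<close> is the norm of \<open>b\<close> up to sign.  As constant term of the characteristic polynomial
  it is divisible by \<open>b\<close> already in \<open>A[b]\<close>.\<close>

definition nu :: "'a \<Rightarrow> 'a" where "nu b = (\<Prod>\<sigma>\<in>Gal. - \<sigma> b)"

lemma nu_charpoly: "nu b = Polynomial.coeff (charpoly b) 0"
  unfolding nu_def charpoly_def poly_0_coeff_0[symmetric] poly_prod by simp

lemma nu_A: "b \<in> B \<Longrightarrow> nu b \<in> A"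
  unfolding nu_charpoly by (rule polysD[OF charpoly_A])

lemma nu_nonzero: "b \<in> N \<Longrightarrow> b \<noteq> 0 \<Longrightarrow> nu b \<noteq> 0"
  unfolding nu_def using finite_gal by auto

lemma nu_dvd:
  assumes b: "b \<in> B" and R: "sring R" "A \<subseteq> R" "b \<in> R"
  obtains c where "c \<in> R" "nu b = b * c"
proof -
  obtain a q where aq: "charpoly b = pCons a q" by (cases "charpoly b")
  have "a = nu b" unfolding nu_charpoly aq by simp
  moreover have "poly (charpoly b) b = 0" using b B_N by (intro poly_charpoly) auto
  ultimately have "nu b = b * - poly q b" unfolding aq by (simp add: eq_neg_iff_add_eq_0)
  moreover have "q \<in> polys R"
  proof (rule polysI)
    fix i show "Polynomial.coeff q i \<in> R"
      using polysD[OF charpoly_A[OF b], of "Suc i"] R(2) unfolding aq by auto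
  qed
  then have "- poly q b \<in> R" using R by (intro sring_uminus poly_mem)
  ultimately show thesis using that by blast
qed

text \<open>
  With \<open>galois_coordinates\<close>, an element \<open>b\<close> is the sum of the products
  \<open>a * tr (c * b)\<close> over the pairs \<open>(a, c)\<close> of the list. When \<open>d\<close> is a
  common denominator of the second coordinates, the traces \<open>tr (d * c * b)\<close> lie in \<open>A\<close>.
\<close>

lemma B_in_span: "\<exists>S. finite S \<and> S \<subseteq> N \<and> B \<subseteq> aspan A S"
proof -
  obtain ps where ps: "set ps \<subseteq> N \<times> N"
    "\<And>\<sigma>. \<sigma> \<in> Gal \<Longrightarrow> (\<Sum>(a, b)\<leftarrow>ps. a * \<sigma> b) = (if \<sigma> = \<one>\<^bsub>\<Gamma>\<^esub> then 1 else 0)"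
    using galois_coordinates by blast
  have "\<exists>d\<in>A. d \<noteq> 0 \<and> (\<forall>(a, b)\<in>set xs. d * b \<in> B)" if "set xs \<subseteq> N \<times> N" for xs :: "('a \<times> 'a) list"
    using that
  proof (induction xs)
    case Nil
    then show ?case using A by (intro bexI[of _ 1]) auto
  next
    case (Cons ab xs)
    obtain a b where ab: "ab = (a, b)" by (cases ab)
    obtain d where d: "d \<in> A" "d \<noteq> 0" "\<forall>(a, b)\<in>set xs. d * b \<in> B" using Cons by auto
    obtain e where e: "e \<in> A" "e \<noteq> 0" "e * b \<in> B" using denominator[of b] Cons ab by auto
    have "(d * e) * y \<in> B" if "(x, y) \<in> set (ab # xs)" for x y
    proof (cases "(x, y) = ab")
      case True
      then have "d * (e * y) \<in> B" using ab d e A_B by (intro sring_mult[OF B, of d "e * y"]) auto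
      then show ?thesis by (simp add: ac_simps)
    next
      case False
      then have "(x, y) \<in> set xs" using that by auto
      then have "e * (d * y) \<in> B" using d e A_B by (intro sring_mult[OF B, of e "d * y"]) auto
      then show ?thesis by (simp add: ac_simps)
    qed
    then show ?case using d e A by (intro bexI[of _ "d * e"]) auto
  qed
  from this[OF ps(1)] obtain d where d: "d \<in> A" "d \<noteq> 0" "\<And>a b. (a, b) \<in> set ps \<Longrightarrow> d * b \<in> B" by fastforce
  let ?S = "(\<lambda>(a, b). a / d) ` set ps"
  have S: "finite ?S" "?S \<subseteq> N" using ps(1) d A_N by (auto intro!: N_divide)
  have "b \<in> aspan A ?S" if b: "b \<in> B" for b
  proof -
    have bN: "b \<in> N" using b B_N by auto
    have inner: "(\<Sum>(a, c)\<leftarrow>xs. a * \<sigma> (c * b)) = (\<Sum>(a, c)\<leftarrow>xs. a * \<sigma> c) * \<sigma> b"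
      if "\<sigma> \<in> Gal" "set xs \<subseteq> N \<times> N" for \<sigma> xs
      using that(2) by (induction xs) (use that(1) bN in \<open>auto simp: gal_mult algebra_simps\<close>)
    have "(\<Sum>(a, c)\<leftarrow>ps. a * (\<Sum>\<sigma>\<in>Gal. \<sigma> (c * b))) = (\<Sum>\<sigma>\<in>Gal. \<Sum>(a, c)\<leftarrow>ps. a * \<sigma> (c * b))"
      using sum_coordinates[OF finite_gal, of "\<lambda>\<sigma> c. \<sigma> (c * b)" ps] by simp
    also have "\<dots> = (\<Sum>\<sigma>\<in>Gal. if \<sigma> = \<one>\<^bsub>\<Gamma>\<^esub> then \<sigma> b else 0)"
      using inner[OF _ ps(1)] ps(2) by (intro sum.cong) auto
    also have "\<dots> = b" using finite_gal gal.one_closed gal_one[OF bN] by (simp add: sum.delta')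
    finally have eq: "b = (\<Sum>(a, c)\<leftarrow>ps. a * (\<Sum>\<sigma>\<in>Gal. \<sigma> (c * b)))" ..
    have "a * (\<Sum>\<sigma>\<in>Gal. \<sigma> (c * b)) \<in> aspan A ?S" if ac: "(a, c) \<in> set ps" for a c
    proof -
      have cN: "c \<in> N" using ac ps(1) by auto
      have "\<sigma> (d * c * b) = d * \<sigma> (c * b)" if "\<sigma> \<in> Gal" for \<sigma>
      proof -
        have "\<sigma> (d * (c * b)) = \<sigma> d * \<sigma> (c * b)"
          using that d(1) A_N cN bN by (intro gal_mult sring_mult[OF N]) auto
        then show ?thesis using that d(1) by (simp add: mult.assoc)
      qed
      then have "(\<Sum>\<sigma>\<in>Gal. \<sigma> (d * c * b)) = d * (\<Sum>\<sigma>\<in>Gal. \<sigma> (c * b))" by (simp add: sum_distrib_left)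
      then have "a * (\<Sum>\<sigma>\<in>Gal. \<sigma> (c * b)) = (\<Sum>\<sigma>\<in>Gal. \<sigma> (d * c * b)) * (a / d)" using d(2) by simp
      moreover have "(\<Sum>\<sigma>\<in>Gal. \<sigma> (d * c * b)) \<in> A" using d(3)[OF ac] b B by (intro trace_A) auto
      moreover have "a / d \<in> aspan A ?S" using S ac by (intro aspan_incl[OF A]) force+
      ultimately show ?thesis using aspan_mult[OF A, of "\<Sum>\<sigma>\<in>Gal. \<sigma> (d * c * b)" "a / d" ?S] by simp
    qed
    then have summand: "(case ac of (a, c) \<Rightarrow> a * (\<Sum>\<sigma>\<in>Gal. \<sigma> (c * b))) \<in> aspan A ?S" if "ac \<in> set ps" for ac
      using that by (cases ac) simp
    have "set xs \<subseteq> set ps \<Longrightarrow> (\<Sum>(a, c)\<leftarrow>xs. a * (\<Sum>\<sigma>\<in>Gal. \<sigma> (c * b))) \<in> aspan A ?S" for xs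
    proof (induction xs)
      case Nil
      show ?case using aspan_0[OF A] by simp
    next
      case (Cons ac xs)
      then show ?case using aspan_add[OF A summand[of ac]] by simp
    qed
    from this[of ps] show ?thesis unfolding eq[symmetric] by simp
  qed
  then show ?thesis using S by blast
qed

lemma B_finite: "\<exists>T. finite T \<and> T \<subseteq> B \<and> B = aspan A T"
proof -
  obtain S where "finite S" "B \<subseteq> aspan A S" using B_in_span by auto
  then show ?thesis using B A_B by (intro submodule_finite) auto
qed

text \<open>
  Reducing the coefficients of the characteristic polynomial modulo \<open>u - \<alpha>\<close> gives a polynomial over
  the constants that annihilates \<open>b\<close> modulo \<open>u - \<alpha>\<close>.
\<close>

lemma charpoly_reduction:
  assumes b: "b \<in> B" and R: "sring R" "A \<subseteq> R" "b \<in> R"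
  obtains g x where "g \<noteq> 0" "Polynomial.degree g = card Gal" "x \<in> R" "evat b g = (u - \<kappa> \<alpha>) * x"
proof -
  let ?n = "card Gal"
  have "\<forall>i. \<exists>f. Polynomial.coeff (charpoly b) i = ev f" using polysD[OF charpoly_A[OF b]] A_E by metis
  then obtain f where f: "\<And>i. Polynomial.coeff (charpoly b) i = ev (f i)" by metis
  have "\<exists>a\<in>A. ev (f i) - \<kappa> (poly (f i) \<alpha>) = (u - \<kappa> \<alpha>) * a" for i using ev_root[of "f i" \<alpha>] by auto
  then obtain a where a: "\<And>i. a i \<in> A" "\<And>i. ev (f i) - \<kappa> (poly (f i) \<alpha>) = (u - \<kappa> \<alpha>) * a i" by metis
  have "ev (f ?n) = 1" using f[of ?n] lead_coeff_charpoly[of b] degree_charpoly[of b] by simp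
  then have fn: "f ?n = 1" using ev_eq_iff[of "f ?n" 1] by simp
  define g where "g = (\<Sum>i\<le>?n. Polynomial.monom (poly (f i) \<alpha>) i)"
  have cg: "Polynomial.coeff g i = (if i \<le> ?n then poly (f i) \<alpha> else 0)" for i
    unfolding g_def by (simp add: coeff_sum if_distrib cong: if_cong)
  have g1: "Polynomial.coeff g ?n = 1" using fn by (simp add: cg)
  then have deg: "Polynomial.degree g = ?n"
    by (intro antisym degree_le le_degree) (auto simp: cg)
  have "0 = (\<Sum>i\<le>?n. ev (f i) * b ^ i)"
    using poly_charpoly[of b] b B_N by (simp add: poly_altdef degree_charpoly f subset_eq)
  moreover have "evat b g = (\<Sum>i\<le>?n. \<kappa> (poly (f i) \<alpha>) * b ^ i)"
    unfolding evat_altdef deg by (intro sum.cong) (auto simp: cg)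
  ultimately have "evat b g = (\<Sum>i\<le>?n. \<kappa> (poly (f i) \<alpha>) * b ^ i) - (\<Sum>i\<le>?n. ev (f i) * b ^ i)" by simp
  also have "\<dots> = (\<Sum>i\<le>?n. (\<kappa> (poly (f i) \<alpha>) - ev (f i)) * b ^ i)" by (simp add: sum_subtractf left_diff_distrib)
  also have "\<dots> = (\<Sum>i\<le>?n. - ((u - \<kappa> \<alpha>) * a i) * b ^ i)" unfolding a(2)[symmetric] by simp
  also have "\<dots> = (u - \<kappa> \<alpha>) * (\<Sum>i\<le>?n. - (a i * b ^ i))" by (simp add: sum_distrib_left mult.assoc)
  finally have "evat b g = (u - \<kappa> \<alpha>) * (\<Sum>i\<le>?n. - (a i * b ^ i))" .
  moreover have "(\<Sum>i\<le>?n. - (a i * b ^ i)) \<in> R"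
    using R a(1) by (auto intro!: sring_sum sring_uminus sring_mult sring_power)
  moreover have "g \<noteq> 0" using g1 by auto
  ultimately show thesis using that deg by blast
qed

text \<open>
  The reduced characteristic polynomial of \<open>b\<close> takes a value in \<open>I\<close>, and the field of
  constants contains its roots.
\<close>

lemma residue:
  assumes R: "sring R" "A \<subseteq> R" "R \<subseteq> B" and I: "primeideal I (subring_of_type R)" and t: "u - \<kappa> \<alpha> \<in> I" and b: "b \<in> R"
  obtains c where "b - \<kappa> c \<in> I"
proof -
  have bB: "b \<in> B" using b R(3) by auto
  obtain g x where g: "g \<noteq> 0" "Polynomial.degree g = card Gal" "x \<in> R" "evat b g = (u - \<kappa> \<alpha>) * x"
    by (rule charpoly_reduction[OF bB R(1,2) b])
  have KR: "K \<subseteq> R" using K_subset R by auto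
  have "evat b g \<in> I" unfolding g(4) by (rule prime_multR[OF R(1) I t g(3)])
  then show thesis using prime_root[OF R(1) I KR b _ g(1)] that by blast
qed

text \<open>
  The norm of a nonzero element of \<open>I\<close> is a polynomial in \<open>u\<close> that lies in
  \<open>I\<close>.
\<close>

lemma prime_contains_linear:
  assumes R: "sring R" "A \<subseteq> R" "R \<subseteq> B" and I: "primeideal I (subring_of_type R)" and "I \<noteq> {0}"
  obtains \<alpha> where "u - \<kappa> \<alpha> \<in> I"
proof -
  obtain b where b: "b \<in> I" "b \<noteq> 0" "b \<in> R" using assms prime_0[OF R(1) I] prime_sub[OF R(1) I] by auto
  have bB: "b \<in> B" using b R by auto
  obtain c where c: "c \<in> R" "nu b = b * c" using nu_dvd[OF bB R(1,2) b(3)] by blast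
  have "nu b \<in> I" using c prime_multR[OF R(1) I b(1)] by simp
  moreover obtain f where f: "nu b = ev f" using nu_A[OF bB] by (rule A_E)
  moreover have "f \<noteq> 0" using nu_nonzero[of b] b bB B_N f by auto
  moreover have "K \<subseteq> R" "u \<in> R" using K_subset R(2) u_mem_A by blast+
  ultimately show thesis
    using prime_root[OF R(1) I, of u f] that by auto
qed

end

section \<open>The local rings of the integral closure\<close>

text \<open>
  As long as the element is not a unit it can be divided by \<open>\<pi>\<close>, and \<open>fin\<close> stops
  this process.
\<close>

lemma unit_times_power:
  assumes R: "sring R" and pi: "max_ideal R \<subseteq> (*) \<pi> ` R" and a: "a \<in> R"
    and fin: "\<And>r. r \<in> R \<Longrightarrow> a \<noteq> \<pi> ^ k * r"
  obtains j w where "a = \<pi> ^ j * w" "w \<in> R" "w \<noteq> 0" "inverse w \<in> R"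
proof (rule ccontr)
  assume no: "\<not> thesis"
  have "\<exists>r\<in>R. a = \<pi> ^ j * r" for j
  proof (induction j)
    case 0
    show ?case using a by auto
  next
    case (Suc j)
    then obtain r where r: "r \<in> R" "a = \<pi> ^ j * r" by auto
    have "r \<in> max_ideal R" using no that[OF r(2,1)] r(1) unfolding max_ideal_eq[OF R] by blast
    then obtain s where "s \<in> R" "r = \<pi> * s" using pi by auto
    then show ?case using r by (auto intro!: bexI[of _ s] simp: ac_simps)
  qed
  then show False using fin by blast
qed

lemma integral_closure_mono: "M \<subseteq> N \<Longrightarrow> integral_closure A M \<subseteq> integral_closure A N"
  unfolding integral_closure_def by blast

context line_ext
begin

lemma t_nonzero: "u - \<kappa> \<alpha> \<noteq> 0"
proof -
  have "ev [:-\<alpha>, 1:] \<noteq> 0" unfolding ev_eq_0_iff by simp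
  then show ?thesis by (simp add: evat_linear \<kappa>_uminus)
qed

lemma A_decomposition:
  assumes a: "a \<in> A" "a \<noteq> 0"
  obtains i b c where "a = (u - \<kappa> \<alpha>) ^ i * b" "b \<in> A" "c \<noteq> 0" "b - \<kappa> c \<in> (*) (u - \<kappa> \<alpha>) ` A"
proof -
  obtain f where f: "a = ev f" using a(1) by (rule A_E)
  then have "f \<noteq> 0" using a by auto
  then obtain g where g: "f = [:-\<alpha>, 1:] ^ Polynomial.order \<alpha> f * g" "\<not> [:-\<alpha>, 1:] dvd g"
    using order_decomp by blast
  have "a = (u - \<kappa> \<alpha>) ^ Polynomial.order \<alpha> f * ev g"
    by (subst f, subst g(1)) (simp only: evat_mult evat_power, simp add: evat_linear \<kappa>_uminus)
  moreover have "poly g \<alpha> \<noteq> 0" using g(2) by (simp only: poly_eq_0_iff_dvd not_False_eq_True)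
  ultimately show thesis using that[OF _ mem_A _ ev_root] by blast
qed

text \<open>
  A maximal ideal above \<open>u = \<alpha>\<close>, from Zorn's lemma. The ideal generated by
  \<open>u - \<alpha>\<close> is proper because \<open>B \<inter> F = A\<close>.
\<close>

lemma prime_containing_linear_exists:
  obtains q where "primeideal q (subring_of_type B)" "u - \<kappa> \<alpha> \<in> q"
proof -
  define S where "S = {I. I \<subseteq> B \<and> u - \<kappa> \<alpha> \<in> I \<and> 1 \<notin> I \<and> 0 \<in> I \<and> (\<forall>a\<in>I. \<forall>b\<in>I. a + b \<in> I) \<and> (\<forall>a\<in>B. \<forall>b\<in>I. a * b \<in> I)}"
  let ?t = "u - \<kappa> \<alpha>"
  have tA: "?t \<in> A" using sring_diff[OF A u_mem_A \<kappa>_mem_A] .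
  then have tB: "?t \<in> B" using A_B by auto
  have "1 \<notin> (*) ?t ` B"
  proof
    assume "1 \<in> (*) ?t ` B"
    then obtain b where b: "b \<in> B" "?t * b = 1" by auto
    then have "inverse ?t = b" by (intro inverse_unique)
    then have "b \<in> A" using b(1) B_F F_inverse[of ?t] tA A_F by auto
    then obtain f where "b = ev f" by (rule A_E)
    then have "ev ([:-\<alpha>, 1:] * f) = ev 1" using b(2) unfolding evat_mult by (simp add: evat_linear \<kappa>_uminus)
    then have eq: "[:-\<alpha>, 1:] * f = 1" by (simp only: ev_eq_iff)
    then have "poly ([:-\<alpha>, 1:] * f) \<alpha> = 1" by simp
    then show False by simp
  qed
  then have "(*) ?t ` B \<in> S"
    unfolding S_def using tB B
    by (auto simp: distrib_left[symmetric] mult.left_commute[of _ ?t] intro!: sring_mult[OF B] sring_add[OF B] intro: image_eqI[of _ _ 1] image_eqI[of _ _ 0])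
  then have "S \<noteq> {}" by auto
  moreover have "\<Union>C \<in> S" if C: "C \<noteq> {}" "subset.chain S C" for C
  proof -
    have CS: "I \<in> S" if "I \<in> C" for I using C(2) that unfolding subset.chain_def by auto
    have tot: "I \<subseteq> J \<or> J \<subseteq> I" if "I \<in> C" "J \<in> C" for I J using C(2) that unfolding subset.chain_def by auto
    have "a + b \<in> \<Union>C" if ab: "a \<in> \<Union>C" "b \<in> \<Union>C" for a b
    proof -
      obtain I J where IJ: "I \<in> C" "J \<in> C" "a \<in> I" "b \<in> J" using ab by auto
      have "\<exists>L\<in>C. a \<in> L \<and> b \<in> L" using tot[OF IJ(1,2)] IJ by blast
      then obtain L where L: "L \<in> C" "a \<in> L" "b \<in> L" by auto
      then have "a + b \<in> L" using CS[OF L(1)] unfolding S_def by blast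
      then show ?thesis using L by auto
    qed
    moreover have "a * b \<in> \<Union>C" if ab: "a \<in> B" "b \<in> \<Union>C" for a b
      using ab CS unfolding S_def by blast
    moreover have "\<Union>C \<subseteq> B" "1 \<notin> \<Union>C" using CS unfolding S_def by blast+
    moreover have "?t \<in> \<Union>C" "0 \<in> \<Union>C" using C(1) CS unfolding S_def by blast+
    ultimately show ?thesis unfolding S_def by blast
  qed
  ultimately obtain q where q: "q \<in> S" "\<And>I. I \<in> S \<Longrightarrow> q \<subseteq> I \<Longrightarrow> I = q"
    using subset_Zorn_nonempty[of S] by blast
  have qB: "q \<subseteq> B" and q0: "0 \<in> q" and q1: "1 \<notin> q" and tq: "?t \<in> q"
    and qa: "\<And>a b. a \<in> q \<Longrightarrow> b \<in> q \<Longrightarrow> a + b \<in> q" and qm: "\<And>a b. a \<in> B \<Longrightarrow> b \<in> q \<Longrightarrow> a * b \<in> q"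
    using q(1) unfolding S_def by blast+
  have max: "\<exists>i\<in>q. \<exists>r\<in>B. 1 = i + a * r" if a: "a \<in> B" "a \<notin> q" for a
  proof (rule ccontr)
    assume no: "\<not> ?thesis"
    let ?I = "{i + a * r | i r. i \<in> q \<and> r \<in> B}"
    have memI: "i + a * r \<in> ?I" if "i \<in> q" "r \<in> B" for i r using that by blast
    have "q \<subseteq> ?I" using memI[OF _ sring_0[OF B]] by auto
    moreover have "a \<in> ?I" using memI[OF q0 sring_1[OF B]] by simp
    moreover have "?I \<in> S"
    proof -
      have "x + y \<in> ?I" if xy: "x \<in> ?I" "y \<in> ?I" for x y
      proof -
        obtain i r j s where xy: "x = i + a * r" "y = j + a * s" "i \<in> q" "j \<in> q" "r \<in> B" "s \<in> B" using xy by blast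
        have "x + y = (i + j) + a * (r + s)" unfolding xy by (simp add: algebra_simps)
        also have "\<dots> \<in> ?I" using xy by (intro memI qa sring_add[OF B])
        finally show ?thesis .
      qed
      moreover have "x * y \<in> ?I" if x: "x \<in> B" and y: "y \<in> ?I" for x y
      proof -
        obtain j s where xy: "y = j + a * s" "j \<in> q" "s \<in> B" using y by blast
        have "x * y = x * j + a * (x * s)" unfolding xy by (simp add: algebra_simps)
        also have "\<dots> \<in> ?I" using xy x by (intro memI qm sring_mult[OF B, of x s])
        finally show ?thesis .
      qed
      moreover have "?I \<subseteq> B" using qB a(1) by (auto intro!: sring_add[OF B] sring_mult[OF B, of a])
      moreover have "1 \<notin> ?I" using no by blast
      moreover have "?t \<in> ?I" "0 \<in> ?I" using memI[OF tq sring_0[OF B]] memI[OF q0 sring_0[OF B]] by auto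
      ultimately show ?thesis unfolding S_def by blast
    qed
    ultimately show False using q(2)[of ?I] a(2) by blast
  qed
  have "a \<in> q \<or> b \<in> q" if ab: "a \<in> B" "b \<in> B" "a * b \<in> q" for a b
  proof (rule ccontr)
    assume "\<not> ?thesis"
    then obtain i r where ir: "i \<in> q" "r \<in> B" "1 = i + a * r" and bq: "b \<notin> q" using max[OF ab(1)] by blast
    have "b = b * (i + a * r)" using ir(3) by simp
    also have "\<dots> = b * i + r * (a * b)" by (simp add: algebra_simps)
    also have "\<dots> \<in> q" by (rule qa[OF qm[OF ab(2) ir(1)] qm[OF ir(2) ab(3)]])
    finally show False using bq by simp
  qed
  then have "primeideal q (subring_of_type B)"
    unfolding primeideal_iff[OF B] using qB q0 q1 qa qm by blast
  then show thesis using that tq by blast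
qed

text \<open>Over the constants all residue fields are trivial, so primes containing \<open>u - \<alpha>\<close> are maximal.\<close>

lemma prime_maximal:
  assumes R: "sring R" "A \<subseteq> R" "R \<subseteq> B" and I: "primeideal I (subring_of_type R)" and t: "u - \<kappa> \<alpha> \<in> I"
    and J: "primeideal J (subring_of_type R)" and IJ: "I \<subseteq> J"
  shows "I = J"
proof
  show "J \<subseteq> I"
  proof
    fix b assume b: "b \<in> J"
    then have bR: "b \<in> R" using prime_sub[OF R(1) J] by auto
    obtain c where c: "b - \<kappa> c \<in> I" using residue[OF R I t bR] by blast
    have "b - (b - \<kappa> c) \<in> J" by (rule prime_diff[OF R(1) J b]) (use c IJ in blast)
    then have "\<kappa> c \<in> J" by simp
    then have "c = 0" using \<kappa>_notin_prime[OF R(1) J] K_subset R(2) by auto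
    then show "b \<in> I" using c by simp
  qed
qed (rule IJ)

lemma gal_preimage_prime:
  assumes R: "sring R" "R \<subseteq> B" and q: "primeideal q (subring_of_type B)" and s: "\<sigma> \<in> Gal"
  shows "primeideal {b \<in> R. \<sigma> b \<in> q} (subring_of_type R)"
proof -
  have RN: "b \<in> R \<Longrightarrow> b \<in> N" and RB: "b \<in> R \<Longrightarrow> \<sigma> b \<in> B" for b using R B_N gal_B[OF s] by auto
  have "\<sigma> (a + b) \<in> q" if "a \<in> R" "b \<in> R" "\<sigma> a \<in> q" "\<sigma> b \<in> q" for a b
    using that prime_add[OF B q, of "\<sigma> a" "\<sigma> b"] gal_add[OF s RN RN] by simp
  moreover have "\<sigma> (a * b) \<in> q" if "a \<in> R" "b \<in> R" "\<sigma> b \<in> q" for a b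
    using that prime_multL[OF B q RB, of a "\<sigma> b"] gal_mult[OF s RN RN] by simp
  moreover have "\<sigma> a \<in> q \<or> \<sigma> b \<in> q" if "a \<in> R" "b \<in> R" "\<sigma> (a * b) \<in> q" for a b
    using that prime_disj[OF B q RB RB, of a b] gal_mult[OF s RN RN] by simp
  ultimately show ?thesis
    unfolding primeideal_iff[OF R(1)] using R(1) s prime_0[OF B q] prime_1[OF B q] by (auto simp: sring_add sring_mult)
qed

text \<open>
  The contractions of the conjugates of one prime of \<open>B\<close> above \<open>u = \<alpha>\<close> are all
  the primes of \<open>R\<close> above \<open>u = \<alpha>\<close>: otherwise the Chinese remainder theorem gives
  an element of the remaining prime whose norm is a unit at \<open>\<alpha>\<close>.
\<close>

lemma lying_over:
  assumes R: "sring R" "A \<subseteq> R" "R \<subseteq> B" and I: "primeideal I (subring_of_type R)" and t: "u - \<kappa> \<alpha> \<in> I"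
  obtains q where "primeideal q (subring_of_type B)" "q \<inter> R = I"
proof -
  obtain q where q: "primeideal q (subring_of_type B)" and tq: "u - \<kappa> \<alpha> \<in> q"
    using prime_containing_linear_exists by blast
  have "\<exists>\<sigma>\<in>Gal. {b \<in> R. \<sigma> b \<in> q} = I"
  proof (rule ccontr)
    assume no: "\<not> ?thesis"
    have "\<exists>c\<in>R. \<sigma> c \<in> q \<and> c - 1 \<in> I" if s: "\<sigma> \<in> Gal" for \<sigma>
    proof -
      let ?J = "{b \<in> R. \<sigma> b \<in> q}"
      have J: "primeideal ?J (subring_of_type R)" by (rule gal_preimage_prime[OF R(1,3) q s])
      have tA: "u - \<kappa> \<alpha> \<in> A" by (rule sring_diff[OF A u_mem_A \<kappa>_mem_A])
      then have tJ: "u - \<kappa> \<alpha> \<in> ?J" using tq R(2) s by auto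
      have "\<not> ?J \<subseteq> I" using no s prime_maximal[OF R J tJ I] by blast
      then obtain c where c: "c \<in> R" "\<sigma> c \<in> q" "c \<notin> I" by auto
      obtain d where d: "c - \<kappa> d \<in> I" using residue[OF R I t c(1)] by blast
      then have d0: "d \<noteq> 0" using c(3) by auto
      have kR: "\<kappa> (inverse d) \<in> R" "\<kappa> (inverse d) \<in> A" "\<kappa> (inverse d) \<in> B" using R(2) A_B by auto
      have "\<kappa> (inverse d) * (c - \<kappa> d) \<in> I" by (rule prime_multL[OF R(1) I kR(1) d])
      moreover have "\<kappa> (inverse d) * \<kappa> d = 1" using d0 by (simp add: \<kappa>_mult[symmetric])
      ultimately have "\<kappa> (inverse d) * c - 1 \<in> I" by (simp add: right_diff_distrib)
      moreover have "\<sigma> (\<kappa> (inverse d) * c) \<in> q"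
      proof -
        have "\<sigma> (\<kappa> (inverse d) * c) = \<sigma> (\<kappa> (inverse d)) * \<sigma> c"
          using s A_N c(1) R(3) B_N by (intro gal_mult) auto
        then show ?thesis using s kR prime_multL[OF B q kR(3) c(2)] by simp
      qed
      ultimately show ?thesis using sring_mult[OF R(1) kR(1) c(1)] by blast
    qed
    then obtain c where c: "\<And>\<sigma>. \<sigma> \<in> Gal \<Longrightarrow> c \<sigma> \<in> R \<and> \<sigma> (c \<sigma>) \<in> q \<and> c \<sigma> - 1 \<in> I" by metis
    define b where "b = 1 - (\<Prod>\<sigma>\<in>Gal. c \<sigma>)"
    have pR: "(\<Prod>\<sigma>\<in>Gal. c \<sigma>) \<in> R" using c by (intro sring_prod[OF R(1)]) auto
    have bR: "b \<in> R" unfolding b_def using R(1) pR by (intro sring_diff) auto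
    have bB: "b \<in> B" "b \<in> N" using bR R(3) B_N by auto
    have "S \<subseteq> Gal \<Longrightarrow> (\<Prod>\<sigma>\<in>S. c \<sigma>) - 1 \<in> I" for S
    proof (induction S rule: infinite_finite_induct)
      case (insert x S)
      have "(\<Prod>\<sigma>\<in>insert x S. c \<sigma>) - 1 = c x * ((\<Prod>\<sigma>\<in>S. c \<sigma>) - 1) + (c x - 1)"
        using insert by (simp add: algebra_simps)
      also have "\<dots> \<in> I" using insert c by (intro prime_add[OF R(1) I] prime_multL[OF R(1) I]) auto
      finally show ?case .
    qed (use prime_0[OF R(1) I] in auto)
    from prime_uminus[OF R(1) I this[of Gal]] have bI: "b \<in> I" unfolding b_def by simp
    have conj: "1 - \<sigma> b \<in> q" if s: "\<sigma> \<in> Gal" for \<sigma>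
    proof -
      have cN: "c \<tau> \<in> N" "\<sigma> (c \<tau>) \<in> B" if "\<tau> \<in> Gal" for \<tau> using c[OF that] R(3) B_N gal_B[OF s] by auto
      have "1 - \<sigma> b = \<sigma> (\<Prod>\<sigma>\<in>Gal. c \<sigma>)"
        unfolding b_def using s N R(3) B_N pR by (subst gal_diff) auto
      also have "\<dots> = (\<Prod>\<tau>\<in>Gal. \<sigma> (c \<tau>))" using s cN by (intro gal_prod)
      also have "\<dots> \<in> q" using c[OF s] cN finite_gal s by (intro prime_prod_mem[OF B q, of _ _ \<sigma>]) auto
      finally show ?thesis .
    qed
    have notq: "- \<sigma> b \<notin> q" if s: "\<sigma> \<in> Gal" for \<sigma>
    proof
      assume "- \<sigma> b \<in> q"
      then have "(1 - \<sigma> b) - (- \<sigma> b) \<in> q" using conj[OF s] by (rule prime_diff[OF B q, rotated])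
      then show False using prime_1[OF B q] by simp
    qed
    have nq: "nu b \<notin> q"
    proof
      assume "nu b \<in> q"
      then have "\<exists>\<sigma>\<in>Gal. - \<sigma> b \<in> q" unfolding nu_def
        using finite_gal gal_B bB by (intro prime_prod[OF B q]) (auto intro: sring_uminus[OF B])
      then show False using notq by auto
    qed
    obtain d where d: "d \<in> R" "nu b = b * d" using nu_dvd[OF bB(1) R(1,2) bR] by blast
    have nI: "nu b \<in> I" unfolding d(2) by (rule prime_multR[OF R(1) I bI d(1)])
    obtain f where f: "nu b = ev f" using nu_A[OF bB(1)] by (rule A_E)
    obtain a where a: "a \<in> A" "nu b - \<kappa> (poly f \<alpha>) = (u - \<kappa> \<alpha>) * a" using ev_root[of f \<alpha>] f by auto
    have "nu b - (u - \<kappa> \<alpha>) * a \<in> I" using a R(2) by (intro prime_diff[OF R(1) I nI] prime_multR[OF R(1) I t]) auto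
    moreover have eq: "nu b - (u - \<kappa> \<alpha>) * a = \<kappa> (poly f \<alpha>)" using a(2) by (simp add: algebra_simps)
    ultimately have "poly f \<alpha> = 0" using \<kappa>_notin_prime[OF R(1) I] K_subset R(2) by auto
    then have "nu b = (u - \<kappa> \<alpha>) * a" using eq by simp
    moreover have "(u - \<kappa> \<alpha>) * a \<in> q" using a A_B by (intro prime_multR[OF B q tq]) auto
    ultimately show False using nq by simp
  qed
  then obtain \<sigma> where s: "\<sigma> \<in> Gal" "{b \<in> R. \<sigma> b \<in> q} = I" by auto
  have "{b \<in> B. \<sigma> b \<in> q} \<inter> R = I" using s(2) R(3) by auto
  then show thesis using that gal_preimage_prime[OF B order.refl q s(1)] by blast
qed

end

text \<open>
  A closed point of the affine chart \<open>B\<close> above the point \<open>u = \<alpha>\<close> of the line,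
  with local ring \<open>R\<close> and maximal ideal \<open>m\<close>; the parameter \<open>t\<close> vanishes at
  the point but generates \<open>m\<close> only in the unramified case.
\<close>

locale place = line_ext \<kappa> u F N
  for \<kappa> :: "'k::alg_closed_field \<Rightarrow> 'a::Fields.field" and u :: 'a and F N :: "'a set" +
  fixes q :: "'a set" and \<alpha> :: 'k
  assumes q: "primeideal q (subring_of_type B)" and linear_q: "u - \<kappa> \<alpha> \<in> q"
begin

definition t where "t = u - \<kappa> \<alpha>"
abbreviation R where "R \<equiv> localization_at B q"
abbreviation m where "m \<equiv> max_ideal R"

lemma R: "sring R" by (rule sring_localization[OF B q])
lemma B_R: "B \<subseteq> R" by (rule localization_sub[OF B q])
lemma A_R: "A \<subseteq> R" using A_B B_R by auto
lemma m: "primeideal m (subring_of_type R)" by (rule primeideal_max_ideal_localization[OF B q])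
lemma m_B: "m \<inter> B = q" by (rule max_ideal_localization_Int[OF B q])
lemma q_m: "q \<subseteq> m" using m_B by auto
lemma t_q: "t \<in> q" using linear_q by (simp add: t_def)
lemma t_m: "t \<in> m" using t_q q_m by auto
lemma m_R: "m \<subseteq> R" by (rule prime_sub[OF R m])
lemma t_A: "t \<in> A" unfolding t_def by (rule sring_diff[OF A u_mem_A \<kappa>_mem_A])
lemma t_R: "t \<in> R" using t_m m_R by auto
lemma t_0 [simp]: "t \<noteq> 0" unfolding t_def by (rule t_nonzero)

lemmas A_decomp = A_decomposition[where \<alpha>=\<alpha>, folded t_def]

lemma R_N: "R \<subseteq> N"
proof
  fix a assume "a \<in> R"
  then show "a \<in> N" using B_N N_divide by (elim localizationE[OF B q]) auto
qed

lemma unit_or_m: "a \<in> R \<Longrightarrow> a \<in> m \<or> inverse a \<in> R"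
  unfolding max_ideal_eq[OF R] by blast

lemma \<kappa>_m: "\<kappa> c \<in> m \<Longrightarrow> c = 0"
  using \<kappa>_notin_prime[OF R m] K_subset A_R by blast

lemma residue_R:
  assumes "a \<in> R"
  obtains c where "a - \<kappa> c \<in> m"
proof -
  obtain b s where bs: "b \<in> B" "s \<in> B" "s \<notin> q" "s \<noteq> 0" "a = b / s" using assms by (rule localizationE[OF B q])
  obtain c where c: "b - \<kappa> c \<in> q" using residue[OF B A_B order.refl q linear_q bs(1)] by blast
  obtain d where d: "s - \<kappa> d \<in> q" using residue[OF B A_B order.refl q linear_q bs(2)] by blast
  have d0: "d \<noteq> 0" using d bs by auto
  have kB: "\<kappa> x \<in> B" for x using A_B by auto
  have "(b - \<kappa> c) - \<kappa> (c / d) * (s - \<kappa> d) \<in> q" by (intro prime_diff[OF B q] c prime_multL[OF B q kB d])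
  moreover have "\<kappa> (c / d) * \<kappa> d = \<kappa> c" using d0 by (simp add: \<kappa>_mult[symmetric])
  ultimately have "b - \<kappa> (c / d) * s \<in> q" by (simp add: algebra_simps)
  then have "(b - \<kappa> (c / d) * s) / s \<in> m" unfolding max_ideal_localization[OF B q] using bs by blast
  moreover have "(b - \<kappa> (c / d) * s) / s = a - \<kappa> (c / d)" using bs by (simp add: field_simps)
  ultimately show thesis using that by simp
qed

text \<open>
  Modulo \<open>t\<close>, an element \<open>b\<close> of \<open>q\<close> satisfies a polynomial equation over
  the constants. Its polynomial is a power of the variable times a factor that is a unit at \<open>b\<close>.
\<close>

lemma m_power_card:
  assumes b: "b \<in> m"
  shows "b ^ card Gal / t \<in> R"
proof -
  have *: "b ^ card Gal / t \<in> R" if b: "b \<in> q" for b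
  proof -
    have bB: "b \<in> B" using b prime_sub[OF B q] by auto
    obtain g x where g: "g \<noteq> 0" "Polynomial.degree g = card Gal" "x \<in> B" "evat b g = t * x"
      by (rule charpoly_reduction[OF bB B A_B bB, of \<alpha>, folded t_def])
    define k where "k = Polynomial.order 0 g"
    obtain h where h: "g = [:0, 1:] ^ k * h" "\<not> [:0, 1:] dvd h"
      using order_decomp[OF g(1), of 0] unfolding k_def by auto
    have k: "k \<le> card Gal" using order_degree[OF g(1), of 0] g(2) by (simp add: k_def)
    obtain c h' where ch: "h = pCons c h'" by (cases h)
    have "c \<noteq> 0"
    proof
      assume "c = 0"
      then have "h = [:0, 1:] * h'" unfolding ch by simp
      then show False using h(2) by (metis dvd_triv_left)
    qed
    have eB: "evat b f \<in> B" for f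
      unfolding evat_altdef using bB A_B B by (auto intro!: sring_sum sring_mult sring_power)
    have "evat b h \<notin> q"
    proof
      assume "evat b h \<in> q"
      then have "evat b h - b * evat b h' \<in> q" by (intro prime_diff[OF B q] prime_multR[OF B q b eB])
      then have "\<kappa> c \<in> q" unfolding ch by (simp add: evat_pCons)
      then show False using \<kappa>_m[of c] q_m \<open>c \<noteq> 0\<close> by auto
    qed
    then have eh: "evat b h \<noteq> 0" "1 / evat b h \<in> R" using prime_0[OF B q] B eB by (auto intro!: localizationI[OF B q])
    have "b ^ k * evat b h = t * x" using g(4) unfolding h(1) evat_mult evat_power by (simp add: evat_linear)
    then have "b ^ k / t = x * (1 / evat b h)" using eh by (simp add: field_simps)
    then have "b ^ k / t \<in> R" using eh(2) g(3) B_R sring_mult[OF R, of x "1 / evat b h"] by auto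
    moreover have "b ^ card Gal / t = b ^ (card Gal - k) * (b ^ k / t)" using k by (simp add: power_add[symmetric])
    moreover have "b ^ (card Gal - k) \<in> R" using bB B_R by (intro sring_power[OF R]) auto
    ultimately show ?thesis using sring_mult[OF R, of "b ^ (card Gal - k)" "b ^ k / t"] by simp
  qed
  obtain r s where rs: "r \<in> q" "s \<in> B" "s \<notin> q" "b = r / s"
    using b unfolding max_ideal_localization[OF B q] by auto
  have "1 / s \<in> R" using rs B by (intro localizationI[OF B q]) auto
  then have "(1 / s) ^ card Gal * (r ^ card Gal / t) \<in> R" using *[OF rs(1)] by (intro sring_mult[OF R] sring_power[OF R])
  then show ?thesis using rs by (simp add: power_divide)
qed

lemma m_power_card_mult:
  assumes b: "b \<in> m"
  shows "b ^ (card Gal * k) / t ^ k \<in> R"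
  using sring_power[OF R m_power_card[OF b], of k] by (simp add: power_divide power_mult)

lemma unit_near_constant:
  assumes "b \<in> A" "c \<noteq> 0" "b - \<kappa> c \<in> (*) t ` A"
  shows "b \<notin> m" "inverse b \<in> R" "b \<noteq> 0"
proof -
  obtain a where a: "a \<in> A" "b - \<kappa> c = t * a" using assms by auto
  show bm: "b \<notin> m"
  proof
    assume "b \<in> m"
    then have "b - t * a \<in> m" using a A_R by (intro prime_diff[OF R m] prime_multR[OF R m t_m]) auto
    moreover have "b - t * a = \<kappa> c" using a(2) by (simp add: algebra_simps)
    ultimately show False using \<kappa>_m assms(2) by auto
  qed
  then show "inverse b \<in> R" using unit_or_m assms(1) A_R by auto
  show "b \<noteq> 0" using bm prime_0[OF R m] by auto
qed

text \<open>
  Krull's intersection theorem. Otherwise the norm of a numerator of \<open>a\<close> would be a nonzero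
  polynomial divisible by all powers of \<open>t\<close>.
\<close>

lemma krull:
  assumes a: "a \<in> N" and div: "\<And>k. a / t ^ k \<in> R"
  shows "a = 0"
proof (rule ccontr)
  assume "a \<noteq> 0"
  obtain b d where bd: "b \<in> B" "d \<in> A" "d \<noteq> 0" "a = b / d" using a by (rule N_cases)
  have b0: "b \<noteq> 0" "b \<in> N" using \<open>a \<noteq> 0\<close> bd B_N by auto
  obtain c where c: "c \<in> B" "nu b = b * c" using nu_dvd[OF bd(1) B A_B bd(1)] by blast
  obtain i e k where e: "nu b = t ^ i * e" "e \<in> A" "k \<noteq> 0" "e - \<kappa> k \<in> (*) t ` A"
    using A_decomp[OF nu_A[OF bd(1)] nu_nonzero[OF b0(2,1)]] by blast
  have "(a / t ^ Suc i) * (c * d) \<in> R" using div[of "Suc i"] c bd A_R B_R by (intro sring_mult[OF R, of _ "c * d"] sring_mult[OF R, of c d]) auto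
  moreover have "(a / t ^ Suc i) * (c * d) = nu b / t ^ Suc i" using bd c by simp
  moreover have "nu b / t ^ Suc i = e / t" using e(1) by simp
  ultimately have "e / t \<in> R" by simp
  then have "t * (e / t) \<in> m" by (rule prime_multR[OF R m t_m])
  then show False using unit_near_constant[OF e(2,3,4)] by simp
qed

lemma pole_bounded:
  assumes g: "g \<in> N"
  shows "\<exists>k. \<forall>j\<ge>k. g * t ^ j \<in> R"
proof -
  obtain b d where bd: "b \<in> B" "d \<in> A" "d \<noteq> 0" "g = b / d" using g by (rule N_cases)
  obtain i e k where e: "d = t ^ i * e" "e \<in> A" "k \<noteq> 0" "e - \<kappa> k \<in> (*) t ` A"
    using A_decomp[OF bd(2,3)] by blast
  have "g * t ^ j \<in> R" if "i \<le> j" for j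
  proof -
    have "g * t ^ j = b * inverse e * t ^ (j - i)"
    proof -
      have "t ^ j = t ^ i * t ^ (j - i)" using that by (simp add: power_add[symmetric])
      then show ?thesis using bd(4) e(1) unit_near_constant[OF e(2-4)] by (simp add: field_simps)
    qed
    then show ?thesis using bd B_R t_R unit_near_constant[OF e(2-4)]
      by (auto intro!: sring_mult[OF R, of "b * inverse e"] sring_mult[OF R, of b] sring_power[OF R])
  qed
  then show ?thesis by blast
qed

lemma F_m:
  assumes f: "f \<in> F" "f \<in> m"
  shows "f / t \<in> R"
proof (cases "f = 0")
  case True
  then show ?thesis using R by simp
next
  case False
  obtain d b where bd: "d \<in> A" "d \<noteq> 0" "b \<in> A" "f = b / d" using f(1) by (rule F_cases)
  have b0: "b \<noteq> 0" using bd False by auto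
  obtain i e k where e: "d = t ^ i * e" "e \<in> A" "k \<noteq> 0" "e - \<kappa> k \<in> (*) t ` A"
    using A_decomp[OF bd(1,2)] by blast
  obtain j h l where h: "b = t ^ j * h" "h \<in> A" "l \<noteq> 0" "h - \<kappa> l \<in> (*) t ` A"
    using A_decomp[OF bd(3) b0] by blast
  note ue = unit_near_constant[OF e(2-4)] and uh = unit_near_constant[OF h(2-4)]
  have eh: "e \<in> R" "h \<in> R" using e h A_R by auto
  show ?thesis
  proof (cases "i < j")
    case True
    have "f / t = t ^ (j - Suc i) * h * inverse e"
    proof -
      have "t ^ j = t ^ Suc i * t ^ (j - Suc i)" using True by (simp only: power_add[symmetric]) simp
      then show ?thesis using bd(4) e(1) h(1) ue by (simp add: field_simps)
    qed
    then show ?thesis using ue eh t_R by (auto intro!: sring_mult[OF R, of _ "inverse e"] sring_mult[OF R, of _ h] sring_power[OF R])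
  next
    case ij: False
    have "inverse f = t ^ (i - j) * e * inverse h"
    proof -
      have "t ^ i = t ^ j * t ^ (i - j)" using ij by (simp only: power_add[symmetric]) simp
      then have "d / b = (t ^ j * (t ^ (i - j) * e)) / (t ^ j * h)" using e(1) h(1) by (simp add: mult.assoc)
      also have "\<dots> = t ^ (i - j) * e / h" by (rule nonzero_mult_divide_mult_cancel_left) simp
      finally show ?thesis using bd(4) by (simp add: divide_inverse mult.commute)
    qed
    then have "inverse f \<in> R" using uh eh t_R by (auto intro!: sring_mult[OF R, of _ "inverse h"] sring_mult[OF R, of _ e] sring_power[OF R])
    then show ?thesis using f(2) False unfolding max_ideal_eq[OF R] by auto
  qed
qed

text \<open>
  Since \<open>m\<close> is nilpotent modulo \<open>t\<close>, there is \<open>c\<close> outside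
  \<open>t R\<close> with \<open>c m \<subseteq> t R\<close>. If \<open>w = c / t\<close> maps some
  \<open>\<pi>\<close> in \<open>m\<close> to a unit, then \<open>\<pi>\<close> is a generator. Otherwise
  \<open>w\<close> maps the finitely generated module \<open>m\<close> to itself and is therefore integral, which
  puts \<open>c\<close> into \<open>t R\<close>.
\<close>

lemma max_ideal_principal:
  obtains \<pi> where "\<pi> \<in> m" "m \<subseteq> (*) \<pi> ` R"
proof -
  define J where "J = {b \<in> R. b / t \<in> R}"
  have J_mult: "a * b \<in> J" if "a \<in> R" "b \<in> J" for a b
    using that sring_mult[OF R, of a b] sring_mult[OF R, of a "b / t"] unfolding J_def by auto
  have J_add: "a + b \<in> J" if "a \<in> J" "b \<in> J" for a b
    using that sring_add[OF R, of a b] sring_add[OF R, of "a / t" "b / t"] unfolding J_def by (auto simp: add_divide_distrib)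
  have J_0: "0 \<in> J" using R unfolding J_def by auto
  have J_1: "1 \<notin> J"
  proof
    assume "1 \<in> J"
    then have "t * (1 / t) \<in> m" unfolding J_def by (intro prime_multR[OF R m t_m]) auto
    then show False using prime_1[OF R m] by simp
  qed
  obtain T where T: "finite T" "T \<subseteq> B" "B = aspan A T" using B_finite by blast
  have "\<exists>Q. finite Q \<and> Q \<subseteq> q \<and> q = aspan A Q"
  proof (rule submodule_finite[OF T(1)])
    show "q \<subseteq> aspan A T" using prime_sub[OF B q] T(3) by simp
    show "a * x \<in> q" if "a \<in> A" "x \<in> q" for a x using that A_B by (intro prime_multL[OF B q]) auto
  qed (auto intro: prime_0[OF B q] prime_add[OF B q])
  then obtain Q where Q: "finite Q" "Q \<subseteq> q" "q = aspan A Q" by blast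
  have "\<exists>c\<in>R. c \<notin> J \<and> (\<forall>x\<in>Q'. c * x \<in> J)" if "finite Q'" "Q' \<subseteq> m" for Q'
    using that
  proof (induction Q' rule: finite_induct)
    case empty
    then show ?case using J_1 R by (intro bexI[of _ 1]) auto
  next
    case (insert x Q')
    then obtain c where c: "c \<in> R" "c \<notin> J" "\<And>y. y \<in> Q' \<Longrightarrow> c * y \<in> J" by auto
    have xm: "x \<in> m" and xR: "x \<in> R" using insert m_R by auto
    have xpow: "x ^ i \<in> R" for i by (rule sring_power[OF R xR])
    have "x ^ card Gal \<in> J" using m_power_card[OF xm] xpow unfolding J_def by auto
    then have ex: "c * x ^ card Gal \<in> J" by (rule J_mult[OF c(1)])
    define e where "e = (LEAST e. c * x ^ e \<in> J)"
    have e: "c * x ^ e \<in> J" unfolding e_def using ex by (rule LeastI)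
    have e0: "e \<noteq> 0" using e c(2) by (cases e) auto
    then obtain e' where e': "e = Suc e'" by (cases e) auto
    have "c * x ^ e' \<notin> J" using not_less_Least[of e' "\<lambda>e. c * x ^ e \<in> J"] e' unfolding e_def by auto
    moreover have "c * x ^ e' * y \<in> J" if "y \<in> insert x Q'" for y
    proof (cases "y = x")
      case True
      then show ?thesis using e e' by (simp add: ac_simps)
    next
      case False
      then have "x ^ e' * (c * y) \<in> J" using that by (intro J_mult xpow c(3)) auto
      then show ?thesis by (simp add: ac_simps)
    qed
    ultimately show ?case using sring_mult[OF R c(1) xpow[of e']] by blast
  qed
  from this[of Q] obtain c where c: "c \<in> R" "c \<notin> J" "\<And>x. x \<in> Q \<Longrightarrow> c * x \<in> J" using Q q_m by blast
  define w where "w = c / t"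
  have wR: "w \<notin> R" using c unfolding J_def w_def by auto
  have wN: "w \<in> N" unfolding w_def using c(1) t_R R_N by (intro N_divide) auto
  have wq: "c * x \<in> J" if "x \<in> q" for x
  proof -
    have "aspan A Q \<subseteq> {x. c * x \<in> J}"
      by (rule aspan_least[OF A]) (use c(3) J_0 J_add J_mult[of _ "c * _"] A_R in \<open>auto simp: distrib_left mult.left_commute\<close>)
    then show ?thesis using that Q(3) by auto
  qed
  have wm: "w * x \<in> R" if x: "x \<in> m" for x
  proof -
    obtain r s where rs: "r \<in> q" "s \<in> B" "s \<notin> q" "x = r / s"
      using x unfolding max_ideal_localization[OF B q] by auto
    have "1 / s \<in> R" using rs B by (intro localizationI[OF B q]) auto
    moreover have "c * r / t \<in> R" using wq[OF rs(1)] unfolding J_def by auto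
    ultimately have "(c * r / t) * (1 / s) \<in> R" by (intro sring_mult[OF R])
    then show ?thesis unfolding w_def rs(4) by simp
  qed
  show thesis
  proof (cases "\<exists>\<pi>\<in>m. w * \<pi> \<notin> m")
    case True
    then obtain \<pi> where pi: "\<pi> \<in> m" "w * \<pi> \<notin> m" by auto
    have inv: "inverse (w * \<pi>) \<in> R" using pi wm[OF pi(1)] unit_or_m by blast
    have nz: "w * \<pi> \<noteq> 0" using pi(2) prime_0[OF R m] by auto
    have "x \<in> (*) \<pi> ` R" if x: "x \<in> m" for x
    proof (rule image_eqI)
      show "x = \<pi> * (w * x * inverse (w * \<pi>))" using nz by (simp add: field_simps)
      show "w * x * inverse (w * \<pi>) \<in> R" by (rule sring_mult[OF R wm[OF x] inv])
    qed
    then show thesis using that pi(1) by blast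
  next
    case False
    have "\<exists>s\<in>B. s \<notin> q \<and> (\<forall>x\<in>Q'. s * w * x \<in> q)" if "finite Q'" "Q' \<subseteq> q" for Q'
      using that
    proof (induction Q' rule: finite_induct)
      case empty
      then show ?case using B prime_1[OF B q] by (intro bexI[of _ 1]) auto
    next
      case (insert x Q')
      then obtain s where s: "s \<in> B" "s \<notin> q" "\<And>y. y \<in> Q' \<Longrightarrow> s * w * y \<in> q" by auto
      have "w * x \<in> m" using False insert q_m by auto
      then obtain r s' where rs: "r \<in> q" "s' \<in> B" "s' \<notin> q" "w * x = r / s'"
        unfolding max_ideal_localization[OF B q] by auto
      have s'0: "s' \<noteq> 0" using rs prime_0[OF B q] by auto
      have "(s * s') * w * y \<in> q" if "y \<in> insert x Q'" for y
      proof (cases "y = x")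
        case True
        have "(s * s') * w * y = s * (s' * (w * x))" by (simp add: True ac_simps)
        also have "s' * (w * x) = r" using rs(4) s'0 by simp
        also have "s * r \<in> q" by (rule prime_multL[OF B q s(1) rs(1)])
        finally show ?thesis .
      next
        case False
        then have "s' * (s * w * y) \<in> q" using that by (intro prime_multL[OF B q rs(2)] s(3)) auto
        then show ?thesis by (simp add: ac_simps)
      qed
      moreover have "s * s' \<notin> q" using prime_mult_notin[OF B q s(1) rs(2) s(2) rs(3)] .
      ultimately show ?case using sring_mult[OF B s(1) rs(2)] by blast
    qed
    from this[of Q] obtain s where s: "s \<in> B" "s \<notin> q" "\<And>x. x \<in> Q \<Longrightarrow> s * w * x \<in> q" using Q by blast
    have "aspan A Q \<subseteq> {x. s * w * x \<in> q}"
      by (rule aspan_least[OF A]) (use s(3) prime_0[OF B q] prime_add[OF B q] prime_multL[OF B q, of _ "s * w * _"] A_B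
        in \<open>auto simp: distrib_left mult.left_commute\<close>)
    then have swq: "s * w * x \<in> q" if "x \<in> q" for x using that Q(3) by auto
    have pow: "(s * w) ^ j * t \<in> q" for j
    proof (induction j)
      case 0
      show ?case using t_q by simp
    next
      case (Suc j)
      then have "s * w * ((s * w) ^ j * t) \<in> q" by (rule swq)
      then show ?case by (simp add: mult.assoc)
    qed
    have "(s * w) ^ j \<in> aspan A ((\<lambda>y. y / t) ` T)" for j
    proof -
      have "aspan A T \<subseteq> {y. y / t \<in> aspan A ((\<lambda>y. y / t) ` T)}"
      proof (rule aspan_least[OF A])
        show "T \<subseteq> {y. y / t \<in> aspan A ((\<lambda>y. y / t) ` T)}" using T(1) by (auto intro!: aspan_incl[OF A])
        show "a * x \<in> {y. y / t \<in> aspan A ((\<lambda>y. y / t) ` T)}" if "a \<in> A" "x \<in> {y. y / t \<in> aspan A ((\<lambda>y. y / t) ` T)}" for a x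
          using aspan_mult[OF A that(1), of "x / t"] that(2) by simp
      qed (auto simp: aspan_0[OF A] aspan_add[OF A] add_divide_distrib)
      moreover have "(s * w) ^ j * t \<in> aspan A T" using pow[of j] prime_sub[OF B q] T(3) by auto
      ultimately have "(s * w) ^ j * t / t \<in> aspan A ((\<lambda>y. y / t) ` T)" by blast
      then show ?thesis by simp
    qed
    moreover have "finite ((\<lambda>y. y / t) ` T)" "(\<lambda>y. y / t) ` T \<subseteq> N" using T B_N t_A A_N by (auto intro!: N_divide)
    moreover have "s * w \<in> N" using s(1) B_N wN by (intro sring_mult[OF N]) auto
    ultimately have "s * w \<in> B" unfolding integral_closure_def by blast
    then have "(s * w) / s \<in> R" using s by (intro localizationI[OF B q])
    moreover have "s \<noteq> 0" using s prime_0[OF B q] by auto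
    ultimately show thesis using wR by simp
  qed
qed

text \<open>The elements of \<open>W\<close> are units times powers of \<open>\<pi>\<close>: divisibility by \<open>t\<close> is bounded by Krull's theorem, and
  a power of \<open>\<pi>\<close> is divisible by \<open>t\<close>.\<close>

lemma regular_valuation_ring:
  assumes W: "sring W" "W \<subseteq> R" and pi: "\<pi> \<in> W" "\<pi> \<in> m" "max_ideal W \<subseteq> (*) \<pi> ` W"
    and quot: "\<And>a. a \<in> N \<Longrightarrow> \<exists>b\<in>W. \<exists>d\<in>W. d \<noteq> 0 \<and> a = b / d"
  shows "valuation_ring N W"
proof -
  have decomp: "\<exists>j w. b = \<pi> ^ j * w \<and> w \<in> W \<and> w \<noteq> 0 \<and> inverse w \<in> W" if b: "b \<in> W" "b \<noteq> 0" for b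
  proof -
    obtain k where k: "b / t ^ k \<notin> R" using krull b W(2) R_N by blast
    have nd: "b \<noteq> \<pi> ^ (card Gal * k) * r" if "r \<in> W" for r
    proof
      assume "b = \<pi> ^ (card Gal * k) * r"
      then have "b / t ^ k = \<pi> ^ (card Gal * k) / t ^ k * r" by simp
      then show False using k sring_mult[OF R m_power_card_mult[OF pi(2), of k]] that W(2) by auto
    qed
    show ?thesis by (rule unit_times_power[OF W(1) pi(3) b(1) nd]) blast+
  qed
  have "a \<in> W \<or> inverse a \<in> max_ideal W" if a: "a \<in> N" for a
  proof (cases "a = 0")
    case False
    obtain b d where bd: "b \<in> W" "d \<in> W" "d \<noteq> 0" "a = b / d" using quot[OF a] by blast
    have b0: "b \<noteq> 0" using bd False by auto
    obtain i v where v: "b = \<pi> ^ i * v" "v \<in> W" "v \<noteq> 0" "inverse v \<in> W" using decomp[OF bd(1) b0] by blast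
    obtain j w where w: "d = \<pi> ^ j * w" "w \<in> W" "w \<noteq> 0" "inverse w \<in> W" using decomp[OF bd(2,3)] by blast
    show ?thesis
    proof (cases "j \<le> i")
      case True
      have "\<pi> ^ i = \<pi> ^ j * \<pi> ^ (i - j)" using True by (simp add: power_add[symmetric])
      then have bv: "b = \<pi> ^ j * (\<pi> ^ (i - j) * v)" using v(1) by (simp add: mult.assoc)
      have "a = (\<pi> ^ j * (\<pi> ^ (i - j) * v)) / (\<pi> ^ j * w)"
        unfolding bd(4) by (subst bv, subst w(1)) (rule refl)
      also have "\<dots> = (\<pi> ^ (i - j) * v) / w"
        by (rule nonzero_mult_divide_mult_cancel_left) (use w(1) bd(3) in auto)
      finally have "a = \<pi> ^ (i - j) * v * inverse w" by (simp add: divide_inverse)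
      then show ?thesis using v w pi(1)
        by (auto intro!: sring_mult[OF W(1), of _ "inverse w"] sring_mult[OF W(1), of _ v] sring_power[OF W(1)])
    next
      case ij: False
      have "\<pi> ^ j = \<pi> ^ i * \<pi> ^ (j - i)" using ij by (simp add: power_add[symmetric])
      moreover have "\<pi> ^ (j - i) = \<pi> * \<pi> ^ (j - i - 1)" using ij by (cases "j - i") auto
      ultimately have dw: "d = \<pi> ^ i * (\<pi> * (\<pi> ^ (j - i - 1) * w))" using w(1) by (simp add: mult.assoc)
      have "inverse a = (\<pi> ^ i * (\<pi> * (\<pi> ^ (j - i - 1) * w))) / (\<pi> ^ i * v)"
        unfolding bd(4) inverse_divide by (subst dw, subst v(1)) (rule refl)
      also have "\<dots> = (\<pi> * (\<pi> ^ (j - i - 1) * w)) / v"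
        by (rule nonzero_mult_divide_mult_cancel_left) (use v(1) b0 in auto)
      finally have ia: "inverse a = \<pi> * (\<pi> ^ (j - i - 1) * w * inverse v)" by (simp add: divide_inverse mult.assoc)
      have r: "\<pi> ^ (j - i - 1) * w * inverse v \<in> W"
        using v w pi(1) by (intro sring_mult[OF W(1), of _ "inverse v"] sring_mult[OF W(1), of _ w] sring_power[OF W(1)])
      have "inverse a \<in> m" unfolding ia using r W(2) by (intro prime_multR[OF R m pi(2)]) auto
      moreover have "inverse a \<in> W" unfolding ia by (rule sring_mult[OF W(1) pi(1) r])
      ultimately show ?thesis using W(2) unfolding max_ideal_eq[OF W(1)] max_ideal_eq[OF R] by blast
    qed
  qed (use W in auto)
  then show ?thesis unfolding valuation_ring_def using W R_N by blast
qed

lemma R_valuation_ring: "valuation_ring N R"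
proof -
  obtain \<pi> where pi: "\<pi> \<in> m" "m \<subseteq> (*) \<pi> ` R" using max_ideal_principal by blast
  show ?thesis
  proof (rule regular_valuation_ring[OF R order.refl _ pi])
    show "\<pi> \<in> R" using pi(1) m_R by blast
    show "\<exists>b\<in>R. \<exists>d\<in>R. d \<noteq> 0 \<and> a = b / d" if a: "a \<in> N" for a
      using N_cases[OF a] B_R A_R by (metis subsetD)
  qed
qed

end

section \<open>Inertia groups\<close>

context place
begin

abbreviation inertia where "inertia \<equiv> inertia_group F N R"

lemma gal_max_ideal:
  assumes s: "\<sigma> \<in> Gal" "\<sigma> ` R = R" and x: "x \<in> m"
  shows "\<sigma> x \<in> m"
proof (rule ccontr)
  assume no: "\<sigma> x \<notin> m"
  have xR: "x \<in> R" "x \<in> N" using x m_R R_N by auto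
  then have "\<sigma> x \<in> R" using s(2) by auto
  then have "inverse (\<sigma> x) \<in> \<sigma> ` R" using no unit_or_m s(2) by auto
  then obtain y where y: "y \<in> R" "\<sigma> y = inverse (\<sigma> x)" by auto
  have x0: "x \<noteq> 0" using no x prime_0[OF R m] s by auto
  have "\<sigma> y = \<sigma> (inverse x)" using y gal_inverse[OF s(1) xR(2)] by simp
  then have "y = inverse x"
    using gal_bij[OF s(1)] y(1) R_N N_inverse[OF xR(2)] unfolding bij_betw_def inj_on_def by blast
  then show False using x x0 y(1) unfolding max_ideal_eq[OF R] by auto
qed

text \<open>As the residue field consists of constants, the inertia group is the decomposition group.\<close>

lemma inertia_iff: "\<sigma> \<in> inertia \<longleftrightarrow> \<sigma> \<in> Gal \<and> \<sigma> ` R = R"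
proof -
  have "\<sigma> a - a \<in> m" if s: "\<sigma> \<in> Gal" "\<sigma> ` R = R" and a: "a \<in> R" for a
  proof -
    obtain c where c: "a - \<kappa> c \<in> m" using residue_R[OF a] by blast
    have "\<sigma> (a - \<kappa> c) \<in> m" by (rule gal_max_ideal[OF s c])
    moreover have "\<sigma> (a - \<kappa> c) = \<sigma> a - \<kappa> c"
      using s(1) a R_N A_N by (subst gal_diff) auto
    ultimately have "\<sigma> a - \<kappa> c \<in> m" by simp
    then have "(\<sigma> a - \<kappa> c) - (a - \<kappa> c) \<in> m" using c by (rule prime_diff[OF R m])
    then show ?thesis by simp
  qed
  then show ?thesis unfolding inertia_group_def by auto
qed

lemma inertia_Gal: "\<sigma> \<in> inertia \<Longrightarrow> \<sigma> \<in> Gal" and inertia_R: "\<sigma> \<in> inertia \<Longrightarrow> \<sigma> ` R = R"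
  using inertia_iff by auto

lemma inertia_mem: "\<sigma> \<in> inertia \<Longrightarrow> a \<in> R \<Longrightarrow> \<sigma> a \<in> R" using inertia_R by blast

lemma inertia_cong: "\<sigma> \<in> inertia \<Longrightarrow> a \<in> R \<Longrightarrow> \<sigma> a - a \<in> m"
  unfolding inertia_group_def by auto

lemma subgroup_inertia: "subgroup inertia \<Gamma>"
proof (rule gal.subgroupI)
  show "inertia \<subseteq> Gal" using inertia_Gal by auto
  have "\<one>\<^bsub>\<Gamma>\<^esub> ` R = R" using R_N by (force simp: galois_group_one)
  then show "inertia \<noteq> {}" using inertia_iff gal.one_closed by blast
next
  fix s assume s: "s \<in> inertia"
  note sG = inertia_Gal[OF s]
  have "(inv\<^bsub>\<Gamma>\<^esub> s) ` (s ` R) = R" using gal_inv(1)[OF sG] R_N by (force simp: image_image)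
  then show "inv\<^bsub>\<Gamma>\<^esub> s \<in> inertia" using inertia_R[OF s] inertia_iff sG by simp
next
  fix s r assume sr: "s \<in> inertia" "r \<in> inertia"
  note G = inertia_Gal[OF sr(1)] inertia_Gal[OF sr(2)]
  have "(s \<otimes>\<^bsub>\<Gamma>\<^esub> r) ` R = s ` (r ` R)" using gal_comp[OF G] R_N by (force simp: image_image)
  then show "s \<otimes>\<^bsub>\<Gamma>\<^esub> r \<in> inertia" using inertia_R sr inertia_iff G by simp
qed

lemma inertia_q:
  assumes s: "\<sigma> \<in> inertia" and b: "b \<in> B"
  shows "\<sigma> b \<in> q \<longleftrightarrow> b \<in> q"
proof -
  note sG = inertia_Gal[OF s]
  have c: "\<sigma> b - b \<in> m" using inertia_cong[OF s] b B_R by auto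
  have "\<sigma> b \<in> m \<longleftrightarrow> b \<in> m"
    using prime_add[OF R m c, of b] prime_diff[OF R m _ c, of "\<sigma> b"] by auto
  then show ?thesis using m_B b gal_B[OF sG b] by blast
qed

text \<open>
  Otherwise \<open>\<sigma>\<close> would preserve the maximal ideal \<open>q\<close> and hence the local ring
  \<open>R\<close>.
\<close>

lemma not_inertia_separates:
  assumes s: "\<sigma> \<in> Gal" and ns: "\<sigma> \<notin> inertia"
  shows "\<exists>b\<in>B. b \<notin> q \<and> \<sigma> b \<in> q"
proof (rule ccontr)
  assume no: "\<not> ?thesis"
  let ?J = "{b \<in> B. \<sigma> b \<in> q}"
  have J: "primeideal ?J (subring_of_type B)" by (rule gal_preimage_prime[OF B order.refl q s])
  have "u - \<kappa> \<alpha> \<in> ?J" using t_q t_A A_B s unfolding t_def by auto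
  from prime_maximal[OF B A_B order.refl J this q] have Jq: "?J = q" using no by blast
  have iff: "\<sigma> b \<in> q \<longleftrightarrow> b \<in> q" if "b \<in> B" for b using Jq that by blast
  have sub: "\<sigma> ` R \<subseteq> R"
  proof
    fix y assume "y \<in> \<sigma> ` R"
    then obtain a where a: "a \<in> R" "y = \<sigma> a" by auto
    obtain b r where br: "b \<in> B" "r \<in> B" "r \<notin> q" "a = b / r" using a(1) by (rule localizationE[OF B q])
    have "y = \<sigma> b / \<sigma> r" unfolding a(2) br(4) using br B_N by (intro gal_divide[OF s]) auto
    then show "y \<in> R" using br gal_B[OF s] iff by (auto intro!: localizationI[OF B q])
  qed
  have "R \<subseteq> \<sigma> ` R"
  proof
    fix a assume "a \<in> R"
    then obtain b r where br: "b \<in> B" "r \<in> B" "r \<notin> q" "a = b / r" by (rule localizationE[OF B q])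
    let ?i = "inv\<^bsub>\<Gamma>\<^esub> \<sigma>"
    have i: "?i b \<in> B" "?i r \<in> B" "\<sigma> (?i b) = b" "\<sigma> (?i r) = r"
      using br s gal_B[of ?i] gal_inv(2)[OF s] B_N by auto
    have "?i r \<notin> q" using iff[OF i(2)] i(4) br(3) by simp
    then have "?i b / ?i r \<in> R" using i by (intro localizationI[OF B q])
    moreover have "\<sigma> (?i b / ?i r) = a" using i br(4) B_N s by (subst gal_divide) auto
    ultimately show "a \<in> \<sigma> ` R" by force
  qed
  then show False using sub ns s inertia_iff by auto
qed

text \<open>
  At \<open>R\<close>, the rational functions approximate the decomposition field. Take \<open>e\<close> in this
  field that is close to \<open>1\<close> at \<open>R\<close> and close to \<open>0\<close> at all other
  conjugates of \<open>R\<close>. Then \<open>g * e\<close> is close to \<open>g\<close>, its other conjugates are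
  close to \<open>0\<close>, and the sum of them all lies in \<open>F\<close>.
\<close>

lemma density:
  assumes g: "g \<in> N" and fixed: "\<And>\<sigma>. \<sigma> \<in> inertia \<Longrightarrow> \<sigma> g = g"
  shows "\<exists>f\<in>F. (g - f) / t ^ k \<in> R"
proof -
  let ?n = "card Gal"
  have finI: "finite inertia" using finite_subset[OF subgroup.subset[OF subgroup_inertia] finite_gal] .
  obtain b where b: "\<And>\<sigma>. \<sigma> \<in> Gal - inertia \<Longrightarrow> b \<sigma> \<in> B \<and> b \<sigma> \<notin> q \<and> \<sigma> (b \<sigma>) \<in> q"
    using not_inertia_separates by (metis DiffD1 DiffD2)
  define c where "c = (\<Prod>\<sigma>\<in>Gal - inertia. b \<sigma>)"
  have cB: "c \<in> B" unfolding c_def using b by (intro sring_prod[OF B]) auto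
  have cq: "c \<notin> q" using b finite_gal prime_prod[OF B q, of "Gal - inertia" b] unfolding c_def by blast
  have sc: "\<sigma> c \<in> q" if s: "\<sigma> \<in> Gal - inertia" for \<sigma>
  proof -
    have bN: "b \<tau> \<in> N" "\<sigma> (b \<tau>) \<in> B" if "\<tau> \<in> Gal - inertia" for \<tau> using b[OF that] B_N gal_B[of \<sigma>] s by auto
    have "\<sigma> c = (\<Prod>\<tau>\<in>Gal - inertia. \<sigma> (b \<tau>))" unfolding c_def using s bN by (intro gal_prod) auto
    also have "\<dots> \<in> q" using finite_gal bN b[OF s] s by (intro prime_prod_mem[OF B q, of _ _ \<sigma>]) auto
    finally show ?thesis .
  qed
  \<comment> \<open>the norm of \<open>c\<close> is invariant under the inertia group; \<open>a\<close> is its multiple with residue one\<close>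
  define d where "d = (\<Prod>\<rho>\<in>inertia. \<rho> c)"
  have dB: "d \<in> B" unfolding d_def using cB inertia_Gal gal_B by (intro sring_prod[OF B]) auto
  have dq: "d \<notin> q"
  proof
    assume "d \<in> q"
    then have "\<exists>\<rho>\<in>inertia. \<rho> c \<in> q" unfolding d_def using finI cB inertia_Gal gal_B by (intro prime_prod[OF B q]) auto
    then show False using inertia_q[OF _ cB] cq by auto
  qed
  have d_fixed: "\<sigma> d = d" if "\<sigma> \<in> inertia" for \<sigma>
    unfolding d_def using that cB B_N by (intro norm_fixed[OF subgroup_inertia]) auto
  have sd: "\<sigma> d \<in> q" if s: "\<sigma> \<in> Gal - inertia" for \<sigma>
  proof -
    have cN: "\<rho> c \<in> N" "\<sigma> (\<rho> c) \<in> B" if "\<rho> \<in> inertia" for \<rho>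
      using cB B_N s inertia_Gal[OF that] gal_B by auto
    have one: "\<one>\<^bsub>\<Gamma>\<^esub> \<in> inertia" by (rule subgroup.one_closed[OF subgroup_inertia])
    have "\<sigma> d = (\<Prod>\<rho>\<in>inertia. \<sigma> (\<rho> c))" unfolding d_def using s cN by (intro gal_prod) auto
    also have "\<dots> \<in> q" using finI cN one sc[OF s] gal_one[of c] cB B_N
      by (intro prime_prod_mem[OF B q, of _ _ "\<one>\<^bsub>\<Gamma>\<^esub>"]) auto
    finally show ?thesis .
  qed
  obtain x where x: "d - \<kappa> x \<in> q" using residue[OF B A_B order.refl q linear_q dB] by blast
  have x0: "x \<noteq> 0" using x dq by auto
  have kA: "\<kappa> (inverse x) \<in> A" "\<kappa> (inverse x) \<in> B" using A_B by auto
  define a where "a = \<kappa> (inverse x) * d"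
  have aB: "a \<in> B" and aN: "a \<in> N" unfolding a_def using sring_mult[OF B kA(2) dB] B_N by auto
  have "\<kappa> (inverse x) * (d - \<kappa> x) \<in> q" by (rule prime_multL[OF B q kA(2) x])
  moreover have "\<kappa> (inverse x) * \<kappa> x = 1" using x0 by (simp add: \<kappa>_mult[symmetric])
  ultimately have a1: "a - 1 \<in> q" unfolding a_def by (simp add: right_diff_distrib)
  have gal_a: "\<sigma> a = \<kappa> (inverse x) * \<sigma> d" if "\<sigma> \<in> Gal" for \<sigma>
    unfolding a_def using that kA dB A_N B_N by (subst gal_mult) auto
  have a_fixed: "\<sigma> a = a" if "\<sigma> \<in> inertia" for \<sigma>
    using gal_a[OF inertia_Gal[OF that]] d_fixed[OF that] by (simp add: a_def)
  have sa: "\<sigma> a \<in> q" if "\<sigma> \<in> Gal - inertia" for \<sigma>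
    using gal_a[of \<sigma>] that sd[OF that] prime_multL[OF B q kA(2)] by auto
  have "\<forall>\<sigma>\<in>Gal. \<exists>k. \<forall>j\<ge>k. \<sigma> g * t ^ j \<in> R" using pole_bounded gal_closed[OF _ g] by blast
  then obtain l where l: "\<And>\<sigma> j. \<sigma> \<in> Gal \<Longrightarrow> l \<sigma> \<le> j \<Longrightarrow> \<sigma> g * t ^ j \<in> R" by metis
  define L where "L = (\<Sum>\<sigma>\<in>Gal. l \<sigma>)"
  have lL: "\<sigma> g * t ^ L \<in> R" if "\<sigma> \<in> Gal" for \<sigma>
    using l[OF that, of L] that finite_gal unfolding L_def by (simp add: member_le_sum)
  \<comment> \<open>\<open>t ^ L\<close> clears the poles of all conjugates of \<open>g\<close>, and \<open>E\<close>-th powers of elements of \<open>m\<close> are divisible by \<open>t ^ (k + L)\<close>\<close>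
  define E where "E = ?n * (k + L)"
  have E: "y ^ E / t ^ (k + L) \<in> R" if "y \<in> m" for y unfolding E_def by (rule m_power_card_mult[OF that])
  have E0: "y ^ E \<in> R" if "y \<in> R" for y using that by (rule sring_power[OF R])
  \<comment> \<open>both \<open>1 - e\<close> and the other conjugates of \<open>e\<close> are multiples of \<open>E\<close>-th powers of elements of \<open>m\<close>\<close>
  define e where "e = 1 - (1 - a ^ E) ^ E"
  have aR: "a \<in> R" using aB B_R by auto
  have one_m: "1 - a ^ E \<in> m"
  proof -
    have "1 - a ^ E = (1 - a) * (\<Sum>i<E. a ^ i)" by (rule one_diff_power_eq)
    also have "(1 - a) \<in> m" using prime_uminus[OF R m, of "a - 1"] a1 q_m by auto
    then have "(1 - a) * (\<Sum>i<E. a ^ i) \<in> m" using aR by (intro prime_multR[OF R m]) (auto intro!: sring_sum[OF R] sring_power[OF R])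
    finally show ?thesis .
  qed
  have aE: "a ^ E \<in> N" using aN by (rule sring_power[OF N])
  have eN: "e \<in> N" unfolding e_def
    by (rule sring_diff[OF N sring_1[OF N] sring_power[OF N sring_diff[OF N sring_1[OF N] aE]]])
  have gal_e: "\<sigma> e = 1 - (1 - \<sigma> a ^ E) ^ E" if s: "\<sigma> \<in> Gal" for \<sigma>
  proof -
    have 1: "1 - a ^ E \<in> N" using aE N by (intro sring_diff) auto
    have "\<sigma> e = 1 - \<sigma> ((1 - a ^ E) ^ E)" unfolding e_def using s N 1 by (subst gal_diff) (auto intro!: sring_power[OF N])
    also have "\<sigma> ((1 - a ^ E) ^ E) = (1 - \<sigma> a ^ E) ^ E"
      using s N 1 aE aN by (simp add: gal_power gal_diff)
    finally show ?thesis .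
  qed
  have e_fixed: "\<sigma> e = e" if "\<sigma> \<in> inertia" for \<sigma>
    using gal_e[OF inertia_Gal[OF that]] a_fixed[OF that] by (simp add: e_def)
  have se: "\<sigma> e / t ^ (k + L) \<in> R" if s: "\<sigma> \<in> Gal - inertia" for \<sigma>
  proof -
    have sm: "\<sigma> a \<in> m" using sa[OF s] q_m by auto
    let ?y = "1 - \<sigma> a ^ E"
    have yR: "?y \<in> R" using sm m_R R by (intro sring_diff[OF R] sring_power[OF R]) auto
    have "\<sigma> e = (1 - ?y) * (\<Sum>i<E. ?y ^ i)" using gal_e[of \<sigma>] s one_diff_power_eq[of ?y E] by simp
    then have "\<sigma> e / t ^ (k + L) = \<sigma> a ^ E / t ^ (k + L) * (\<Sum>i<E. ?y ^ i)" by simp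
    also have "\<dots> \<in> R" using E[OF sm] yR by (intro sring_mult[OF R] sring_sum[OF R] sring_power[OF R])
    finally show ?thesis .
  qed
  have scale: "x * y / t ^ k \<in> R" if "x * t ^ L \<in> R" "y / t ^ (k + L) \<in> R" for x y
  proof -
    have "x * y / t ^ k = (x * t ^ L) * (y / t ^ (k + L))" by (simp add: power_add field_simps)
    then show ?thesis using sring_mult[OF R that] by simp
  qed
  define h where "h = g * e"
  have hN: "h \<in> N" unfolding h_def using g eN N by auto
  have gal_h: "\<sigma> h = \<sigma> g * \<sigma> e" if "\<sigma> \<in> Gal" for \<sigma> unfolding h_def using that g eN by (rule gal_mult)
  let ?O = "(\<lambda>\<sigma>. \<sigma> h) ` Gal"
  have finO: "finite ?O" using finite_gal by auto
  \<comment> \<open>each conjugate is counted once, since the trace would be \<open>h\<close> times the order of its stabilizer up to small terms\<close>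
  define f where "f = \<Sum>?O"
  have "f \<in> F"
  proof (rule fixedI)
    show "f \<in> N" unfolding f_def using hN by (intro sring_sum[OF N]) auto
    show "\<sigma> f = f" if s: "\<sigma> \<in> Gal" for \<sigma>
    proof -
      have "\<sigma> f = (\<Sum>y\<in>?O. \<sigma> y)" unfolding f_def using s hN by (intro gal_sum) auto
      also have "\<dots> = f" unfolding f_def using sum.reindex_bij_betw[OF orbit_image[OF hN s], of "\<lambda>y. y"] by simp
      finally show ?thesis .
    qed
  qed
  moreover have "(g - f) / t ^ k \<in> R"
  proof -
    have hO: "h \<in> ?O" by (rule image_eqI[where x="\<one>\<^bsub>\<Gamma>\<^esub>"]) (simp_all add: gal_one[OF hN])
    have "f = h + \<Sum>(?O - {h})" unfolding f_def using finO hO by (simp add: sum.remove)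
    then have eq: "(g - f) / t ^ k = g * (1 - e) / t ^ k - (\<Sum>y\<in>?O - {h}. y / t ^ k)"
      unfolding h_def by (simp add: diff_divide_distrib add_divide_distrib sum_divide_distrib right_diff_distrib)
    have "y / t ^ k \<in> R" if y: "y \<in> ?O - {h}" for y
    proof -
      obtain \<sigma> where s: "\<sigma> \<in> Gal" "y = \<sigma> h" "\<sigma> h \<noteq> h" using y by auto
      have "\<sigma> \<notin> inertia"
      proof
        assume "\<sigma> \<in> inertia"
        then have "\<sigma> g = g" "\<sigma> e = e" using fixed e_fixed by auto
        then show False using s(3) gal_h[OF s(1)] by (simp add: h_def)
      qed
      then have "\<sigma> e / t ^ (k + L) \<in> R" using se s(1) by auto
      then show ?thesis unfolding s(2) gal_h[OF s(1)] using lL[OF s(1)] by (intro scale)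
    qed
    moreover have "g * (1 - e) / t ^ k \<in> R"
    proof (rule scale)
      show "g * t ^ L \<in> R" using lL[OF gal.one_closed] gal_one[OF g] by simp
      show "(1 - e) / t ^ (k + L) \<in> R" unfolding e_def using E[OF one_m] by simp
    qed
    ultimately show ?thesis unfolding eq using R by (intro sring_diff[OF R] sring_sum[OF R])
  qed
  ultimately show ?thesis by blast
qed

text \<open>
  By density \<open>x\<close> is congruent modulo \<open>t\<close> to a rational function, for which vanishing at
  the place means divisibility by \<open>t\<close>.
\<close>

lemma trivial_inertia_unramified:
  assumes triv: "\<And>\<sigma>. \<sigma> \<in> inertia \<Longrightarrow> \<sigma> = \<one>\<^bsub>\<Gamma>\<^esub>" and x: "x \<in> m"
  shows "x / t \<in> R"
proof -
  have xN: "x \<in> N" using x m_R R_N by auto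
  obtain f where f: "f \<in> F" "(x - f) / t ^ 1 \<in> R"
    using density[OF xN, of 1] triv gal_one[OF xN] by metis
  have "t * ((x - f) / t) \<in> m" using f(2) by (intro prime_multR[OF R m t_m]) simp
  then have "x - f \<in> m" by simp
  then have "x - (x - f) \<in> m" by (rule prime_diff[OF R m x])
  then have "f / t \<in> R" using F_m[OF f(1)] by simp
  then have "(x - f) / t + f / t \<in> R" using f(2) by (intro sring_add[OF R]) auto
  then show ?thesis by (simp add: diff_divide_distrib)
qed

text \<open>
  Only the remainder of the Taylor expansion is moved, so \<open>\<sigma> a - a\<close> is divisible by all powers
  of \<open>t\<close>.
\<close>

lemma inertia_taylor:
  assumes W: "W \<subseteq> R" and taylor: "\<And>a. a \<in> W \<Longrightarrow> \<exists>c. \<exists>w\<in>W. a = \<kappa> c + t * w"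
    and s: "\<sigma> \<in> inertia" and a: "a \<in> W"
  shows "\<sigma> a = a"
proof -
  note sG = inertia_Gal[OF s]
  have "a \<in> W \<Longrightarrow> (\<sigma> a - a) / t ^ k \<in> R" for k a
  proof (induction k arbitrary: a)
    case 0
    then show ?case using inertia_mem[OF s, of a] W R by (auto intro!: sring_diff)
  next
    case (Suc k)
    obtain c w where cw: "w \<in> W" "a = \<kappa> c + t * w" using taylor[OF Suc.prems] by auto
    have N': "\<kappa> c \<in> N" "t \<in> N" "w \<in> N" "t * w \<in> N" using A_N t_A cw W R_N by (auto intro!: sring_mult[OF N])
    have "\<sigma> a = \<kappa> c + t * \<sigma> w"
      unfolding cw(2) gal_add[OF sG N'(1,4)] gal_mult[OF sG N'(2,3)] using sG t_A by simp
    then have "\<sigma> a - a = t * (\<sigma> w - w)" unfolding cw(2) by (simp add: algebra_simps)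
    then have "(\<sigma> a - a) / t ^ Suc k = (\<sigma> w - w) / t ^ k" by simp
    then show ?case using Suc.IH[OF cw(1)] by simp
  qed
  then have "\<sigma> a - a = 0"
    using a W R_N sG by (intro krull) (auto intro!: sring_diff[OF N])
  then show ?thesis by simp
qed

lemma unramified_inertia_trivial:
  assumes "\<And>x. x \<in> m \<Longrightarrow> x / t \<in> R" and s: "\<sigma> \<in> inertia"
  shows "\<sigma> = \<one>\<^bsub>\<Gamma>\<^esub>"
proof (rule gal_ext[OF inertia_Gal[OF s] gal.one_closed])
  have fix_R: "\<sigma> a = a" if "a \<in> R" for a
  proof (rule inertia_taylor[OF order.refl _ s that])
    fix a assume "a \<in> R"
    then obtain c where c: "a - \<kappa> c \<in> m" using residue_R by blast
    have "a = \<kappa> c + t * ((a - \<kappa> c) / t)" by simp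
    then show "\<exists>c. \<exists>w\<in>R. a = \<kappa> c + t * w" using assms(1)[OF c] by blast
  qed
  fix a assume a: "a \<in> N"
  then obtain b d where bd: "b \<in> B" "d \<in> A" "d \<noteq> 0" "a = b / d" by (rule N_cases)
  have "\<sigma> a = \<sigma> b / \<sigma> d" unfolding bd(4) using bd B_N A_N by (intro gal_divide[OF inertia_Gal[OF s]]) auto
  then show "\<sigma> a = \<one>\<^bsub>\<Gamma>\<^esub> a" using fix_R[of b] bd B_R inertia_Gal[OF s] gal_one[OF a] by auto
qed

text \<open>Such a ring is a valuation ring and hence maximal with respect to domination.\<close>

lemma regular_dominated_eq:
  assumes W: "sring W" "W \<subseteq> R" "max_ideal W \<subseteq> m" and pi: "\<pi> \<in> W" "max_ideal W = (*) \<pi> ` W"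
    and quot: "\<And>a. a \<in> N \<Longrightarrow> \<exists>b\<in>W. \<exists>d\<in>W. d \<noteq> 0 \<and> a = b / d"
  shows "W = R"
proof -
  have "\<pi> \<in> max_ideal W" using pi(2) sring_1[OF W(1)] by force
  then have "valuation_ring N W" using W pi quot by (intro regular_valuation_ring[of W \<pi>]) auto
  moreover have "lies_above R W" using W(2,3) unfolding lies_above_def by blast
  ultimately show ?thesis using valuation_ring_dominated[OF _ R R_N] by blast
qed

end

locale place_tower = place \<kappa> u F N q \<alpha> + E: galois F E
  for \<kappa> :: "'k::alg_closed_field \<Rightarrow> 'a::Fields.field" and u :: 'a and F N E q :: "'a set" and \<alpha> :: 'k +
  assumes EN: "E \<subseteq> N"
begin

sublocale E: line_ext \<kappa> u F E
  by unfold_locales (rule F_eq)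

lemma BE_B: "E.B \<subseteq> B" by (rule integral_closure_mono[OF EN])

lemma linear_qE: "u - \<kappa> \<alpha> \<in> q \<inter> E.B" using linear_q t_A E.A_B unfolding t_def by auto

sublocale E: place \<kappa> u F E "q \<inter> E.B" \<alpha>
  by (intro place.intro place_axioms.intro E.line_ext_axioms linear_qE primeideal_contract[OF E.B B q BE_B])

text \<open>The ring \<open>R \<inter> E\<close> dominates the valuation ring \<open>E.R\<close>.\<close>

lemma R_E: "E.R = R \<inter> E"
proof -
  have sub: "E.R \<subseteq> R \<inter> E" and dom: "max_ideal E.R \<subseteq> m"
  proof -
    have *: "s \<in> E.B \<Longrightarrow> s \<notin> q \<inter> E.B \<Longrightarrow> 1 / s \<in> R" for s
      using BE_B sring_1[OF B] by (intro localizationI[OF B q]) auto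
    have "a \<in> R" if a: "a \<in> E.R" for a
    proof -
      obtain b s where bs: "b \<in> E.B" "s \<in> E.B" "s \<notin> q \<inter> E.B" "a = b / s" using a by (rule localizationE[OF E.B E.q])
      then have "b * (1 / s) \<in> R" using BE_B B_R by (intro sring_mult[OF R] *) auto
      then show ?thesis using bs by simp
    qed
    then show "E.R \<subseteq> R \<inter> E" using E.R_N by auto
    show "max_ideal E.R \<subseteq> m"
    proof
      fix a assume "a \<in> max_ideal E.R"
      then obtain b s where bs: "b \<in> q" "s \<in> E.B" "s \<notin> q \<inter> E.B" "a = b / s"
        unfolding max_ideal_localization[OF E.B E.q] by auto
      then have "b * (1 / s) \<in> m" using q_m by (intro prime_multR[OF R m] *) auto
      then show "a \<in> m" using bs by simp
    qed
  qed
  have RE: "sring (R \<inter> E)" using R E.N by (auto intro!: sringI)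
  have "max_ideal E.R \<subseteq> max_ideal (R \<inter> E)"
    using sub dom E.m_R unfolding max_ideal_eq[OF RE] unfolding max_ideal_eq[OF R] by blast
  then have "lies_above (R \<inter> E) E.R" unfolding lies_above_def using sub by auto
  then show ?thesis using valuation_ring_dominated[OF E.R_valuation_ring RE] by auto
qed

lemma m_E: "max_ideal E.R = m \<inter> E"
proof -
  have RE: "sring (R \<inter> E)" using E.R R_E by simp
  show ?thesis unfolding R_E max_ideal_eq[OF RE] using E.N_inverse unfolding max_ideal_eq[OF R] by blast
qed

lemma restrict_inertia:
  assumes s: "\<sigma> \<in> inertia"
  shows "restrict \<sigma> E \<in> E.inertia"
proof -
  note sG = inertia_Gal[OF s]
  have rG: "restrict \<sigma> E \<in> E.Gal" by (rule galois_stable[OF E.galois_axioms galois_axioms EN sG])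
  have "restrict \<sigma> E ` (R \<inter> E) = R \<inter> E"
  proof (intro equalityI subsetI)
    fix a assume "a \<in> restrict \<sigma> E ` (R \<inter> E)"
    then show "a \<in> R \<inter> E" using inertia_mem[OF s] E.gal_closed[OF rG] by auto
  next
    fix a assume a: "a \<in> R \<inter> E"
    then obtain b where b: "b \<in> R" "a = \<sigma> b" using inertia_R[OF s] by blast
    have "a \<in> restrict \<sigma> E ` E" using a E.gal_bij[OF rG] unfolding bij_betw_def by auto
    then obtain c where c: "c \<in> E" "a = \<sigma> c" by auto
    then have "b = c" using gal_bij[OF sG] b EN R_N unfolding bij_betw_def inj_on_def by (metis subsetD)
    then have "c \<in> R \<inter> E" "a = restrict \<sigma> E c" using b c by auto
    then show "a \<in> restrict \<sigma> E ` (R \<inter> E)" by blast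
  qed
  then show ?thesis using E.inertia_iff rG R_E by simp
qed

text \<open>
  Inertia groups map onto inertia groups.  Elements of \<open>E\<close> fixed by the image \<open>J\<close> are approximated by
  elements of \<open>F\<close>, hence are fixed by the inertia group of \<open>E\<close>; by Artin's theorem this group is \<open>J\<close>.
\<close>

lemma inertia_surjective: "(\<lambda>\<sigma>. restrict \<sigma> E) ` inertia = E.inertia"
proof
  let ?J = "(\<lambda>\<sigma>. restrict \<sigma> E) ` inertia"
  show "?J \<subseteq> E.inertia" using restrict_inertia by auto
  have rG: "restrict \<sigma> E \<in> E.Gal" if "\<sigma> \<in> Gal" for \<sigma>
    by (rule galois_stable[OF E.galois_axioms galois_axioms EN that])
  note rmult = restrict_galois_mult[OF E.galois_axioms galois_axioms EN]
  have J: "subgroup ?J E.\<Gamma>"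
  proof (rule E.gal.subgroupI)
    show "?J \<subseteq> E.Gal" using rG inertia_Gal by auto
    show "?J \<noteq> {}" using subgroup.one_closed[OF subgroup_inertia] by auto
    show "x \<otimes>\<^bsub>E.\<Gamma>\<^esub> y \<in> ?J" if xy: "x \<in> ?J" "y \<in> ?J" for x y
    proof -
      obtain \<sigma> \<tau> where st: "\<sigma> \<in> inertia" "\<tau> \<in> inertia" "x = restrict \<sigma> E" "y = restrict \<tau> E" using xy by blast
      then have "x \<otimes>\<^bsub>E.\<Gamma>\<^esub> y = restrict (\<sigma> \<otimes>\<^bsub>\<Gamma>\<^esub> \<tau>) E" using rmult inertia_Gal by simp
      then show ?thesis using subgroup.m_closed[OF subgroup_inertia st(1,2)] by blast
    qed
    show "inv\<^bsub>E.\<Gamma>\<^esub> x \<in> ?J" if x: "x \<in> ?J" for x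
    proof -
      obtain \<sigma> where s: "\<sigma> \<in> inertia" "x = restrict \<sigma> E" using x by blast
      note sG = inertia_Gal[OF s(1)]
      let ?i = "inv\<^bsub>\<Gamma>\<^esub> \<sigma>"
      have "restrict ?i E \<otimes>\<^bsub>E.\<Gamma>\<^esub> x = \<one>\<^bsub>E.\<Gamma>\<^esub>"
      proof -
        have "restrict ?i E \<otimes>\<^bsub>E.\<Gamma>\<^esub> x = restrict (?i \<otimes>\<^bsub>\<Gamma>\<^esub> \<sigma>) E" unfolding s(2) by (rule rmult[symmetric]) (use sG in auto)
        also have "\<dots> = \<one>\<^bsub>E.\<Gamma>\<^esub>" using sG EN by (auto simp: galois_group_one fun_eq_iff)
        finally show ?thesis .
      qed
      then have "inv\<^bsub>E.\<Gamma>\<^esub> x = restrict ?i E"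
        using rG sG s(2) by (intro E.gal.inv_equality) auto
      then show ?thesis using subgroup.m_inv_closed[OF subgroup_inertia s(1)] by auto
    qed
  qed
  show "E.inertia \<subseteq> ?J"
  proof
    fix \<tau> assume t': "\<tau> \<in> E.inertia"
    note tG = E.inertia_Gal[OF t']
    show "\<tau> \<in> ?J"
    proof (rule E.artin_fixed_field[OF J tG])
      fix a assume a: "a \<in> E" and fixed: "\<And>\<sigma>. \<sigma> \<in> ?J \<Longrightarrow> \<sigma> a = a"
      have fixed': "\<sigma> a = a" if "\<sigma> \<in> inertia" for \<sigma> using fixed[of "restrict \<sigma> E"] that a by auto
      have "(\<tau> a - a) / t ^ k \<in> R" for k
      proof -
        obtain f where f: "f \<in> F" "(a - f) / t ^ k \<in> R" 
        proof -
          have "a \<in> N" using a EN by auto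
          then have "\<exists>f\<in>F. (a - f) / t ^ k \<in> R" using fixed' by (rule density)
          then show thesis using that by blast
        qed
        have tk: "t ^ k \<in> E" "t ^ k \<in> F" 
        proof -
          have "t \<in> E" "t \<in> F" using t_A E.A_N A_F by blast+
          then show "t ^ k \<in> E" "t ^ k \<in> F" using sring_power[OF E.N] sring_power[OF F] by simp_all
        qed
        have fE: "f \<in> E" using f(1) E.F_subset by auto
        have dE: "a - f \<in> E" using a fE by (rule sring_diff[OF E.N])
        then have mem: "(a - f) / t ^ k \<in> E.R" using R_E f(2) tk E.N_divide by blast
        have "\<tau> ((a - f) / t ^ k) = (\<tau> a - f) / t ^ k"
          using E.gal_divide[OF tG dE tk(1)] E.gal_diff[OF tG a fE] E.gal_fix[OF tG] tk f(1) by simp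
        then have "(\<tau> a - f) / t ^ k \<in> R" using E.inertia_mem[OF t' mem] R_E by auto
        then have "(\<tau> a - f) / t ^ k - (a - f) / t ^ k \<in> R" using f(2) by (intro sring_diff[OF R])
        then show ?thesis by (simp add: diff_divide_distrib)
      qed
      moreover have "\<tau> a - a \<in> N" using a EN E.gal_closed[OF tG a] by (intro sring_diff[OF N]) auto
      ultimately have "\<tau> a - a = 0" by (rule krull[rotated])
      then show "\<tau> a = a" by simp
    qed
  qed
qed

end

section \<open>Artin--Schreier extensions\<close>

definition wp :: "'a::Fields.field \<Rightarrow> 'a" where "wp x = x ^ CHAR('a) - x"

context
  assumes char_pos: "CHAR('a::Fields.field) > 0"
begin

lemma prime_char: "Factorial_Ring.prime CHAR('a)" by (rule prime_CHAR_semidom[OF char_pos])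

lemma frobenius_add: "((x::'a) + y) ^ CHAR('a) = x ^ CHAR('a) + y ^ CHAR('a)"
  by (rule freshmans_dream[OF prime_char refl])

lemma frobenius_uminus: "(- x::'a) ^ CHAR('a) = - (x ^ CHAR('a))"
  using frobenius_add[of x "- x"] char_pos by (simp add: eq_neg_iff_add_eq_0 add.commute zero_power)

lemma frobenius_of_nat: "(of_nat n :: 'a) ^ CHAR('a) = of_nat n"
  by (induction n) (use char_pos in \<open>auto simp: frobenius_add zero_power\<close>)

lemma wp_add: "wp ((x::'a) + y) = wp x + wp y"
  by (simp add: wp_def frobenius_add)

lemma wp_uminus: "wp (- x::'a) = - wp x"
  by (simp add: wp_def frobenius_uminus)

lemma wp_diff: "wp ((x::'a) - y) = wp x - wp y"
  using wp_add[of x "- y"] by (simp add: wp_uminus)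

lemma wp_of_nat [simp]: "wp (of_nat n :: 'a) = 0"
  by (simp add: wp_def frobenius_of_nat)

lemma of_nat_char_less: "0 < n \<Longrightarrow> n < CHAR('a) \<Longrightarrow> of_nat n \<noteq> (0 :: 'a)"
  by (auto simp: of_nat_eq_0_iff_char_dvd dest: dvd_imp_le)

lemma inj_on_of_nat_char: "inj_on (of_nat :: nat \<Rightarrow> 'a) {..<CHAR('a)}"
proof (rule linorder_inj_onI)
  fix i j assume ij: "i < j" "i \<in> {..<CHAR('a)}" "j \<in> {..<CHAR('a)}"
  then have "of_nat (j - i) \<noteq> (0 :: 'a)" by (intro of_nat_char_less) auto
  then show "of_nat i \<noteq> (of_nat j :: 'a)" using ij by (simp add: of_nat_diff)
qed auto

lemma wp_eq_0:
  assumes "wp (x :: 'a) = 0"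
  obtains i where "i < CHAR('a)" "x = of_nat i"
proof -
  let ?p = "CHAR('a)"
  let ?f = "Polynomial.monom 1 ?p - [:0, 1:] :: 'a poly"
  have p2: "2 \<le> ?p" using prime_char by (rule prime_ge_2_nat)
  have "Polynomial.coeff ?f ?p = 1" using p2 by (auto simp: coeff_pCons split: nat.splits)
  then have f0: "?f \<noteq> 0" by (metis coeff_0 zero_neq_one)
  have deg: "Polynomial.degree ?f \<le> ?p" using p2 by (intro degree_diff_le) (auto simp: degree_monom_eq)
  have sub: "of_nat ` {..<?p} \<subseteq> {x. poly ?f x = 0}"
    by (auto simp: poly_monom frobenius_of_nat)
  have "card {x. poly ?f x = 0} \<le> ?p" using card_poly_roots_bound[OF f0] deg by linarith
  then have "card {x. poly ?f x = 0} \<le> card (of_nat ` {..<?p} :: 'a set)" by (simp add: card_image[OF inj_on_of_nat_char])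
  then have "of_nat ` {..<?p} = {x. poly ?f x = 0}" using sub by (intro card_seteq poly_roots_finite[OF f0])
  moreover have "x \<in> {x. poly ?f x = 0}" using assms by (simp add: wp_def poly_monom)
  ultimately show thesis using that by blast
qed

lemma wp_finite: "finite {x :: 'a. wp x = a}"
proof -
  let ?f = "Polynomial.monom 1 CHAR('a) - [:a, 1:] :: 'a poly"
  have "2 \<le> CHAR('a)" using prime_char by (rule prime_ge_2_nat)
  then have "Polynomial.coeff ?f CHAR('a) = 1" by (auto simp: coeff_pCons split: nat.splits)
  then have "?f \<noteq> 0" by (metis coeff_0 zero_neq_one)
  then have "finite {x. poly ?f x = 0}" by (rule poly_roots_finite)
  moreover have "{x. wp x = a} = {x. poly ?f x = 0}" by (auto simp: wp_def poly_monom algebra_simps)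
  ultimately show ?thesis by simp
qed

end

lemma (in galois) gal_wp: "\<sigma> \<in> Gal \<Longrightarrow> a \<in> N \<Longrightarrow> \<sigma> (wp a) = wp (\<sigma> a)"
  unfolding wp_def by (simp add: gal_diff gal_power sring_power[OF N])

lemma (in galois) gal_of_nat [simp]: "\<sigma> \<in> Gal \<Longrightarrow> \<sigma> (of_nat n) = of_nat n"
  using sring_of_nat[OF F] by simp

lemma polys_power: "sring A \<Longrightarrow> f \<in> polys A \<Longrightarrow> f ^ n \<in> polys A"
  by (induction n) (auto intro: polys_mult)

lemma monic_division:
  assumes E: "sring E" and M: "M \<in> polys E" "Polynomial.coeff M n = 1" "Polynomial.degree M = n" "n > 0"
    and "g \<in> polys E"
  shows "\<exists>q\<in>polys E. \<exists>r\<in>polys E. g = q * M + r \<and> Polynomial.degree r < n"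
  using assms(6)
proof (induction g)
  case 0
  show ?case using E M by (intro bexI[of _ 0]) auto
next
  case (pCons a g)
  have a: "a \<in> E" using polysD[OF pCons.prems, of 0] by simp
  have "g \<in> polys E" using polysD[OF pCons.prems, of "Suc _"] by (auto intro!: polysI)
  then obtain q r where qr: "q \<in> polys E" "r \<in> polys E" "g = q * M + r" "Polynomial.degree r < n" using pCons.IH by blast
  define c where "c = Polynomial.coeff (pCons a r) n"
  have ar: "pCons a r \<in> polys E" using E a qr(2) by (rule polys_pCons)
  have cE: "c \<in> E" unfolding c_def by (rule polysD[OF ar])
  define s where "s = pCons a r - Polynomial.smult c M"
  have "Polynomial.degree s \<le> n" unfolding s_def
    using qr(4) M(3) by (intro degree_diff_le) (auto simp: degree_pCons_eq_if intro: le_trans[OF degree_smult_le])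
  moreover have "Polynomial.coeff s n = 0" unfolding s_def by (simp add: c_def M(2))
  ultimately have "Polynomial.degree s < n"
    using M(4) by (metis leading_coeff_0_iff degree_0 le_neq_implies_less)
  moreover have "pCons a g = (pCons 0 q + [:c:]) * M + s"
    unfolding s_def qr(3) by (simp add: algebra_simps)
  moreover have "s \<in> polys E" unfolding s_def using E ar cE M(1) by (intro polys_diff polys_smult)
  moreover have "pCons 0 q + [:c:] \<in> polys E" using E qr(1) cE by (intro polys_add polys_pCons) auto
  ultimately show ?case by blast
qed

text \<open>
  The assumption \<open>lift\<close> makes the extension obtained by adjoining \<open>z\<close> Galois over
  \<open>F\<close>, not only over \<open>E\<close>.
\<close>

locale artin_schreier = galois F E for F E :: "'a::Fields.field set" +
  fixes \<delta> z :: 'a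
  assumes char_pos: "CHAR('a) > 0" and \<delta>: "\<delta> \<in> E" and wp_z: "wp z = \<delta>" and z_E: "z \<notin> E"
    and lift: "\<And>\<sigma>. \<sigma> \<in> carrier (galois_group F E) \<Longrightarrow> \<exists>c\<in>E. wp c = \<sigma> \<delta> - \<delta>"
begin

definition L where "L = (\<lambda>g. poly g z) ` polys E"

definition M :: "'a poly" where "M = Polynomial.monom 1 CHAR('a) - [:\<delta>, 1:]"

lemma p2: "2 \<le> CHAR('a)" using prime_char[OF char_pos] by (rule prime_ge_2_nat)

lemma M: "M \<in> polys E" "Polynomial.coeff M CHAR('a) = 1" "Polynomial.degree M = CHAR('a)" "CHAR('a) > 0"
proof -
  show "M \<in> polys E" unfolding M_def using N \<delta>
    by (intro polys_diff polys_monom polys_pCons) auto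
  show c: "Polynomial.coeff M CHAR('a) = 1" unfolding M_def using p2 by (auto simp: coeff_pCons split: nat.splits)
  have "Polynomial.degree M \<le> CHAR('a)" unfolding M_def using p2 by (intro degree_diff_le) (auto simp: degree_monom_eq)
  moreover have "CHAR('a) \<le> Polynomial.degree M" using c by (intro le_degree) simp
  ultimately show "Polynomial.degree M = CHAR('a)" by simp
  show "CHAR('a) > 0" by (rule char_pos)
qed

lemma poly_M: "poly M x = wp x - \<delta>" by (simp add: M_def wp_def poly_monom)

text \<open>
  Given a monic relation of minimal degree \<open>d < p\<close>, raise it to the power \<open>p\<close>, replace \<open>z ^ p\<close> by \<open>z + \<delta>\<close> and
  subtract the relation.  The result has smaller degree, hence vanishes; its coefficient at \<open>d - 1\<close> says that
  \<open>\<delta> = wp b\<close> for some \<open>b\<close> of \<open>E\<close>, so that \<open>z - b\<close> lies in the prime field.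
\<close>

lemma independent:
  assumes "g \<in> polys E" "Polynomial.degree g < CHAR('a)" "poly g z = 0"
  shows "g = 0"
proof (rule ccontr)
  assume "g \<noteq> 0"
  let ?P = "\<lambda>g. g \<in> polys E \<and> g \<noteq> 0 \<and> poly g z = 0"
  have "?P g" using assms \<open>g \<noteq> 0\<close> by simp
  from ex_has_least_nat[of ?P, OF this, of Polynomial.degree]
  obtain f where f: "f \<in> polys E" "f \<noteq> 0" "poly f z = 0"
    and min: "\<And>g. ?P g \<Longrightarrow> Polynomial.degree f \<le> Polynomial.degree g" by blast
  define d where "d = Polynomial.degree f"
  have dp: "d < CHAR('a)" using min[of g] assms \<open>g \<noteq> 0\<close> unfolding d_def by auto
  have "d \<noteq> 0"
  proof
    assume "d = 0"
    then obtain c where "f = [:c:]" unfolding d_def by (metis degree_eq_zeroE)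
    then show False using f by simp
  qed
  define l where "l = Polynomial.lead_coeff f"
  have l: "l \<in> E" "l \<noteq> 0" unfolding l_def using polysD[OF f(1)] f(2) by auto
  define a where "a i = Polynomial.coeff f i / l" for i
  have aE: "a i \<in> E" for i unfolding a_def using l polysD[OF f(1)] by (intro N_divide)
  have ad: "a d = 1" unfolding a_def d_def using l l_def by simp
  have rel: "(\<Sum>i\<le>d. a i * z ^ i) = 0"
  proof -
    have "(\<Sum>i\<le>d. a i * z ^ i) = poly f z / l" unfolding a_def d_def poly_altdef by (simp add: sum_divide_distrib)
    then show ?thesis using f by simp
  qed
  define h where "h = (\<Sum>i\<le>d. Polynomial.smult (a i ^ CHAR('a)) ([:\<delta>, 1:] ^ i)) - (\<Sum>i\<le>d. Polynomial.monom (a i) i)"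
  have hE: "h \<in> polys E" unfolding h_def using N aE \<delta>
    by (intro polys_diff polys_sum polys_smult polys_power polys_pCons polys_monom sring_power) auto
  have z: "z ^ CHAR('a) = \<delta> + z" using wp_z by (simp add: wp_def algebra_simps)
  have "poly h z = (\<Sum>i\<le>d. a i ^ CHAR('a) * (\<delta> + z) ^ i) - (\<Sum>i\<le>d. a i * z ^ i)"
    unfolding h_def by (simp add: poly_sum poly_monom)
  also have "(\<Sum>i\<le>d. a i ^ CHAR('a) * (\<delta> + z) ^ i) = (\<Sum>i\<le>d. (a i * z ^ i) ^ CHAR('a))"
    unfolding z[symmetric] by (simp add: power_mult_distrib power_mult[symmetric] mult.commute)
  also have "\<dots> = (\<Sum>i\<le>d. a i * z ^ i) ^ CHAR('a)" using freshmans_dream_sum[OF prime_char[OF char_pos] refl] by metis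
  finally have hz: "poly h z = 0" using rel char_pos by (simp add: zero_power)
  have ch: "Polynomial.coeff h j = (\<Sum>i\<le>d. a i ^ CHAR('a) * (of_nat (i choose j) * \<delta> ^ (i - j))) - (if j \<le> d then a j else 0)" for j
  proof -
    have "Polynomial.coeff ([:\<delta>, 1:] ^ i) j = of_nat (i choose j) * \<delta> ^ (i - j)" for i
    proof (cases "j \<le> i")
      case True
      then show ?thesis by (simp add: coeff_linear_poly_power)
    next
      case False
      then have "Polynomial.degree ([:\<delta>, 1:] ^ i) < j" using degree_power_le[of "[:\<delta>, 1:]" i] by simp
      then show ?thesis using False by (simp add: coeff_eq_0 binomial_eq_0)
    qed
    then show ?thesis unfolding h_def by (simp add: coeff_sum if_distrib cong: if_cong)
  qed
  have "Polynomial.coeff h j = 0" if "j \<ge> d" for j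
  proof -
    have "(\<Sum>i\<le>d. a i ^ CHAR('a) * (of_nat (i choose j) * \<delta> ^ (i - j))) = (\<Sum>i\<le>d. if i = j then 1 else 0)"
      by (rule sum.cong) (use that ad in \<open>auto simp: binomial_eq_0\<close>)
    then show ?thesis using that ad unfolding ch by (cases "j = d") auto
  qed
  then have "h = 0 \<or> Polynomial.degree h < d"
    by (metis leading_coeff_0_iff not_le)
  then have h0: "h = 0" using min[of h] hE hz unfolding d_def by (meson not_le)
  obtain e where e: "d = Suc e" using \<open>d \<noteq> 0\<close> by (cases d) auto
  have "(\<Sum>i\<le>d. a i ^ CHAR('a) * (of_nat (i choose e) * \<delta> ^ (i - e))) = a e ^ CHAR('a) + of_nat d * \<delta>"
  proof -
    have "(\<Sum>i\<in>{..<e}. a i ^ CHAR('a) * (of_nat (i choose e) * \<delta> ^ (i - e))) = 0"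
      by (rule sum.neutral) (auto simp: binomial_eq_0)
    moreover have "{..d} = insert d (insert e {..<e})" unfolding e by auto
    ultimately show ?thesis using ad e by (simp add: binomial_Suc_n)
  qed
  then have key: "a e ^ CHAR('a) + of_nat d * \<delta> - a e = 0" using ch[of e] h0 e by simp
  let ?d = "of_nat d :: 'a"
  have d0: "?d \<noteq> 0" using \<open>d \<noteq> 0\<close> dp by (intro of_nat_char_less[OF char_pos]) auto
  have "wp (z + a e / ?d) = \<delta> + (a e ^ CHAR('a) / ?d - a e / ?d)"
    unfolding wp_add[OF char_pos] wp_z unfolding wp_def power_divide frobenius_of_nat[OF char_pos] ..
  also have "\<dots> = (a e ^ CHAR('a) + ?d * \<delta> - a e) / ?d" using d0 by (simp add: add_divide_distrib diff_divide_distrib)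
  finally have "wp (z + a e / ?d) = 0" using key by simp
  then obtain i where "z + a e / ?d = of_nat i" using wp_eq_0[OF char_pos] by blast
  then have "z = of_nat i - a e / ?d" by (simp add: algebra_simps)
  moreover have "of_nat i - a e / ?d \<in> E" using aE N by (intro sring_diff N_divide sring_of_nat)
  ultimately show False using z_E by simp
qed

lemma L_cases:
  assumes "a \<in> L"
  obtains g where "g \<in> polys E" "Polynomial.degree g < CHAR('a)" "a = poly g z"
proof -
  obtain f where f: "f \<in> polys E" "a = poly f z" using assms unfolding L_def by auto
  obtain q r where qr: "r \<in> polys E" "f = q * M + r" "Polynomial.degree r < CHAR('a)"
    using monic_division[OF N M f(1)] by blast
  have "poly f z = poly r z" unfolding qr(2) by (simp add: poly_M wp_z)
  then show thesis using that qr f(2) by auto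
qed

lemma LI: "g \<in> polys E \<Longrightarrow> poly g z \<in> L" unfolding L_def by auto

lemma E_L: "E \<subseteq> L"
proof
  fix a assume "a \<in> E"
  then have "[:a:] \<in> polys E" using N by (intro polys_pCons) auto
  then show "a \<in> L" using LI[of "[:a:]"] by simp
qed

lemma z_L: "z \<in> L"
proof -
  have "[:0, 1:] \<in> polys E" using N by (intro polys_pCons) auto
  then show ?thesis using LI[of "[:0, 1:]"] by simp
qed

lemma L: "sring L"
proof (rule sringI)
  show "1 \<in> L" using E_L N by auto
  show "- a \<in> L" if aL: "a \<in> L" for a
  proof -
    obtain g where g: "g \<in> polys E" "a = poly g z" using aL by (rule L_cases)
    have "0 - g \<in> polys E" using N g by (intro polys_diff) auto
    then show ?thesis using LI[of "0 - g"] g by simp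
  qed
next
  fix a b assume ab: "a \<in> L" "b \<in> L"
  obtain f where f: "f \<in> polys E" "a = poly f z" using ab(1) by (rule L_cases)
  obtain g where g: "g \<in> polys E" "b = poly g z" using ab(2) by (rule L_cases)
  note fg = f g
  show "a * b \<in> L" "a + b \<in> L"
    using LI[OF polys_mult[OF N fg(1,3)]] LI[OF polys_add[OF N fg(1,3)]] fg by auto
qed

text \<open>
  Among the nonzero polynomials \<open>h\<close> of degree less than \<open>p\<close> such that
  \<open>h (z)\<close> is a multiple of \<open>a\<close>, one of minimal degree is constant: otherwise
  \<open>h\<close> would divide \<open>M\<close> by minimality, and the two factors of \<open>M\<close> cannot
  vanish at \<open>z\<close>.
\<close>

lemma L_inverse:
  assumes aL: "a \<in> L"
  shows "inverse a \<in> L"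
proof (cases "a = 0")
  case True
  then show ?thesis using aL by simp
next
  case a0: False
  let ?P = "\<lambda>h. h \<in> polys E \<and> h \<noteq> 0 \<and> Polynomial.degree h < CHAR('a) \<and> (\<exists>b\<in>L. poly h z = a * b)"
  obtain g where g: "g \<in> polys E" "Polynomial.degree g < CHAR('a)" "a = poly g z" using aL by (rule L_cases)
  have "?P g" using g a0 sring_1[OF L] by (auto intro!: bexI[of _ 1])
  from ex_has_least_nat[of ?P, OF this, of Polynomial.degree]
  obtain f b where f: "f \<in> polys E" "f \<noteq> 0" "Polynomial.degree f < CHAR('a)" and b: "b \<in> L" "poly f z = a * b"
    and min: "\<And>g. ?P g \<Longrightarrow> Polynomial.degree f \<le> Polynomial.degree g" by blast
  define l where "l = inverse (Polynomial.lead_coeff f)"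
  have l: "l \<in> E" "l \<noteq> 0" unfolding l_def using polysD[OF f(1)] f(2) by (auto intro: N_inverse)
  define h where "h = Polynomial.smult l f"
  have h: "h \<in> polys E" "Polynomial.degree h = Polynomial.degree f" "Polynomial.coeff h (Polynomial.degree f) = 1"
    unfolding h_def using polys_smult[OF N l(1) f(1)] l f(2) by (auto simp: l_def)
  have hz: "poly h z = a * (l * b)" "l * b \<in> L" unfolding h_def using b l E_L sring_mult[OF L, of l b] by auto
  have h0: "h \<noteq> 0" unfolding h_def using l f by simp
  show ?thesis
  proof (cases "Polynomial.degree f = 0")
    case True
    then have "h = [:1:]" using h by (metis degree_eq_zeroE coeff_pCons_0)
    then have "a * (l * b) = 1" using hz by simp
    then have "inverse a = l * b" by (rule inverse_unique)
    then show ?thesis using hz by simp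
  next
    case False
    then obtain q r where qr: "q \<in> polys E" "r \<in> polys E" "M = q * h + r" "Polynomial.degree r < Polynomial.degree f"
      using monic_division[OF N h(1,3,2) _ M(1)] by auto
    have "poly r z = - poly q z * poly h z" using poly_M[of z] wp_z unfolding qr(3) by (simp add: eq_neg_iff_add_eq_0 add.commute)
    then have "poly r z = a * (- poly q z * (l * b))" using hz by simp
    moreover have "- poly q z * (l * b) \<in> L" using LI[OF qr(1)] hz(2) by (intro sring_mult[OF L, of "- poly q z"] sring_uminus[OF L])
    ultimately have "r = 0" using min[of r] qr f(3) by (metis not_le order.strict_trans)
    then have Mq: "M = q * h" using qr by simp
    have "poly h z \<noteq> 0" using independent[of h] h f(3) h0 by auto
    then have "poly q z = 0" using poly_M[of z] wp_z unfolding Mq by simp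
    moreover have "q \<noteq> 0" using Mq M(3,4) by auto
    moreover from this have "Polynomial.degree q < CHAR('a)" using M(3) False h unfolding Mq by (simp add: degree_mult_eq h0)
    ultimately show ?thesis using independent[OF qr(1)] by simp
  qed
qed

text \<open>
  Map \<open>g (z)\<close> to \<open>(\<sigma> g) (z + c)\<close>. This is well defined because
  \<open>\<sigma>\<close> maps the equation of \<open>z\<close> to that of \<open>z + c\<close>.
\<close>

lemma lift_automorphism:
  assumes s: "\<sigma> \<in> Gal" and c: "c \<in> E" "wp c = \<sigma> \<delta> - \<delta>"
  shows "\<exists>\<theta>\<in>carrier (galois_group F L). (\<forall>a\<in>E. \<theta> a = \<sigma> a) \<and> \<theta> z = z + c"
proof -
  let ?e = "\<lambda>g. poly (map_poly \<sigma> g) (z + c)"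
  have e_add: "?e (f + g) = ?e f + ?e g" if "f \<in> polys E" "g \<in> polys E" for f g
    using map_poly_add_on[OF that, of \<sigma>] s by (simp add: gal_add)
  have e_mult: "?e (f * g) = ?e f * ?e g" if "f \<in> polys E" "g \<in> polys E" for f g
    using map_poly_mult_on[OF N that, of \<sigma>] s by (simp add: gal_add gal_mult)
  have e_const: "?e [:a:] = \<sigma> a" for a using s by (simp add: map_poly_pCons)
  have e_M: "?e M = 0"
  proof -
    have mon: "Polynomial.monom 1 CHAR('a) \<in> polys E" "[:- \<delta>, - 1:] \<in> polys E"
      using N \<delta> by (auto intro!: polys_monom polys_pCons sring_uminus)
    have "M = Polynomial.monom 1 CHAR('a) + [:- \<delta>, - 1:]" by (simp add: M_def)
    then have "?e M = ?e (Polynomial.monom 1 CHAR('a)) + ?e [:- \<delta>, - 1:]" using e_add[OF mon] by simp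
    also have "\<dots> = wp (z + c) - \<sigma> \<delta>"
      using s \<delta> N by (simp add: map_poly_monom map_poly_pCons poly_monom wp_def gal_uminus)
    finally show ?thesis using c wp_z by (simp add: wp_add[OF char_pos])
  qed
  have well: "?e f = ?e g" if fg: "f \<in> polys E" "g \<in> polys E" "poly f z = poly g z" for f g
  proof -
    have fg': "f - g \<in> polys E" using N fg by (intro polys_diff)
    obtain q r where qr: "q \<in> polys E" "r \<in> polys E" "f - g = q * M + r" "Polynomial.degree r < CHAR('a)"
      using monic_division[OF N M fg'] by blast
    have "poly (f - g) z = 0" using fg by simp
    then have "poly r z = 0" unfolding qr(3) using poly_M[of z] wp_z by simp
    then have "r = 0" using independent qr by auto
    then have f: "f = g + q * M" using qr(3) by (simp add: algebra_simps)
    have "?e f = ?e g + ?e (q * M)" unfolding f by (rule e_add[OF fg(2) polys_mult[OF N qr(1) M(1)]])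
    then show ?thesis using e_mult[OF qr(1) M(1)] e_M by simp
  qed
  define rep where "rep a = (SOME g. g \<in> polys E \<and> poly g z = a)" for a
  define \<theta> where "\<theta> = (\<lambda>a\<in>L. ?e (rep a))"
  have rep: "rep (poly g z) \<in> polys E" "poly (rep (poly g z)) z = poly g z" if "g \<in> polys E" for g
    using someI[of "\<lambda>f. f \<in> polys E \<and> poly f z = poly g z" g] that unfolding rep_def by auto
  have th: "\<theta> (poly g z) = ?e g" if "g \<in> polys E" for g
    unfolding \<theta>_def using well[OF rep(1)[OF that] that rep(2)[OF that]] LI[OF that] by simp
  have th_E: "\<theta> a = \<sigma> a" if "a \<in> E" for a
    using th[of "[:a:]"] that N e_const[of a] by (simp add: polys_pCons)
  have th_z: "\<theta> z = z + c"
    using th[of "[:0, 1:]"] N s by (simp add: polys_pCons map_poly_pCons)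
  have th_L: "\<theta> a \<in> L" if "a \<in> L" for a
  proof -
    obtain g where g: "g \<in> polys E" "a = poly g z" using \<open>a \<in> L\<close> by (rule L_cases)
    have "map_poly \<sigma> g \<in> polys E" using polysD[OF g(1)] s by (auto intro!: polysI simp: coeff_map_poly)
    then have "map_poly \<sigma> g \<in> polys L" using E_L by (rule polys_mono[rotated])
    moreover have "z + c \<in> L" using z_L c E_L by (intro sring_add[OF L]) auto
    ultimately show ?thesis unfolding g(2) th[OF g(1)] by (rule poly_mem[OF L])
  qed
  have th_hom: "\<theta> (a + b) = \<theta> a + \<theta> b \<and> \<theta> (a * b) = \<theta> a * \<theta> b" if ab: "a \<in> L" "b \<in> L" for a b
  proof -
    obtain f where f: "f \<in> polys E" "a = poly f z" using ab(1) by (rule L_cases)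
    obtain g where g: "g \<in> polys E" "b = poly g z" using ab(2) by (rule L_cases)
    note fg = f g
    have "\<theta> (poly (f + g) z) = ?e (f + g)" by (rule th[OF polys_add[OF N fg(1,3)]])
    moreover have "\<theta> (poly (f * g) z) = ?e (f * g)" by (rule th[OF polys_mult[OF N fg(1,3)]])
    ultimately show ?thesis using fg e_add[OF fg(1,3)] e_mult[OF fg(1,3)] th by simp
  qed
  have th_1: "\<theta> 1 = 1" using th_E[of 1] s N by simp
  have th_0: "\<theta> 0 = 0" using th_E[of 0] s N by simp
  have th_diff: "\<theta> (a - b) = \<theta> a - \<theta> b" if "a \<in> L" "b \<in> L" for a b
    using th_hom[of "a - b" b] that sring_diff[OF L that] by simp
  have inj: "inj_on \<theta> L"
  proof (rule inj_onI)
    fix a b assume ab: "a \<in> L" "b \<in> L" "\<theta> a = \<theta> b"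
    have d: "a - b \<in> L" using ab by (intro sring_diff[OF L])
    show "a = b"
    proof (rule ccontr)
      assume "a \<noteq> b"
      then have "(a - b) * inverse (a - b) = 1" by simp
      then have "\<theta> (a - b) * \<theta> (inverse (a - b)) = 1" using th_hom[OF d L_inverse[OF d]] th_1 by simp
      then show False using th_diff ab by simp
    qed
  qed
  have surj: "L \<subseteq> \<theta> ` L"
  proof -
    have img: "sring (\<theta> ` L)"
    proof (rule sringI)
      show "1 \<in> \<theta> ` L" using th_1 sring_1[OF L] by (metis imageI)
      show "- a \<in> \<theta> ` L" if aL: "a \<in> \<theta> ` L" for a
      proof -
        obtain b where b: "b \<in> L" "a = \<theta> b" using aL by auto
        have "\<theta> (0 - b) = - a" using th_diff[of 0 b] b L th_0 by simp
        then show ?thesis using sring_diff[OF L sring_0[OF L] b(1)] by (metis imageI)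
      qed
      show "a * b \<in> \<theta> ` L" "a + b \<in> \<theta> ` L" if ab: "a \<in> \<theta> ` L" "b \<in> \<theta> ` L" for a b
      proof -
        obtain x y where xy: "x \<in> L" "y \<in> L" "a = \<theta> x" "b = \<theta> y" using ab by auto
        have "a * b = \<theta> (x * y)" "a + b = \<theta> (x + y)" using th_hom[OF xy(1,2)] xy by auto
        then show "a * b \<in> \<theta> ` L" "a + b \<in> \<theta> ` L" using sring_mult[OF L xy(1,2)] sring_add[OF L xy(1,2)] by auto
      qed
    qed
    have E_img: "E \<subseteq> \<theta> ` L"
    proof
      fix a assume "a \<in> E"
      then obtain b where "b \<in> E" "a = \<sigma> b" using gal_bij[OF s] unfolding bij_betw_def by blast
      then show "a \<in> \<theta> ` L" using th_E[of b] E_L by (metis imageI subsetD)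
    qed
    have "\<theta> z - c \<in> \<theta> ` L" using z_L c(1) E_img by (intro sring_diff[OF img]) auto
    then have "z \<in> \<theta> ` L" using th_z by simp
    then show ?thesis
      unfolding L_def[of] using poly_mem[OF img polys_mono[OF E_img]] unfolding L_def by auto
  qed
  have "\<theta> \<in> Bij L" using inj surj th_L unfolding Bij_def bij_betw_def \<theta>_def by auto
  moreover have "\<theta> a = a" if "a \<in> F" for a using th_E[of a] that F_subset s by auto
  ultimately have "\<theta> \<in> carrier (galois_group F L)"
    unfolding galois_group_mem using th_L th_1 th_hom by blast
  then show ?thesis using th_E th_z by blast
qed

text \<open>
  Let \<open>a = g (z)\<close> with \<open>g\<close> of degree \<open>d < p\<close>. The polynomial
  \<open>g (X + 1) - g (X)\<close> vanishes at \<open>z\<close>, so it is zero; but its coefficient at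
  \<open>d - 1\<close> is \<open>d\<close> times the leading coefficient of \<open>g\<close>.
\<close>

lemma fixed_by_translation:
  assumes a: "a \<in> L" and \<theta>: "\<theta> \<in> carrier (galois_group F L)" "\<And>a. a \<in> E \<Longrightarrow> \<theta> a = a" "\<theta> z = z + 1" "\<theta> a = a"
  shows "a \<in> E"
proof -
  obtain g where g: "g \<in> polys E" "Polynomial.degree g < CHAR('a)" "a = poly g z" using a by (rule L_cases)
  define d where "d = Polynomial.degree g"
  have hom: "\<theta> (x + y) = \<theta> x + \<theta> y" "\<theta> (x * y) = \<theta> x * \<theta> y" if "x \<in> L" "y \<in> L" for x y
    using \<theta>(1) that unfolding galois_group_mem by auto
  have th_poly: "f \<in> polys E \<Longrightarrow> \<theta> (poly f z) = poly f (z + 1)" for f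
  proof (induction f)
    case 0
    show ?case using \<theta>(2)[of 0] N by simp
  next
    case (pCons b f)
    have "b \<in> E" using polysD[OF pCons.prems, of 0] by simp
    moreover have f: "f \<in> polys E" using polysD[OF pCons.prems, of "Suc _"] by (auto intro!: polysI)
    ultimately show ?case using hom[of b "z * poly f z"] hom[of z "poly f z"] E_L z_L LI[OF f] sring_mult[OF L z_L LI[OF f]]
      pCons.IH[OF f] \<theta>(2,3) by auto
  qed
  define h where "h = (\<Sum>i\<le>d. Polynomial.smult (Polynomial.coeff g i) ([:1, 1:] ^ i)) - g"
  have hE: "h \<in> polys E" unfolding h_def using N polysD[OF g(1)] g(1)
    by (intro polys_diff polys_sum polys_smult polys_power polys_pCons) auto
  have "poly h z = (\<Sum>i\<le>d. Polynomial.coeff g i * (1 + z) ^ i) - poly g z"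
    by (simp add: h_def poly_sum)
  also have "(\<Sum>i\<le>d. Polynomial.coeff g i * (1 + z) ^ i) = poly g (z + 1)"
    by (simp add: poly_altdef d_def add.commute)
  finally have "poly h z = poly g (z + 1) - poly g z" .
  then have hz: "poly h z = 0" using th_poly[OF g(1)] \<theta>(4) g(3) by simp
  have cl: "Polynomial.coeff ([:1, 1:] ^ i :: 'a poly) j = of_nat (i choose j)" for i j
  proof (cases "j \<le> i")
    case True
    then show ?thesis by (simp add: coeff_linear_poly_power)
  next
    case False
    then have "Polynomial.degree ([:1, 1:] ^ i :: 'a poly) < j" using degree_power_le[of "[:1, 1:] :: 'a poly" i] by simp
    then show ?thesis using False by (simp add: coeff_eq_0 binomial_eq_0)
  qed
  have "Polynomial.degree h \<le> d" unfolding h_def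
    by (intro degree_diff_le degree_sum_le)
      (auto simp: d_def intro!: le_trans[OF degree_smult_le] le_trans[OF degree_power_le])
  then have h0: "h = 0" using independent[OF hE _ hz] g(2) unfolding d_def by simp
  have "d = 0"
  proof (rule ccontr)
    assume "d \<noteq> 0"
    then obtain e where e: "d = Suc e" by (cases d) auto
    have "(\<Sum>i\<in>{..<e}. Polynomial.coeff g i * of_nat (i choose e)) = 0"
      by (rule sum.neutral) (auto simp: binomial_eq_0)
    moreover have "{..d} = insert d (insert e {..<e})" unfolding e by auto
    ultimately have "(\<Sum>i\<le>d. Polynomial.coeff g i * of_nat (i choose e)) = Polynomial.coeff g d * of_nat d + Polynomial.coeff g e"
      using e by (simp add: binomial_Suc_n)
    moreover have "Polynomial.coeff h e = (\<Sum>i\<le>d. Polynomial.coeff g i * of_nat (i choose e)) - Polynomial.coeff g e"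
      unfolding h_def by (simp add: coeff_sum cl)
    ultimately have "Polynomial.coeff g d * of_nat d = 0" using h0 by simp
    moreover have "Polynomial.coeff g d \<noteq> 0" unfolding d_def using \<open>d \<noteq> 0\<close> d_def by auto
    moreover have "of_nat d \<noteq> (0 :: 'a)" using \<open>d \<noteq> 0\<close> g(2) d_def by (intro of_nat_char_less[OF char_pos]) auto
    ultimately show False by simp
  qed
  then obtain b where "g = [:b:]" unfolding d_def by (metis degree_eq_zeroE)
  then show ?thesis using g polysD[OF g(1), of 0] by simp
qed

lemma hom_determined:
  assumes \<theta>: "\<theta> \<in> carrier (galois_group F L)" "\<theta>' \<in> carrier (galois_group F L)"
    and E: "\<And>a. a \<in> E \<Longrightarrow> \<theta> a = \<theta>' a" and z: "\<theta> z = \<theta>' z"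
  shows "\<theta> = \<theta>'"
proof (rule extensionalityI[where A=L])
  show "\<theta> \<in> extensional L" "\<theta>' \<in> extensional L" using \<theta> unfolding galois_group_mem Bij_def by blast+
  have hom: "\<theta> (x + y) = \<theta> x + \<theta> y" "\<theta> (x * y) = \<theta> x * \<theta> y"
    "\<theta>' (x + y) = \<theta>' x + \<theta>' y" "\<theta>' (x * y) = \<theta>' x * \<theta>' y" if "x \<in> L" "y \<in> L" for x y
    using \<theta> that unfolding galois_group_mem by auto
  have "f \<in> polys E \<Longrightarrow> \<theta> (poly f z) = \<theta>' (poly f z)" for f
  proof (induction f)
    case 0
    show ?case using E[of 0] N by simp
  next
    case (pCons b f)
    have "b \<in> E" using polysD[OF pCons.prems, of 0] by simp
    moreover have f: "f \<in> polys E" using polysD[OF pCons.prems, of "Suc _"] by (auto intro!: polysI)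
    ultimately show ?case using hom[of b "z * poly f z"] hom[of z "poly f z"] E_L z_L LI[OF f] sring_mult[OF L z_L LI[OF f]]
      pCons.IH[OF f] E[of b] z by auto
  qed
  then show "\<theta> a = \<theta>' a" if "a \<in> L" for a using that unfolding L_def by auto
qed

text \<open>
  An element fixed by the translation \<open>z \<mapsto> z + 1\<close> lies in \<open>E\<close>, and then in
  \<open>F\<close> because the automorphisms of \<open>E\<close> lift. The group is finite since an automorphism
  is determined by its restriction to \<open>E\<close> and by the image of \<open>z\<close>, for which there are
  finitely many possibilities.
\<close>

lemma galois_L: "galois F L"
proof (rule galois.intro)
  show "sring L" by (rule L)
  show "inverse a \<in> L" if "a \<in> L" for a using that by (rule L_inverse)
  let ?G = "carrier (galois_group F L)"
  have wp0: "wp (0::'a) = 0" using wp_of_nat[OF char_pos, of 0] by simp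
  have fixF: "a \<in> F" if a: "a \<in> L" "\<And>\<theta>. \<theta> \<in> ?G \<Longrightarrow> \<theta> a = a" for a
  proof -
    obtain \<rho> where \<rho>: "\<rho> \<in> ?G" "\<And>a. a \<in> E \<Longrightarrow> \<rho> a = \<one>\<^bsub>\<Gamma>\<^esub> a" "\<rho> z = z + 1"
      using lift_automorphism[OF gal.one_closed, of 1] N gal_one[OF \<delta>] wp_of_nat[OF char_pos, of 1] by auto
    have aE: "a \<in> E" using \<rho> a gal_one by (intro fixed_by_translation[OF a(1), of \<rho>]) auto
    show ?thesis
    proof (rule fixedI[OF aE])
      fix \<sigma> assume s: "\<sigma> \<in> Gal"
      obtain c where c: "c \<in> E" "wp c = \<sigma> \<delta> - \<delta>" using lift[OF s] by blast
      obtain \<theta> where "\<theta> \<in> ?G" "\<And>a. a \<in> E \<Longrightarrow> \<theta> a = \<sigma> a" using lift_automorphism[OF s c] by blast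
      then show "\<sigma> a = a" using a(2) aE by metis
    qed
  qed
  have FL: "F \<subseteq> L" using F_subset E_L by auto
  show "galois_extension F L"
    unfolding galois_extension_def
  proof (intro equalityI subsetI)
    fix a assume "a \<in> {a \<in> L. \<forall>\<sigma>\<in>?G. \<sigma> a = a}"
    then show "a \<in> F" using fixF[of a] by simp
  next
    fix a assume a: "a \<in> F"
    have "\<sigma> a = a" if "\<sigma> \<in> ?G" for \<sigma> using that a unfolding galois_group_mem by blast
    then show "a \<in> {a \<in> L. \<forall>\<sigma>\<in>?G. \<sigma> a = a}" using a FL by blast
  qed
  have stable: "\<theta> a \<in> E" if th: "\<theta> \<in> ?G" and a: "a \<in> E" for \<theta> a
  proof -
    have hom: "\<theta> (x + y) = \<theta> x + \<theta> y" "\<theta> (x * y) = \<theta> x * \<theta> y" if "x \<in> L" "y \<in> L" for x y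
      using th that unfolding galois_group_mem by auto
    have fix_F: "\<theta> b = b" if "b \<in> F" for b using th that unfolding galois_group_mem by auto
    have "f \<in> polys F \<Longrightarrow> \<theta> (poly f a) = poly f (\<theta> a) \<and> poly f a \<in> E" for f
    proof (induction f)
      case 0
      show ?case using fix_F[of 0] F N by simp
    next
      case (pCons b f)
      have b: "b \<in> F" using polysD[OF pCons.prems, of 0] by simp
      have f: "f \<in> polys F" using polysD[OF pCons.prems, of "Suc _"] by (auto intro!: polysI)
      have IH: "\<theta> (poly f a) = poly f (\<theta> a)" "poly f a \<in> E" using pCons.IH[OF f] by auto
      have "a * poly f a \<in> E" "b \<in> E" using a IH b F_subset N by auto
      moreover from this have "a * poly f a \<in> L" "b \<in> L" "a \<in> L" "poly f a \<in> L" using E_L a IH(2) by blast+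
      ultimately show ?case using hom[of b "a * poly f a"] hom[of a "poly f a"] IH(1) fix_F[OF b] sring_add[OF N] by simp
    qed
    from this[OF charpoly_polys[OF a]] have "poly (charpoly a) (\<theta> a) = 0" using poly_charpoly[OF a] fix_F[of 0] F by simp
    then obtain \<tau> where "\<tau> \<in> Gal" "\<theta> a = \<tau> a" using finite_gal unfolding charpoly_def by (auto simp: poly_prod)
    then show ?thesis using a by simp
  qed
  show "finite ?G"
  proof -
    let ?r = "\<lambda>\<theta>. (restrict \<theta> E, \<theta> z)"
    have "inj_on ?r ?G"
    proof (rule inj_onI)
      fix \<theta> \<theta>' assume *: "\<theta> \<in> ?G" "\<theta>' \<in> ?G" "?r \<theta> = ?r \<theta>'"
      then have "\<theta> a = \<theta>' a" if "a \<in> E" for a using that by (metis Pair_inject restrict_apply')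
      then show "\<theta> = \<theta>'" using * by (intro hom_determined) auto
    qed
    moreover have "?r ` ?G \<subseteq> (\<Union>\<sigma>\<in>Gal. {\<sigma>} \<times> {w. wp w = \<sigma> \<delta>})"
    proof -
      have "restrict \<theta> E \<in> Gal \<and> wp (\<theta> z) = restrict \<theta> E \<delta>" if th: "\<theta> \<in> ?G" for \<theta>
      proof -
        interpret LL: group "galois_group F L" by (rule group_galois_group[OF L FL])
        have hom: "\<theta> (x + y) = \<theta> x + \<theta> y" "\<theta> (x * y) = \<theta> x * \<theta> y" if "x \<in> L" "y \<in> L" for x y
          using th that unfolding galois_group_mem by auto
        have th1: "\<theta> 1 = 1" and thF: "\<And>a. a \<in> F \<Longrightarrow> \<theta> a = a" and thinj: "inj_on \<theta> L"
          using th unfolding galois_group_mem Bij_def bij_betw_def by auto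
        let ?i = "inv\<^bsub>galois_group F L\<^esub> \<theta>"
        have iG: "?i \<in> ?G" using th by simp
        have ii: "\<theta> (?i a) = a" if "a \<in> L" for a
          using LL.r_inv[OF th] galois_group_mult[OF th iG] that by (simp add: galois_group_one fun_eq_iff compose_def) metis
        have "bij_betw (restrict \<theta> E) E E"
        proof (rule bij_betw_imageI)
          show "inj_on (restrict \<theta> E) E" using thinj E_L by (auto simp: inj_on_def)
          show "restrict \<theta> E ` E = E"
            using stable[OF th] stable[OF iG] ii E_L by (force simp: image_iff)
        qed
        then have "restrict \<theta> E \<in> Gal"
          unfolding galois_group_mem Bij_def using stable[OF th] th1 thF hom E_L N F_subset
          by (auto simp: sring_add sring_mult subset_eq)
        moreover have "wp (\<theta> z) = \<theta> \<delta>"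
        proof -
          have pow: "\<theta> (z ^ n) = \<theta> z ^ n" for n
            by (induction n) (use th1 hom z_L sring_power[OF L z_L] in auto)
          have "\<theta> (z ^ CHAR('a) - z) + \<theta> z = \<theta> (z ^ CHAR('a))"
            using hom(1)[of "z ^ CHAR('a) - z" z] z_L sring_diff[OF L sring_power[OF L z_L] z_L] by simp
          then show ?thesis using pow[of "CHAR('a)"] wp_z unfolding wp_def by (simp add: algebra_simps)
        qed
        ultimately show ?thesis using \<delta> by simp
      qed
      then show ?thesis by blast
    qed
    moreover have "finite (\<Union>\<sigma>\<in>Gal. {\<sigma>} \<times> {w. wp w = \<sigma> \<delta>})"
      using finite_gal wp_finite[OF char_pos] by auto
    ultimately show ?thesis by (meson finite_imageD finite_subset)
  qed
qed

end

section \<open>The smooth projective model\<close>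

lemma algebra_generated_subring: "sring (algebra_generated K S)"
proof -
  interpret Ring.field "ring_of_type_algebra :: 'a ring" by auto
  show ?thesis unfolding algebra_generated_def by (rule generate_ring_is_subring) simp
qed

lemma algebra_generated_incl: "K \<subseteq> algebra_generated K S" "S \<subseteq> algebra_generated K S"
  unfolding algebra_generated_def by (auto intro: generate_ring.incl)

lemma algebra_generated_least:
  assumes "sring R" "K \<subseteq> R" "S \<subseteq> R"
  shows "algebra_generated K S \<subseteq> R"
proof
  fix a assume "a \<in> algebra_generated K S"
  then show "a \<in> R" unfolding algebra_generated_def
    by (induction rule: generate_ring.induct) (use assms in auto)
qed

lemma chart_subring: "sring (chart K S f)"
  unfolding chart_def by (rule algebra_generated_subring)

lemma chart_incl: "K \<subseteq> chart K S f" "s \<in> S \<Longrightarrow> s / f \<in> chart K S f"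
  unfolding chart_def using algebra_generated_incl[where K=K and S="(\<lambda>g. g / f) ` S"] by auto

text \<open>
  At the points where \<open>g / f\<close> does not vanish, the quotients \<open>s / g = (s / f) * (f / g)\<close>
  are regular.
\<close>

lemma chart_change:
  assumes S: "f \<in> S" "f \<noteq> 0" "g \<in> S" "g \<noteq> 0"
    and I: "primeideal I (subring_of_type (chart K S f))" and gI: "g / f \<notin> I"
  shows "localization_at (chart K S f) I \<in> spec (chart K S g)"
proof -
  let ?A = "chart K S f" and ?B = "chart K S g"
  let ?O = "localization_at ?A I"
  note A = chart_subring[of K S f] and B = chart_subring[of K S g]
  note O = sring_localization[OF A I]
  have AO: "?A \<subseteq> ?O" by (rule localization_sub[OF A I])
  have gA: "g / f \<in> ?A" using S by (intro chart_incl)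
  have inv: "f / g \<in> ?O"
    using localizationI[OF A I sring_1[OF A] gA gI] by simp
  have BO: "?B \<subseteq> ?O"
    unfolding chart_def[of K S g]
  proof (rule algebra_generated_least[OF O])
    show "K \<subseteq> ?O" using chart_incl(1)[of K S f] AO by auto
    have "s / g \<in> ?O" if "s \<in> S" for s
    proof -
      have "s / f * (f / g) \<in> ?O" using chart_incl(2)[OF that, of f K] AO inv by (intro sring_mult[OF O]) auto
      then show ?thesis using S by simp
    qed
    then show "(\<lambda>s. s / g) ` S \<subseteq> ?O" by auto
  qed
  note M = primeideal_max_ideal_localization[OF A I]
  let ?J = "max_ideal ?O \<inter> ?B"
  note J = primeideal_contract[OF B O M BO]
  have fg: "f / g \<in> ?B" using S by (intro chart_incl)
  have "\<exists>n. (f / g) ^ n * a \<in> ?B" if "a \<in> ?A" for a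
    using that unfolding chart_def[of K S f] algebra_generated_def
  proof (induction rule: generate_ring.induct)
    case one
    then show ?case using B by (intro exI[of _ 0]) auto
  next
    case (incl h)
    then consider "h \<in> K" | s where "s \<in> S" "h = s / f" by auto
    then show ?case
    proof cases
      case 1
      then show ?thesis using chart_incl(1)[of K S g] by (intro exI[of _ 0]) auto
    next
      case 2
      then show ?thesis using chart_incl(2)[of s S g K] S by (intro exI[of _ 1]) auto
    qed
  next
    case (a_inv h)
    then obtain n where "(f / g) ^ n * h \<in> ?B" by auto
    then show ?case using sring_uminus[OF B] by (intro exI[of _ n]) auto
  next
    case (eng_add h h')
    then obtain n n' where n: "(f / g) ^ n * h \<in> ?B" "(f / g) ^ n' * h' \<in> ?B" by auto
    have "(f / g) ^ n' * ((f / g) ^ n * h) + (f / g) ^ n * ((f / g) ^ n' * h') \<in> ?B"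
      by (intro sring_add[OF B] sring_mult[OF B sring_power[OF B fg]] n)
    moreover have "(f / g) ^ n' * ((f / g) ^ n * h) + (f / g) ^ n * ((f / g) ^ n' * h') = (f / g) ^ (n + n') * (h + h')"
      by (simp add: power_add algebra_simps)
    ultimately show ?case by (intro exI[of _ "n + n'"]) simp
  next
    case (eng_mult h h')
    then obtain n n' where n: "(f / g) ^ n * h \<in> ?B" "(f / g) ^ n' * h' \<in> ?B" by auto
    have eq: "(f / g) ^ n * h * ((f / g) ^ n' * h') = (f / g) ^ (n + n') * (h * h')"
      by (simp only: power_add ac_simps)
    have "(f / g) ^ (n + n') * (h * h') \<in> ?B" using sring_mult[OF B n] unfolding eq .
    then show ?case by (intro exI[of _ "n + n'"]) simp
  qed
  note clear = this
  have "?O \<subseteq> localization_at ?B ?J"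
  proof
    fix a assume "a \<in> ?O"
    then obtain b s where bs: "b \<in> ?A" "s \<in> ?A" "s \<notin> I" "s \<noteq> 0" "a = b / s" by (rule localizationE[OF A I])
    obtain n where n: "(f / g) ^ n * b \<in> ?B" using clear[OF bs(1)] by blast
    obtain n' where n': "(f / g) ^ n' * s \<in> ?B" using clear[OF bs(2)] by blast
    let ?e = "(f / g) ^ (n + n')"
    have e1: "?e * b \<in> ?B" "?e * s \<in> ?B"
      using sring_mult[OF B sring_power[OF B fg, of n'] n] sring_mult[OF B sring_power[OF B fg, of n] n']
      by (simp_all add: power_add ac_simps)
    have "inverse (?e * s) \<in> ?O"
    proof -
      have "(g / f) ^ (n + n') * (1 / s) \<in> ?O"
        using gA AO localizationI[OF A I sring_1[OF A] bs(2,3)] by (intro sring_mult[OF O sring_power[OF O]]) auto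
      moreover have "(g / f) ^ (n + n') * (1 / s) = inverse (?e * s)"
        by (simp add: power_divide divide_inverse power_mult_distrib power_inverse ac_simps)
      ultimately show ?thesis by (simp only:)
    qed
    then have "?e * s \<notin> ?J" using bs(4) S unfolding max_ideal_eq[OF O] by auto
    then have "(?e * b) / (?e * s) \<in> localization_at ?B ?J" using e1 by (intro localizationI[OF B J])
    moreover have "(?e * b) / (?e * s) = a" unfolding bs(5) using S by (intro nonzero_mult_divide_mult_cancel_left) simp
    ultimately show "a \<in> localization_at ?B ?J" by simp
  qed
  then have "?O = localization_at ?B ?J" using localization_contract(1)[OF B O M BO] by auto
  then show ?thesis unfolding spec_def using J by blast
qed

lemma zero_prime: "sring R \<Longrightarrow> primeideal {0} (subring_of_type R)"
  by (auto simp: primeideal_iff)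

context rational_line
begin

lemma A_generated: "algebra_generated K {u} = A" "algebra_generated K {u, 1} = A" "algebra_generated K {1, u} = A"
proof -
  have *: "algebra_generated K S = A" if "u \<in> S" "S \<subseteq> A" for S
  proof
    show "algebra_generated K S \<subseteq> A" by (rule algebra_generated_least[OF A K_subset that(2)])
    show "A \<subseteq> algebra_generated K S"
      using algebra_generated_incl[where K=K and S=S] that(1) by (intro A_subsetI algebra_generated_subring) auto
  qed
  show "algebra_generated K {u} = A" "algebra_generated K {u, 1} = A" "algebra_generated K {1, u} = A"
    by (rule *; use sring_1[OF A] in simp)+
qed

lemma u_nonzero: "u \<noteq> 0"
proof -
  have "ev [:0, 1:] \<noteq> 0" unfolding ev_eq_0_iff by simp
  then show ?thesis by (simp add: evat_linear)
qed

text \<open>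
  The polynomial \<open>g\<close> is the reversal of \<open>h\<close> with respect to the degree bound
  \<open>l\<close>.
\<close>

lemma reversal:
  assumes v: "v = inverse u" and h: "Polynomial.degree h \<le> l"
  obtains g where "Polynomial.degree g \<le> l" "Polynomial.coeff g l = Polynomial.coeff h 0" "Polynomial.coeff g 0 = Polynomial.coeff h l"
    "u ^ l * evat v h = evat u g"
proof -
  define g where "g = (\<Sum>k\<le>l. Polynomial.monom (Polynomial.coeff h k) (l - k))"
  have "Polynomial.degree g \<le> l" unfolding g_def
    by (intro degree_sum_le) (auto intro: le_trans[OF degree_monom_le])
  moreover have "Polynomial.coeff g l = Polynomial.coeff h 0"
  proof -
    have "Polynomial.coeff g l = (\<Sum>k\<le>l. if k = 0 then Polynomial.coeff h k else 0)"
      unfolding g_def coeff_sum by (rule sum.cong) auto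
    then show ?thesis by simp
  qed
  moreover have "Polynomial.coeff g 0 = Polynomial.coeff h l"
  proof -
    have "Polynomial.coeff g 0 = (\<Sum>k\<le>l. if k = l then Polynomial.coeff h k else 0)"
      unfolding g_def coeff_sum by (rule sum.cong) auto
    then show ?thesis by simp
  qed
  moreover have "u ^ l * evat v h = evat u g"
  proof -
    have ev_sum: "evat u (\<Sum>k\<in>I. f k) = (\<Sum>k\<in>I. evat u (f k))" for I :: "nat set" and f
      by (induction I rule: infinite_finite_induct) (auto simp: evat_add)
    have ev_monom: "evat u (Polynomial.monom c k) = \<kappa> c * u ^ k" for c k
      by (simp add: evat_def map_poly_monom poly_monom)
    have "evat v h = (\<Sum>k\<le>l. \<kappa> (Polynomial.coeff h k) * v ^ k)"
      unfolding evat_altdef using h by (intro sum.mono_neutral_left) (auto simp: coeff_eq_0)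
    then have "u ^ l * evat v h = (\<Sum>k\<le>l. \<kappa> (Polynomial.coeff h k) * (u ^ l * v ^ k))"
      by (simp add: sum_distrib_left mult.left_commute)
    also have "\<dots> = (\<Sum>k\<le>l. \<kappa> (Polynomial.coeff h k) * u ^ (l - k))"
    proof (rule sum.cong[OF refl])
      fix k assume "k \<in> {..l}"
      then have "u ^ l = u ^ (l - k) * u ^ k" by (simp add: power_add[symmetric])
      then show "\<kappa> (Polynomial.coeff h k) * (u ^ l * v ^ k) = \<kappa> (Polynomial.coeff h k) * u ^ (l - k)"
        using u_nonzero unfolding v by (simp add: power_inverse)
    qed
    also have "\<dots> = evat u g" unfolding g_def ev_sum ev_monom ..
    finally show ?thesis .
  qed
  ultimately show thesis using that by blast
qed

end

context line_ext
begin

text \<open>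
  If \<open>b\<close> were not in \<open>V\<close>, its characteristic equation divided by \<open>b ^ n\<close>
  would put \<open>1\<close> into the maximal ideal.
\<close>

lemma valuation_ring_B:
  assumes V: "valuation_ring N V" and AV: "A \<subseteq> V" and P: "primeideal (max_ideal V) (subring_of_type V)"
  shows "B \<subseteq> V"
proof
  fix b assume b: "b \<in> B"
  have VR: "sring V" using V unfolding valuation_ring_def by simp
  have bN: "b \<in> N" using b B_N by auto
  show "b \<in> V"
  proof (rule ccontr)
    assume "b \<notin> V"
    then have im: "inverse b \<in> max_ideal V" "b \<noteq> 0" using V bN VR unfolding valuation_ring_def by auto
    let ?n = "card Gal"
    have "1 = b ^ ?n * inverse b ^ ?n" using im by (simp add: power_mult_distrib[symmetric])
    also have "\<dots> = - (\<Sum>i<?n. Polynomial.coeff (charpoly b) i * (b ^ i * inverse b ^ ?n))"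
      unfolding charpoly_equation[OF bN] by (simp add: sum_distrib_right mult.assoc)
    also have "\<dots> = - (\<Sum>i<?n. Polynomial.coeff (charpoly b) i * inverse b ^ (?n - i))"
    proof -
      have "b ^ i * inverse b ^ ?n = inverse b ^ (?n - i)" if "i < ?n" for i
      proof -
        have "inverse b ^ ?n = inverse b ^ i * inverse b ^ (?n - i)" using that by (simp add: power_add[symmetric])
        moreover have "b ^ i * inverse b ^ i = 1" using im by (simp add: power_mult_distrib[symmetric])
        ultimately show ?thesis by (metis mult.assoc mult_1)
      qed
      then show ?thesis by simp
    qed
    also have "\<dots> \<in> max_ideal V"
    proof (rule prime_uminus[OF VR P prime_sum[OF VR P]])
      fix i assume i: "i \<in> {..<?n}"
      have "inverse b ^ (?n - i) = inverse b * inverse b ^ (?n - i - 1)" using i by (cases "?n - i") auto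
      also have "\<dots> \<in> max_ideal V" using im prime_sub[OF VR P] by (intro prime_multR[OF VR P] sring_power[OF VR]) auto
      finally show "Polynomial.coeff (charpoly b) i * inverse b ^ (?n - i) \<in> max_ideal V"
        using polysD[OF charpoly_A[OF b], of i] AV by (intro prime_multL[OF VR P]) auto
    qed
    finally show False using prime_1[OF VR P] by simp
  qed
qed

lemma localization_0: "localization_at B {0} = N"
proof
  show "localization_at B {0} \<subseteq> N" unfolding localization_at_def using B_N N_divide by blast
  show "N \<subseteq> localization_at B {0}"
  proof
    fix a assume "a \<in> N"
    then obtain b d where "b \<in> B" "d \<in> A" "d \<noteq> 0" "a = b / d" by (rule N_cases)
    then show "a \<in> localization_at B {0}" unfolding localization_at_def using A_B by blast
  qed
qed

lemma N_spec: "N \<in> spec B"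
  unfolding spec_def using localization_0 zero_prime[OF B] by force

lemma spec_B_cases:
  assumes "Q \<in> spec B"
  obtains (generic) "Q = N" | (place) q \<alpha> where "place \<kappa> u F N q \<alpha>" "Q = localization_at B q"
proof -
  obtain q where q: "primeideal q (subring_of_type B)" "Q = localization_at B q" using assms unfolding spec_def by auto
  show thesis
  proof (cases "q = {0}")
    case True
    then show thesis using generic q localization_0 by simp
  next
    case False
    then obtain \<alpha> where "u - \<kappa> \<alpha> \<in> q" using prime_contains_linear[OF B A_B order.refl q(1)] by blast
    then have "place \<kappa> u F N q \<alpha>" using q(1) by (intro place.intro line_ext_axioms place_axioms.intro)
    then show thesis using place q(2) by blast
  qed
qed

lemma max_ideal_N: "max_ideal N = {0}"
  unfolding max_ideal_eq[OF N] using N N_inverse by auto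

lemma valuation_ring_N: "valuation_ring N N"
  unfolding valuation_ring_def using N by auto

lemma spec_B_properties:
  assumes Q: "Q \<in> spec B"
  shows "valuation_ring N Q" "sring Q" "Q \<subseteq> N" "A \<subseteq> Q" "primeideal (max_ideal Q) (subring_of_type Q)"
    "\<exists>\<pi>\<in>Q. max_ideal Q = PIdl\<^bsub>subring_of_type Q\<^esub> \<pi>"
proof -
  have "valuation_ring N Q \<and> sring Q \<and> Q \<subseteq> N \<and> A \<subseteq> Q \<and> primeideal (max_ideal Q) (subring_of_type Q)
    \<and> (\<exists>\<pi>\<in>Q. max_ideal Q = PIdl\<^bsub>subring_of_type Q\<^esub> \<pi>)"
    using Q
  proof (cases rule: spec_B_cases)
    case generic
    have "max_ideal N = PIdl\<^bsub>subring_of_type N\<^esub> 0"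
      unfolding max_ideal_N cgenideal_def using N by auto
    then show ?thesis
      unfolding generic using valuation_ring_N N A_N zero_prime[OF N] max_ideal_N by auto
  next
    case (place q \<alpha>)
    interpret place \<kappa> u F N q \<alpha> by (rule place)
    obtain \<pi> where pi: "\<pi> \<in> m" "m \<subseteq> (*) \<pi> ` R" using max_ideal_principal by blast
    have "m = PIdl\<^bsub>subring_of_type R\<^esub> \<pi>"
    proof
      show "m \<subseteq> PIdl\<^bsub>subring_of_type R\<^esub> \<pi>"
        using pi(2) unfolding cgenideal_def by (auto simp: mult.commute)
      show "PIdl\<^bsub>subring_of_type R\<^esub> \<pi> \<subseteq> m"
        unfolding cgenideal_def using prime_multL[OF R m _ pi(1)] by auto
    qed
    then show ?thesis unfolding place(2) using R_valuation_ring R R_N A_R m pi m_R by blast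
  qed
  then show "valuation_ring N Q" "sring Q" "Q \<subseteq> N" "A \<subseteq> Q" "primeideal (max_ideal Q) (subring_of_type Q)"
    "\<exists>\<pi>\<in>Q. max_ideal Q = PIdl\<^bsub>subring_of_type Q\<^esub> \<pi>" by auto
qed

text \<open>
  \<open>V\<close> dominates the local ring of \<open>B\<close> at the contraction of its maximal ideal, and this
  local ring is a valuation ring.
\<close>

lemma valuation_ring_in_spec:
  assumes V: "valuation_ring N V" and AV: "A \<subseteq> V" and P: "primeideal (max_ideal V) (subring_of_type V)"
  shows "V \<in> spec B"
proof -
  have VR: "sring V" "V \<subseteq> N" using V unfolding valuation_ring_def by auto
  note BV = valuation_ring_B[OF assms]
  note l = lies_above_contract[OF B VR(1) P BV]
  have "V = localization_at B (max_ideal V \<inter> B)"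
    by (rule valuation_ring_dominated[OF spec_B_properties(1)[OF l(2)] VR l(1)])
  then show ?thesis using l(2) by simp
qed

lemma N_separable: "separable_extension F N"
  unfolding separable_extension_def coeffs_subset_iff[OF F] using orbit_poly_polys orbit_poly_simple_roots by blast

end

text \<open>
  The smooth projective curve with function field \<open>N\<close>, given by the integral closures over the two
  standard affine charts of the projective line.
\<close>

locale curve = X: line_ext \<kappa> x F N + Y: line_ext \<kappa> y F N
  for \<kappa> :: "'k::alg_closed_field \<Rightarrow> 'a::Fields.field" and x y :: 'a and F N :: "'a set" +
  assumes y: "y = inverse x"
begin

lemma x: "x = inverse y" by (simp add: y)
lemma x0 [simp]: "x \<noteq> 0" and y0 [simp]: "y \<noteq> 0" using X.u_nonzero Y.u_nonzero by auto

definition points :: "'a set set" where "points = spec X.B \<union> spec Y.B"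

abbreviation n where "n \<equiv> card X.Gal"

text \<open>\<open>pole m f\<close>: an integral equation showing that \<open>f\<close> has poles of order at most \<open>m\<close> above infinity and no others.\<close>

definition pole :: "nat \<Rightarrow> 'a \<Rightarrow> bool" where
  "pole m f \<longleftrightarrow> f \<in> N \<and> (\<exists>g. (\<forall>i<n. Polynomial.degree (g i) \<le> m * (n - i)) \<and> f ^ n = (\<Sum>i<n. X.ev (g i) * f ^ i))"

lemma pole_integral:
  assumes "pole m f"
  shows "f \<in> X.B" "f * y ^ m \<in> Y.B"
proof -
  obtain g where g: "f \<in> N" "\<And>i. i < n \<Longrightarrow> Polynomial.degree (g i) \<le> m * (n - i)" "f ^ n = (\<Sum>i<n. X.ev (g i) * f ^ i)"
    using assms unfolding pole_def by auto
  show "f \<in> X.B"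
    by (rule integral_closureI_monic[OF X.A X.N X.A_N g(1), where n=n and c="\<lambda>i. X.ev (g i)"]) (simp_all add: g(3))
  have mem: "y ^ (m * (n - i)) * X.ev (g i) \<in> Y.A" if i: "i < n" for i
  proof -
    obtain h where "y ^ (m * (n - i)) * X.ev (g i) = Y.ev h"
      using Y.reversal[OF x g(2)[OF i]] by metis
    then show ?thesis by simp
  qed
  have eq: "(f * y ^ m) ^ n = (\<Sum>i<n. (y ^ (m * (n - i)) * X.ev (g i)) * (f * y ^ m) ^ i)"
  proof -
    have "y ^ (m * (n - i)) * (y ^ m) ^ i = y ^ (m * n)" if "i < n" for i
      using that by (simp add: power_mult[symmetric] power_add[symmetric] distrib_left[symmetric])
    then have "(\<Sum>i<n. (y ^ (m * (n - i)) * X.ev (g i)) * (f * y ^ m) ^ i) = (\<Sum>i<n. y ^ (m * n) * (X.ev (g i) * f ^ i))"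
      by (intro sum.cong) (auto simp: power_mult_distrib ac_simps)
    also have "\<dots> = y ^ (m * n) * f ^ n" by (simp add: g(3) sum_distrib_left)
    finally show ?thesis by (simp add: power_mult_distrib power_mult mult.commute)
  qed
  have "f * y ^ m \<in> N" using g(1) Y.A_N by (intro sring_mult[OF X.N] sring_power[OF X.N]) auto
  then show "f * y ^ m \<in> Y.B"
    using mem eq by (intro integral_closureI_monic[OF Y.A X.N Y.A_N, where n=n and c="\<lambda>i. y ^ (m * (n - i)) * X.ev (g i)"])
qed

lemma pole_power:
  assumes "j \<le> m"
  shows "pole m (x ^ j)"
proof -
  define g where "g i = (if i = n - 1 then Polynomial.monom 1 j else (0 :: 'k poly))" for i
  have n0: "n > 0" by (rule X.card_Gal)
  have ev1: "X.ev (g (n - 1)) = x ^ j"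
    by (simp add: g_def X.evat_def map_poly_monom poly_monom)
  have "Polynomial.degree (g i) \<le> m * (n - i)" if "i < n" for i
    using assms that by (auto simp: g_def degree_monom_eq intro: le_trans[OF assms])
  moreover have "(x ^ j) ^ n = (\<Sum>i<n. X.ev (g i) * (x ^ j) ^ i)"
  proof -
    have "(\<Sum>i<n. X.ev (g i) * (x ^ j) ^ i) = (\<Sum>i<n. if i = n - 1 then X.ev (g (n - 1)) * (x ^ j) ^ (n - 1) else 0)"
      by (rule sum.cong) (auto simp: g_def)
    also have "\<dots> = X.ev (g (n - 1)) * (x ^ j) ^ (n - 1)" using n0 by (simp add: sum.delta)
    also have "\<dots> = (x ^ j) ^ Suc (n - 1)" unfolding ev1 by (simp only: power_Suc)
    also have "Suc (n - 1) = n" using n0 by simp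
    finally show ?thesis ..
  qed
  moreover have "x ^ j \<in> N" using X.A_N by (intro sring_power[OF X.N]) auto
  ultimately show ?thesis unfolding pole_def by blast
qed

lemma pole_X:
  assumes b: "b \<in> X.B"
  shows "\<exists>m0. \<forall>m\<ge>m0. pole m b"
proof -
  have bN: "b \<in> N" using b X.B_N by auto
  have "\<forall>i. \<exists>f. - Polynomial.coeff (X.charpoly b) i = X.ev f"
  proof
    fix i
    have "- Polynomial.coeff (X.charpoly b) i \<in> X.A" by (rule sring_uminus[OF X.A polysD[OF X.charpoly_A[OF b]]])
    then show "\<exists>f. - Polynomial.coeff (X.charpoly b) i = X.ev f" using X.A_E by metis
  qed
  then obtain g where g: "\<And>i. - Polynomial.coeff (X.charpoly b) i = X.ev (g i)" by metis
  define m0 where "m0 = (\<Sum>i<n. Polynomial.degree (g i))"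
  have "pole m b" if "m0 \<le> m" for m
  proof -
    have "Polynomial.degree (g i) \<le> m * (n - i)" if "i < n" for i
    proof -
      have "Polynomial.degree (g i) \<le> m0" unfolding m0_def using that by (intro member_le_sum) auto
      also have "\<dots> \<le> m * 1" using \<open>m0 \<le> m\<close> by simp
      also have "\<dots> \<le> m * (n - i)" using that by (intro mult_le_mono2) auto
      finally show ?thesis .
    qed
    moreover have "b ^ n = (\<Sum>i<n. X.ev (g i) * b ^ i)"
      using X.charpoly_equation[OF bN] unfolding g[symmetric] by (simp add: sum_negf)
    ultimately show ?thesis unfolding pole_def using bN by blast
  qed
  then show ?thesis by blast
qed

text \<open>
  The characteristic equation of \<open>b\<close> over the polynomials in \<open>y\<close> turns into one of
  \<open>x ^ m * b\<close> over the polynomials in \<open>x\<close>.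
\<close>

lemma pole_Y:
  assumes b: "b \<in> Y.B"
  shows "\<exists>m0. \<forall>m\<ge>m0. pole m (x ^ m * b)"
proof -
  have bN: "b \<in> N" using b Y.B_N by auto
  have "\<forall>i. \<exists>f. - Polynomial.coeff (X.charpoly b) i = Y.ev f"
  proof
    fix i
    have "- Polynomial.coeff (X.charpoly b) i \<in> Y.A" by (rule sring_uminus[OF Y.A polysD[OF Y.charpoly_A[OF b]]])
    then show "\<exists>f. - Polynomial.coeff (X.charpoly b) i = Y.ev f" using Y.A_E by metis
  qed
  then obtain h where h: "\<And>i. - Polynomial.coeff (X.charpoly b) i = Y.ev (h i)" by metis
  define m0 where "m0 = (\<Sum>i<n. Polynomial.degree (h i))"
  have "pole m (x ^ m * b)" if "m0 \<le> m" for m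
  proof -
    have deg: "Polynomial.degree (h i) \<le> m * (n - i)" if "i < n" for i
    proof -
      have "Polynomial.degree (h i) \<le> m0" unfolding m0_def using that by (intro member_le_sum) auto
      also have "\<dots> \<le> m * 1" using \<open>m0 \<le> m\<close> by simp
      also have "\<dots> \<le> m * (n - i)" using that by (intro mult_le_mono2) auto
      finally show ?thesis .
    qed
    have "\<forall>i. \<exists>g. i < n \<longrightarrow> Polynomial.degree g \<le> m * (n - i) \<and> x ^ (m * (n - i)) * Y.ev (h i) = X.ev g"
      using X.reversal[OF y deg] by metis
    then obtain g where g: "\<And>i. i < n \<Longrightarrow> Polynomial.degree (g i) \<le> m * (n - i)"
      "\<And>i. i < n \<Longrightarrow> x ^ (m * (n - i)) * Y.ev (h i) = X.ev (g i)" by metis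
    have "(x ^ m * b) ^ n = x ^ (m * n) * (\<Sum>i<n. Y.ev (h i) * b ^ i)"
      using X.charpoly_equation[OF bN] unfolding h[symmetric] by (simp add: sum_negf power_mult_distrib power_mult)
    also have "\<dots> = (\<Sum>i<n. X.ev (g i) * (x ^ m * b) ^ i)"
      unfolding sum_distrib_left
    proof (rule sum.cong[OF refl])
      fix i assume i: "i \<in> {..<n}"
      then have "x ^ (m * n) = x ^ (m * (n - i)) * (x ^ m) ^ i"
        by (simp add: power_mult[symmetric] power_add[symmetric] distrib_left[symmetric])
      then show "x ^ (m * n) * (Y.ev (h i) * b ^ i) = X.ev (g i) * (x ^ m * b) ^ i"
        using g(2)[of i] i by (simp add: power_mult_distrib ac_simps)
    qed
    finally have "(x ^ m * b) ^ n = (\<Sum>i<n. X.ev (g i) * (x ^ m * b) ^ i)" .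
    moreover have "x ^ m * b \<in> N" using bN X.A_N by (intro sring_mult[OF X.N] sring_power[OF X.N]) auto
    ultimately show ?thesis unfolding pole_def using g(1) by blast
  qed
  then show ?thesis by blast
qed

lemma eventually_pole:
  fixes P :: "nat \<Rightarrow> 'a \<Rightarrow> bool"
  assumes "finite T" "\<And>b. b \<in> T \<Longrightarrow> \<exists>m0. \<forall>m\<ge>m0. P m b"
  shows "\<exists>m0. \<forall>m\<ge>m0. \<forall>b\<in>T. P m b"
  using assms
proof (induction T rule: finite_induct)
  case (insert b T)
  then obtain m1 m2 where "\<forall>m\<ge>m1. P m b" "\<forall>m\<ge>m2. \<forall>b\<in>T. P m b" by (metis insertCI)
  then show ?case by (intro exI[of _ "max m1 m2"]) auto
qed auto

text \<open>
  The set \<open>S\<close> consists of powers of \<open>x\<close> and of generators of the two integral closures,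
  multiplied by \<open>x ^ m\<close> in the second case, all with poles of order at most \<open>m\<close> above
  infinity. The charts of \<open>1\<close> and \<open>x ^ m\<close> are the two integral closures. At a point of
  the chart of \<open>f\<close> where both \<open>1 / f\<close> and \<open>x ^ m / f\<close> vanish, all
  \<open>x ^ j / f\<close> would vanish, against the integral equation of \<open>f\<close>.
\<close>

lemma points_projective: "projective_scheme X.K points"
proof -
  obtain T0 where T0: "finite T0" "X.B = aspan X.A T0" using X.B_finite by blast
  obtain T1 where T1: "finite T1" "Y.B = aspan Y.A T1" using Y.B_finite by blast
  have T0B: "T0 \<subseteq> X.B" "T1 \<subseteq> Y.B" using T0 T1 aspan_incl[OF X.A T0(1)] aspan_incl[OF Y.A T1(1)] by auto
  obtain m1 where m1: "\<forall>m\<ge>m1. \<forall>b\<in>T0. pole m b"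
    using eventually_pole[OF T0(1), of pole] pole_X T0B by blast
  obtain m2 where m2: "\<forall>m\<ge>m2. \<forall>b\<in>T1. pole m (x ^ m * b)"
    using eventually_pole[OF T1(1), of "\<lambda>m b. pole m (x ^ m * b)"] pole_Y T0B by blast
  define m where "m = Suc (max m1 m2)"
  define S where "S = (\<lambda>j. x ^ j) ` {..m} \<union> T0 \<union> (*) (x ^ m) ` T1"
  have finS: "finite S" unfolding S_def using T0 T1 by auto
  have S_pole: "pole m f" if "f \<in> S" for f
  proof -
    have "m1 \<le> m" "m2 \<le> m" unfolding m_def by auto
    then show ?thesis using that m1 m2 pole_power unfolding S_def by auto
  qed
  have xS: "x ^ j \<in> S" if "j \<le> m" for j using that unfolding S_def by auto
  have oneS: "1 \<in> S" and xmS: "x ^ m \<in> S" using xS[of 0] xS[of m] by auto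
  have chart1: "chart X.K S 1 = X.B"
  proof
    have "S \<subseteq> X.B" using S_pole pole_integral(1) by blast
    then show "chart X.K S 1 \<subseteq> X.B" unfolding chart_def
      using X.K_subset X.A_B by (intro algebra_generated_least[OF X.B]) auto
    have "x \<in> chart X.K S 1" using chart_incl(2)[OF xS[of 1], of 1 X.K] by (simp add: m_def)
    then have A: "X.A \<subseteq> chart X.K S 1" by (intro X.A_subsetI chart_subring chart_incl)
    have "T0 \<subseteq> chart X.K S 1" using chart_incl(2)[of _ S 1 X.K] unfolding S_def by auto
    then have "aspan X.A T0 \<subseteq> chart X.K S 1" by (intro aspan_subring[OF X.A chart_subring A])
    then show "X.B \<subseteq> chart X.K S 1" using T0(2) by simp
  qed
  have chartm: "chart X.K S (x ^ m) = Y.B"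
  proof
    show "chart X.K S (x ^ m) \<subseteq> Y.B" unfolding chart_def
    proof (rule algebra_generated_least[OF Y.B])
      show "X.K \<subseteq> Y.B" using Y.K_subset Y.A_B by auto
      have "f / x ^ m \<in> Y.B" if "f \<in> S" for f
        using pole_integral(2)[OF S_pole[OF that]] by (simp add: y divide_inverse power_inverse)
      then show "(\<lambda>g. g / x ^ m) ` S \<subseteq> Y.B" by auto
    qed
    have "x ^ (m - 1) / x ^ m = y"
    proof -
      have "x ^ m = x ^ (m - 1) * x" by (simp add: m_def)
      then show ?thesis by (simp add: y divide_inverse)
    qed
    then have "y \<in> chart X.K S (x ^ m)" using chart_incl(2)[OF xS[of "m - 1"], of "x ^ m" X.K] by simp
    then have A: "Y.A \<subseteq> chart X.K S (x ^ m)" by (intro Y.A_subsetI chart_subring chart_incl)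
    have "T1 \<subseteq> chart X.K S (x ^ m)"
    proof
      fix c assume "c \<in> T1"
      then have "x ^ m * c \<in> S" unfolding S_def by auto
      then show "c \<in> chart X.K S (x ^ m)" using chart_incl(2)[of "x ^ m * c" S "x ^ m" X.K] by simp
    qed
    then have "aspan Y.A T1 \<subseteq> chart X.K S (x ^ m)" by (intro aspan_subring[OF Y.A chart_subring A])
    then show "Y.B \<subseteq> chart X.K S (x ^ m)" using T1(2) by simp
  qed
  have "spec (chart X.K S f) \<subseteq> points" if f: "f \<in> S - {0}" for f
  proof
    fix Q assume "Q \<in> spec (chart X.K S f)"
    then obtain I where I: "primeideal I (subring_of_type (chart X.K S f))" "Q = localization_at (chart X.K S f) I"
      unfolding spec_def by auto
    note C = chart_subring[of X.K S f]
    have "1 / f \<notin> I \<or> x ^ m / f \<notin> I"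
    proof (rule ccontr)
      assume "\<not> ?thesis"
      then have both: "1 / f \<in> I" "x ^ m / f \<in> I" by auto
      have uC: "x ^ j / f \<in> chart X.K S f" if "j \<le> m" for j using chart_incl(2)[OF xS[OF that]] .
      have u: "x ^ j / f \<in> I" if j: "j \<le> m" for j
      proof (cases "j = 0")
        case True
        then show ?thesis using both by simp
      next
        case False
        have "(x ^ j / f) ^ m = (1 / f) ^ (m - j) * (x ^ m / f) ^ j"
        proof -
          have "f ^ m = f ^ (m - j) * f ^ j" using j by (simp add: power_add[symmetric])
          then show ?thesis by (simp add: power_divide power_mult[symmetric] mult.commute)
        qed
        also have "(x ^ m / f) ^ j = x ^ m / f * (x ^ m / f) ^ (j - 1)" using False by (cases j) auto
        also have "(1 / f) ^ (m - j) * (x ^ m / f * (x ^ m / f) ^ (j - 1)) \<in> I"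
          using both uC[of 0] uC[of m] by (intro prime_multL[OF C I(1)] prime_multR[OF C I(1)] sring_power[OF C]) auto
        finally show ?thesis by (rule prime_power[OF C I(1) uC[OF j]])
      qed
      have pw: "x ^ k / f ^ l \<in> (if l = 0 then chart X.K S f else I)" if "k \<le> m * l" for k l
        using that
      proof (induction l arbitrary: k)
        case 0
        then show ?case using C by simp
      next
        case (Suc l)
        define j where "j = min k m"
        have j: "j \<le> m" "k - j \<le> m * l" "k = j + (k - j)" using Suc.prems unfolding j_def by auto
        have "x ^ (k - j) / f ^ l \<in> (if l = 0 then chart X.K S f else I)" by (rule Suc.IH[OF j(2)])
        then have mem: "x ^ (k - j) / f ^ l \<in> chart X.K S f" using prime_sub[OF C I(1)] by (auto split: if_splits)
        have "x ^ j / f * (x ^ (k - j) / f ^ l) \<in> I" by (rule prime_multR[OF C I(1) u[OF j(1)] mem])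
        moreover have "x ^ k = x ^ j * x ^ (k - j)" using j(3) by (metis power_add)
        then have "x ^ j / f * (x ^ (k - j) / f ^ l) = x ^ k / f ^ Suc l" by simp
        ultimately have "x ^ k / f ^ Suc l \<in> I" by (simp only:)
        then show ?case by simp
      qed
      obtain g where g: "\<And>i. i < n \<Longrightarrow> Polynomial.degree (g i) \<le> m * (n - i)" "f ^ n = (\<Sum>i<n. X.ev (g i) * f ^ i)"
        using S_pole[of f] f unfolding pole_def by auto
      have "1 = f ^ n / f ^ n" using f by simp
      also have "\<dots> = (\<Sum>i<n. X.ev (g i) * f ^ i) / f ^ n" by (simp only: g(2)[symmetric])
      also have "\<dots> = (\<Sum>i<n. X.ev (g i) * f ^ i / f ^ n)" by (simp add: sum_divide_distrib)
      also have "\<dots> = (\<Sum>i<n. X.ev (g i) / f ^ (n - i))"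
      proof (rule sum.cong[OF refl])
        fix i assume "i \<in> {..<n}"
        then have "f ^ n = f ^ (n - i) * f ^ i" by (simp add: power_add[symmetric])
        then show "X.ev (g i) * f ^ i / f ^ n = X.ev (g i) / f ^ (n - i)" using f by simp
      qed
      also have "\<dots> \<in> I"
      proof (rule prime_sum[OF C I(1)])
        fix i assume i: "i \<in> {..<n}"
        have "X.ev (g i) / f ^ (n - i) = (\<Sum>k\<le>Polynomial.degree (g i). \<kappa> (Polynomial.coeff (g i) k) * (x ^ k / f ^ (n - i)))"
          by (simp add: X.evat_altdef sum_divide_distrib)
        also have "\<dots> \<in> I"
        proof (rule prime_sum[OF C I(1)], rule prime_multL[OF C I(1)])
          fix k assume "k \<in> {..Polynomial.degree (g i)}"
          then have "k \<le> m * (n - i)" using g(1)[of i] i by auto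
          then show "x ^ k / f ^ (n - i) \<in> I" using pw[of k "n - i"] i by simp
          show "\<kappa> (Polynomial.coeff (g i) k) \<in> chart X.K S f" using chart_incl(1)[of X.K S f] by auto
        qed
        finally show "X.ev (g i) / f ^ (n - i) \<in> I" .
      qed
      finally show False using prime_1[OF C I(1)] by simp
    qed
    then show "Q \<in> points"
    proof
      assume "1 / f \<notin> I"
      then have "Q \<in> spec (chart X.K S 1)" unfolding I(2) using f oneS I(1) by (intro chart_change) auto
      then show ?thesis unfolding points_def chart1 by simp
    next
      assume "x ^ m / f \<notin> I"
      then have "Q \<in> spec (chart X.K S (x ^ m))" unfolding I(2) using f xmS I(1) by (intro chart_change) auto
      then show ?thesis unfolding points_def chartm by simp
    qed
  qed
  moreover have "points \<subseteq> proj_model X.K S"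
    unfolding points_def proj_model_def chart1[symmetric] chartm[symmetric] using oneS xmS by auto
  ultimately have "points = proj_model X.K S" unfolding proj_model_def by blast
  moreover have "\<not> S \<subseteq> {0}" using oneS by auto
  ultimately show ?thesis unfolding projective_scheme_def using finS by blast
qed

lemma points_properties:
  assumes "Q \<in> points"
  shows "valuation_ring N Q" "sring Q" "Q \<subseteq> N" "primeideal (max_ideal Q) (subring_of_type Q)"
    "\<exists>\<pi>\<in>Q. max_ideal Q = PIdl\<^bsub>subring_of_type Q\<^esub> \<pi>" "X.K \<subseteq> Q"
proof -
  have Q: "Q \<in> spec X.B \<or> Q \<in> spec Y.B" using assms unfolding points_def by auto
  show "valuation_ring N Q" using Q X.spec_B_properties(1) Y.spec_B_properties(1) by blast
  show "sring Q" using Q X.spec_B_properties(2) Y.spec_B_properties(2) by blast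
  show "Q \<subseteq> N" using Q X.spec_B_properties(3) Y.spec_B_properties(3) by blast
  show "primeideal (max_ideal Q) (subring_of_type Q)" using Q X.spec_B_properties(5) Y.spec_B_properties(5) by blast
  show "\<exists>\<pi>\<in>Q. max_ideal Q = PIdl\<^bsub>subring_of_type Q\<^esub> \<pi>" using Q X.spec_B_properties(6) Y.spec_B_properties(6) by blast
  show "X.K \<subseteq> Q" using Q X.spec_B_properties(4)[of Q] Y.spec_B_properties(4)[of Q] X.K_subset Y.K_subset by blast
qed

lemma function_field_points: "\<Union>points = N"
  using points_properties(3) X.N_spec unfolding points_def by auto

lemma points_finite_over:
  shows "finite_over_affine points X.A" "finite_over_affine points Y.A"
proof -
  have "{Q \<in> points. \<exists>z\<in>spec X.A. lies_above Q z} = spec X.B"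
  proof (intro equalityI subsetI)
    fix Q assume "Q \<in> {Q \<in> points. \<exists>z\<in>spec X.A. lies_above Q z}"
    then obtain I where I: "Q \<in> points" "primeideal I (subring_of_type X.A)" "lies_above Q (localization_at X.A I)"
      unfolding spec_def by auto
    then have "X.A \<subseteq> Q" using localization_sub[OF X.A I(2)] unfolding lies_above_def by auto
    then show "Q \<in> spec X.B" using points_properties[OF I(1)] by (intro X.valuation_ring_in_spec)
  next
    fix Q assume Q: "Q \<in> spec X.B"
    then show "Q \<in> {Q \<in> points. \<exists>z\<in>spec X.A. lies_above Q z}"
      using lies_above_contract[OF X.A X.spec_B_properties(2,5,4)[OF Q]] unfolding points_def by blast
  qed
  moreover have "finite_module X.A X.B" unfolding finite_module_def using X.B_finite unfolding aspan_def by blast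
  ultimately show "finite_over_affine points X.A" unfolding finite_over_affine_def using X.B X.A_B by blast
  have "{Q \<in> points. \<exists>z\<in>spec Y.A. lies_above Q z} = spec Y.B"
  proof (intro equalityI subsetI)
    fix Q assume "Q \<in> {Q \<in> points. \<exists>z\<in>spec Y.A. lies_above Q z}"
    then obtain I where I: "Q \<in> points" "primeideal I (subring_of_type Y.A)" "lies_above Q (localization_at Y.A I)"
      unfolding spec_def by auto
    then have "Y.A \<subseteq> Q" using localization_sub[OF Y.A I(2)] unfolding lies_above_def by auto
    then show "Q \<in> spec Y.B" using points_properties[OF I(1)] by (intro Y.valuation_ring_in_spec)
  next
    fix Q assume Q: "Q \<in> spec Y.B"
    then show "Q \<in> {Q \<in> points. \<exists>z\<in>spec Y.A. lies_above Q z}"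
      using lies_above_contract[OF Y.A Y.spec_B_properties(2,5,4)[OF Q]] unfolding points_def by blast
  qed
  moreover have "finite_module Y.A Y.B" unfolding finite_module_def using Y.B_finite unfolding aspan_def by blast
  ultimately show "finite_over_affine points Y.A" unfolding finite_over_affine_def using Y.B Y.A_B by blast
qed

lemma projective_line: "proj_model X.K {1, x} = spec X.A \<union> spec Y.A"
proof -
  have "chart X.K {1, x} 1 = X.A" unfolding chart_def using X.A_generated by simp
  moreover have "chart X.K {1, x} x = Y.A" unfolding chart_def using Y.A_generated by (simp add: y inverse_eq_divide)
  ultimately show ?thesis unfolding proj_model_def by auto
qed

end

section \<open>Ramification of covers of the line\<close>

lemma genideal_least:
  assumes W: "sring W" and t: "t \<in> W" and S: "S \<subseteq> (*) t ` W"
  shows "Idl\<^bsub>subring_of_type W\<^esub> S \<subseteq> (*) t ` W"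
proof -
  interpret W: cring "subring_of_type W" by (rule cring_subring_of_type[OF W])
  have P: "PIdl\<^bsub>subring_of_type W\<^esub> t = (*) t ` W"
    unfolding cgenideal_def by (auto simp: mult.commute)
  have "ideal (PIdl\<^bsub>subring_of_type W\<^esub> t) (subring_of_type W)" using t by (intro W.cgenideal_ideal) simp
  from W.genideal_minimal[OF this] show ?thesis using S unfolding P by simp
qed

context place
begin

text \<open>A pole of \<open>v\<close> would be a pole of \<open>v ^ p - v\<close>.\<close>

lemma wp_mem_R:
  assumes char: "CHAR('a) > 0" and v: "v \<in> N" "wp v \<in> R"
  shows "v \<in> R"
proof (rule ccontr)
  assume "v \<notin> R"
  then have iv: "inverse v \<in> m" "v \<noteq> 0" using R_valuation_ring v R unfolding valuation_ring_def by auto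
  obtain j where j: "CHAR('a) = Suc (Suc j)"
    using prime_ge_2_nat[OF prime_char[OF char]] by (metis Suc_le_D numeral_2_eq_2 Suc_le_mono)
  have "1 = inverse v ^ CHAR('a) * v ^ CHAR('a)" using iv by (simp add: power_mult_distrib[symmetric])
  also have "\<dots> = inverse v ^ CHAR('a) * (wp v + v)" by (simp add: wp_def)
  also have "\<dots> = inverse v * (inverse v ^ Suc j * wp v) + inverse v * inverse v ^ j * (inverse v * v)"
    unfolding j by (simp add: algebra_simps)
  also have "\<dots> = inverse v * (inverse v ^ Suc j * wp v + inverse v ^ j)" using iv(2) by (simp add: algebra_simps)
  also have "\<dots> \<in> m"
    using iv(1) m_R v(2) by (intro prime_multR[OF R m] sring_add[OF R] sring_mult[OF R, of "inverse v ^ Suc j"] sring_power[OF R]) auto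
  finally show False using prime_1[OF R m] by simp
qed

text \<open>The difference \<open>\<sigma> v - v\<close> lies in the prime field and vanishes at the place.\<close>

lemma inertia_fixes_root:
  assumes char: "CHAR('a) > 0" and v: "v \<in> N" "wp v \<in> R" and s: "\<sigma> \<in> inertia" and fixed: "\<sigma> (wp v) = wp v"
  shows "\<sigma> v = v"
proof -
  have vR: "v \<in> R" by (rule wp_mem_R[OF char v])
  have "wp (\<sigma> v - v) = 0"
    using gal_wp[OF inertia_Gal[OF s] v(1)] fixed by (simp add: wp_diff[OF char])
  then obtain i where i: "\<sigma> v - v = of_nat i" using wp_eq_0[OF char] by blast
  have "\<kappa> (of_nat i) \<in> m" using inertia_cong[OF s vR] i by (simp add: \<kappa>_of_nat)
  then have "of_nat i = (0 :: 'a)" using \<kappa>_m[of "of_nat i"] \<kappa>_of_nat[of i] by simp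
  then show ?thesis using i by simp
qed

lemma m_A: "m \<inter> A = {ev f | f. poly f \<alpha> = 0}"
proof -
  have "ev f \<in> m \<longleftrightarrow> poly f \<alpha> = 0" for f
  proof -
    obtain a where a: "a \<in> A" "ev f - \<kappa> (poly f \<alpha>) = t * a" using ev_root[of f \<alpha>] unfolding t_def by auto
    have ta: "t * a \<in> m" using a A_R by (intro prime_multR[OF R m t_m]) auto
    show ?thesis
    proof
      assume "ev f \<in> m"
      then have "ev f - t * a \<in> m" using ta by (rule prime_diff[OF R m])
      moreover have "ev f - t * a = \<kappa> (poly f \<alpha>)" using a(2) by (simp add: algebra_simps)
      ultimately show "poly f \<alpha> = 0" using \<kappa>_m by simp
    next
      assume "poly f \<alpha> = 0"
      then show "ev f \<in> m" using a(2) ta by simp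
    qed
  qed
  note iff = this
  show ?thesis
  proof (intro equalityI subsetI)
    fix a assume a: "a \<in> m \<inter> A"
    then obtain f where "a = ev f" using A_E by blast
    then show "a \<in> {ev f | f. poly f \<alpha> = 0}" using a iff[of f] by blast
  next
    fix a assume "a \<in> {ev f | f. poly f \<alpha> = 0}"
    then show "a \<in> m \<inter> A" using iff by auto
  qed
qed

text \<open>The local ring of the line below the place.\<close>

abbreviation base where "base \<equiv> localization_at A (m \<inter> A)"

lemma base_prime: "primeideal (m \<inter> A) (subring_of_type A)"
  by (rule primeideal_contract[OF A R m A_R])

lemma base: "sring base" by (rule sring_localization[OF A base_prime])

lemma base_R: "base \<subseteq> R" by (rule localization_contract(1)[OF A R m A_R])

lemma K_base: "K \<subseteq> base" using K_subset localization_sub[OF A base_prime] by blast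

lemma t_base: "t \<in> max_ideal base"
  using prime_sub_max_ideal[OF A base_prime] t_m t_A by auto

lemma max_ideal_base: "max_ideal base \<subseteq> (*) t ` base"
proof
  fix a assume "a \<in> max_ideal base"
  then obtain b s where bs: "b \<in> m \<inter> A" "s \<in> A" "s \<notin> m \<inter> A" "a = b / s"
    unfolding max_ideal_localization[OF A base_prime] by auto
  obtain f where f: "b = ev f" "poly f \<alpha> = 0" using bs(1) unfolding m_A by auto
  obtain c where c: "c \<in> A" "b = t * c" using ev_root[of f \<alpha>] f unfolding t_def by auto
  have "c / s \<in> base" using c bs by (intro localizationI[OF A base_prime])
  moreover have "a = t * (c / s)" using c bs by simp
  ultimately show "a \<in> (*) t ` base" by blast
qed

lemma unramifiedI:
  assumes "\<And>x. x \<in> m \<Longrightarrow> x / t \<in> R"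
  shows "unramified R base"
proof -
  interpret RR: cring "subring_of_type R" by (rule cring_subring_of_type[OF R])
  have la: "lies_above R base" by (rule lies_above_contract(1)[OF A R m A_R])
  have sub: "max_ideal base \<subseteq> m" using la unfolding lies_above_def by simp
  have idm: "ideal m (subring_of_type R)" using m by (rule primeideal.axioms(1))
  have "Idl\<^bsub>subring_of_type R\<^esub> (max_ideal base) = m"
  proof
    show "Idl\<^bsub>subring_of_type R\<^esub> (max_ideal base) \<subseteq> m" by (rule RR.genideal_minimal[OF idm sub])
    have idI: "ideal (Idl\<^bsub>subring_of_type R\<^esub> (max_ideal base)) (subring_of_type R)"
      using sub m_R by (intro RR.genideal_ideal) auto
    have "t \<in> Idl\<^bsub>subring_of_type R\<^esub> (max_ideal base)"
      using t_base RR.genideal_self[of "max_ideal base"] sub m_R by auto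
    then have "t * (x / t) \<in> Idl\<^bsub>subring_of_type R\<^esub> (max_ideal base)" if "x \<in> m" for x
      using ideal.I_r_closed[OF idI, of t "x / t"] assms[OF that] by simp
    then show "m \<subseteq> Idl\<^bsub>subring_of_type R\<^esub> (max_ideal base)" by auto
  qed
  moreover have "\<exists>f. set (Polynomial.coeffs f) \<subseteq> base \<and> poly f a \<in> m \<and> poly (Polynomial.pderiv f) a \<notin> m" if a: "a \<in> R" for a
  proof -
    obtain c where c: "a - \<kappa> c \<in> m" using residue_R[OF a] by blast
    have "[:- \<kappa> c, 1:] \<in> polys base" using K_base base by (auto intro!: polys_pCons sring_uminus)
    moreover have "poly [:- \<kappa> c, 1:] a \<in> m" using c by simp
    moreover have "poly (Polynomial.pderiv [:- \<kappa> c, 1:]) a \<notin> m" using prime_1[OF R m] by (simp add: pderiv_pCons)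
    ultimately show ?thesis using coeffs_subset_iff[OF base] by blast
  qed
  ultimately show ?thesis unfolding unramified_def using la by blast
qed

lemma unramifiedD:
  assumes W: "sring W" "base \<subseteq> W" and un: "unramified W base"
  shows "max_ideal W \<subseteq> (*) t ` W"
proof -
  have "t \<in> W" using t_base W(2) max_ideal_eq[OF base] by auto
  moreover have "max_ideal base \<subseteq> (*) t ` W" using max_ideal_base W(2) by auto
  ultimately have "Idl\<^bsub>subring_of_type W\<^esub> (max_ideal base) \<subseteq> (*) t ` W" by (rule genideal_least[OF W(1)])
  then show ?thesis using un unfolding unramified_def by simp
qed

text \<open>
  As \<open>t\<close> generates the maximal ideal of \<open>W\<close>, the elements of \<open>W\<close> have
  Taylor expansions in \<open>t\<close>.
\<close>

lemma unramified_below_inertia_trivial: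
  assumes W: "sring W" "W \<subseteq> R" "max_ideal W = m \<inter> W" "base \<subseteq> W" and un: "unramified W base"
    and quot: "\<And>a. a \<in> N \<Longrightarrow> \<exists>b\<in>W. \<exists>d\<in>W. d \<noteq> 0 \<and> a = b / d" and s: "\<sigma> \<in> inertia"
  shows "\<sigma> = \<one>\<^bsub>\<Gamma>\<^esub>"
proof (rule gal_ext[OF inertia_Gal[OF s] gal.one_closed])
  have fixW: "\<sigma> a = a" if a: "a \<in> W" for a
  proof (rule inertia_taylor[OF W(2) _ s a])
    fix a assume a: "a \<in> W"
    then obtain c where c: "a - \<kappa> c \<in> m" using residue_R W(2) by blast
    have "\<kappa> c \<in> W" using K_base W(4) by blast
    then have "a - \<kappa> c \<in> max_ideal W" unfolding W(3) using c sring_diff[OF W(1) a] by simp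
    then obtain w where "w \<in> W" "a - \<kappa> c = t * w" using unramifiedD[OF W(1,4) un] by auto
    then have "w \<in> W" "a = \<kappa> c + t * w" by (auto simp: algebra_simps)
    then show "\<exists>c. \<exists>w\<in>W. a = \<kappa> c + t * w" by blast
  qed
  fix a assume a: "a \<in> N"
  then obtain b d where bd: "b \<in> W" "d \<in> W" "d \<noteq> 0" "a = b / d" using quot by blast
  have "\<sigma> a = \<sigma> b / \<sigma> d" unfolding bd(4) using bd W(2) R_N by (intro gal_divide[OF inertia_Gal[OF s]]) auto
  then show "\<sigma> a = \<one>\<^bsub>\<Gamma>\<^esub> a" using fixW[OF bd(1)] fixW[OF bd(2)] gal_one[OF a] bd(4) by simp
qed

end

context line_ext
begin

lemma max_ideal_below:
  assumes V: "sring V" "primeideal (max_ideal V) (subring_of_type V)"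
    and I: "primeideal I (subring_of_type A)" and la: "lies_above V (localization_at A I)"
  shows "I = max_ideal V \<inter> A"
proof
  have AV: "localization_at A I \<subseteq> V" "max_ideal (localization_at A I) \<subseteq> max_ideal V"
    using la unfolding lies_above_def by auto
  show "I \<subseteq> max_ideal V \<inter> A" using AV(2) prime_sub_max_ideal[OF A I] prime_sub[OF A I] by auto
  show "max_ideal V \<inter> A \<subseteq> I"
  proof
    fix a assume a: "a \<in> max_ideal V \<inter> A"
    show "a \<in> I"
    proof (rule ccontr)
      assume "a \<notin> I"
      then have "1 / a \<in> V" "a \<noteq> 0" using a AV(1) localizationI[OF A I sring_1[OF A]] prime_0[OF A I] by auto
      then show False using a unfolding max_ideal_eq[OF V(1)] by (auto simp: inverse_eq_divide)
    qed
  qed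
qed

text \<open>At the generic point the maximal ideals are zero, and separability is witnessed by \<open>orbit_poly\<close>.\<close>

lemma unramified_generic:
  assumes I: "primeideal I (subring_of_type A)" and la: "lies_above N (localization_at A I)"
  shows "unramified N (localization_at A I)"
proof -
  have "I = max_ideal N \<inter> A"
    using la zero_prime[OF N] by (intro max_ideal_below[OF N _ I]) (simp add: max_ideal_N)
  then have I0: "I = {0}" using max_ideal_N A by auto
  have FI: "F \<subseteq> localization_at A I"
  proof
    fix a assume "a \<in> F"
    then obtain d b where "d \<in> A" "d \<noteq> 0" "b \<in> A" "a = b / d" by (rule F_cases)
    then show "a \<in> localization_at A I" unfolding I0 localization_at_def by blast
  qed
  have "max_ideal (localization_at A I) = {0}"
    using max_ideal_localization[OF A I] I0 prime_1[OF A I] sring_1[OF A] by auto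
  moreover have "Idl\<^bsub>subring_of_type N\<^esub> {0} = {0}"
  proof -
    interpret NN: cring "subring_of_type N" by (rule cring_subring_of_type[OF N])
    have "Idl\<^bsub>subring_of_type N\<^esub> {0} \<subseteq> {0}" using genideal_least[OF N sring_0[OF N], of "{0}"] N by auto
    moreover have "{0} \<subseteq> Idl\<^bsub>subring_of_type N\<^esub> {0}" using NN.genideal_self[of "{0}"] N by auto
    ultimately show ?thesis by blast
  qed
  moreover have "\<exists>f. set (Polynomial.coeffs f) \<subseteq> localization_at A I \<and> poly f a \<in> max_ideal N \<and> poly (Polynomial.pderiv f) a \<notin> max_ideal N"
    if a: "a \<in> N" for a
    using orbit_poly_polys[OF a] orbit_poly_simple_roots[OF a] FI coeffs_subset_iff[OF F] unfolding max_ideal_N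
    by (intro exI[of _ "orbit_poly a"]) auto
  ultimately show ?thesis unfolding unramified_def using la max_ideal_N by simp
qed

text \<open>
  The local ring of \<open>B'\<close> at a regular point is maximal with respect to domination, so it is the local
  ring of \<open>B\<close> at a point above it.
\<close>

lemma regular_point_is_place:
  assumes B': "sring B'" "A \<subseteq> B'" "B' \<subseteq> B" and I: "primeideal I (subring_of_type B')" "u - \<kappa> \<alpha> \<in> I"
    and pi: "\<pi> \<in> localization_at B' I" "max_ideal (localization_at B' I) = PIdl\<^bsub>subring_of_type (localization_at B' I)\<^esub> \<pi>"
    and quot: "\<And>a. a \<in> N \<Longrightarrow> \<exists>b\<in>B'. \<exists>d\<in>B'. d \<noteq> 0 \<and> a = b / d"
  obtains q where "place \<kappa> u F N q \<alpha>" "localization_at B q = localization_at B' I"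
proof -
  obtain q where qq: "primeideal q (subring_of_type B)" "q \<inter> B' = I" using lying_over[OF B' I] by blast
  have pl: "place \<kappa> u F N q \<alpha>"
    using qq I(2) by (intro place.intro line_ext_axioms place_axioms.intro) auto
  interpret place \<kappa> u F N q \<alpha> by (rule pl)
  let ?W = "localization_at B' I"
  note W = sring_localization[OF B'(1) I(1)]
  have inv: "1 / s \<in> R" if "s \<in> B'" "s \<notin> I" for s
    using that qq(2) B'(3) sring_1[OF B] by (intro localizationI[OF B qq(1)]) auto
  have WR: "?W \<subseteq> R"
  proof
    fix a assume "a \<in> ?W"
    then obtain b s where bs: "b \<in> B'" "s \<in> B'" "s \<notin> I" "a = b / s" by (rule localizationE[OF B'(1) I(1)])
    then have "b * (1 / s) \<in> R" using B'(3) B_R inv by (intro sring_mult[OF R]) auto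
    then show "a \<in> R" using bs by simp
  qed
  have Wm: "max_ideal ?W \<subseteq> m"
  proof
    fix a assume "a \<in> max_ideal ?W"
    then obtain b s where bs: "b \<in> I" "s \<in> B'" "s \<notin> I" "a = b / s"
      unfolding max_ideal_localization[OF B'(1) I(1)] by auto
    then have "b * (1 / s) \<in> m" using qq(2) q_m inv by (intro prime_multR[OF R m]) auto
    then show "a \<in> m" using bs by simp
  qed
  have P: "max_ideal ?W = (*) \<pi> ` ?W" unfolding pi(2) cgenideal_def by (auto simp: mult.commute)
  have "?W = R"
  proof (rule regular_dominated_eq[OF W WR Wm pi(1) P])
    fix a assume "a \<in> N"
    then show "\<exists>b\<in>?W. \<exists>d\<in>?W. d \<noteq> 0 \<and> a = b / d"
      using quot localization_sub[OF B'(1) I(1)] by blast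
  qed
  then show thesis using that pl by simp
qed

text \<open>
  The coordinate ring of the affine part of a cover is integral over \<open>A\<close>. Its field of fractions is
  \<open>N\<close> because the generic point of the cover lies in the affine part.
\<close>

lemma cover_algebra:
  assumes C: "finite_over_affine C A" "\<Union>C = N" "N \<in> C"
  obtains B' where "sring B'" "A \<subseteq> B'" "B' \<subseteq> B" "{Q \<in> C. \<exists>z\<in>spec A. lies_above Q z} = spec B'"
    "\<And>a. a \<in> N \<Longrightarrow> \<exists>b\<in>B'. \<exists>d\<in>B'. d \<noteq> 0 \<and> a = b / d"
proof -
  obtain B' where B': "sring B'" "A \<subseteq> B'" "finite_module A B'" "{Q \<in> C. \<exists>z\<in>spec A. lies_above Q z} = spec B'"
    using C(1) unfolding finite_over_affine_def by blast
  have "lies_above N (localization_at A (max_ideal N \<inter> A))" "localization_at A (max_ideal N \<inter> A) \<in> spec A"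
    using lies_above_contract[OF A N _ A_N] zero_prime[OF N] max_ideal_N by auto
  then have "N \<in> spec B'" unfolding B'(4)[symmetric] using C(3) by blast
  then obtain I where I: "primeideal I (subring_of_type B')" "N = localization_at B' I" unfolding spec_def by auto
  have BN: "B' \<subseteq> N" unfolding I(2) by (rule localization_sub[OF B'(1) I(1)])
  have "B' \<subseteq> B" by (rule finite_module_integral[OF A N A_N B'(1) BN B'(3,2)])
  moreover have "\<exists>b\<in>B'. \<exists>d\<in>B'. d \<noteq> 0 \<and> a = b / d" if "a \<in> N" for a
    using that localizationE[OF B'(1) I(1), of a] unfolding I(2)[symmetric] by blast
  ultimately show thesis using that B' by blast
qed

end

context curve
begin

text \<open>The local ring of the line at \<open>y = 0\<close>.\<close>

definition infinity :: "'a set" where "infinity = localization_at Y.A {Y.ev f | f. poly f 0 = 0}"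

lemma infinity_place:
  assumes "place \<kappa> y F N q 0"
  shows "localization_at Y.A (max_ideal (localization_at Y.B q) \<inter> Y.A) = infinity"
  unfolding infinity_def using place.m_A[OF assms] by simp

lemma x_infinity: "x \<notin> infinity"
proof
  assume "x \<in> infinity"
  then obtain a s where as: "a \<in> Y.A" "s \<in> Y.A" "s \<notin> {Y.ev f | f. poly f 0 = 0}" "x = a / s"
    unfolding infinity_def localization_at_def by blast
  obtain f where f: "s = Y.ev f" using as(2) by (rule Y.A_E)
  obtain g where g: "a = Y.ev g" using as(1) by (rule Y.A_E)
  have "poly f 0 \<noteq> 0" using as(3) f by blast
  then have "s \<noteq> 0" using f by auto
  then have "s = y * a" using as(4) by (simp add: y field_simps)
  then have "Y.ev f = Y.ev ([:0, 1:] * g)" unfolding f g Y.evat_mult by (simp add: Y.evat_linear)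
  then have "f = [:0, 1:] * g" by (simp only: Y.ev_eq_iff)
  then have "poly f 0 = 0" by simp
  then show False using \<open>poly f 0 \<noteq> 0\<close> by simp
qed

text \<open>
  A point of the chart with coordinate \<open>y\<close> belongs to the other chart unless \<open>y\<close>
  vanishes there.
\<close>

lemma finite_points:
  assumes z: "z \<in> spec X.A \<union> spec Y.A" "z \<noteq> infinity"
  shows "z \<in> spec X.A"
proof (cases "z \<in> spec X.A")
  case False
  then obtain I where I: "primeideal I (subring_of_type Y.A)" "z = localization_at Y.A I"
    using z unfolding spec_def by auto
  have c1: "chart X.K {1, x} 1 = X.A" unfolding chart_def using X.A_generated by simp
  have cx: "chart X.K {1, x} x = Y.A" unfolding chart_def using Y.A_generated by (simp add: y inverse_eq_divide)
  have "y \<notin> I"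
  proof
    assume yI: "y \<in> I"
    have "Y.ev f \<in> I \<longleftrightarrow> poly f 0 = 0" for f
    proof -
      obtain a where a: "a \<in> Y.A" "Y.ev f - \<kappa> (poly f 0) = y * a" using Y.ev_root[of f 0] by auto
      have ya: "y * a \<in> I" by (rule prime_multR[OF Y.A I(1) yI a(1)])
      show ?thesis
      proof
        assume "Y.ev f \<in> I"
        then have "Y.ev f - y * a \<in> I" using ya by (rule prime_diff[OF Y.A I(1)])
        moreover have "Y.ev f - y * a = \<kappa> (poly f 0)" using a(2) by (simp add: algebra_simps)
        ultimately show "poly f 0 = 0" using Y.\<kappa>_notin_prime[OF Y.A I(1) Y.K_subset] by simp
      next
        assume "poly f 0 = 0"
        then show "Y.ev f \<in> I" using a(2) ya by simp
      qed
    qed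
    then have "I = {Y.ev f | f. poly f 0 = 0}" using prime_sub[OF Y.A I(1)] Y.A_E by blast
    then show False using z(2) I(2) unfolding infinity_def by simp
  qed
  then have "localization_at (chart X.K {1, x} x) I \<in> spec (chart X.K {1, x} 1)"
    using I(1) unfolding cx[symmetric] by (intro chart_change) (auto simp: y inverse_eq_divide)
  then show ?thesis using I(2) unfolding c1 cx by simp
qed

text \<open>
  A closed point above the affine line is a place of \<open>X.B\<close>, where trivial inertia makes
  \<open>t\<close> a generator of the maximal ideal.
\<close>

lemma unramified_outside_infinity:
  assumes triv: "\<And>q \<alpha> \<sigma>. place \<kappa> x F N q \<alpha> \<Longrightarrow> \<sigma> \<in> inertia_group F N (localization_at X.B q) \<Longrightarrow> \<sigma> = \<one>\<^bsub>X.\<Gamma>\<^esub>"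
    and z: "z \<in> spec X.A \<union> spec Y.A" "z \<noteq> infinity" and Q: "Q \<in> points" "lies_above Q z"
  shows "unramified Q z"
proof -
  have "z \<in> spec X.A" by (rule finite_points[OF z])
  then obtain I where I: "primeideal I (subring_of_type X.A)" "z = localization_at X.A I" unfolding spec_def by auto
  have "X.A \<subseteq> Q" using Q(2) localization_sub[OF X.A I(1)] unfolding lies_above_def I(2) by auto
  then have "Q \<in> spec X.B" using points_properties[OF Q(1)] by (intro X.valuation_ring_in_spec)
  then show ?thesis
  proof (cases rule: X.spec_B_cases)
    case generic
    then show ?thesis using X.unramified_generic[OF I(1)] Q(2) unfolding I(2) by simp
  next
    case (place q \<alpha>)
    interpret P: place \<kappa> x F N q \<alpha> by (rule place(1))
    have "I = max_ideal P.R \<inter> X.A"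
      using Q(2) unfolding I(2) place(2) by (intro X.max_ideal_below[OF P.R P.m I(1)])
    moreover have "unramified P.R P.base"
      using triv[OF place(1)] by (intro P.unramifiedI P.trivial_inertia_unramified)
    ultimately show ?thesis unfolding I(2) place(2) by simp
  qed
qed

lemma ramified_at_infinity:
  assumes pl: "place \<kappa> y F N q 0" and s: "\<sigma> \<in> inertia_group F N (localization_at Y.B q)" "\<sigma> \<noteq> \<one>\<^bsub>X.\<Gamma>\<^esub>"
  shows "localization_at Y.B q \<in> points" "lies_above (localization_at Y.B q) infinity"
    "\<not> unramified (localization_at Y.B q) infinity"
proof -
  interpret P: place \<kappa> y F N q 0 by (rule pl)
  have inf: "P.base = infinity" by (rule infinity_place[OF pl])
  show "P.R \<in> points" unfolding points_def spec_def using P.q by blast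
  show "lies_above P.R infinity" unfolding inf[symmetric] by (rule lies_above_contract(1)[OF Y.A P.R P.m P.A_R])
  show "\<not> unramified P.R infinity"
  proof
    assume "unramified P.R infinity"
    then have "max_ideal P.R \<subseteq> (*) P.t ` P.R" unfolding inf[symmetric] by (rule P.unramifiedD[OF P.R P.base_R])
    then have "x / P.t \<in> P.R" if "x \<in> max_ideal P.R" for x using that by auto
    then show False using P.unramified_inertia_trivial[OF _ s(1)] s(2) by blast
  qed
qed

text \<open>After division with remainder, the remaining proper fraction vanishes at infinity.\<close>

lemma polynomial_part_at_infinity:
  assumes pl: "place \<kappa> y F N q 0" and f: "f \<in> F"
  shows "\<exists>g. f - X.ev g \<in> max_ideal (localization_at Y.B q)"
proof -
  interpret P: place \<kappa> y F N q 0 by (rule pl)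
  obtain a b where ab: "f = X.ev a / X.ev b" using f X.F_eq by blast
  show ?thesis
  proof (cases "b = 0 \<or> Polynomial.degree b = 0")
    case True
    then have "\<exists>g. f = X.ev g"
    proof
      assume "b = 0"
      then have "f = X.ev 0" using ab by simp
      then show ?thesis ..
    next
      assume "Polynomial.degree b = 0"
      then obtain c where c: "b = [:c:]" by (metis degree_eq_zeroE)
      show ?thesis
      proof (cases "c = 0")
        case True
        then have "f = X.ev 0" using ab c by simp
        then show ?thesis ..
      next
        case False
        then have "\<kappa> c * \<kappa> (inverse c) = 1" by (simp add: X.\<kappa>_mult[symmetric])
        then have "inverse (\<kappa> c) = \<kappa> (inverse c)" by (rule inverse_unique)
        then have "f = X.ev (Polynomial.smult (inverse c) a)"
          using ab c by (simp add: X.evat_smult divide_inverse mult.commute)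
        then show ?thesis ..
      qed
    qed
    then obtain g where "f = X.ev g" by blast
    then show ?thesis using prime_0[OF P.R P.m] by (intro exI[of _ g]) simp
  next
    case False
    then have b0: "b \<noteq> 0" and d0: "Polynomial.degree b \<noteq> 0" by auto
    define g r where "g = a div b" and "r = a mod b"
    have a: "a = g * b + r" unfolding g_def r_def by simp
    have "r = 0 \<or> Polynomial.degree r < Polynomial.degree b"
      using degree_mod_less[OF b0, of a] unfolding r_def by auto
    then obtain d where d: "Polynomial.degree b = Suc d" "Polynomial.degree r \<le> d"
      using d0 by (cases "Polynomial.degree b") auto
    obtain b' where b': "Polynomial.coeff b' 0 = Polynomial.coeff b (Suc d)" "y ^ Suc d * X.ev b = Y.ev b'"
      using Y.reversal[OF x, of b "Suc d"] d(1) by auto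
    obtain r' where r': "y ^ d * X.ev r = Y.ev r'" using Y.reversal[OF x d(2)] by metis
    have c0: "poly b' 0 \<noteq> 0" using b'(1) d(1) b0 by (metis leading_coeff_0_iff poly_0_coeff_0)
    have root: "Y.ev b' - \<kappa> (poly b' 0) \<in> (*) P.t ` Y.A" using Y.ev_root[of b' 0] unfolding P.t_def .
    note unit = P.unit_near_constant[OF Y.mem_A c0 root]
    have "f - X.ev g = X.ev r / X.ev b"
      unfolding ab a using b0 by (simp add: X.evat_add X.evat_mult field_simps)
    also have "\<dots> = (y ^ Suc d * X.ev r) / (y ^ Suc d * X.ev b)" by simp
    also have "\<dots> = y * (Y.ev r' * inverse (Y.ev b'))" using b'(2) r' by (simp add: divide_inverse mult.assoc)
    also have "\<dots> \<in> max_ideal P.R"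
    proof (rule prime_multR[OF P.R P.m])
      show "y \<in> max_ideal P.R" using P.t_m unfolding P.t_def by simp
      show "Y.ev r' * inverse (Y.ev b') \<in> P.R" using P.A_R unit(2) by (intro sring_mult[OF P.R]) auto
    qed
    finally show ?thesis by blast
  qed
qed

text \<open>
  The heart of the construction. By Hilbert's Theorem 90 the cocycle is split by some \<open>z\<close>, and
  \<open>wp z - \<delta>\<close> is fixed by the inertia group. By density it differs from a rational function,
  and therefore from a polynomial in \<open>x\<close>, by a function that vanishes at the place.
\<close>

lemma split_cocycle_at_infinity:
  assumes char: "CHAR('a) > 0" and pl: "place \<kappa> y F N q 0" and \<delta>: "\<delta> \<in> N"
    and kN: "\<And>\<tau>. \<tau> \<in> inertia_group F N (localization_at Y.B q) \<Longrightarrow> k \<tau> \<in> N"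
    and cocycle: "\<And>\<sigma> \<tau>. \<sigma> \<in> inertia_group F N (localization_at Y.B q) \<Longrightarrow> \<tau> \<in> inertia_group F N (localization_at Y.B q) \<Longrightarrow>
      k (\<sigma> \<otimes>\<^bsub>X.\<Gamma>\<^esub> \<tau>) = k \<sigma> + \<sigma> (k \<tau>)"
    and wp_k: "\<And>\<tau>. \<tau> \<in> inertia_group F N (localization_at Y.B q) \<Longrightarrow> wp (k \<tau>) = \<tau> \<delta> - \<delta>"
  shows "\<exists>g. \<exists>z\<in>N. (\<forall>\<tau>\<in>inertia_group F N (localization_at Y.B q). \<tau> z = z + k \<tau>) \<and>
    (\<forall>\<tau>\<in>inertia_group F N (localization_at Y.B q). \<tau> (wp z - \<delta>) = wp z - \<delta>) \<and>
    wp z - \<delta> - X.ev g \<in> max_ideal (localization_at Y.B q)"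
proof -
  interpret P: place \<kappa> y F N q 0 by (rule pl)
  obtain z where z: "z \<in> N" "\<And>\<tau>. \<tau> \<in> P.inertia \<Longrightarrow> \<tau> z = z + k \<tau>"
    using X.hilbert90[OF P.subgroup_inertia kN cocycle] by blast
  have wz: "wp z \<in> N" unfolding wp_def using z(1) by (intro sring_diff[OF X.N] sring_power[OF X.N])
  then have gN: "wp z - \<delta> \<in> N" using \<delta> by (intro sring_diff[OF X.N])
  have fixed: "\<tau> (wp z - \<delta>) = wp z - \<delta>" if t: "\<tau> \<in> P.inertia" for \<tau>
  proof -
    note tG = P.inertia_Gal[OF t]
    have "\<tau> (wp z - \<delta>) = wp (z + k \<tau>) - \<tau> \<delta>"
      using X.gal_diff[OF tG wz \<delta>] X.gal_wp[OF tG z(1)] z(2)[OF t] by simp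
    then show ?thesis using wp_k[OF t] by (simp add: wp_add[OF char])
  qed
  obtain f where f: "f \<in> F" "(wp z - \<delta> - f) / P.t ^ 1 \<in> P.R" using P.density[OF gN, of 1] fixed by blast
  have "P.t * ((wp z - \<delta> - f) / P.t) \<in> max_ideal P.R" using f(2) by (intro prime_multR[OF P.R P.m P.t_m]) simp
  then have 1: "wp z - \<delta> - f \<in> max_ideal P.R" by simp
  obtain g where g: "f - X.ev g \<in> max_ideal P.R" using polynomial_part_at_infinity[OF pl f(1)] by blast
  have "wp z - \<delta> - X.ev g = (wp z - \<delta> - f) + (f - X.ev g)" by (simp add: algebra_simps)
  also have "\<dots> \<in> max_ideal P.R" by (rule prime_add[OF P.R P.m 1 g])
  finally have "wp z - \<delta> - X.ev g \<in> max_ideal P.R" .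
  then show ?thesis using z fixed by blast
qed

end

text \<open>
  The difference \<open>z - z0\<close> satisfies an Artin--Schreier equation whose right hand side is fixed by the
  inertia group and vanishes at the place. So the inertia group fixes \<open>z - z0\<close>.
\<close>

lemma (in place_tower) inertia_acts_by_cocycle:
  assumes char: "CHAR('a) > 0" and z: "z \<in> E" "\<And>\<tau>. \<tau> \<in> E.inertia \<Longrightarrow> \<tau> z = z + k \<tau>"
    and fixed: "\<And>\<tau>. \<tau> \<in> E.inertia \<Longrightarrow> \<tau> (wp z - \<delta>) = wp z - \<delta>" and \<delta>: "\<delta> \<in> E"
    and near: "wp z - \<delta> - g \<in> max_ideal E.R" and g: "g \<in> F" and z0: "z0 \<in> N" "wp z0 = \<delta> + g" and t: "\<tau> \<in> inertia"
  shows "\<tau> z0 = z0 + k (restrict \<tau> E)"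
proof -
  note rt = restrict_inertia[OF t] and tG = inertia_Gal[OF t]
  have zN: "z \<in> N" using z(1) EN by auto
  have wz: "wp z \<in> E" unfolding wp_def using z(1) by (intro sring_diff[OF E.N] sring_power[OF E.N])
  have eq: "wp (z - z0) = wp z - \<delta> - g" using z0(2) by (simp add: wp_diff[OF char])
  have gE: "g \<in> E" using g E.F_subset by auto
  have dE: "wp z - \<delta> \<in> E" using wz \<delta> by (rule sring_diff[OF E.N])
  have "\<tau> (wp z - \<delta> - g) = wp z - \<delta> - g"
  proof -
    have "\<tau> (wp z - \<delta> - g) = \<tau> (wp z - \<delta>) - \<tau> g" using dE gE EN by (intro gal_diff[OF tG]) auto
    also have "\<tau> (wp z - \<delta>) = wp z - \<delta>" using fixed[OF rt] dE by simp
    also have "\<tau> g = g" using g tG by simp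
    finally show ?thesis .
  qed
  then have fx: "\<tau> (wp (z - z0)) = wp (z - z0)" unfolding eq .
  have wR: "wp (z - z0) \<in> R" unfolding eq using near m_E m_R by auto
  have vN: "z - z0 \<in> N" using zN z0(1) by (rule sring_diff[OF N])
  have "\<tau> (z - z0) = z - z0" by (rule inertia_fixes_root[OF char vN wR t fx])
  then have "\<tau> z - \<tau> z0 = z - z0" using gal_diff[OF tG zN z0(1)] by simp
  moreover have "\<tau> z = z + k (restrict \<tau> E)" using z(2)[OF rt] z(1) by simp
  ultimately show ?thesis by (simp add: algebra_simps)
qed

section \<open>Cyclic extensions of degree the square of the characteristic\<close>

text \<open>
  The maps \<open>(y, z) \<mapsto> (y + n, z + cs n y)\<close> form an action of the integers that factors through the integers modulo
  \<open>p ^ 2\<close>, because \<open>cs p = 1\<close>.  The function \<open>ds\<close> is chosen such that \<open>wp z - ds y\<close> is invariant; it is the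
  solution of \<open>ds (y + 1) - ds y = wp (trace_unit y)\<close> given by the additive form of Hilbert's Theorem 90, since
  \<open>trace_unit\<close> has trace one with respect to the translation by one.
\<close>

definition trace_unit :: "'a::Fields.field \<Rightarrow> 'a" where "trace_unit y = 1 - y ^ (CHAR('a) - 1)"

definition cs :: "nat \<Rightarrow> 'a::Fields.field \<Rightarrow> 'a" where "cs n y = (\<Sum>l<n. trace_unit (y + of_nat l))"

definition ds :: "'a::Fields.field \<Rightarrow> 'a" where
  "ds y = - (\<Sum>i<CHAR('a). wp (cs i y) * trace_unit (y + of_nat i))"

lemma cs_0 [simp]: "cs 0 y = 0" and cs_Suc: "cs (Suc n) y = cs n y + trace_unit (y + of_nat n)"
  by (simp_all add: cs_def)

lemma cs_add: "cs (i + n) y = cs i y + cs n (y + of_nat i)"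
  by (induction n) (auto simp: cs_Suc add.assoc)

lemma of_nat_mod_char:
  assumes "CHAR('a) dvd k"
  shows "(of_nat (n mod k) :: 'a::Fields.field) = of_nat n"
proof -
  have "(of_nat k :: 'a) = 0" using assms by (simp add: of_nat_eq_0_iff_char_dvd)
  then have "(of_nat (k * (n div k)) :: 'a) = 0" by simp
  moreover have "(of_nat n :: 'a) = of_nat (k * (n div k)) + of_nat (n mod k)"
    by (subst of_nat_add[symmetric]) simp
  ultimately show ?thesis by simp
qed

context
  assumes char: "CHAR('a::Fields.field) > 0"
begin

text \<open>
  On the prime field \<open>trace_unit\<close> is one at zero and zero elsewhere, so the sum over a full orbit of
  the translation is one there.
\<close>

lemma trace_unit_one: "cs CHAR('a) (y :: 'a) = 1"
proof -
  let ?p = "CHAR('a)"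
  have p2: "2 \<le> ?p" using prime_char[OF char] by (rule prime_ge_2_nat)
  have shift: "cs ?p (y + 1) = cs ?p y" for y :: 'a
  proof -
    have "cs (1 + ?p) y = cs (?p + 1) y" by (simp add: add.commute)
    then have "cs 1 y + cs ?p (y + of_nat 1) = cs ?p y + cs 1 (y + of_nat ?p)" by (simp only: cs_add)
    then show ?thesis by simp
  qed
  have at_0: "cs ?p (0 :: 'a) = 1"
  proof -
    have "trace_unit (of_nat l :: 'a) = (if l = 0 then 1 else 0)" if l: "l < ?p" for l
    proof (cases "l = 0")
      case True
      then show ?thesis using p2 by (simp add: trace_unit_def zero_power)
    next
      case False
      then have nz: "(of_nat l :: 'a) \<noteq> 0" using l by (intro of_nat_char_less[OF char]) auto
      have "(of_nat l :: 'a) ^ (?p - 1) * of_nat l = of_nat l ^ Suc (?p - 1)" by (simp only: power_Suc2)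
      also have "Suc (?p - 1) = ?p" using p2 by simp
      finally have "(of_nat l :: 'a) ^ (?p - 1) * of_nat l = 1 * of_nat l" by (simp add: frobenius_of_nat[OF char])
      then have "(of_nat l :: 'a) ^ (?p - 1) = 1" using nz by (simp only: mult_cancel_right) simp
      then show ?thesis using False by (simp add: trace_unit_def)
    qed
    then have "cs ?p (0 :: 'a) = (\<Sum>l<?p. if l = 0 then 1 else 0)" unfolding cs_def by (intro sum.cong) auto
    then show ?thesis using char by simp
  qed
  have at_nat: "cs ?p (of_nat i :: 'a) = 1" for i
  proof (induction i)
    case (Suc i)
    then show ?case using shift[of "of_nat i"] by (simp add: add.commute)
  qed (simp add: at_0)
  \<comment> \<open>a polynomial of degree less than \<open>p\<close> with \<open>p\<close> zeros\<close>
  define f :: "'a poly" where "f = (\<Sum>l<?p. 1 - [:of_nat l, 1:] ^ (?p - 1)) - 1"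
  have ev: "poly f y = cs ?p y - 1" for y
    unfolding f_def cs_def trace_unit_def by (simp add: poly_sum add.commute)
  have deg: "Polynomial.degree f \<le> ?p - 1" unfolding f_def
    by (intro degree_diff_le degree_sum_le) (auto intro: le_trans[OF degree_power_le] degree_diff_le)
  have "f = 0"
  proof (rule ccontr)
    assume f0: "f \<noteq> 0"
    have "?p = card (of_nat ` {..<?p} :: 'a set)" by (simp add: card_image[OF inj_on_of_nat_char[OF char]])
    also have "\<dots> \<le> card {x. poly f x = 0}" using at_nat ev by (intro card_mono poly_roots_finite[OF f0]) auto
    also have "\<dots> \<le> Polynomial.degree f" by (rule card_poly_roots_bound[OF f0])
    also have "\<dots> \<le> ?p - 1" by (rule deg)
    finally show False using char by simp
  qed
  then show ?thesis using ev[of y] by simp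
qed

lemma cs_char_mult: "cs (CHAR('a) * j) (y :: 'a) = of_nat j"
  by (induction j) (auto simp: cs_add trace_unit_one add.commute)

lemma cs_add_char_mult: "cs (i + CHAR('a) * j) (y :: 'a) = cs i y + of_nat j"
  by (simp add: cs_add cs_char_mult)

lemma cs_mod: "cs (n mod CHAR('a) ^ 2) (y :: 'a) = cs n y"
proof -
  have "cs n y = cs (n mod CHAR('a) ^ 2 + CHAR('a) * (CHAR('a) * (n div CHAR('a) ^ 2))) y"
    by (simp add: power2_eq_square mult.assoc[symmetric])
  then show ?thesis by (simp only: cs_add_char_mult of_nat_mult of_nat_CHAR) simp
qed

lemma ds_step: "ds (y + 1 :: 'a) = ds y + wp (trace_unit y)"
proof -
  let ?p = "CHAR('a)"
  let ?h = "\<lambda>i. wp (cs i y) * trace_unit (y + of_nat i)"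
  have c1: "cs (Suc i) y = trace_unit y + cs i (y + 1)" for i
    using cs_add[of 1 i y] by (simp add: cs_def)
  have "- ds (y + 1) = (\<Sum>i<?p. wp (cs i (y + 1)) * trace_unit (y + 1 + of_nat i))" by (simp add: ds_def)
  also have "\<dots> = (\<Sum>i<?p. ?h (Suc i) - wp (trace_unit y) * trace_unit (y + 1 + of_nat i))"
  proof (rule sum.cong[OF refl])
    fix i
    have "wp (cs (Suc i) y) = wp (trace_unit y) + wp (cs i (y + 1))" unfolding c1 by (rule wp_add[OF char])
    then show "wp (cs i (y + 1)) * trace_unit (y + 1 + of_nat i) = ?h (Suc i) - wp (trace_unit y) * trace_unit (y + 1 + of_nat i)"
      by (simp add: algebra_simps)
  qed
  also have "\<dots> = (\<Sum>i<?p. ?h (Suc i)) - wp (trace_unit y) * cs ?p (y + 1)"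
    by (simp add: sum_subtractf sum_distrib_left cs_def)
  also have "(\<Sum>i<?p. ?h (Suc i)) = (\<Sum>i<?p. ?h i)"
  proof -
    have "(\<Sum>i<Suc ?p. ?h i) = ?h 0 + (\<Sum>i<?p. ?h (Suc i))" by (rule sum.lessThan_Suc_shift)
    moreover have "(\<Sum>i<Suc ?p. ?h i) = (\<Sum>i<?p. ?h i) + ?h ?p" by (rule sum.lessThan_Suc)
    moreover have "?h 0 = 0" unfolding cs_0 using wp_of_nat[OF char, of 0] by (simp only: of_nat_0 mult_zero_left)
    moreover have "?h ?p = 0" unfolding trace_unit_one using wp_of_nat[OF char, of 1] by (simp only: of_nat_1 mult_zero_left)
    ultimately show ?thesis by (simp only: add_0_left add_0_right)
  qed
  also have "(\<Sum>i<?p. ?h i) = - ds y" by (simp add: ds_def)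
  finally show ?thesis by (simp add: trace_unit_one algebra_simps)
qed

lemma ds_cs: "ds (y + of_nat n :: 'a) = ds y + wp (cs n y)"
proof (induction n)
  case 0
  then show ?case using wp_of_nat[OF char, of 0] by simp
next
  case (Suc n)
  have "ds (y + of_nat (Suc n)) = ds (y + of_nat n) + wp (trace_unit (y + of_nat n))"
    using ds_step[of "y + of_nat n"] by (simp add: ac_simps)
  then show ?case using Suc.IH by (simp add: cs_Suc wp_add[OF char])
qed

end

lemma cs_mem: "sring A \<Longrightarrow> y \<in> A \<Longrightarrow> cs n y \<in> A"
  unfolding cs_def trace_unit_def
  by (intro sring_sum sring_diff sring_power sring_add sring_of_nat sring_1)

lemma ds_mem: "sring A \<Longrightarrow> y \<in> A \<Longrightarrow> ds y \<in> A"
  unfolding ds_def wp_def trace_unit_def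
  by (intro sring_uminus sring_sum sring_mult sring_diff sring_power sring_add sring_of_nat sring_1 cs_mem)

context galois
begin

lemma gal_trace_unit: "\<sigma> \<in> Gal \<Longrightarrow> y \<in> N \<Longrightarrow> \<sigma> (trace_unit y) = trace_unit (\<sigma> y)"
  unfolding trace_unit_def using N by (simp add: gal_diff gal_power sring_power)

lemma trace_unit_mem: "y \<in> N \<Longrightarrow> trace_unit (y + of_nat l) \<in> N"
  unfolding trace_unit_def using N by (intro sring_diff sring_power sring_add sring_of_nat sring_1)

lemma gal_translate: "\<sigma> \<in> Gal \<Longrightarrow> y \<in> N \<Longrightarrow> \<sigma> (trace_unit (y + of_nat l)) = trace_unit (\<sigma> y + of_nat l)"
  using gal_trace_unit[of \<sigma> "y + of_nat l"] gal_add[of \<sigma> y "of_nat l"] sring_of_nat[OF N] sring_add[OF N] by simp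

lemma gal_cs: "\<sigma> \<in> Gal \<Longrightarrow> y \<in> N \<Longrightarrow> \<sigma> (cs n y) = cs n (\<sigma> y)"
  unfolding cs_def by (subst gal_sum) (auto simp: gal_translate trace_unit_mem)

lemma wp_mem: "a \<in> N \<Longrightarrow> wp a \<in> N"
  unfolding wp_def by (intro sring_diff[OF N] sring_power[OF N])

lemma gal_ds: "\<sigma> \<in> Gal \<Longrightarrow> y \<in> N \<Longrightarrow> \<sigma> (ds y) = ds (\<sigma> y)"
proof -
  assume s: "\<sigma> \<in> Gal" and y: "y \<in> N"
  have mem: "wp (cs i y) * trace_unit (y + of_nat i) \<in> N" for i
    by (intro sring_mult[OF N] wp_mem cs_mem[OF N y] trace_unit_mem[OF y])
  have "\<sigma> (ds y) = - (\<Sum>i<CHAR('a). \<sigma> (wp (cs i y) * trace_unit (y + of_nat i)))"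
    unfolding ds_def using s mem by (simp add: gal_uminus sring_sum[OF N] gal_sum)
  also have "(\<Sum>i<CHAR('a). \<sigma> (wp (cs i y) * trace_unit (y + of_nat i))) = (\<Sum>i<CHAR('a). wp (cs i (\<sigma> y)) * trace_unit (\<sigma> y + of_nat i))"
    by (intro sum.cong refl)
      (simp add: gal_mult[OF s wp_mem[OF cs_mem[OF N y]] trace_unit_mem[OF y]] gal_wp[OF s cs_mem[OF N y]] gal_cs[OF s y] gal_translate[OF s y])
  finally show ?thesis by (simp add: ds_def)
qed

end

text \<open>
  A Galois cover of the projective line that is unramified outside infinity, with a point \<open>q\<close> above
  infinity.
\<close>

locale unramified_cover = curve \<kappa> x y F N
  for \<kappa> :: "'k::alg_closed_field \<Rightarrow> 'a::alg_closed_field" and x y :: 'a and F N :: "'a set" +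
  fixes q :: "'a set"
  assumes pl: "place \<kappa> y F N q 0"
    and triv: "\<And>q \<alpha> \<sigma>. place \<kappa> x F N q \<alpha> \<Longrightarrow> \<sigma> \<in> inertia_group F N (localization_at X.B q) \<Longrightarrow> \<sigma> = \<one>\<^bsub>X.\<Gamma>\<^esub>"
    and char: "CHAR('a) > 0"
begin

abbreviation inertia where "inertia \<equiv> inertia_group F N (localization_at Y.B q)"

lemma exists_root: "\<exists>z. wp z = (a :: 'a)"
proof -
  let ?f = "Polynomial.monom 1 CHAR('a) - [:a, 1:] :: 'a poly"
  have p2: "2 \<le> CHAR('a)" using prime_char[OF char] by (rule prime_ge_2_nat)
  have "Polynomial.coeff ?f CHAR('a) = 1" using p2 by (auto simp: coeff_pCons split: nat.splits)
  then have "CHAR('a) \<le> Polynomial.degree ?f" by (intro le_degree) simp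
  then have "Polynomial.degree ?f > 0" using p2 by simp
  then obtain z where "poly ?f z = 0" using alg_closed_imp_poly_has_root by blast
  then show ?thesis by (intro exI[of _ z]) (simp add: wp_def poly_monom algebra_simps)
qed

text \<open>
  One Artin--Schreier step. The polynomial \<open>g\<close> is the one of
  \<open>split_cocycle_at_infinity\<close>; it prescribes the action of the inertia group at infinity and, being
  regular on the affine line, causes no ramification there. If the equation had a solution in \<open>N\<close>,
  the inertia group would act on it in the same way; \<open>nosol\<close> excludes this.
\<close>

lemma extend_cover:
  assumes \<delta>: "\<delta> \<in> N" and lift: "\<And>\<sigma>. \<sigma> \<in> X.Gal \<Longrightarrow> \<exists>c\<in>N. wp c = \<sigma> \<delta> - \<delta>"
    and integral: "\<And>q \<alpha>. place \<kappa> x F N q \<alpha> \<Longrightarrow> \<delta> \<in> localization_at X.B q"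
    and kN: "\<And>\<tau>. \<tau> \<in> inertia \<Longrightarrow> k \<tau> \<in> N"
    and cocycle: "\<And>\<sigma> \<tau>. \<sigma> \<in> inertia \<Longrightarrow> \<tau> \<in> inertia \<Longrightarrow> k (\<sigma> \<otimes>\<^bsub>X.\<Gamma>\<^esub> \<tau>) = k \<sigma> + \<sigma> (k \<tau>)"
    and wp_k: "\<And>\<tau>. \<tau> \<in> inertia \<Longrightarrow> wp (k \<tau>) = \<tau> \<delta> - \<delta>"
    and nosol: "\<And>z g. z \<in> N \<Longrightarrow> wp z = \<delta> + X.ev g \<Longrightarrow> (\<And>\<tau>. \<tau> \<in> inertia \<Longrightarrow> \<tau> z = z + k \<tau>) \<Longrightarrow> False"
  shows "\<exists>g z q'. artin_schreier F N (\<delta> + X.ev g) z \<and> unramified_cover \<kappa> x y F (artin_schreier.L N z) q' \<and>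
    q' \<inter> Y.B = q \<and>
    (\<forall>\<tau>\<in>inertia_group F (artin_schreier.L N z) (localization_at (integral_closure Y.A (artin_schreier.L N z)) q'). \<tau> z = z + k (restrict \<tau> N))"
proof -
  interpret P: place \<kappa> y F N q 0 by (rule pl)
  obtain g z1 where z1: "z1 \<in> N" "\<And>\<tau>. \<tau> \<in> inertia \<Longrightarrow> \<tau> z1 = z1 + k \<tau>"
    "\<And>\<tau>. \<tau> \<in> inertia \<Longrightarrow> \<tau> (wp z1 - \<delta>) = wp z1 - \<delta>" "wp z1 - \<delta> - X.ev g \<in> max_ideal P.R"
    using split_cocycle_at_infinity[OF char pl \<delta> kN cocycle wp_k] by blast
  obtain z where z: "wp z = \<delta> + X.ev g" using exists_root by blast
  have gF: "X.ev g \<in> F" using X.A_F by auto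
  have "z \<notin> N"
  proof
    assume zN: "z \<in> N"
    interpret T: place_tower \<kappa> y F N N q 0
      by (intro place_tower.intro place_tower_axioms.intro pl X.galois_axioms order.refl)
    have qB: "q \<inter> Y.B = q" using prime_sub[OF Y.B P.q] by auto
    have "\<tau> z = z + k \<tau>" if t: "\<tau> \<in> inertia" for \<tau>
    proof -
      have "\<tau> z = z + k (restrict \<tau> N)"
        by (rule T.inertia_acts_by_cocycle[OF char z1(1), of k \<delta> "X.ev g" z \<tau>, unfolded qB]) (use z1 \<delta> gF zN z t in auto)
      moreover have "restrict \<tau> N = \<tau>"
      proof (rule extensional_restrict)
        show "\<tau> \<in> extensional N" using P.inertia_Gal[OF t] unfolding galois_group_mem Bij_def by blast
      qed
      ultimately show ?thesis by simp
    qed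
    then show False using nosol[OF zN z] by blast
  qed
  then have AS: "artin_schreier F N (\<delta> + X.ev g) z"
  proof (intro artin_schreier.intro artin_schreier_axioms.intro)
    show "galois F N" by (rule X.galois_axioms)
    show "0 < CHAR('a)" by (rule char)
    show "\<delta> + X.ev g \<in> N" using \<delta> gF X.F_subset by (intro sring_add[OF X.N]) auto
    show "wp z = \<delta> + X.ev g" by (rule z)
    show "\<exists>c\<in>N. wp c = \<sigma> (\<delta> + X.ev g) - (\<delta> + X.ev g)" if s: "\<sigma> \<in> X.Gal" for \<sigma>
    proof -
      have "\<sigma> (\<delta> + X.ev g) = \<sigma> \<delta> + X.ev g" using s \<delta> gF X.F_subset by (subst X.gal_add) auto
      then show ?thesis using lift[OF s] by simp
    qed
  qed
  interpret AS: artin_schreier F N "\<delta> + X.ev g" z by (rule AS)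
  let ?L = "AS.L"
  have NL: "N \<subseteq> ?L" by (rule AS.E_L)
  interpret L: galois F ?L by (rule AS.galois_L)
  interpret L: curve \<kappa> x y F ?L
    by (intro curve.intro curve_axioms.intro line_ext.intro line_ext_axioms.intro X.rational_line_axioms Y.rational_line_axioms
        L.galois_axioms X.F_eq Y.F_eq y)
  have BB: "Y.B \<subseteq> L.Y.B" by (rule integral_closure_mono[OF NL])
  obtain q' where q': "primeideal q' (subring_of_type L.Y.B)" "q' \<inter> Y.B = q"
    using L.Y.lying_over[OF Y.B Y.A_B BB P.q P.linear_q] by blast
  have pl': "place \<kappa> y F ?L q' 0"
    using q' P.linear_q by (intro place.intro L.Y.line_ext_axioms place_axioms.intro) auto
  interpret T: place_tower \<kappa> y F ?L N q' 0
    by (intro place_tower.intro place_tower_axioms.intro pl' X.galois_axioms NL)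
  have act: "\<tau> z = z + k (restrict \<tau> N)" if t: "\<tau> \<in> T.inertia" for \<tau>
    by (rule T.inertia_acts_by_cocycle[OF char z1(1), of k \<delta> "X.ev g" z \<tau>, unfolded q'(2)]) (use z1 \<delta> gF AS.z_L z t in auto)
  have "unramified_cover \<kappa> x y F ?L q'"
  proof (intro unramified_cover.intro unramified_cover_axioms.intro L.curve_axioms pl' char)
    fix q1 \<alpha> \<sigma>
    assume pl1: "place \<kappa> x F ?L q1 \<alpha>" and s: "\<sigma> \<in> inertia_group F ?L (localization_at L.X.B q1)"
    interpret U: place_tower \<kappa> x F ?L N q1 \<alpha>
      by (intro place_tower.intro place_tower_axioms.intro pl1 X.galois_axioms NL)
    have "restrict \<sigma> N = \<one>\<^bsub>X.\<Gamma>\<^esub>" by (rule triv[OF U.E.place_axioms U.restrict_inertia[OF s]])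
    then have fixN: "\<sigma> a = a" if "a \<in> N" for a using that X.gal_one[OF that] by (metis restrict_apply')
    have dg: "\<delta> + X.ev g \<in> N" using \<delta> gF X.F_subset by (intro sring_add[OF X.N]) auto
    have "\<delta> \<in> U.R" using integral[OF U.E.place_axioms] U.R_E by auto
    then have "wp z \<in> U.R" unfolding z using U.A_R by (intro sring_add[OF U.R]) auto
    moreover have "\<sigma> (wp z) = wp z" unfolding z by (rule fixN[OF dg])
    ultimately have "\<sigma> z = z" using U.inertia_fixes_root[OF char AS.z_L _ s] by blast
    then show "\<sigma> = \<one>\<^bsub>L.\<Gamma>\<^esub>"
      using fixN U.inertia_Gal[OF s] L.gal.one_closed L.gal_one NL AS.z_L by (intro AS.hom_determined) auto
  qed
  then show ?thesis using AS q'(2) act by blast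
qed

text \<open>
  Adjoin \<open>y0\<close> with the cocycle \<open>\<nu>\<close> modulo \<open>p\<close>, and then
  \<open>z0\<close> with \<open>wp z0 = ds y0 + g\<close> and the cocycle \<open>cs (\<nu> \<tau>) y0\<close>.
  Neither step is trivial: a root of the first equation in \<open>N\<close> would give an epimorphism onto the
  integers modulo \<open>p\<close>, and a root of the second one would be moved after \<open>p\<close>
  translations of \<open>y0\<close>, which are the identity.
\<close>

lemma cyclic_extension:
  fixes \<nu> :: "('a \<Rightarrow> 'a) \<Rightarrow> nat"
  assumes hom: "\<And>\<sigma> \<tau>. \<sigma> \<in> inertia \<Longrightarrow> \<tau> \<in> inertia \<Longrightarrow> \<nu> (\<sigma> \<otimes>\<^bsub>X.\<Gamma>\<^esub> \<tau>) = (\<nu> \<sigma> + \<nu> \<tau>) mod CHAR('a) ^ 2"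
    and onto: "\<And>i. i < CHAR('a) \<Longrightarrow> \<exists>\<tau>\<in>inertia. \<nu> \<tau> mod CHAR('a) = i"
    and no_epi: "epi X.\<Gamma> (integer_mod_group CHAR('a)) = {}"
  shows "\<exists>M q' y0 z0. N \<subseteq> M \<and> unramified_cover \<kappa> x y F M q' \<and> q' \<inter> Y.B = q \<and> y0 \<in> M \<and> z0 \<in> M \<and>
    (\<forall>\<sigma>\<in>X.Gal. \<forall>n. \<exists>\<theta>\<in>carrier (galois_group F M). (\<forall>a\<in>N. \<theta> a = \<sigma> a) \<and> \<theta> y0 = y0 + of_nat n \<and> \<theta> z0 = z0 + cs n y0) \<and>
    (\<forall>\<theta>\<in>carrier (galois_group F M). \<exists>n. \<theta> y0 = y0 + of_nat n \<and> \<theta> z0 = z0 + cs n y0) \<and>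
    (\<forall>\<theta>\<in>carrier (galois_group F M). \<forall>\<theta>'\<in>carrier (galois_group F M). (\<forall>a\<in>N. \<theta> a = \<theta>' a) \<longrightarrow> \<theta> y0 = \<theta>' y0 \<longrightarrow> \<theta> z0 = \<theta>' z0 \<longrightarrow> \<theta> = \<theta>') \<and>
    (\<forall>\<tau>\<in>inertia_group F M (localization_at (integral_closure Y.A M) q').
      \<tau> y0 = y0 + of_nat (\<nu> (restrict \<tau> N)) \<and> \<tau> z0 = z0 + cs (\<nu> (restrict \<tau> N)) y0)"
proof -
  let ?p = "CHAR('a)"
  interpret P: place \<kappa> y F N q 0 by (rule pl)
  have wp0: "wp (0 :: 'a) = 0" using wp_of_nat[OF char, of 0] by simp
  have dvd: "?p dvd ?p ^ 2" by (simp add: power2_eq_square)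
  have "\<exists>g z q'. artin_schreier F N (0 + X.ev g) z \<and> unramified_cover \<kappa> x y F (artin_schreier.L N z) q' \<and>
    q' \<inter> Y.B = q \<and>
    (\<forall>\<tau>\<in>inertia_group F (artin_schreier.L N z) (localization_at (integral_closure Y.A (artin_schreier.L N z)) q'). \<tau> z = z + of_nat (\<nu> (restrict \<tau> N)))"
  proof (rule extend_cover)
    show "0 \<in> N" by (rule sring_0[OF X.N])
    show "\<exists>c\<in>N. wp c = \<sigma> 0 - 0" if "\<sigma> \<in> X.Gal" for \<sigma> using that X.N wp0 by (intro bexI[of _ 0]) auto
    show "0 \<in> localization_at X.B q" if "place \<kappa> x F N q \<alpha>" for q \<alpha> by (rule sring_0[OF place.R[OF that]])
    show "of_nat (\<nu> \<tau>) \<in> N" for \<tau> by (rule sring_of_nat[OF X.N])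
    show "of_nat (\<nu> (\<sigma> \<otimes>\<^bsub>X.\<Gamma>\<^esub> \<tau>)) = of_nat (\<nu> \<sigma>) + \<sigma> (of_nat (\<nu> \<tau>))" if st: "\<sigma> \<in> inertia" "\<tau> \<in> inertia" for \<sigma> \<tau>
      using P.inertia_Gal[OF st(1)] unfolding hom[OF st] of_nat_mod_char[OF dvd] by simp
    show "wp (of_nat (\<nu> \<tau>)) = \<tau> 0 - 0" if "\<tau> \<in> inertia" for \<tau>
      using P.inertia_Gal[OF that] by (simp add: wp_of_nat[OF char])
    fix z g
    assume zN: "z \<in> N" and z: "wp z = 0 + X.ev g" and act: "\<And>\<tau>. \<tau> \<in> inertia \<Longrightarrow> \<tau> z = z + of_nat (\<nu> \<tau>)"
    \<comment> \<open>a solution in \<open>N\<close> would define an epimorphism from the Galois group to the integers modulo \<open>p\<close>\<close>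
    have ex: "\<exists>i<?p. \<sigma> z = z + of_nat i" if s: "\<sigma> \<in> X.Gal" for \<sigma>
    proof -
      have "\<sigma> (wp z) = wp z" unfolding z using s X.A_F by simp
      then have "wp (\<sigma> z - z) = 0" using X.gal_wp[OF s zN] by (simp add: wp_diff[OF char])
      then obtain i where "i < ?p" "\<sigma> z - z = of_nat i" using wp_eq_0[OF char] by blast
      then show ?thesis by (intro exI[of _ i]) (simp add: algebra_simps)
    qed
    then obtain h where h: "\<And>\<sigma>. \<sigma> \<in> X.Gal \<Longrightarrow> h \<sigma> < ?p \<and> \<sigma> z = z + of_nat (h \<sigma>)" by metis
    have inj: "i = j" if "i < ?p" "j < ?p" "(of_nat i :: 'a) = of_nat j" for i j :: nat
      by (rule inj_onD[OF inj_on_of_nat_char[OF char]]) (use that in auto)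
    have hm: "h (\<sigma> \<otimes>\<^bsub>X.\<Gamma>\<^esub> \<tau>) = (h \<sigma> + h \<tau>) mod ?p" if st: "\<sigma> \<in> X.Gal" "\<tau> \<in> X.Gal" for \<sigma> \<tau>
    proof (rule inj)
      show "h (\<sigma> \<otimes>\<^bsub>X.\<Gamma>\<^esub> \<tau>) < ?p" using h st by simp
      show "(h \<sigma> + h \<tau>) mod ?p < ?p" using char by simp
      have "z + of_nat (h (\<sigma> \<otimes>\<^bsub>X.\<Gamma>\<^esub> \<tau>)) = \<sigma> (z + of_nat (h \<tau>))"
        using h[of "\<sigma> \<otimes>\<^bsub>X.\<Gamma>\<^esub> \<tau>"] h[OF st(2)] X.gal_comp[OF st zN] st by simp
      also have "\<dots> = z + of_nat (h \<sigma>) + of_nat (h \<tau>)"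
        using X.gal_add[OF st(1) zN sring_of_nat[OF X.N]] h[OF st(1)] st by simp
      finally show "(of_nat (h (\<sigma> \<otimes>\<^bsub>X.\<Gamma>\<^esub> \<tau>)) :: 'a) = of_nat ((h \<sigma> + h \<tau>) mod ?p)"
        using of_nat_mod_char[OF dvd_refl, of "h \<sigma> + h \<tau>", where ?'a='a] by simp
    qed
    have "(\<lambda>\<sigma>. int (h \<sigma>)) \<in> hom X.\<Gamma> (integer_mod_group ?p)"
      using h hm by (intro homI) (auto simp: carrier_integer_mod_group zmod_int char)
    moreover have "(\<lambda>\<sigma>. int (h \<sigma>)) ` X.Gal = carrier (integer_mod_group ?p)"
    proof (intro equalityI subsetI)
      fix i assume "i \<in> (\<lambda>\<sigma>. int (h \<sigma>)) ` X.Gal"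
      then show "i \<in> carrier (integer_mod_group ?p)" using h char by (auto simp: carrier_integer_mod_group)
    next
      fix i assume "i \<in> carrier (integer_mod_group ?p)"
      then have i: "0 \<le> i" "i < int ?p" using char by (auto simp: carrier_integer_mod_group)
      then have "nat i < ?p" by linarith
      then obtain \<tau> where t: "\<tau> \<in> inertia" "\<nu> \<tau> mod ?p = nat i" using onto by blast
      note tG = P.inertia_Gal[OF t(1)]
      have "h \<tau> = nat i"
      proof (rule inj)
        show "h \<tau> < ?p" using h[OF tG] by simp
        show "nat i < ?p" by fact
        have "(of_nat (h \<tau>) :: 'a) = of_nat (\<nu> \<tau>)" using h[OF tG] act[OF t(1)] by simp
        also have "\<dots> = of_nat (nat i)" using of_nat_mod_char[OF dvd_refl, of "\<nu> \<tau>", where ?'a='a] t(2) by simp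
        finally show "(of_nat (h \<tau>) :: 'a) = of_nat (nat i)" .
      qed
      then have "i = int (h \<tau>)" using i by simp
      then show "i \<in> (\<lambda>\<sigma>. int (h \<sigma>)) ` X.Gal" using tG by blast
    qed
    ultimately show False using no_epi unfolding epi_def by blast
  qed
  then obtain g1 y0 q1 where AS1: "artin_schreier F N (0 + X.ev g1) y0"
    and U1: "unramified_cover \<kappa> x y F (artin_schreier.L N y0) q1" and q1: "q1 \<inter> Y.B = q"
    and act1: "\<forall>\<tau>\<in>inertia_group F (artin_schreier.L N y0) (localization_at (integral_closure Y.A (artin_schreier.L N y0)) q1).
      \<tau> y0 = y0 + of_nat (\<nu> (restrict \<tau> N))" by blast
  interpret AS1: artin_schreier F N "0 + X.ev g1" y0 by (rule AS1)
  define E where "E = AS1.L"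
  interpret U1: unramified_cover \<kappa> x y F E q1 using U1 unfolding E_def .
  have gE: "galois F E" by (rule U1.X.galois_axioms)
  have NE: "N \<subseteq> E" and y0E: "y0 \<in> E" unfolding E_def using AS1.E_L AS1.z_L by auto
  interpret T1: place_tower \<kappa> y F E N q1 0
    by (intro place_tower.intro place_tower_axioms.intro U1.pl X.galois_axioms NE)
  have rI: "restrict \<tau> N \<in> inertia" if "\<tau> \<in> U1.inertia" for \<tau>
    using T1.restrict_inertia[OF that] unfolding q1 .
  have act1: "\<tau> y0 = y0 + of_nat (\<nu> (restrict \<tau> N))" if "\<tau> \<in> U1.inertia" for \<tau>
    using act1 that unfolding E_def by blast
  have wpy0: "wp y0 = X.ev g1" using AS1.wp_z by simp
  have trans: "\<exists>i. \<sigma> y0 = y0 + of_nat i" if s: "\<sigma> \<in> U1.X.Gal" for \<sigma>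
  proof -
    have "\<sigma> (wp y0) = wp y0" unfolding wpy0 using s U1.X.A_F by simp
    then have "wp (\<sigma> y0 - y0) = 0" using U1.X.gal_wp[OF s y0E] by (simp add: wp_diff[OF char])
    then obtain i where "\<sigma> y0 - y0 = of_nat i" using wp_eq_0[OF char] by blast
    then show ?thesis by (intro exI[of _ i]) (simp add: algebra_simps)
  qed
  have wp_cs: "wp (cs n y0) = ds (y0 + of_nat n) - ds y0" for n by (simp add: ds_cs[OF char])
  have "\<exists>g z q'. artin_schreier F E (ds y0 + X.ev g) z \<and> unramified_cover \<kappa> x y F (artin_schreier.L E z) q' \<and>
    q' \<inter> U1.Y.B = q1 \<and>
    (\<forall>\<tau>\<in>inertia_group F (artin_schreier.L E z) (localization_at (integral_closure Y.A (artin_schreier.L E z)) q').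
      \<tau> z = z + cs (\<nu> (restrict (restrict \<tau> E) N)) y0)"
  proof (rule U1.extend_cover[where k="\<lambda>\<tau>. cs (\<nu> (restrict \<tau> N)) y0"])
    show "ds y0 \<in> E" by (rule ds_mem[OF U1.X.N y0E])
    show "\<exists>c\<in>E. wp c = \<sigma> (ds y0) - ds y0" if s: "\<sigma> \<in> U1.X.Gal" for \<sigma>
    proof -
      obtain i where "\<sigma> y0 = y0 + of_nat i" using trans[OF s] by blast
      then have "wp (cs i y0) = \<sigma> (ds y0) - ds y0" using U1.X.gal_ds[OF s y0E] wp_cs by simp
      then show ?thesis using cs_mem[OF U1.X.N y0E] by blast
    qed
    show "ds y0 \<in> localization_at U1.X.B q" if p': "place \<kappa> x F E q \<alpha>" for q \<alpha>
    proof -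
      have "wp y0 \<in> localization_at U1.X.B q" unfolding wpy0 using place.A_R[OF p'] by auto
      then have "y0 \<in> localization_at U1.X.B q" by (rule place.wp_mem_R[OF p' char y0E])
      then show ?thesis by (rule ds_mem[OF place.R[OF p']])
    qed
    show "cs (\<nu> (restrict \<tau> N)) y0 \<in> E" for \<tau> by (rule cs_mem[OF U1.X.N y0E])
    show "cs (\<nu> (restrict (\<sigma> \<otimes>\<^bsub>U1.X.\<Gamma>\<^esub> \<tau>) N)) y0 = cs (\<nu> (restrict \<sigma> N)) y0 + \<sigma> (cs (\<nu> (restrict \<tau> N)) y0)"
      if st: "\<sigma> \<in> U1.inertia" "\<tau> \<in> U1.inertia" for \<sigma> \<tau>
    proof -
      note G = T1.inertia_Gal[OF st(1)] T1.inertia_Gal[OF st(2)]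
      have "\<nu> (restrict (\<sigma> \<otimes>\<^bsub>U1.X.\<Gamma>\<^esub> \<tau>) N) = (\<nu> (restrict \<sigma> N) + \<nu> (restrict \<tau> N)) mod ?p ^ 2"
        unfolding restrict_galois_mult[OF X.galois_axioms gE NE G] by (rule hom[OF rI[OF st(1)] rI[OF st(2)]])
      then have "cs (\<nu> (restrict (\<sigma> \<otimes>\<^bsub>U1.X.\<Gamma>\<^esub> \<tau>) N)) y0 = cs (\<nu> (restrict \<sigma> N) + \<nu> (restrict \<tau> N)) y0"
        by (simp add: cs_mod[OF char])
      then show ?thesis using U1.X.gal_cs[OF G(1) y0E] act1[OF st(1)] by (simp add: cs_add)
    qed
    show "wp (cs (\<nu> (restrict \<tau> N)) y0) = \<tau> (ds y0) - ds y0" if t: "\<tau> \<in> U1.inertia" for \<tau>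
      using U1.X.gal_ds[OF T1.inertia_Gal[OF t] y0E] act1[OF t] wp_cs by simp
    fix z g
    assume zE: "z \<in> E" and z: "wp z = ds y0 + X.ev g"
    \<comment> \<open>the translation \<open>y0 \<mapsto> y0 + 1\<close> has order \<open>p\<close> but would move \<open>z\<close> by one after \<open>p\<close> steps\<close>
    obtain \<rho> where \<rho>: "\<rho> \<in> U1.X.Gal" "\<And>a. a \<in> N \<Longrightarrow> \<rho> a = a" "\<rho> y0 = y0 + 1"
      using AS1.lift_automorphism[OF X.gal.one_closed, of 1] X.N X.gal_one[OF AS1.\<delta>] wp_of_nat[OF char, of 1] X.gal_one
      unfolding E_def[symmetric] by auto
    have "wp (\<rho> z - z - cs 1 y0) = 0"
    proof -
      have "wp (\<rho> z) = \<rho> (ds y0 + X.ev g)" using U1.X.gal_wp[OF \<rho>(1) zE] z by simp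
      also have "\<dots> = ds (y0 + 1) + X.ev g"
        using \<rho>(1,3) U1.X.gal_ds[OF \<rho>(1) y0E] U1.X.A_N ds_mem[OF U1.X.N y0E] by (subst U1.X.gal_add) auto
      finally show ?thesis using z wp_cs[of 1] by (simp add: wp_diff[OF char])
    qed
    then obtain i where i: "\<rho> z - z - cs 1 y0 = of_nat i" using wp_eq_0[OF char] by blast
    have \<rho>z: "\<rho> z = z + cs 1 y0 + of_nat i" using i by (simp add: algebra_simps)
    let ?r = "\<lambda>n. \<rho> [^]\<^bsub>U1.X.\<Gamma>\<^esub> (n :: nat)"
    have rG: "?r n \<in> U1.X.Gal" for n using \<rho>(1) by simp
    have iter: "(\<forall>a\<in>N. ?r n a = a) \<and> ?r n y0 = y0 + of_nat n \<and> ?r n z = z + cs n y0 + of_nat (n * i)" for n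
    proof (induction n)
      case 0
      show ?case using NE y0E zE by (auto simp: U1.X.gal_one)
    next
      case (Suc n)
      have step: "?r (Suc n) a = ?r n (\<rho> a)" if "a \<in> E" for a
        using U1.X.gal_comp[OF rG[of n] \<rho>(1) that] by simp
      have nat: "of_nat l \<in> E" for l by (rule sring_of_nat[OF U1.X.N])
      have c1: "cs 1 y0 \<in> E" "z + cs 1 y0 \<in> E" using cs_mem[OF U1.X.N y0E] zE by (auto intro: sring_add[OF U1.X.N])
      have "?r (Suc n) a = a" if "a \<in> N" for a using step[of a] that NE \<rho>(2) Suc.IH by auto
      moreover have "?r (Suc n) y0 = y0 + of_nat (Suc n)"
        using step[OF y0E] \<rho>(3) U1.X.gal_add[OF rG[of n] y0E sring_1[OF U1.X.N]] Suc.IH rG[of n] by (simp add: ac_simps)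
      moreover have "?r (Suc n) z = z + cs (Suc n) y0 + of_nat (Suc n * i)"
      proof -
        have "?r (Suc n) z = ?r n z + ?r n (cs 1 y0) + of_nat i"
          unfolding step[OF zE] \<rho>z U1.X.gal_add[OF rG[of n] c1(2) nat] U1.X.gal_add[OF rG[of n] zE c1(1)] using rG[of n] by simp
        also have "?r n (cs 1 y0) = cs 1 (y0 + of_nat n)" using U1.X.gal_cs[OF rG[of n] y0E] Suc.IH by simp
        finally show ?thesis using Suc.IH cs_add[of n 1 y0] by (simp add: algebra_simps)
      qed
      ultimately show ?case by blast
    qed
    have "?r ?p = \<one>\<^bsub>U1.X.\<Gamma>\<^esub>"
    proof (rule AS1.hom_determined)
      show "?r ?p \<in> carrier (galois_group F AS1.L)" using rG[of ?p] unfolding E_def .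
      show "\<one>\<^bsub>U1.X.\<Gamma>\<^esub> \<in> carrier (galois_group F AS1.L)" using U1.X.gal.one_closed unfolding E_def .
      show "?r ?p a = \<one>\<^bsub>U1.X.\<Gamma>\<^esub> a" if "a \<in> N" for a using iter[of ?p] that NE U1.X.gal_one[of a] by auto
      show "?r ?p y0 = \<one>\<^bsub>U1.X.\<Gamma>\<^esub> y0" using iter[of ?p] U1.X.gal_one[OF y0E] by simp
    qed
    then show False using iter[of ?p] U1.X.gal_one[OF zE] by (simp add: trace_unit_one[OF char])
  qed
  then obtain g2 z0 q2 where AS2: "artin_schreier F E (ds y0 + X.ev g2) z0"
    and U2: "unramified_cover \<kappa> x y F (artin_schreier.L E z0) q2" and q2: "q2 \<inter> U1.Y.B = q1"
    and act2: "\<forall>\<tau>\<in>inertia_group F (artin_schreier.L E z0) (localization_at (integral_closure Y.A (artin_schreier.L E z0)) q2).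
      \<tau> z0 = z0 + cs (\<nu> (restrict (restrict \<tau> E) N)) y0" by blast
  interpret AS2: artin_schreier F E "ds y0 + X.ev g2" z0 by (rule AS2)
  define M where "M = AS2.L"
  interpret U2: unramified_cover \<kappa> x y F M q2 using U2 unfolding M_def .
  have gM: "galois F M" by (rule U2.X.galois_axioms)
  have EM: "E \<subseteq> M" and z0M: "z0 \<in> M" unfolding M_def using AS2.E_L AS2.z_L by auto
  have NM: "N \<subseteq> M" and y0M: "y0 \<in> M" using NE EM y0E by auto
  interpret T2: place_tower \<kappa> y F M E q2 0
    by (intro place_tower.intro place_tower_axioms.intro U2.pl gE EM)
  have rI2: "restrict \<tau> E \<in> U1.inertia" if "\<tau> \<in> U2.inertia" for \<tau>
    using T2.restrict_inertia[OF that] unfolding q2 .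
  have rr: "restrict (restrict \<tau> E) N = restrict \<tau> N" for \<tau> :: "'a \<Rightarrow> 'a" using NE by (auto simp: restrict_def fun_eq_iff)
  have A1: "\<exists>\<theta>\<in>U2.X.Gal. (\<forall>a\<in>N. \<theta> a = \<sigma> a) \<and> \<theta> y0 = y0 + of_nat n \<and> \<theta> z0 = z0 + cs n y0" if s: "\<sigma> \<in> X.Gal" for \<sigma> n
  proof -
    have "wp (of_nat n) = \<sigma> (0 + X.ev g1) - (0 + X.ev g1)" using s X.A_F by (simp add: wp_of_nat[OF char])
    then obtain \<theta>1 where t1: "\<theta>1 \<in> U1.X.Gal" "\<And>a. a \<in> N \<Longrightarrow> \<theta>1 a = \<sigma> a" "\<theta>1 y0 = y0 + of_nat n"
      using AS1.lift_automorphism[OF s sring_of_nat[OF X.N]] unfolding E_def[symmetric] by blast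
    have "\<theta>1 (ds y0 + X.ev g2) = ds (y0 + of_nat n) + X.ev g2"
      using t1(1,3) U1.X.gal_ds[OF t1(1) y0E] U1.X.A_N ds_mem[OF U1.X.N y0E] by (subst U1.X.gal_add) auto
    then have "wp (cs n y0) = \<theta>1 (ds y0 + X.ev g2) - (ds y0 + X.ev g2)" using wp_cs[of n] by simp
    then obtain \<theta> where t2: "\<theta> \<in> U2.X.Gal" "\<And>a. a \<in> E \<Longrightarrow> \<theta> a = \<theta>1 a" "\<theta> z0 = z0 + cs n y0"
      using AS2.lift_automorphism[OF t1(1) cs_mem[OF U1.X.N y0E]] unfolding M_def[symmetric] by blast
    then show ?thesis using t1 NE y0E by (intro bexI[of _ \<theta>]) auto
  qed
  have A2: "\<exists>n. \<theta> y0 = y0 + of_nat n \<and> \<theta> z0 = z0 + cs n y0" if th: "\<theta> \<in> U2.X.Gal" for \<theta>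
  proof -
    have "restrict \<theta> E \<in> U1.X.Gal" by (rule galois_stable[OF gE gM EM th])
    then obtain i where "restrict \<theta> E y0 = y0 + of_nat i" using trans by blast
    then have i: "\<theta> y0 = y0 + of_nat i" using y0E by simp
    have "wp (\<theta> z0) = \<theta> (ds y0 + X.ev g2)" using U2.X.gal_wp[OF th z0M] AS2.wp_z by simp
    also have "\<dots> = ds (y0 + of_nat i) + X.ev g2"
      using th i U2.X.gal_ds[OF th y0M] U2.X.A_N ds_mem[OF U2.X.N y0M] by (subst U2.X.gal_add) auto
    finally have "wp (\<theta> z0 - z0 - cs i y0) = 0" using wp_cs[of i] AS2.wp_z by (simp add: wp_diff[OF char])
    then obtain j where "\<theta> z0 - z0 - cs i y0 = of_nat j" using wp_eq_0[OF char] by blast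
    then have "\<theta> z0 = z0 + cs (i + ?p * j) y0" unfolding cs_add_char_mult[OF char] by (simp add: algebra_simps)
    moreover have "\<theta> y0 = y0 + of_nat (i + ?p * j)" using i by simp
    ultimately show ?thesis by blast
  qed
  have A3: "\<theta> = \<theta>'" if th: "\<theta> \<in> U2.X.Gal" "\<theta>' \<in> U2.X.Gal" and eq: "\<And>a. a \<in> N \<Longrightarrow> \<theta> a = \<theta>' a" "\<theta> y0 = \<theta>' y0" "\<theta> z0 = \<theta>' z0" for \<theta> \<theta>'
  proof -
    have "restrict \<theta> E = restrict \<theta>' E"
    proof (rule AS1.hom_determined)
      show "restrict \<theta> E \<in> carrier (galois_group F AS1.L)" "restrict \<theta>' E \<in> carrier (galois_group F AS1.L)"
        using galois_stable[OF gE gM EM th(1)] galois_stable[OF gE gM EM th(2)] unfolding E_def by auto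
    qed (use eq NE y0E in auto)
    then have "\<theta> a = \<theta>' a" if "a \<in> E" for a using that by (metis restrict_apply')
    then show ?thesis using th eq(3) unfolding M_def by (intro AS2.hom_determined)
  qed
  have A4: "\<tau> y0 = y0 + of_nat (\<nu> (restrict \<tau> N)) \<and> \<tau> z0 = z0 + cs (\<nu> (restrict \<tau> N)) y0" if t: "\<tau> \<in> U2.inertia" for \<tau>
  proof
    show "\<tau> y0 = y0 + of_nat (\<nu> (restrict \<tau> N))" using act1[OF rI2[OF t]] y0E unfolding rr by simp
    show "\<tau> z0 = z0 + cs (\<nu> (restrict \<tau> N)) y0" using act2 t unfolding M_def rr by blast
  qed
  have "q2 \<inter> Y.B = q"
    using q1 q2 integral_closure_mono[OF NE, of Y.A] by blast
  moreover have "\<forall>\<sigma>\<in>X.Gal. \<forall>n. \<exists>\<theta>\<in>U2.X.Gal. (\<forall>a\<in>N. \<theta> a = \<sigma> a) \<and> \<theta> y0 = y0 + of_nat n \<and> \<theta> z0 = z0 + cs n y0"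
    by (intro ballI allI) (rule A1)
  moreover have "\<forall>\<theta>\<in>U2.X.Gal. \<exists>n. \<theta> y0 = y0 + of_nat n \<and> \<theta> z0 = z0 + cs n y0"
    by (intro ballI) (rule A2)
  moreover have "\<forall>\<theta>\<in>U2.X.Gal. \<forall>\<theta>'\<in>U2.X.Gal. (\<forall>a\<in>N. \<theta> a = \<theta>' a) \<longrightarrow> \<theta> y0 = \<theta>' y0 \<longrightarrow> \<theta> z0 = \<theta>' z0 \<longrightarrow> \<theta> = \<theta>'"
    by (intro ballI impI, rule A3) simp_all
  moreover have "\<forall>\<tau>\<in>U2.inertia. \<tau> y0 = y0 + of_nat (\<nu> (restrict \<tau> N)) \<and> \<tau> z0 = z0 + cs (\<nu> (restrict \<tau> N)) y0"
    by (intro ballI) (rule A4)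
  ultimately show ?thesis using NM U2.unramified_cover_axioms y0M z0M
    by (intro exI[of _ M] exI[of _ q2] exI[of _ y0] exI[of _ z0] conjI)
qed

end

section \<open>Covers of the projective line as integral closures\<close>

lemma localization_zero_field:
  assumes A: "sring A"
  shows "sring (localization_at A {0})" "A \<subseteq> localization_at A {0}" "a \<in> localization_at A {0} \<Longrightarrow> inverse a \<in> localization_at A {0}"
proof -
  note z = zero_prime[OF A]
  show s: "sring (localization_at A {0})" by (rule sring_localization[OF A z])
  show "A \<subseteq> localization_at A {0}" by (rule localization_sub[OF A z])
  assume "a \<in> localization_at A {0}"
  then obtain b d where bd: "b \<in> A" "d \<in> A" "d \<noteq> 0" "a = b / d" using localizationE[OF A z, of a thesis] by auto
  show "inverse a \<in> localization_at A {0}"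
  proof (cases "b = 0")
    case True
    then show ?thesis using bd s by simp
  next
    case False
    then have "d / b \<in> localization_at A {0}" using bd by (intro localizationI[OF A z]) auto
    then show ?thesis using bd by simp
  qed
qed

lemma localization_zero_least:
  assumes A: "sring A" and L: "sring L" "\<And>a. a \<in> L \<Longrightarrow> inverse a \<in> L" and AL: "A \<subseteq> L"
  shows "localization_at A I \<subseteq> L"
proof
  fix a assume "a \<in> localization_at A I"
  then obtain b d where "b \<in> A" "d \<in> A" "a = b / d" unfolding localization_at_def by blast
  then show "a \<in> L" using L(2)[of d] sring_mult[OF L(1), of b "inverse d"] AL by (auto simp: divide_inverse)
qed

text \<open>All charts have the same field of fractions, which is the local ring of the generic point.\<close>

lemma function_field_projective:
  assumes "projective_scheme K C"
  shows "sring (\<Union>C)" "a \<in> \<Union>C \<Longrightarrow> inverse a \<in> \<Union>C" "\<Union>C \<in> C"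
proof -
  obtain S f where S: "C = proj_model K S" and f: "f \<in> S" "f \<noteq> 0" using assms unfolding projective_scheme_def by blast
  let ?A = "chart K S"
  let ?L = "localization_at (?A f) {0}"
  note L = localization_zero_field[OF chart_subring[of K S f]]
  have Ag: "?A g \<subseteq> ?L" if g: "g \<in> S" "g \<noteq> 0" for g
  proof -
    have "(\<lambda>h. h / g) ` S \<subseteq> ?L"
    proof
      fix b assume "b \<in> (\<lambda>h. h / g) ` S"
      then obtain h where h: "h \<in> S" "b = h / g" by blast
      have "h / f \<in> ?L" "inverse (g / f) \<in> ?L" using h(1) g(1) L(2,3) chart_incl(2)[of _ S f K] by blast+
      then have "h / f * inverse (g / f) \<in> ?L" by (rule sring_mult[OF L(1)])
      moreover have "h / f * inverse (g / f) = h / g" using f(2) g(2) by (simp add: field_simps)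
      ultimately show "b \<in> ?L" unfolding h(2) by (simp only:)
    qed
    moreover have "K \<subseteq> ?L" using chart_incl(1)[of K S f] L(2) by blast
    ultimately show ?thesis unfolding chart_def[of K S g] by (intro algebra_generated_least[OF L(1)])
  qed
  have "Q \<subseteq> ?L" if "Q \<in> C" for Q
    using that localization_zero_least[OF chart_subring L(1) L(3) Ag] unfolding S proj_model_def spec_def by blast
  moreover have LC: "?L \<in> C"
    using f zero_prime[OF chart_subring, of K S f] unfolding S proj_model_def spec_def by blast
  ultimately have "\<Union>C = ?L" by blast
  then show "sring (\<Union>C)" "a \<in> \<Union>C \<Longrightarrow> inverse a \<in> \<Union>C" "\<Union>C \<in> C" using L(1,3) LC by auto
qed

context rational_line
begin

lemma char_eq: "CHAR('a) = CHAR('k)"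
proof (rule CHAR_eqI)
  show "(of_nat CHAR('k) :: 'a) = 0" unfolding \<kappa>_of_nat[symmetric] by simp
  fix n assume "(of_nat n :: 'a) = 0"
  then have "(of_nat n :: 'k) = 0" unfolding \<kappa>_of_nat[symmetric] by simp
  then show "CHAR('k) dvd n" by (simp add: of_nat_eq_0_iff_char_dvd)
qed

lemma rational_line_inverse: "rational_line \<kappa> (inverse u)"
proof (intro rational_line.intro)
  fix f assume f: "poly (map_poly \<kappa> f) (inverse u) = 0"
  obtain g where g: "Polynomial.coeff g 0 = Polynomial.coeff f (Polynomial.degree f)"
    "u ^ Polynomial.degree f * evat (inverse u) f = evat u g"
    using reversal[OF refl order.refl, of f thesis] by blast
  have "ev g = 0" using g(2) f by (simp add: evat_def)
  then have "g = 0" by simp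
  then show "f = 0" using g(1) by simp
qed (simp_all add: \<kappa>_add \<kappa>_mult)

lemma quotients_inverse:
  assumes v: "v = inverse u"
  shows "{evat v f / evat v g | f g. True} \<subseteq> {ev f / ev g | f g. True}"
proof
  fix a assume "a \<in> {evat v f / evat v g | f g. True}"
  then obtain f g where a: "a = evat v f / evat v g" by blast
  let ?l = "max (Polynomial.degree f) (Polynomial.degree g)"
  obtain f' where f': "u ^ ?l * evat v f = ev f'" using reversal[OF v max.cobounded1, of f "Polynomial.degree g" thesis] by blast
  obtain g' where g': "u ^ ?l * evat v g = ev g'" using reversal[OF v max.cobounded2, of "Polynomial.degree f" g thesis] by blast
  have "a = ev f' / ev g'" unfolding a f'[symmetric] g'[symmetric] using u_nonzero by simp
  then show "a \<in> {ev f / ev g | f g. True}" by blast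
qed

end

context curve
begin

text \<open>
  Multiplying numerator and denominator by a power of \<open>x\<close> or of \<open>y\<close> exchanges the
  condition that the denominator does not vanish at \<open>y = 0\<close> with the comparison of degrees.
\<close>

lemma infinity_degree: "infinity = {X.ev f / X.ev g | f g. g \<noteq> 0 \<and> Polynomial.degree f \<le> Polynomial.degree g}" (is "_ = ?D")
proof (intro equalityI subsetI)
  fix a assume "a \<in> infinity"
  then obtain b d where bd: "b \<in> Y.A" "d \<in> Y.A" "d \<notin> {Y.ev f | f. poly f 0 = 0}" "a = b / d"
    unfolding infinity_def localization_at_def by blast
  obtain f where f: "b = Y.ev f" using bd(1) by (rule Y.A_E)
  obtain g where g: "d = Y.ev g" using bd(2) by (rule Y.A_E)
  have g0: "Polynomial.coeff g 0 \<noteq> 0" using bd(3) g by (auto simp: poly_0_coeff_0)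
  let ?l = "max (Polynomial.degree f) (Polynomial.degree g)"
  obtain f' where f': "Polynomial.degree f' \<le> ?l" "x ^ ?l * Y.ev f = X.ev f'"
    using X.reversal[OF y max.cobounded1, of f "Polynomial.degree g" thesis] by blast
  obtain g' where g': "Polynomial.degree g' \<le> ?l" "Polynomial.coeff g' ?l = Polynomial.coeff g 0" "x ^ ?l * Y.ev g = X.ev g'"
    using X.reversal[OF y max.cobounded2, of "Polynomial.degree f" g thesis] by blast
  have "?l \<le> Polynomial.degree g'" using g'(2) g0 by (intro le_degree) simp
  moreover have "g' \<noteq> 0" using g'(2) g0 by auto
  moreover have "a = X.ev f' / X.ev g'" unfolding bd(4) f g f'(2)[symmetric] g'(3)[symmetric] by simp
  ultimately show "a \<in> ?D" using f'(1) by (blast intro: le_trans)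
next
  fix a assume "a \<in> ?D"
  then obtain f g where fg: "a = X.ev f / X.ev g" "g \<noteq> 0" "Polynomial.degree f \<le> Polynomial.degree g" by blast
  let ?l = "Polynomial.degree g"
  obtain f' where f': "y ^ ?l * X.ev f = Y.ev f'" using Y.reversal[OF x fg(3), of thesis] by blast
  obtain g' where g': "Polynomial.coeff g' 0 = Polynomial.coeff g ?l" "y ^ ?l * X.ev g = Y.ev g'"
    using Y.reversal[OF x order.refl, of g thesis] by blast
  have "poly g' 0 \<noteq> 0" using g'(1) fg(2) by (simp add: poly_0_coeff_0)
  then have "Y.ev g' \<notin> {Y.ev f | f. poly f 0 = 0}" by auto
  moreover have "a = Y.ev f' / Y.ev g'" unfolding fg(1) f'[symmetric] g'(2)[symmetric] by simp
  ultimately show "a \<in> infinity" unfolding infinity_def localization_at_def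
    by (intro CollectI exI[of _ "Y.ev f'"] exI[of _ "Y.ev g'"] conjI DiffI Y.mem_A)
qed

lemma infinity_spec: "infinity \<in> spec Y.A" "y \<in> max_ideal infinity"
proof -
  let ?I = "{Y.ev f | f. poly f 0 = 0}"
  have iff: "Y.ev f \<in> ?I \<longleftrightarrow> poly f 0 = 0" for f by auto
  have I: "primeideal ?I (subring_of_type Y.A)"
    unfolding primeideal_iff[OF Y.A]
  proof (intro conjI ballI impI)
    show "?I \<subseteq> Y.A" by auto
    show "0 \<in> ?I" using iff[of 0] by simp
    show "1 \<notin> ?I" using iff[of 1] by simp
  next
    fix a b assume "a \<in> ?I" "b \<in> ?I"
    then obtain f g where "a = Y.ev f" "b = Y.ev g" "poly f 0 = 0" "poly g 0 = 0" by blast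
    then show "a + b \<in> ?I" using iff[of "f + g"] by (simp add: Y.evat_add)
  next
    fix a b assume a: "a \<in> Y.A" and b: "b \<in> ?I"
    obtain f where f: "a = Y.ev f" using a by (rule Y.A_E)
    obtain g where "b = Y.ev g" "poly g 0 = 0" using b by blast
    then show "a * b \<in> ?I" using iff[of "f * g"] f by (simp add: Y.evat_mult)
  next
    fix a b assume a: "a \<in> Y.A" and b: "b \<in> Y.A" and ab: "a * b \<in> ?I"
    obtain f where f: "a = Y.ev f" using a by (rule Y.A_E)
    obtain g where g: "b = Y.ev g" using b by (rule Y.A_E)
    have "poly (f * g) 0 = 0" using ab iff[of "f * g"] f g by (simp add: Y.evat_mult)
    then show "a \<in> ?I \<or> b \<in> ?I" using iff[of f] iff[of g] f g by simp
  qed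
  show "infinity \<in> spec Y.A" unfolding infinity_def spec_def using I by blast
  have "y \<in> ?I" using iff[of "[:0, 1:]"] by (simp add: Y.evat_linear)
  then show "y \<in> max_ideal infinity" unfolding infinity_def using prime_sub_max_ideal[OF Y.A I] by blast
qed

lemma charts: "chart X.K {1, x} 1 = X.A" "chart X.K {1, x} x = Y.A"
  unfolding chart_def using X.A_generated Y.A_generated by (simp_all add: y inverse_eq_divide)

lemma points_dominant: "dominant_morphism points (spec X.A \<union> spec Y.A)"
  unfolding dominant_morphism_def function_field_points
proof (intro conjI ballI)
  have "localization_at X.A I \<subseteq> N" "localization_at Y.A I \<subseteq> N" for I
    using localization_zero_least[OF X.A X.N X.N_inverse X.A_N] localization_zero_least[OF Y.A X.N X.N_inverse Y.A_N] by auto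
  then show "\<Union> (spec X.A \<union> spec Y.A) \<subseteq> N" unfolding spec_def by blast
  fix Q assume Q: "Q \<in> points"
  show "\<exists>z\<in>spec X.A \<union> spec Y.A. lies_above Q z"
  proof (cases "Q \<in> spec X.B")
    case True
    note Q = X.spec_B_properties[OF True]
    show ?thesis using lies_above_contract[OF X.A Q(2,5,4)] by blast
  next
    case False
    then have "Q \<in> spec Y.B" using Q unfolding points_def by blast
    note Q = Y.spec_B_properties[OF this]
    show ?thesis using lies_above_contract[OF Y.A Q(2,5,4)] by blast
  qed
qed

lemma points_regular: "Q \<in> points \<Longrightarrow> \<exists>\<pi>\<in>Q. max_ideal Q = PIdl\<^bsub>subring_of_type Q\<^esub> \<pi>"
  unfolding points_def using X.spec_B_properties(6) Y.spec_B_properties(6) by blast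

lemma not_constant: "\<not> N \<subseteq> X.K"
proof
  assume "N \<subseteq> X.K"
  moreover have "x \<in> N" using X.A_N by auto
  ultimately obtain c where "x = \<kappa> c" by blast
  then have "X.ev [:0, 1:] = X.ev [:c:]" by (simp add: X.evat_linear)
  then show False by (simp only: X.ev_eq_iff) simp
qed

text \<open>
  A regular local ring is maximal with respect to domination, so the smooth cover has the same point as the
  integral closure.
\<close>

lemma cover_place_at_infinity:
  assumes C: "\<Union>C = N" "N \<in> C" "finite_over_affine C Y.A"
    and smooth: "\<And>Q. Q \<in> C \<Longrightarrow> \<exists>\<pi>\<in>Q. max_ideal Q = PIdl\<^bsub>subring_of_type Q\<^esub> \<pi>"
    and Q: "Q \<in> C" "lies_above Q infinity"
  obtains q where "place \<kappa> y F N q 0" "Q = localization_at Y.B q"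
proof -
  obtain B' where B': "sring B'" "Y.A \<subseteq> B'" "B' \<subseteq> Y.B" "{Q \<in> C. \<exists>z\<in>spec Y.A. lies_above Q z} = spec B'"
    "\<And>a. a \<in> N \<Longrightarrow> \<exists>b\<in>B'. \<exists>d\<in>B'. d \<noteq> 0 \<and> a = b / d"
    using Y.cover_algebra[OF C(3,1,2), of thesis] by blast
  have "Q \<in> spec B'" using Q infinity_spec(1) unfolding B'(4)[symmetric] by blast
  then obtain I where I: "primeideal I (subring_of_type B')" "Q = localization_at B' I" unfolding spec_def by blast
  have "y \<in> max_ideal Q \<inter> B'" using Q(2) infinity_spec(2) B'(2) Y.u_mem_A unfolding lies_above_def by blast
  then have yI: "y - \<kappa> 0 \<in> I" unfolding I(2) max_ideal_localization_Int[OF B'(1) I(1)] by simp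
  obtain \<pi> where pi: "\<pi> \<in> localization_at B' I" "max_ideal (localization_at B' I) = PIdl\<^bsub>subring_of_type (localization_at B' I)\<^esub> \<pi>"
    using smooth[OF Q(1)] unfolding I(2) by blast
  show thesis
    by (rule Y.regular_point_is_place[OF B'(1-3) I(1) yI pi B'(5)]) (use that I(2) in auto)
qed

text \<open>
  The place dominates a local ring of the cover, which is unramified over the line since \<open>x\<close> has no
  pole there.
\<close>

lemma cover_inertia_trivial:
  assumes C: "\<Union>C = N" "N \<in> C" "finite_over_affine C X.A"
    and un: "\<And>Q z. Q \<in> C \<Longrightarrow> z \<in> spec X.A \<union> spec Y.A \<Longrightarrow> lies_above Q z \<Longrightarrow> z \<noteq> infinity \<Longrightarrow> unramified Q z"
    and pl: "place \<kappa> x F N q \<alpha>" and s: "\<sigma> \<in> inertia_group F N (localization_at X.B q)"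
  shows "\<sigma> = \<one>\<^bsub>X.\<Gamma>\<^esub>"
proof -
  interpret P: place \<kappa> x F N q \<alpha> by (rule pl)
  obtain B' where B': "sring B'" "X.A \<subseteq> B'" "B' \<subseteq> X.B" "{Q \<in> C. \<exists>z\<in>spec X.A. lies_above Q z} = spec B'"
    "\<And>a. a \<in> N \<Longrightarrow> \<exists>b\<in>B'. \<exists>d\<in>B'. d \<noteq> 0 \<and> a = b / d"
    using X.cover_algebra[OF C(3,1,2), of thesis] by blast
  have BR: "B' \<subseteq> P.R" using B'(3) P.B_R by blast
  let ?I = "P.m \<inter> B'"
  let ?W = "localization_at B' ?I"
  note I = primeideal_contract[OF B'(1) P.R P.m BR]
  note W = sring_localization[OF B'(1) I]
  note WR = localization_contract[OF B'(1) P.R P.m BR]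
  note BW = localization_sub[OF B'(1) I]
  have mW: "max_ideal ?W = P.m \<inter> ?W"
  proof (intro equalityI subsetI)
    fix a assume a: "a \<in> max_ideal ?W"
    then show "a \<in> P.m \<inter> ?W" using WR(2) prime_sub[OF W primeideal_max_ideal_localization[OF B'(1) I]] by blast
  next
    fix a assume a: "a \<in> P.m \<inter> ?W"
    then have "a = 0 \<or> inverse a \<notin> P.R" using max_ideal_eq[OF P.R] by blast
    then show "a \<in> max_ideal ?W" using a WR(1) unfolding max_ideal_eq[OF W] by blast
  qed
  have AW: "X.A \<subseteq> ?W" using B'(2) BW by blast
  have Wprime: "primeideal (max_ideal ?W) (subring_of_type ?W)" by (rule primeideal_max_ideal_localization[OF B'(1) I])
  have mA: "max_ideal ?W \<inter> X.A = P.m \<inter> X.A" unfolding mW using AW by blast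
  note la = lies_above_contract[OF X.A W Wprime AW, unfolded mA]
  have "?W \<in> spec B'" unfolding spec_def using I by blast
  then have "?W \<in> C" unfolding B'(4)[symmetric] by blast
  moreover have "P.base \<noteq> infinity"
    using x_infinity localization_sub[OF X.A P.base_prime] X.u_mem_A by blast
  ultimately have "unramified ?W P.base" using la by (intro un) auto
  moreover have "P.base \<subseteq> ?W" using la(1) unfolding lies_above_def by blast
  moreover have "\<exists>b\<in>?W. \<exists>d\<in>?W. d \<noteq> 0 \<and> a = b / d" if a: "a \<in> N" for a
    using B'(5)[OF a] BW by blast
  ultimately show ?thesis using WR(1) mW s by (intro P.unramified_below_inertia_trivial[OF W]) auto
qed

end

section \<open>Extension of the Galois group\<close>

text \<open>
  The first equation determines \<open>n\<close> modulo \<open>p\<close>, and then the second one determines the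
  quotient, since \<open>cs (i + p * j) = cs i + j\<close>.
\<close>

lemma cs_faithful:
  assumes char: "CHAR('a::Fields.field) > 0" and mn: "m < CHAR('a) ^ 2" "n < CHAR('a) ^ 2"
    and eq: "(of_nat m :: 'a) = of_nat n" "cs m (y :: 'a) = cs n y"
  shows "m = n"
proof -
  let ?p = "CHAR('a)"
  have inj: "i = j" if "i < ?p" "j < ?p" "(of_nat i :: 'a) = of_nat j" for i j :: nat
    by (rule inj_onD[OF inj_on_of_nat_char[OF char]]) (use that in auto)
  have m: "(of_nat (m mod ?p) :: 'a) = of_nat m" and n: "(of_nat (n mod ?p) :: 'a) = of_nat n"
    using of_nat_mod_char[OF dvd_refl, where ?'a='a] by auto
  have r: "m mod ?p = n mod ?p" by (rule inj) (use char m n eq in auto)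
  have "cs (m mod ?p + ?p * (m div ?p)) y = cs (n mod ?p + ?p * (n div ?p)) y" using eq(2) by simp
  then have "(of_nat (m div ?p) :: 'a) = of_nat (n div ?p)" unfolding cs_add_char_mult[OF char] r by simp
  moreover have "m div ?p < ?p" "n div ?p < ?p" using mn by (auto simp: power2_eq_square less_mult_imp_div_less)
  ultimately have "m div ?p = n div ?p" by (intro inj)
  then show ?thesis using r by (metis div_mult_mod_eq)
qed

context unramified_cover
begin

text \<open>
  The pair \<open>(g, j)\<close> acts as \<open>g\<close> on \<open>N\<close> and as \<open>j\<close> steps of the
  translation action on \<open>y0\<close> and \<open>z0\<close>. The inertia group above infinity acts on
  \<open>y0\<close> and \<open>z0\<close> through \<open>b\<close>, so it is contained in the graph of
  \<open>b\<close>. It is the whole graph because inertia groups map onto inertia groups.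
\<close>

lemma cyclic_extension_group:
  fixes G :: "('g, 'r) monoid_scheme" and H :: "'g set" and b :: "'g \<Rightarrow> int"
  assumes G: "group G" "finite (carrier G)" and H: "subgroup H G" and iso: "\<phi> \<in> iso G X.\<Gamma>" and HI: "\<phi> ` H = inertia"
    and epi: "b \<in> epi (G\<lparr>carrier := H\<rparr>) (integer_mod_group (CHAR('a) ^ 2))"
    and no_epi: "epi G (integer_mod_group CHAR('a)) = {}"
  obtains M q' \<Phi> where "unramified_cover \<kappa> x y F M q'"
    "\<Phi> \<in> iso (G \<times>\<times> integer_mod_group (CHAR('a) ^ 2)) (galois_group F M)"
    "\<Phi> ` {(g, b g) | g. g \<in> H} = inertia_group F M (localization_at (integral_closure Y.A M) q')"
proof -
  let ?p = "CHAR('a)"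
  let ?Z = "integer_mod_group (?p ^ 2)"
  interpret G: group G by (rule G(1))
  interpret P: place \<kappa> y F N q 0 by (rule pl)
  have hom\<phi>: "\<phi> \<in> hom G X.\<Gamma>" and bij: "bij_betw \<phi> (carrier G) X.Gal" using iso by (auto simp: iso_def)
  have Hsub: "H \<subseteq> carrier G" by (rule subgroup.subset[OF H])
  have p2: "0 < ?p ^ 2" using char by simp
  have inj\<phi>: "inj_on \<phi> (carrier G)" and surj\<phi>: "\<phi> ` carrier G = X.Gal" using bij by (auto simp: bij_betw_def)
  have bhom: "b (g \<otimes>\<^bsub>G\<^esub> h) = (b g + b h) mod int (?p ^ 2)" if "g \<in> H" "h \<in> H" for g h
  proof -
    have "b \<in> hom (G\<lparr>carrier := H\<rparr>) ?Z" using epi unfolding epi_def by blast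
    then have "b (g \<otimes>\<^bsub>G\<lparr>carrier := H\<rparr>\<^esub> h) = b g \<otimes>\<^bsub>?Z\<^esub> b h" using that by (intro hom_mult) auto
    then show ?thesis by simp
  qed
  have bim: "b ` H = {0..<int (?p ^ 2)}"
    using epi p2 char unfolding epi_def by (simp add: carrier_integer_mod_group)
  have b0: "0 \<le> b g" "b g < int (?p ^ 2)" if "g \<in> H" for g using bim that by auto
  define \<nu> where "\<nu> \<tau> = nat (b (inv_into (carrier G) \<phi> \<tau>))" for \<tau>
  have \<nu>: "\<nu> (\<phi> g) = nat (b g)" if "g \<in> H" for g
    unfolding \<nu>_def using inv_into_f_f[OF inj\<phi>, of g] that Hsub by auto
  have A: "\<exists>M q' y0 z0. N \<subseteq> M \<and> unramified_cover \<kappa> x y F M q' \<and> q' \<inter> Y.B = q \<and> y0 \<in> M \<and> z0 \<in> M \<and>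
    (\<forall>\<sigma>\<in>X.Gal. \<forall>n. \<exists>\<theta>\<in>carrier (galois_group F M). (\<forall>a\<in>N. \<theta> a = \<sigma> a) \<and> \<theta> y0 = y0 + of_nat n \<and> \<theta> z0 = z0 + cs n y0) \<and>
    (\<forall>\<theta>\<in>carrier (galois_group F M). \<exists>n. \<theta> y0 = y0 + of_nat n \<and> \<theta> z0 = z0 + cs n y0) \<and>
    (\<forall>\<theta>\<in>carrier (galois_group F M). \<forall>\<theta>'\<in>carrier (galois_group F M). (\<forall>a\<in>N. \<theta> a = \<theta>' a) \<longrightarrow> \<theta> y0 = \<theta>' y0 \<longrightarrow> \<theta> z0 = \<theta>' z0 \<longrightarrow> \<theta> = \<theta>') \<and>
    (\<forall>\<tau>\<in>inertia_group F M (localization_at (integral_closure Y.A M) q').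
      \<tau> y0 = y0 + of_nat (\<nu> (restrict \<tau> N)) \<and> \<tau> z0 = z0 + cs (\<nu> (restrict \<tau> N)) y0)"
  proof (rule cyclic_extension)
    fix \<sigma> \<tau> assume st: "\<sigma> \<in> inertia" "\<tau> \<in> inertia"
    obtain g where g: "g \<in> H" "\<sigma> = \<phi> g" using st(1) unfolding HI[symmetric] by blast
    obtain h where h: "h \<in> H" "\<tau> = \<phi> h" using st(2) unfolding HI[symmetric] by blast
    have gh: "g \<otimes>\<^bsub>G\<^esub> h \<in> H" by (rule subgroup.m_closed[OF H g(1) h(1)])
    have "\<sigma> \<otimes>\<^bsub>X.\<Gamma>\<^esub> \<tau> = \<phi> (g \<otimes>\<^bsub>G\<^esub> h)" unfolding g(2) h(2) using g(1) h(1) Hsub by (intro hom_mult[OF hom\<phi>, symmetric]) auto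
    then have *: "\<nu> (\<sigma> \<otimes>\<^bsub>X.\<Gamma>\<^esub> \<tau>) = nat ((b g + b h) mod int (?p ^ 2))" using \<nu>[OF gh] bhom[OF g(1) h(1)] by simp
    have "0 \<le> b g + b h" using b0(1)[OF g(1)] b0(1)[OF h(1)] by simp
    then have e: "nat ((b g + b h) mod int (?p ^ 2)) = nat (b g + b h) mod ?p ^ 2"
      using nat_mod_distrib[OF _ of_nat_0_le_iff, of "b g + b h" "?p ^ 2"] by (simp only: nat_int)
    note * also note e
    also have "nat (b g + b h) mod ?p ^ 2 = (\<nu> \<sigma> + \<nu> \<tau>) mod ?p ^ 2" unfolding g(2) h(2) \<nu>[OF g(1)] \<nu>[OF h(1)] using b0 g(1) h(1) by (subst nat_add_distrib) auto
    finally show "\<nu> (\<sigma> \<otimes>\<^bsub>X.\<Gamma>\<^esub> \<tau>) = (\<nu> \<sigma> + \<nu> \<tau>) mod ?p ^ 2" .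
  next
    fix i assume i: "i < ?p"
    have "?p * 1 \<le> ?p * ?p" using char by (intro mult_le_mono) auto
    then have "i < ?p ^ 2" using i unfolding power2_eq_square by linarith
    then have "int i \<in> {0..<int (?p ^ 2)}" by (simp only: atLeastLessThan_iff of_nat_less_iff of_nat_0_le_iff)
    then obtain g where g: "g \<in> H" "b g = int i" unfolding bim[symmetric] by (metis imageE)
    then have "\<phi> g \<in> inertia" "\<nu> (\<phi> g) mod ?p = i" using HI \<nu>[OF g(1)] i by auto
    then show "\<exists>\<tau>\<in>inertia. \<nu> \<tau> mod ?p = i" by blast
  next
    show "epi X.\<Gamma> (integer_mod_group ?p) = {}"
    proof (rule ccontr)
      assume "epi X.\<Gamma> (integer_mod_group ?p) \<noteq> {}"
      then obtain f where f: "f \<in> hom X.\<Gamma> (integer_mod_group ?p)" "f ` X.Gal = carrier (integer_mod_group ?p)"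
        unfolding epi_def by blast
      have "f \<circ> \<phi> \<in> hom G (integer_mod_group ?p)" by (rule hom_compose[OF hom\<phi> f(1)])
      moreover have "(f \<circ> \<phi>) ` carrier G = carrier (integer_mod_group ?p)" unfolding image_comp[symmetric] surj\<phi> by (rule f(2))
      ultimately show False using no_epi unfolding epi_def by blast
    qed
  qed
  then obtain M q' y0 z0 where NM: "N \<subseteq> M" and U: "unramified_cover \<kappa> x y F M q'" and q': "q' \<inter> Y.B = q"
    and yz: "y0 \<in> M" "z0 \<in> M"
    and ex: "\<forall>\<sigma>\<in>X.Gal. \<forall>n. \<exists>\<theta>\<in>carrier (galois_group F M). (\<forall>a\<in>N. \<theta> a = \<sigma> a) \<and> \<theta> y0 = y0 + of_nat n \<and> \<theta> z0 = z0 + cs n y0"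
    and all: "\<forall>\<theta>\<in>carrier (galois_group F M). \<exists>n. \<theta> y0 = y0 + of_nat n \<and> \<theta> z0 = z0 + cs n y0"
    and unique: "\<forall>\<theta>\<in>carrier (galois_group F M). \<forall>\<theta>'\<in>carrier (galois_group F M). (\<forall>a\<in>N. \<theta> a = \<theta>' a) \<longrightarrow> \<theta> y0 = \<theta>' y0 \<longrightarrow> \<theta> z0 = \<theta>' z0 \<longrightarrow> \<theta> = \<theta>'"
    and act: "\<forall>\<tau>\<in>inertia_group F M (localization_at (integral_closure Y.A M) q').
      \<tau> y0 = y0 + of_nat (\<nu> (restrict \<tau> N)) \<and> \<tau> z0 = z0 + cs (\<nu> (restrict \<tau> N)) y0"
    by (elim exE conjE)
  interpret U: unramified_cover \<kappa> x y F M q' by (rule U)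
  interpret T: place_tower \<kappa> y F M N q' 0
    by (intro place_tower.intro place_tower_axioms.intro U.pl X.galois_axioms NM)
  have surj: "(\<lambda>\<tau>. restrict \<tau> N) ` U.inertia = inertia" using T.inertia_surjective unfolding q' .
  have nat_M: "of_nat n \<in> M" for n by (rule sring_of_nat[OF U.X.N])
  have cs_M: "cs n y0 \<in> M" for n by (rule cs_mem[OF U.X.N yz(1)])
  define \<Psi> where "\<Psi> \<sigma> n \<theta> \<longleftrightarrow> \<theta> \<in> U.X.Gal \<and> (\<forall>a\<in>N. \<theta> a = \<sigma> a) \<and> \<theta> y0 = y0 + of_nat n \<and> \<theta> z0 = z0 + cs n y0" for \<sigma> n \<theta>
  have \<Psi>_unique: "\<theta> = \<theta>'" if "\<Psi> \<sigma> n \<theta>" "\<Psi> \<sigma> n \<theta>'" for \<sigma> n \<theta> \<theta>'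
    using that unique unfolding \<Psi>_def by simp
  have \<Psi>_mod: "\<Psi> \<sigma> (n mod ?p ^ 2) \<theta> \<longleftrightarrow> \<Psi> \<sigma> n \<theta>" for \<sigma> n \<theta>
  proof -
    have "(of_nat (n mod ?p ^ 2) :: 'a) = of_nat n" by (rule of_nat_mod_char) (simp add: power2_eq_square)
    then show ?thesis unfolding \<Psi>_def cs_mod[OF char] by simp
  qed
  have \<Psi>_mult: "\<Psi> (\<sigma> \<otimes>\<^bsub>X.\<Gamma>\<^esub> \<tau>) (m + n) (\<theta> \<otimes>\<^bsub>U.X.\<Gamma>\<^esub> \<theta>')"
    if st: "\<sigma> \<in> X.Gal" "\<tau> \<in> X.Gal" and \<theta>: "\<Psi> \<sigma> m \<theta>" "\<Psi> \<tau> n \<theta>'" for \<sigma> \<tau> m n \<theta> \<theta>'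
  proof -
    have G: "\<theta> \<in> U.X.Gal" "\<theta>' \<in> U.X.Gal" using \<theta> unfolding \<Psi>_def by auto
    have "(\<theta> \<otimes>\<^bsub>U.X.\<Gamma>\<^esub> \<theta>') a = (\<sigma> \<otimes>\<^bsub>X.\<Gamma>\<^esub> \<tau>) a" if a: "a \<in> N" for a
    proof -
      have "\<tau> a \<in> N" using st(2) a by simp
      then have "\<theta> (\<theta>' a) = \<sigma> (\<tau> a)" using \<theta> a unfolding \<Psi>_def by simp
      then show ?thesis using U.X.gal_comp[OF G, of a] X.gal_comp[OF st a] a NM by auto
    qed
    moreover have "(\<theta> \<otimes>\<^bsub>U.X.\<Gamma>\<^esub> \<theta>') y0 = y0 + of_nat (m + n)"
      using U.X.gal_comp[OF G yz(1)] U.X.gal_add[OF G(1) yz(1) nat_M] \<theta> G(1) unfolding \<Psi>_def by (simp add: ac_simps)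
    moreover have "(\<theta> \<otimes>\<^bsub>U.X.\<Gamma>\<^esub> \<theta>') z0 = z0 + cs (m + n) y0"
      using U.X.gal_comp[OF G yz(2)] U.X.gal_add[OF G(1) yz(2) cs_M] U.X.gal_cs[OF G(1) yz(1)] \<theta> unfolding \<Psi>_def
      by (simp add: cs_add ac_simps)
    ultimately show ?thesis using G unfolding \<Psi>_def by simp
  qed
  define \<Phi> where "\<Phi> = (\<lambda>(g, j). SOME \<theta>. \<Psi> (\<phi> g) (nat j) \<theta>)"
  have \<phi>G: "\<phi> g \<in> X.Gal" if "g \<in> carrier G" for g using that surj\<phi> by blast
  have \<Phi>: "\<Psi> (\<phi> g) (nat j) (\<Phi> (g, j))" if "g \<in> carrier G" for g j
  proof -
    have "\<exists>\<theta>. \<Psi> (\<phi> g) (nat j) \<theta>" using ex \<phi>G[OF that] unfolding \<Psi>_def by blast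
    then show ?thesis unfolding \<Phi>_def by (simp add: someI_ex)
  qed
  have \<Phi>I: "\<Phi> (g, j) = \<theta>" if "g \<in> carrier G" "\<Psi> (\<phi> g) (nat j) \<theta>" for g j \<theta>
    by (rule \<Psi>_unique[OF \<Phi>[OF that(1)] that(2)])
  have "\<Phi> \<in> hom (G \<times>\<times> ?Z) U.X.\<Gamma>"
  proof (rule homI)
    fix a assume "a \<in> carrier (G \<times>\<times> ?Z)"
    then show "\<Phi> a \<in> U.X.Gal" using \<Phi> unfolding \<Psi>_def by auto
  next
    fix a c assume "a \<in> carrier (G \<times>\<times> ?Z)" "c \<in> carrier (G \<times>\<times> ?Z)"
    then obtain g j h l where ac: "a = (g, j)" "c = (h, l)" "g \<in> carrier G" "h \<in> carrier G" "0 \<le> j" "0 \<le> l"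
      using char by (auto simp: carrier_integer_mod_group)
    have "\<Psi> (\<phi> g \<otimes>\<^bsub>X.\<Gamma>\<^esub> \<phi> h) (nat j + nat l) (\<Phi> a \<otimes>\<^bsub>U.X.\<Gamma>\<^esub> \<Phi> c)"
      unfolding ac(1,2) using \<phi>G \<Phi> ac by (intro \<Psi>_mult) auto
    then have "\<Psi> (\<phi> (g \<otimes>\<^bsub>G\<^esub> h)) ((nat j + nat l) mod ?p ^ 2) (\<Phi> a \<otimes>\<^bsub>U.X.\<Gamma>\<^esub> \<Phi> c)"
      unfolding \<Psi>_mod hom_mult[OF hom\<phi> ac(3,4)] .
    moreover have "(nat j + nat l) mod ?p ^ 2 = nat ((j + l) mod int (?p ^ 2))"
      using ac(5,6) by (simp only: nat_mod_distrib nat_add_distrib add_nonneg_nonneg of_nat_0_le_iff nat_int)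
    ultimately show "\<Phi> (a \<otimes>\<^bsub>G \<times>\<times> ?Z\<^esub> c) = \<Phi> a \<otimes>\<^bsub>U.X.\<Gamma>\<^esub> \<Phi> c"
      unfolding ac(1,2) mult_DirProd mult_integer_mod_group using ac(3,4) by (intro \<Phi>I) auto
  qed
  moreover have "inj_on \<Phi> (carrier (G \<times>\<times> ?Z))"
  proof (rule inj_onI)
    fix a c assume "a \<in> carrier (G \<times>\<times> ?Z)" "c \<in> carrier (G \<times>\<times> ?Z)" and eq: "\<Phi> a = \<Phi> c"
    then obtain g j h l where ac: "a = (g, j)" "c = (h, l)" "g \<in> carrier G" "h \<in> carrier G" "0 \<le> j" "0 \<le> l"
      "j < int (?p ^ 2)" "l < int (?p ^ 2)"
      using char by (auto simp: carrier_integer_mod_group)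
    have 1: "\<Psi> (\<phi> g) (nat j) (\<Phi> a)" "\<Psi> (\<phi> h) (nat l) (\<Phi> a)"
      using \<Phi>[OF ac(3), of j] \<Phi>[OF ac(4), of l] ac(1,2) eq by auto
    have "\<phi> g = \<phi> h" by (rule X.gal_ext[OF \<phi>G[OF ac(3)] \<phi>G[OF ac(4)]]) (use 1 in \<open>auto simp: \<Psi>_def\<close>)
    then have "g = h" using inj\<phi> ac(3,4) by (simp add: inj_on_def)
    moreover have "nat j = nat l"
    proof (rule cs_faithful[OF char, of _ _ y0])
      have "int (nat j) < int (?p ^ 2)" "int (nat l) < int (?p ^ 2)" using ac by auto
      then show "nat j < ?p ^ 2" "nat l < ?p ^ 2" by (simp_all only: of_nat_less_iff)
    qed (use 1 in \<open>auto simp: \<Psi>_def\<close>)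
    then have "j = l" using ac(5,6) by simp
    ultimately show "a = c" using ac by simp
  qed
  moreover have "\<Phi> ` carrier (G \<times>\<times> ?Z) = U.X.Gal"
  proof (intro equalityI subsetI)
    fix \<theta> assume "\<theta> \<in> \<Phi> ` carrier (G \<times>\<times> ?Z)"
    then show "\<theta> \<in> U.X.Gal" using \<Phi> unfolding \<Psi>_def by auto
  next
    fix \<theta> assume \<theta>: "\<theta> \<in> U.X.Gal"
    have "restrict \<theta> N \<in> X.Gal" by (rule galois_stable[OF X.galois_axioms U.X.galois_axioms NM \<theta>])
    then obtain g where g: "g \<in> carrier G" "restrict \<theta> N = \<phi> g" unfolding surj\<phi>[symmetric] by blast
    obtain n where n: "\<theta> y0 = y0 + of_nat n" "\<theta> z0 = z0 + cs n y0" using all \<theta> by blast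
    have "\<theta> a = \<phi> g a" if "a \<in> N" for a using g(2) that by (metis restrict_apply')
    then have "\<Psi> (\<phi> g) n \<theta>" unfolding \<Psi>_def using \<theta> n by blast
    then have "\<Phi> (g, int (n mod ?p ^ 2)) = \<theta>" by (intro \<Phi>I[OF g(1)]) (simp add: \<Psi>_mod)
    moreover have "(g, int (n mod ?p ^ 2)) \<in> carrier (G \<times>\<times> ?Z)"
      using g(1) char p2 mod_less_divisor[OF p2, of n] by (auto simp: carrier_integer_mod_group simp del: of_nat_power of_nat_mod)
    ultimately show "\<theta> \<in> \<Phi> ` carrier (G \<times>\<times> ?Z)" by (metis imageI)
  qed
  ultimately have \<Phi>iso: "\<Phi> \<in> iso (G \<times>\<times> ?Z) U.X.\<Gamma>" by (simp add: iso_def bij_betw_def)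
  have inertia_\<Phi>: "\<Phi> (g, b g) = \<tau>" if t: "\<tau> \<in> U.inertia" and g: "g \<in> H" "restrict \<tau> N = \<phi> g" for \<tau> g
  proof (rule \<Phi>I)
    show "g \<in> carrier G" using g(1) Hsub by blast
    have "\<tau> a = \<phi> g a" if "a \<in> N" for a using g(2) that by (metis restrict_apply')
    moreover have "\<tau> y0 = y0 + of_nat (nat (b g))" "\<tau> z0 = z0 + cs (nat (b g)) y0"
      using act[rule_format, OF t] unfolding g(2) \<nu>[OF g(1)] by auto
    ultimately show "\<Psi> (\<phi> g) (nat (b g)) \<tau>" unfolding \<Psi>_def using T.inertia_Gal[OF t] by blast
  qed
  have "\<Phi> ` {(g, b g) | g. g \<in> H} = U.inertia"
  proof (intro equalityI subsetI)
    fix \<theta> assume "\<theta> \<in> \<Phi> ` {(g, b g) | g. g \<in> H}"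
    then obtain g where g: "g \<in> H" "\<theta> = \<Phi> (g, b g)" by blast
    have "\<phi> g \<in> inertia" using g(1) HI by blast
    then obtain \<tau> where "\<tau> \<in> U.inertia" "restrict \<tau> N = \<phi> g" unfolding surj[symmetric] by (metis imageE)
    then show "\<theta> \<in> U.inertia" using inertia_\<Phi> g by metis
  next
    fix \<tau> assume t: "\<tau> \<in> U.inertia"
    then have "restrict \<tau> N \<in> \<phi> ` H" unfolding HI surj[symmetric] by blast
    then obtain g where g: "g \<in> H" "restrict \<tau> N = \<phi> g" by blast
    then have "\<Phi> (g, b g) = \<tau>" by (rule inertia_\<Phi>[OF t])
    then show "\<tau> \<in> \<Phi> ` {(g, b g) | g. g \<in> H}" using g(1) by blast
  qed
  then show thesis using that[OF U \<Phi>iso] by blast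
qed

end

section \<open>The graph of a homomorphism in a fibre product\<close>

lemma card_residue_class:
  assumes p: "0 < p"
  shows "card {c \<in> {0..<int (p ^ 2)}. r mod int p = c mod int p} = p"
proof -
  let ?f = "\<lambda>s. r mod int p + int p * s"
  have "{c \<in> {0..<int (p ^ 2)}. r mod int p = c mod int p} = ?f ` {0..<int p}"
  proof (intro equalityI subsetI)
    fix c assume c: "c \<in> {c \<in> {0..<int (p ^ 2)}. r mod int p = c mod int p}"
    then have "0 \<le> c" "c < int p * int p" by (auto simp: power2_eq_square)
    moreover have "c div int p < int p"
    proof (rule ccontr)
      assume "\<not> c div int p < int p"
      then have "int p * int p \<le> int p * (c div int p)" by (intro mult_left_mono) auto
      moreover have "c = int p * (c div int p) + c mod int p" "0 \<le> c mod int p" using p by auto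
      ultimately show False using \<open>c < int p * int p\<close> by linarith
    qed
    ultimately have "0 \<le> c div int p" "c div int p < int p" using p by (simp_all add: pos_imp_zdiv_nonneg_iff)
    moreover have "c = ?f (c div int p)" using c by simp
    ultimately show "c \<in> ?f ` {0..<int p}" by (metis atLeastLessThan_iff imageI)
  next
    fix c assume "c \<in> ?f ` {0..<int p}"
    then obtain s where s: "0 \<le> s" "s < int p" "c = ?f s" by auto
    have "0 \<le> r mod int p" "r mod int p < int p" using p by auto
    moreover have "0 \<le> int p * s" using s by simp
    moreover have "int p * s + int p \<le> int p * int p"
    proof -
      have "int p * (s + 1) \<le> int p * int p" using s p by (intro mult_left_mono) auto
      then show ?thesis by (simp add: algebra_simps)
    qed
    ultimately have "0 \<le> c" "c < int p * int p" unfolding s(3) by linarith+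
    then show "c \<in> {c \<in> {0..<int (p ^ 2)}. r mod int p = c mod int p}" using s(3) by (simp add: power2_eq_square)
  qed
  moreover have "inj_on ?f {0..<int p}" using p by (auto simp: inj_on_def)
  ultimately show ?thesis by (simp add: card_image)
qed

text \<open>Above each element of \<open>P\<close>, the fibre product has \<open>p\<close> elements and the graph has one.\<close>

lemma graph_in_fibre_product:
  fixes G :: "'g monoid"
  assumes G: "group G" "finite (carrier G)" and P: "subgroup P G" and p: "0 < p"
    and a: "a \<in> epi (G\<lparr>carrier := P\<rparr>) (integer_mod_group (p ^ 2))"
  defines "D \<equiv> G \<times>\<times> integer_mod_group (p ^ 2)" and "Q \<equiv> {(g, a g) | g. g \<in> P}"
  shows "subgroup Q D" "subgroup Q (D\<lparr>carrier := fibre_product p P a\<rparr>)"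
    "card (rcosets\<^bsub>D\<lparr>carrier := fibre_product p P a\<rparr>\<^esub> Q) = p"
proof -
  let ?Z = "integer_mod_group (p ^ 2)"
  let ?F = "fibre_product p P a"
  interpret G: group G by (rule G(1))
  interpret D: group D unfolding D_def by (rule DirProd_group[OF G(1)]) simp
  interpret PG: group "G\<lparr>carrier := P\<rparr>" by (rule subgroup.subgroup_is_group[OF P G(1)])
  have ahom: "a \<in> hom (G\<lparr>carrier := P\<rparr>) ?Z" using a unfolding epi_def by blast
  interpret a: group_hom "G\<lparr>carrier := P\<rparr>" ?Z a
    by (intro group_hom.intro group_hom_axioms.intro PG.group_axioms ahom) simp
  have Psub: "P \<subseteq> carrier G" by (rule subgroup.subset[OF P])
  have aZ: "a g \<in> carrier ?Z" if "g \<in> P" for g using a.hom_closed[of g] that by simp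
  have ainv: "a (inv\<^bsub>G\<^esub> g) = (- a g) mod int (p ^ 2)" if g: "g \<in> P" for g
    using a.hom_inv[of g] g aZ[OF g] G.m_inv_consistent[OF P g] by simp
  have amult: "a (g \<otimes>\<^bsub>G\<^esub> h) = (a g + a h) mod int (p ^ 2)" if "g \<in> P" "h \<in> P" for g h
    using a.hom_mult[of g h] that by simp
  have dvd: "int p dvd int (p ^ 2)" by (simp add: power2_eq_square)
  have Dinv: "inv\<^bsub>D\<^esub> (g, c) = (inv\<^bsub>G\<^esub> g, (- c) mod int (p ^ 2))" if "g \<in> carrier G" "c \<in> carrier ?Z" for g c
    unfolding D_def using inv_DirProd[OF G(1) group_integer_mod_group that] that(2) by simp
  have mod_Z: "c mod int (p ^ 2) \<in> carrier ?Z" for c using p by (auto simp: carrier_integer_mod_group)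
  have QF: "Q \<subseteq> ?F" unfolding Q_def fibre_product_def using aZ by auto
  have FD: "?F \<subseteq> carrier D" unfolding D_def fibre_product_def using Psub by auto
  note P1 = subgroup.one_closed[OF P]
  have a1: "a \<one>\<^bsub>G\<^esub> = 0" using a.hom_one by simp
  show QD: "subgroup Q D"
  proof (rule D.subgroupI)
    show "Q \<subseteq> carrier D" using QF FD by blast
    show "Q \<noteq> {}" unfolding Q_def using P1 by blast
  next
    fix u assume "u \<in> Q"
    then obtain g where g: "g \<in> P" "u = (g, a g)" unfolding Q_def by blast
    then have "inv\<^bsub>D\<^esub> u = (inv\<^bsub>G\<^esub> g, a (inv\<^bsub>G\<^esub> g))" using Dinv[of g "a g"] Psub aZ ainv by auto
    then show "inv\<^bsub>D\<^esub> u \<in> Q" unfolding Q_def using subgroup.m_inv_closed[OF P g(1)] by blast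
  next
    fix u v assume "u \<in> Q" "v \<in> Q"
    then obtain g h where gh: "g \<in> P" "h \<in> P" "u = (g, a g)" "v = (h, a h)" unfolding Q_def by blast
    then have "u \<otimes>\<^bsub>D\<^esub> v = (g \<otimes>\<^bsub>G\<^esub> h, a (g \<otimes>\<^bsub>G\<^esub> h))" unfolding D_def by (simp add: amult)
    then show "u \<otimes>\<^bsub>D\<^esub> v \<in> Q" unfolding Q_def using subgroup.m_closed[OF P gh(1,2)] by blast
  qed
  have FS: "subgroup ?F D"
  proof (rule D.subgroupI)
    show "?F \<subseteq> carrier D" by (rule FD)
    show "?F \<noteq> {}" using QF subgroup.one_closed[OF QD] by blast
  next
    fix u assume "u \<in> ?F"
    then obtain g c where gc: "g \<in> P" "c \<in> carrier ?Z" "a g mod int p = c mod int p" "u = (g, c)" unfolding fibre_product_def by blast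
    have "inv\<^bsub>D\<^esub> u = (inv\<^bsub>G\<^esub> g, (- c) mod int (p ^ 2))" unfolding gc(4) using gc Psub by (intro Dinv) auto
    moreover have "a (inv\<^bsub>G\<^esub> g) mod int p = ((- c) mod int (p ^ 2)) mod int p"
      unfolding ainv[OF gc(1)] mod_mod_cancel[OF dvd] by (rule mod_minus_cong[OF gc(3)])
    ultimately show "inv\<^bsub>D\<^esub> u \<in> ?F" unfolding fibre_product_def using subgroup.m_inv_closed[OF P gc(1)] mod_Z by simp
  next
    fix u v assume "u \<in> ?F" "v \<in> ?F"
    then obtain g c h d where gc: "g \<in> P" "c \<in> carrier ?Z" "a g mod int p = c mod int p" "u = (g, c)"
      "h \<in> P" "d \<in> carrier ?Z" "a h mod int p = d mod int p" "v = (h, d)" unfolding fibre_product_def by blast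
    have "u \<otimes>\<^bsub>D\<^esub> v = (g \<otimes>\<^bsub>G\<^esub> h, (c + d) mod int (p ^ 2))" unfolding D_def gc(4,8) by simp
    moreover have "a (g \<otimes>\<^bsub>G\<^esub> h) mod int p = ((c + d) mod int (p ^ 2)) mod int p"
      unfolding amult[OF gc(1,5)] mod_mod_cancel[OF dvd] by (rule mod_add_cong[OF gc(3,7)])
    ultimately show "u \<otimes>\<^bsub>D\<^esub> v \<in> ?F" unfolding fibre_product_def using subgroup.m_closed[OF P gc(1,5)] mod_Z by simp
  qed
  show QF': "subgroup Q (D\<lparr>carrier := ?F\<rparr>)" by (rule D.subgroup_incl[OF QD FS QF])
  interpret F: group "D\<lparr>carrier := ?F\<rparr>" by (rule subgroup.subgroup_is_group[OF FS D.group_axioms])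
  have finP: "finite P" using Psub G(2) by (rule finite_subset)
  have cardQ: "card Q = card P"
  proof -
    have "Q = (\<lambda>g. (g, a g)) ` P" unfolding Q_def by blast
    then show ?thesis by (simp add: card_image inj_on_def)
  qed
  have F: "?F = (SIGMA g:P. {c \<in> {0..<int (p ^ 2)}. a g mod int p = c mod int p})"
    unfolding fibre_product_def using p by (auto simp: carrier_integer_mod_group)
  have "finite {c \<in> {0..<int (p ^ 2)}. a g mod int p = c mod int p}" for g
    by (rule rev_finite_subset[OF finite_atLeastLessThan_int]) blast
  then have "card ?F = (\<Sum>g\<in>P. card {c \<in> {0..<int (p ^ 2)}. a g mod int p = c mod int p})"
    unfolding F using finP by (intro card_SigmaI) blast+
  then have "card ?F = (\<Sum>g\<in>P. p)" by (simp only: card_residue_class[OF p])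
  then have cardF: "card ?F = p * card P" by (simp add: mult.commute)
  have "card (rcosets\<^bsub>D\<lparr>carrier := ?F\<rparr>\<^esub> Q) * card Q = p * card P"
    using F.lagrange[OF QF'] cardF by (simp add: Coset.order_def)
  moreover have "card P > 0" using finP P1 by (auto simp: card_gt_0_iff)
  ultimately show "card (rcosets\<^bsub>D\<lparr>carrier := ?F\<rparr>\<^esub> Q) = p" using cardQ by simp
qed

section \<open>The algebraic closure of the field of rational functions\<close>

definition const :: "'k::Fields.field \<Rightarrow> 'k ambient" where "const c = of_polynomial [:c:]"

lemma of_polynomial_add: "of_polynomial (f + g) = of_polynomial f + of_polynomial g"
  and of_polynomial_mult: "of_polynomial (f * g) = of_polynomial f * of_polynomial g"
  and of_polynomial_eq_iff: "of_polynomial f = of_polynomial g \<longleftrightarrow> f = g"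
  and of_polynomial_0: "of_polynomial 0 = 0" and of_polynomial_1: "of_polynomial 1 = 1"
  unfolding of_polynomial_def
  by (simp_all add: to_ac_add[symmetric] to_ac_mult[symmetric] eq_fract Zero_fract_def[symmetric] One_fract_def[symmetric] del: to_ac_add to_ac_mult)

lemma evaluate_coordinate: "poly (map_poly const f) coordinate = of_polynomial f"
proof (induction f)
  case 0
  show ?case by (simp add: of_polynomial_0)
next
  case (pCons c f)
  have c0: "const 0 = 0" by (simp add: const_def of_polynomial_0)
  have "pCons c f = [:c:] + [:0, 1:] * f" by simp
  then have "of_polynomial (pCons c f) = const c + coordinate * of_polynomial f"
    by (simp only: of_polynomial_add of_polynomial_mult const_def coordinate_def)
  then show ?case using pCons by (simp add: map_poly_pCons c0)
qed

interpretation line: rational_line "const :: 'k::alg_closed_field \<Rightarrow> 'k ambient" coordinate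
proof
  show "const (c + d) = const c + const d" for c d :: 'k using of_polynomial_add[of "[:c:]" "[:d:]"] by (simp add: const_def)
  show "const (c * d) = const c * const d" for c d :: 'k using of_polynomial_mult[of "[:c:]" "[:d:]"] by (simp add: const_def mult.commute)
  show "const (1 :: 'k) = 1" using of_polynomial_1 by (simp add: const_def pCons_one)
  show "f = 0" if "poly (map_poly const f) coordinate = 0" for f :: "'k poly"
    using that of_polynomial_eq_iff[of f 0] by (simp add: evaluate_coordinate of_polynomial_0)
qed

interpretation inverse_line: rational_line "const :: 'k::alg_closed_field \<Rightarrow> 'k ambient" "inverse coordinate"
  by (rule line.rational_line_inverse)

lemma evaluation: "line.ev f = of_polynomial f"
  by (simp add: line.evat_def evaluate_coordinate)

lemma rational_functions_quotients: "(rational_functions :: 'k::alg_closed_field ambient set) = {line.ev f / line.ev g | f g. True}"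
proof (intro equalityI subsetI)
  fix a :: "'k ambient" assume "a \<in> rational_functions"
  then obtain r where r: "a = to_ac r" unfolding rational_functions_def by blast
  obtain f g where fg: "r = Fraction_Field.Fract f g" "g \<noteq> 0" by (cases r)
  have "r = Fraction_Field.Fract f 1 / Fraction_Field.Fract g 1" unfolding fg(1) by simp
  then have "a = line.ev f / line.ev g" unfolding r evaluation of_polynomial_def by (simp only: to_ac_divide)
  then show "a \<in> {line.ev f / line.ev g | f g. True}" by blast
next
  fix a :: "'k ambient" assume "a \<in> {line.ev f / line.ev g | f g. True}"
  then show "a \<in> rational_functions"
    unfolding evaluation of_polynomial_def to_ac_divide[symmetric] rational_functions_def by blast
qed

lemma constants_const: "constants = range const"
  unfolding constants_def const_def ..

lemma curve_of_galois:
  assumes "galois rational_functions (N :: 'k::alg_closed_field ambient set)"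
  shows "curve const coordinate (inverse coordinate) rational_functions N"
proof -
  have "(rational_functions :: 'k ambient set) = {inverse_line.ev f / inverse_line.ev g | f g. True}"
    unfolding rational_functions_quotients
    by (rule equalityI[OF inverse_line.quotients_inverse line.quotients_inverse]) simp_all
  then show ?thesis
    by (intro curve.intro curve_axioms.intro line_ext.intro line_ext_axioms.intro line.rational_line_axioms
        inverse_line.rational_line_axioms assms rational_functions_quotients refl)
qed

context
  fixes N :: "'k::alg_closed_field ambient set"
  assumes curve: "curve const coordinate (inverse coordinate) rational_functions N"
begin

interpretation curve const coordinate "inverse coordinate" rational_functions N by (rule curve)

lemma P1_charts: "(P1 :: 'k ambient set set) = spec line.A \<union> spec inverse_line.A"
  unfolding P1_def constants_const by (rule projective_line)

lemma infinity_point_eq: "infinity_point = infinity"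
  unfolding infinity_point_def infinity_degree evaluation ..

lemma standard_charts:
  "chart constants {1, coordinate :: 'k ambient} 1 = line.A" "chart constants {1, coordinate :: 'k ambient} coordinate = inverse_line.A"
  unfolding constants_const by (rule charts)+

lemma points_G_cover:
  assumes "\<phi> \<in> iso G (galois_group rational_functions N)"
  shows "G_cover G points \<phi>"
  unfolding G_cover_def smooth_projective_curve_def finite_morphism_P1_def function_field_points
proof (intro conjI ballI)
  show "projective_scheme constants points" unfolding constants_const by (rule points_projective)
  show "\<not> N \<subseteq> constants" unfolding constants_const by (rule not_constant)
  show "\<exists>t\<in>Q. max_ideal Q = PIdl\<^bsub>subring_of_type Q\<^esub> t" if "Q \<in> points" for Q by (rule points_regular[OF that])
  show "dominant_morphism points P1" unfolding P1_charts by (rule points_dominant)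
  show "finite_over_affine points (chart constants {1, coordinate} f)" if "f \<in> {1, coordinate}" for f
    using that points_finite_over standard_charts by auto
  show "separable_extension rational_functions N" by (rule X.N_separable)
  show "galois_extension rational_functions N" by (rule X.galois_extension)
  show "\<phi> \<in> iso G (galois_group rational_functions N)" by (rule assms)
qed

end

text \<open>
  The function field of the given cover determines its integral closure over the line; the points of the cover are
  compared with the places of this integral closure.
\<close>

lemma realizable_unramified_cover:
  fixes G :: "('g, 'r) monoid_scheme"
  assumes "realizable TYPE('k::alg_closed_field) G H" and G: "finite (carrier G)" and char: "CHAR('k) > 0"
  obtains \<phi> q N where "unramified_cover const (coordinate :: 'k ambient) (inverse coordinate) rational_functions N q"
    "\<phi> \<in> iso G (galois_group rational_functions N)"
    "\<phi> ` H = inertia_group rational_functions N (localization_at (integral_closure inverse_line.A N) q)"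
proof -
  obtain C :: "'k ambient set set" and \<phi> Q where cover: "G_cover G C \<phi>" and branch: "branch_locus C P1 = {infinity_point}"
    and Q: "Q \<in> C" "lies_above Q infinity_point" "\<phi> ` H = inertia_group rational_functions (function_field C) Q"
    using assms(1) unfolding realizable_def by blast
  define N where "N = function_field C"
  have proj: "projective_scheme constants C" and smooth: "\<And>Q. Q \<in> C \<Longrightarrow> \<exists>t\<in>Q. max_ideal Q = PIdl\<^bsub>subring_of_type Q\<^esub> t"
    and fin: "\<And>f. f \<in> {1, coordinate} \<Longrightarrow> finite_over_affine C (chart constants {1, coordinate} f)"
    and gal: "galois_extension rational_functions N" and iso: "\<phi> \<in> iso G (galois_group rational_functions N)"
    using cover unfolding G_cover_def smooth_projective_curve_def finite_morphism_P1_def N_def by blast+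
  note field = function_field_projective[OF proj, folded N_def]
  have "bij_betw \<phi> (carrier G) (carrier (galois_group rational_functions N))" using iso by (simp add: iso_def)
  then have "finite (carrier (galois_group rational_functions N))" using G by (simp add: bij_betw_finite)
  then have "galois rational_functions N" using field gal by (intro galois.intro) auto
  then have curve: "curve const coordinate (inverse coordinate) rational_functions N" by (rule curve_of_galois)
  interpret curve const coordinate "inverse coordinate" rational_functions N by (rule curve)
  have UC: "\<Union>C = N" by (simp add: N_def)
  have finX: "finite_over_affine C line.A" and finY: "finite_over_affine C inverse_line.A"
    using fin[of 1] fin[of coordinate] unfolding standard_charts[OF curve] by auto
  obtain q where pl: "place const (inverse coordinate) rational_functions N q 0" and q: "Q = localization_at Y.B q"
    using cover_place_at_infinity[OF UC field(3) finY smooth Q(1)] Q(2) unfolding infinity_point_eq[OF curve] by blast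
  have un: "unramified R z" if R: "R \<in> C" "z \<in> spec line.A \<union> spec inverse_line.A" "lies_above R z" "z \<noteq> infinity" for R z
  proof (rule ccontr)
    assume "\<not> unramified R z"
    then have "z \<in> branch_locus C P1" unfolding branch_locus_def P1_charts[OF curve] using R by blast
    then show False using R(4) unfolding branch infinity_point_eq[OF curve] by blast
  qed
  have "unramified_cover const coordinate (inverse coordinate) rational_functions N q"
  proof (intro unramified_cover.intro unramified_cover_axioms.intro curve pl)
    show "\<sigma> = \<one>\<^bsub>X.\<Gamma>\<^esub>" if "place const coordinate rational_functions N q \<alpha>"
      "\<sigma> \<in> inertia_group rational_functions N (localization_at X.B q)" for q \<alpha> \<sigma>
      by (rule cover_inertia_trivial[OF UC field(3) finX un that])
    show "0 < CHAR('k ambient)" using char by (simp only: line.char_eq)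
  qed
  then show thesis using that iso Q(3) q unfolding N_def[symmetric] by blast
qed

text \<open>The nontrivial element of \<open>H\<close> ensures that there is ramification at infinity.\<close>

lemma unramified_cover_realizable:
  fixes G :: "('g, 'r) monoid_scheme"
  assumes cover: "unramified_cover const (coordinate :: 'k::alg_closed_field ambient) (inverse coordinate) rational_functions N q"
    and G: "group G" and iso: "\<phi> \<in> iso G (galois_group rational_functions N)"
    and H: "subgroup H G" "\<phi> ` H = inertia_group rational_functions N (localization_at (integral_closure inverse_line.A N) q)"
    and nontrivial: "h \<in> H" "h \<noteq> \<one>\<^bsub>G\<^esub>"
  shows "realizable TYPE('k) G H"
proof -
  interpret unramified_cover const coordinate "inverse coordinate" rational_functions N q by (rule cover)
  interpret G: group G by (rule G)
  have inj: "inj_on \<phi> (carrier G)" and hom: "\<phi> \<in> hom G X.\<Gamma>" using iso by (auto simp: iso_def bij_betw_def)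
  have "\<phi> \<one>\<^bsub>G\<^esub> = \<one>\<^bsub>X.\<Gamma>\<^esub>" by (rule hom_one[OF hom G X.gal.group_axioms])
  moreover have "h \<in> carrier G" using nontrivial(1) subgroup.subset[OF H(1)] by blast
  ultimately have h: "\<phi> h \<in> inertia" "\<phi> h \<noteq> \<one>\<^bsub>X.\<Gamma>\<^esub>" using inj_onD[OF inj, of h "\<one>\<^bsub>G\<^esub>"] nontrivial H(2) by auto
  note ram = ramified_at_infinity[OF pl h]
  have "branch_locus points P1 = {infinity_point}"
    unfolding branch_locus_def P1_charts[OF curve_axioms] infinity_point_eq[OF curve_axioms]
  proof (intro equalityI subsetI)
    fix z assume "z \<in> {z \<in> spec line.A \<union> spec inverse_line.A. \<exists>Q\<in>points. lies_above Q z \<and> \<not> unramified Q z}"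
    then obtain Q where "z \<in> spec line.A \<union> spec inverse_line.A" "Q \<in> points" "lies_above Q z" "\<not> unramified Q z" by blast
    then have zs: "z \<in> spec line.A \<union> spec inverse_line.A" and Q: "Q \<in> points" "lies_above Q z" "\<not> unramified Q z" by auto
    have "unramified Q z" if z: "z \<noteq> infinity"
      by (rule unramified_outside_infinity[OF _ zs z Q(1,2)]) (rule triv)
    then show "z \<in> {infinity}" using Q(3) by blast
  next
    fix z assume "z \<in> {infinity}"
    then show "z \<in> {z \<in> spec line.A \<union> spec inverse_line.A. \<exists>Q\<in>points. lies_above Q z \<and> \<not> unramified Q z}"
      using ram infinity_spec(1) by blast
  qed
  moreover have "G_cover G points \<phi>" by (rule points_G_cover[OF curve_axioms iso])
  ultimately show ?thesis
    unfolding realizable_def using H ram(1,2) function_field_points infinity_point_eq[OF curve_axioms] by metis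
qed

theorem theorem4p6:
  fixes p :: nat and G :: "'g monoid" and P :: "'g set" and a :: "'g \<Rightarrow> int"
  assumes "CHAR('k::alg_closed_field) = p" and "p > 0"
    and "quasi_p_group p G"
    and "p_subgroup p P G"
    and "realizable TYPE('k) G P"
    and "epi G (integer_mod_group p) = {}"
    and "a \<in> epi (G\<lparr>carrier := P\<rparr>) (integer_mod_group (p ^ 2))"
  shows "\<exists>Q. subgroup Q ((G \<times>\<times> integer_mod_group (p ^ 2))\<lparr>carrier := fibre_product p P a\<rparr>) \<and>
             card (rcosets\<^bsub>(G \<times>\<times> integer_mod_group (p ^ 2))\<lparr>carrier := fibre_product p P a\<rparr>\<^esub> Q) = p \<and>
             realizable TYPE('k) (G \<times>\<times> integer_mod_group (p ^ 2)) Q"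
proof -
  let ?Z = "integer_mod_group (p ^ 2)"
  let ?Q = "{(g, a g) | g. g \<in> P}"
  have G: "group G" "finite (carrier G)" using assms(3) unfolding quasi_p_group_def by auto
  have P: "subgroup P G" using assms(4) unfolding p_subgroup_def by blast
  have char: "CHAR('k ambient) = p" using assms(1) by (simp only: line.char_eq)
  have p2: "2 \<le> p" using prime_CHAR_semidom[where ?'a='k] assms(1,2) prime_ge_2_nat by auto
  note Q = graph_in_fibre_product[OF G P assms(2,7)]
  obtain \<phi> q N where U: "unramified_cover const (coordinate :: 'k ambient) (inverse coordinate) rational_functions N q"
    and iso: "\<phi> \<in> iso G (galois_group rational_functions N)"
    and PI: "\<phi> ` P = inertia_group rational_functions N (localization_at (integral_closure inverse_line.A N) q)"
    by (rule realizable_unramified_cover[OF assms(5) G(2)]) (use assms(1,2) in simp)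
  have epis: "a \<in> epi (G\<lparr>carrier := P\<rparr>) (integer_mod_group (CHAR('k ambient) ^ 2))" "epi G (integer_mod_group CHAR('k ambient)) = {}"
    unfolding char by (rule assms(7), rule assms(6))
  obtain M q' \<Phi> where U': "unramified_cover const (coordinate :: 'k ambient) (inverse coordinate) rational_functions M q'"
    and iso': "\<Phi> \<in> iso (G \<times>\<times> ?Z) (galois_group rational_functions M)"
    and QI: "\<Phi> ` ?Q = inertia_group rational_functions M (localization_at (integral_closure inverse_line.A M) q')"
    by (rule unramified_cover.cyclic_extension_group[OF U G P iso PI epis, unfolded char])
  \<comment> \<open>the graph is not trivial, since \<open>a\<close> takes the value one\<close>
  have "p ^ 2 \<noteq> 1" using p2 by simp
  then have "1 \<in> a ` P" using assms(7) unfolding epi_def by auto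
  then obtain g where g: "g \<in> P" "a g = 1" by auto
  have "realizable TYPE('k) (G \<times>\<times> ?Z) ?Q"
  proof (rule unramified_cover_realizable[OF U' _ iso' Q(1) QI])
    show "group (G \<times>\<times> ?Z)" by (rule DirProd_group[OF G(1)]) simp
    show "(g, a g) \<in> ?Q" using g by blast
    show "(g, a g) \<noteq> \<one>\<^bsub>G \<times>\<times> ?Z\<^esub>" using g by simp
  qed
  then show ?thesis using Q(2,3) by blast
qed

end
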